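(* Let $\mathbb K\in\{\mathbb R,\mathbb C\}$ and let $G$ be a compact group. Then the weakly complete symmetric Hopf algebra $\mathbb K[G]$ is a direct product $$\mathbb K[G]=\prod_{\varepsilon\in\hat G_{\mathbb K}}\mathbb K_\varepsilon[G]$$ of finite dimensional minimal two-sided ideals $\mathbb K_\varepsilon[G]$ such that for each $\varepsilon\in\hat G_{\mathbb K}$ there is a $\mathbb K$-algebra isomorphism $$\mathbb K_\varepsilon[G]\cong \mathrm{End}_{\mathbb L_{\varepsilon,\mathbb K}}(E_{\varepsilon,\mathbb K}).$$ In particular, each of these two-sided ideals $\mathbb K_\varepsilon[G]$ is a simple two-sided $G\times G$-module, and as an algebra it is isomorphic to a full matrix ring over $\mathbb L_{\varepsilon,\mathbb K}$.
   Context: Compact groups are Hausdorff. A topological vector space over $\mathbb K$ ($=\mathbb R$ or $\mathbb C$) is weakly complete if it is isomorphic to $\mathbb K^J$ (product topology) for some set $J$. A weakly complete algebra is an associative unital $\mathbb K$-algebra on a weakly complete vector space with continuous multiplication; morphisms are continuous unital algebra homomorphisms. $A^{-1}$ denotes the group of units of such an $A$, a topological group in the subspace topology. Weakly complete group algebra: $G\mapsto \mathbb K[G]$ is the left adjoint of $A\mapsto A^{-1}$ from weakly complete algebras to topological groups. That is, there is a continuous homomorphism $\eta_G\colon G\to\mathbb K[G]^{-1}$ such that for every weakly complete algebra $A$ and continuous homomorphism $f\colon G\to A^{-1}$ there is a unique morphism $f'\colon\mathbb K[G]\to A$ of weakly complete algebras with $f=f'\circ\eta_G$ on $G$. For compact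 $G$, $\eta_G$ is an embedding, and $G$ is regarded as a subgroup of $\mathbb K[G]^{-1}$. $\mathbb K[G]$ is a symmetric Hopf algebra (with antipode) in the category of weakly complete vector spaces with its completed tensor product; its comultiplication sends $g$ to $g\otimes g$ for $g\in G$. The product decomposition is one of weakly complete algebras. The group $G\times G$ acts on $\mathbb K[G]$ and on its two-sided ideals through left and right multiplication by elements of $G$: $(g,h)\cdot x=gxh^{-1}$. $\hat G_{\mathbb K}$ is the set of all characters $g\mapsto \mathrm{tr}_{\mathbb K}(\rho(g))$ of continuous irreducible finite dimensional representations $\rho$ of $G$ over $\mathbb K$. For $\varepsilon\in\hat G_{\mathbb K}$, $E_{\varepsilon,\mathbb K}$ is a chosen simple finite dimensional $G$-module over $\mathbb K$ with character $\varepsilon$ (unique up to isomorphism), and $\mathbb L_{\varepsilon,\mathbb K}=\mathrm{End}_G(E_{\varepsilon,\mathbb K})$ is the division ring of $\mathbb K$-linear endomorphisms commuting with the $G$-action; it is $\mathbb C$ if $\mathbb K=\mathbb C$, and is one of $\mathbb R,\mathbb C,\mathbb H$ if $\mathbb K=\mathbb R$. $\mathrm{End}_{\mathbb L_{\varepsilon,\mathbb K}}(E_{\varepsilon,\mathbb K})$ is the $\mathbb K$-algebra of $\mathbb K$-linear endomorphisms of $E_{\varepsilon,\mathbb K}$ commuting with $\mathbb L_{\varepsilon,\mathbb K}$. *)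

theory Defs
  imports "HOL-Analysis.T1_Spaces" "HOL-Algebra.Ideal" "Jordan_Normal_Form.VS_Connect"
begin

section \<open>The ground field\<close>

text \<open>The types of this class are, as topological fields, exactly the copies of \<^typ>\<open>real\<close> and
  \<^typ>\<open>complex\<close>: the norm of a real normed field is multiplicative.\<close>

class real_or_complex = real_normed_field +
  assumes real_or_complex:
    "(\<forall>x. \<exists>a. x = a *\<^sub>R 1) \<or>
     (\<exists>i. i * i = - 1 \<and> (\<forall>x. \<exists>a b. x = a *\<^sub>R 1 + b *\<^sub>R i))"

instance real :: real_or_complex
  by standard auto

instance complex :: real_or_complex
proof
  have "x = Re x *\<^sub>R 1 + Im x *\<^sub>R \<i>" for x
    by (simp add: complex_eq_iff)
  moreover have "\<i> * \<i> = - 1"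
    by simp
  ultimately show "(\<forall>x::complex. \<exists>a. x = a *\<^sub>R 1) \<or>
     (\<exists>i::complex. i * i = - 1 \<and> (\<forall>x. \<exists>a b. x = a *\<^sub>R 1 + b *\<^sub>R i))"
    by blast
qed

section \<open>Topological groups and weakly complete algebras\<close>

definition compact_group :: "('g, 'm) monoid_scheme \<Rightarrow> 'g topology \<Rightarrow> bool" where
  "compact_group G TG \<longleftrightarrow>
     group G \<and> topspace TG = carrier G \<and>
     continuous_map (prod_topology TG TG) TG (\<lambda>(x, y). x \<otimes>\<^bsub>G\<^esub> y) \<and>
     continuous_map TG TG (m_inv G) \<and>
     compact_space TG \<and> Hausdorff_space TG"

definition continuous_homs ::
    "('g, 'm) monoid_scheme \<Rightarrow> 'g topology \<Rightarrow> ('h, 'n) monoid_scheme \<Rightarrow> 'h topology \<Rightarrow> ('g \<Rightarrow> 'h) set"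
where
  "continuous_homs G TG H TH = {f \<in> hom G H. continuous_map TG TH f}"

text \<open>The locale \<^locale>\<open>algebra\<close> of HOL-Algebra is restricted to commutative algebras. As there, the
  multiplication of an algebra is the \<open>mult\<close> field of the module record.\<close>

definition unital_algebra :: "('k::field, 'a, 'm) module_scheme \<Rightarrow> bool" where
  "unital_algebra A \<longleftrightarrow>
     vectorspace class_ring A \<and> ring A \<and>
     (\<forall>c. \<forall>x\<in>carrier A. \<forall>y\<in>carrier A.
        (c \<odot>\<^bsub>A\<^esub> x) \<otimes>\<^bsub>A\<^esub> y = c \<odot>\<^bsub>A\<^esub> (x \<otimes>\<^bsub>A\<^esub> y) \<and>
        x \<otimes>\<^bsub>A\<^esub> (c \<odot>\<^bsub>A\<^esub> y) = c \<odot>\<^bsub>A\<^esub> (x \<otimes>\<^bsub>A\<^esub> y))"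

definition algebra_homs ::
    "('k::field, 'a, 'm) module_scheme \<Rightarrow> ('k, 'b, 'n) module_scheme \<Rightarrow> ('a \<Rightarrow> 'b) set" where
  "algebra_homs A B = Ring.ring_hom A B \<inter> module_hom class_ring A B"

definition algebra_isos ::
    "('k::field, 'a, 'm) module_scheme \<Rightarrow> ('k, 'b, 'n) module_scheme \<Rightarrow> ('a \<Rightarrow> 'b) set" where
  "algebra_isos A B = {\<phi> \<in> algebra_homs A B. bij_betw \<phi> (carrier A) (carrier B)}"

text \<open>If \<open>V\<close> is isomorphic to \<open>K\<^sup>J\<close>, then \<open>J\<close> is in bijection with a subset of \<open>V\<close> (the unit
  vectors), so it is no restriction to take \<open>J\<close> in the carrier type of \<open>V\<close>.\<close>

definition weakly_complete_space ::
    "('k::real_or_complex, 'a, 'm) module_scheme \<Rightarrow> 'a topology \<Rightarrow> bool" where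
  "weakly_complete_space V T \<longleftrightarrow>
     vectorspace class_ring V \<and> topspace T = carrier V \<and>
     (\<exists>(J :: 'a set) \<phi>. \<phi> \<in> module_hom class_ring V (ring.func_space class_ring J) \<and>
        homeomorphic_map T (product_topology (\<lambda>j. euclidean) J) \<phi>)"

definition weakly_complete_algebra ::
    "('k::real_or_complex, 'a, 'm) module_scheme \<Rightarrow> 'a topology \<Rightarrow> bool" where
  "weakly_complete_algebra A T \<longleftrightarrow>
     unital_algebra A \<and> weakly_complete_space A T \<and>
     continuous_map (prod_topology T T) T (\<lambda>(x, y). x \<otimes>\<^bsub>A\<^esub> y)"

text \<open>Morphisms are made extensional, so that equality of morphisms is equality on the carrier.\<close>

definition wc_morphisms ::
    "('k::real_or_complex, 'a, 'm) module_scheme \<Rightarrow> 'a topology \<Rightarrow>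
     ('k, 'b, 'n) module_scheme \<Rightarrow> 'b topology \<Rightarrow> ('a \<Rightarrow> 'b) set" where
  "wc_morphisms A T B S =
     {F \<in> algebra_homs A B \<inter> extensional (carrier A). continuous_map T S F}"

section \<open>The weakly complete group algebra\<close>

text \<open>HOL cannot quantify over types inside a formula, so the test algebras \<open>B\<close> of the universal
  property are those whose carrier is a subset of the type \<open>('g \<Rightarrow> 'k) \<Rightarrow> 'k\<close>. That type has room for
  every algebra on a space \<open>K\<^sup>J\<close> with \<open>J\<close> a set of functions on the group; in particular for the
  group algebra itself, which is the linear dual of the space of representative functions, and for
  all finite dimensional algebras. Since every weakly complete algebra is a projective limit of
  finite dimensional ones, the universal property for these \<open>B\<close> is equivalent to the universal
  property for all weakly complete algebras, in whatever type (and is always implied by it).\<close>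

definition weakly_complete_group_algebra ::
    "('g, 'm) monoid_scheme \<Rightarrow> 'g topology \<Rightarrow>
     ('k::real_or_complex, 'a) module \<Rightarrow> 'a topology \<Rightarrow> ('g \<Rightarrow> 'a) \<Rightarrow> bool" where
  "weakly_complete_group_algebra G TG A T \<eta> \<longleftrightarrow>
     weakly_complete_algebra A T \<and>
     \<eta> \<in> continuous_homs G TG (units_of A) (subtopology T (Units A)) \<and>
     (\<forall>(B :: ('k, ('g \<Rightarrow> 'k) \<Rightarrow> 'k) module) S f.
        weakly_complete_algebra B S \<longrightarrow>
        f \<in> continuous_homs G TG (units_of B) (subtopology S (Units B)) \<longrightarrow>
        (\<exists>!F. F \<in> wc_morphisms A T B S \<and> (\<forall>g\<in>carrier G. f g = F (\<eta> g))))"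

section \<open>Group modules and representations\<close>

definition group_module ::
    "('h, 'n) monoid_scheme \<Rightarrow> ('k::field, 'e, 'm) module_scheme \<Rightarrow> ('h \<Rightarrow> 'e \<Rightarrow> 'e) \<Rightarrow> bool" where
  "group_module H V act \<longleftrightarrow>
     vectorspace class_ring V \<and>
     (\<forall>h\<in>carrier H. act h \<in> module_hom class_ring V V) \<and>
     (\<forall>x\<in>carrier V. act \<one>\<^bsub>H\<^esub> x = x) \<and>
     (\<forall>h\<in>carrier H. \<forall>h'\<in>carrier H. \<forall>x\<in>carrier V. act (h \<otimes>\<^bsub>H\<^esub> h') x = act h (act h' x))"

definition simple_group_module ::
    "('h, 'n) monoid_scheme \<Rightarrow> ('k::field, 'e, 'm) module_scheme \<Rightarrow> ('h \<Rightarrow> 'e \<Rightarrow> 'e) \<Rightarrow> bool" where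
  "simple_group_module H V act \<longleftrightarrow>
     group_module H V act \<and> carrier V \<noteq> {\<zero>\<^bsub>V\<^esub>} \<and>
     (\<forall>U. VectorSpace.subspace class_ring U V \<and> (\<forall>h\<in>carrier H. \<forall>x\<in>U. act h x \<in> U) \<longrightarrow>
        U = {\<zero>\<^bsub>V\<^esub>} \<or> U = carrier V)"

text \<open>Finite dimensional representations are taken on the coordinate spaces \<open>K\<^sup>n\<close>, with \<open>n\<close> an
  arbitrary natural number: \<open>module_vec TYPE('k) n\<close> is \<open>K\<^sup>n\<close> and \<open>module_mat TYPE('k) n n\<close> is the
  algebra of its endomorphisms.\<close>

definition irreducible_representation ::
    "('g, 'm) monoid_scheme \<Rightarrow> 'g topology \<Rightarrow> nat \<Rightarrow> ('g \<Rightarrow> 'k::real_or_complex mat) \<Rightarrow> bool" where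
  "irreducible_representation G TG n \<rho> \<longleftrightarrow>
     \<rho> \<in> hom G (units_of (module_mat TYPE('k) n n)) \<and>
     (\<forall>i<n. \<forall>j<n. continuous_map TG euclidean (\<lambda>g. \<rho> g $$ (i, j))) \<and>
     simple_group_module G (module_vec TYPE('k) n) (\<lambda>g v. \<rho> g *\<^sub>v v)"

definition character ::
    "('g, 'm) monoid_scheme \<Rightarrow> nat \<Rightarrow> ('g \<Rightarrow> 'k::real_or_complex mat) \<Rightarrow> 'g \<Rightarrow> 'k" where
  "character G n \<rho> = (\<lambda>g\<in>carrier G. \<Sum>i<n. \<rho> g $$ (i, i))"

definition irreducible_characters ::
    "('g, 'm) monoid_scheme \<Rightarrow> 'g topology \<Rightarrow> ('g \<Rightarrow> 'k::real_or_complex) set" where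
  "irreducible_characters G TG =
     {character G n \<rho> | n \<rho>. irreducible_representation G TG n \<rho>}"

definition End_G ::
    "('g, 'm) monoid_scheme \<Rightarrow> nat \<Rightarrow> ('g \<Rightarrow> 'k::real_or_complex mat) \<Rightarrow> ('k, 'k mat) module" where
  "End_G G n \<rho> = (module_mat TYPE('k) n n)
     \<lparr>carrier := {X \<in> carrier_mat n n. \<forall>g\<in>carrier G. X * \<rho> g = \<rho> g * X}\<rparr>"

definition End_over ::
    "('k::real_or_complex, 'k mat) module \<Rightarrow> nat \<Rightarrow> ('k, 'k mat) module" where
  "End_over L n = (module_mat TYPE('k) n n)
     \<lparr>carrier := {Y \<in> carrier_mat n n. \<forall>X\<in>carrier L. Y * X = X * Y}\<rparr>"

section \<open>Constructions with algebras\<close>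

definition full_matrix_algebra ::
    "nat \<Rightarrow> ('k, 'r, 'm) module_scheme \<Rightarrow> ('k, 'r mat) module" where
  "full_matrix_algebra m R =
     \<lparr>carrier = {A \<in> carrier_mat m m. elements_mat A \<subseteq> carrier R},
      monoid.mult = (\<lambda>A B. mat m m (\<lambda>(i, j). \<Oplus>\<^bsub>R\<^esub>k\<in>{..<m}. A $$ (i, k) \<otimes>\<^bsub>R\<^esub> B $$ (k, j))),
      one = mat m m (\<lambda>(i, j). if i = j then \<one>\<^bsub>R\<^esub> else \<zero>\<^bsub>R\<^esub>),
      zero = mat m m (\<lambda>_. \<zero>\<^bsub>R\<^esub>),
      add = (\<lambda>A B. mat m m (\<lambda>ij. A $$ ij \<oplus>\<^bsub>R\<^esub> B $$ ij)),
      smult = (\<lambda>c A. mat m m (\<lambda>ij. c \<odot>\<^bsub>R\<^esub> A $$ ij))\<rparr>"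

definition product_algebra ::
    "'i set \<Rightarrow> ('i \<Rightarrow> ('k, 'a, 'm) module_scheme) \<Rightarrow> ('k, 'i \<Rightarrow> 'a) module" where
  "product_algebra J R =
     \<lparr>carrier = (\<Pi>\<^sub>E j\<in>J. carrier (R j)),
      monoid.mult = (\<lambda>x y. \<lambda>j\<in>J. x j \<otimes>\<^bsub>R j\<^esub> y j),
      one = (\<lambda>j\<in>J. \<one>\<^bsub>R j\<^esub>),
      zero = (\<lambda>j\<in>J. \<zero>\<^bsub>R j\<^esub>),
      add = (\<lambda>x y. \<lambda>j\<in>J. x j \<oplus>\<^bsub>R j\<^esub> y j),
      smult = (\<lambda>c x. \<lambda>j\<in>J. c \<odot>\<^bsub>R j\<^esub> x j)\<rparr>"

text \<open>The two-sided ideal \<open>I\<close> regarded as an algebra of its own. Its unit is not that of \<open>A\<close>; it is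
  meaningful only if \<open>I\<close> has a unit, which an algebra isomorphism from \<open>ideal_algebra A I\<close> to a
  unital algebra guarantees.\<close>

definition ideal_algebra ::
    "('k, 'a) module \<Rightarrow> 'a set \<Rightarrow> ('k, 'a) module" where
  "ideal_algebra A I =
     A\<lparr>carrier := I, one := (THE e. e \<in> I \<and> (\<forall>x\<in>I. e \<otimes>\<^bsub>A\<^esub> x = x \<and> x \<otimes>\<^bsub>A\<^esub> e = x))\<rparr>"

definition minimal_ideal :: "'a set \<Rightarrow> ('a, 'm) ring_scheme \<Rightarrow> bool" where
  "minimal_ideal I A \<longleftrightarrow>
     ideal I A \<and> I \<noteq> {\<zero>\<^bsub>A\<^esub>} \<and> (\<forall>J. ideal J A \<and> J \<subseteq> I \<longrightarrow> J = {\<zero>\<^bsub>A\<^esub>} \<or> J = I)"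

text \<open>\<open>A\<close> is the direct product of its ideals \<open>I j\<close>, as a topological algebra; the last clause says
  that the isomorphism identifies each \<open>I j\<close> with the factor of index \<open>j\<close>.\<close>

definition direct_product_of_ideals ::
    "('k::field, 'a) module \<Rightarrow> 'a topology \<Rightarrow> 'i set \<Rightarrow> ('i \<Rightarrow> 'a set) \<Rightarrow> bool" where
  "direct_product_of_ideals A T J I \<longleftrightarrow>
     (\<exists>\<Phi> \<in> algebra_isos A (product_algebra J (\<lambda>j. ideal_algebra A (I j))).
        homeomorphic_map T (product_topology (\<lambda>j. subtopology T (I j)) J) \<Phi> \<and>
        (\<forall>j\<in>J. \<forall>x\<in>I j. \<Phi> x = (\<lambda>i\<in>J. if i = j then x else \<zero>\<^bsub>A\<^esub>)))"

definition two_sided_action ::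
    "('a, 'm) monoid_scheme \<Rightarrow> ('g \<Rightarrow> 'a) \<Rightarrow> 'g \<times> 'g \<Rightarrow> 'a \<Rightarrow> 'a" where
  "two_sided_action A \<eta> = (\<lambda>(g, h) x. \<eta> g \<otimes>\<^bsub>A\<^esub> x \<otimes>\<^bsub>A\<^esub> inv\<^bsub>A\<^esub> (\<eta> h))"

end

theory Submission
  imports Defs "HOL-Library.Function_Algebras" "HOL-Analysis.Elementary_Metric_Spaces"
    "HOL-Analysis.Abstract_Limits" "Jordan_Normal_Form.Char_Poly"
begin

text \<open>Haar measure is avoided: a continuous linear action of a compact group on a finite dimensional
  space has a fixed point in every nonempty closed convex invariant set, namely the point at which
  the supremum of \<open>norm (g f)\<close> over the group is least. This gives equivariant projections, and with
  them the bicommutant theorem: a matrix that commutes with the commutant of a representation is a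
  combination of group elements.

  A continuous functional on \<open>K[G]\<close> depends on finitely many coordinates only, and therefore is a
  matrix coefficient of a finite dimensional representation of \<open>K[G]\<close>. By the uniqueness in the
  universal property, conjugation by an invertible matrix in the commutant of \<open>G\<close> fixes the image of
  \<open>K[G]\<close>, so this image lies in the bicommutant, that is, in the span of \<open>G\<close>. Hence the functional is
  determined by its values on \<open>G\<close>, and it is a combination of entries of the extensions \<open>\<Phi> \<epsilon>\<close> of the
  irreducible representations. It follows that the \<open>\<Phi> \<epsilon>\<close> together map \<open>K[G]\<close> isomorphically and
  homeomorphically onto the product of the algebras \<open>End\<^sub>L(E)\<close>, which are simple two-sided modules.

  Coordinates with respect to an \<open>L\<close>-basis of \<open>E\<close> identify \<open>End\<^sub>L(E)\<close> with the matrices over the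
  opposite of \<open>L\<close>; the adjoint with respect to an invariant bilinear form (if \<open>K\<close> is real), or
  commutativity (if \<open>K\<close> is complex), shows that \<open>L\<close> is isomorphic to its opposite.\<close>

section \<open>Scalars: properties shared by the real and the complex numbers\<close>

section \<open>The ground field\<close>

text \<open>The universal property is the only access to \<open>KG\<close>, and it tests with
  algebras inside one fixed type. It is applied to matrix algebras alone, copied into that type, and
  the structure of \<open>KG\<close> is read off from its continuous matrix representations. Without
  integration there are no orthogonality relations. Their place is taken by the bicommutant theorem
  for a direct sum of representations with no nonzero intertwiners between different summands: it
  shows both that a character determines its irreducible representation and that values in finitely
  many different blocks can be prescribed independently by one combination of group elements. The
  passage to infinitely many blocks rests on \<open>KG\<close> being a full power of
  \<open>'k\<close>: each coordinate is a finite combination of entries of the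
  \<open>\<Phi> \<epsilon>\<close>, so an element with prescribed images can be written down by its
  coordinates. The real case needs extra care at the end, since the commutant may then be
  noncommutative and coordinates over it reverse products.\<close>

lemma real_or_complex_cases:
  fixes dummy :: "'k::real_or_complex itself"
  obtains (real) "\<And>x::'k. \<exists>a. x = of_real a"
  | (complex) h :: "complex \<Rightarrow> 'k" where "bij h" "\<And>x y. h (x + y) = h x + h y"
      "\<And>x y. h (x * y) = h x * h y" "h 1 = 1" "\<And>x. norm (h x) = cmod x"
proof (cases "\<forall>x::'k. \<exists>a. x = a *\<^sub>R 1")
  case True
  then show ?thesis using real by (metis of_real_def)
next
  case False
  then obtain i :: 'k where i: "i * i = -1" and gen: "\<And>x. \<exists>a b. x = a *\<^sub>R 1 + b *\<^sub>R i"
    using real_or_complex by blast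
  define h :: "complex \<Rightarrow> 'k" where "h z = of_real (Re z) + of_real (Im z) * i" for z
  have add: "h (x + y) = h x + h y" for x y
    by (simp add: h_def algebra_simps)
  have i2: "i * (i * x) = - x" for x
    using i by (simp flip: mult.assoc)
  have mult: "h (x * y) = h x * h y" for x y
    by (simp add: h_def algebra_simps i i2)
  have one: "h 1 = 1"
    by (simp add: h_def)
  have real: "h (of_real r) = of_real r" for r
    by (simp add: h_def)
  have pow: "h (x ^ k) = h x ^ k" for x k
    by (induct k) (auto simp: one mult)
  have "norm i * norm i = 1"
    by (simp flip: norm_mult add: i)
  then have ni: "norm i = 1"
    by (metis abs_norm_cancel abs_square_eq_1 power2_eq_square)
  have bound: "norm (h z) \<le> 2 * cmod z" for z
  proof -
    have "norm (h z) \<le> \<bar>Re z\<bar> + \<bar>Im z\<bar>"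
      unfolding h_def by (rule norm_triangle_le) (simp add: norm_mult ni)
    also have "\<dots> \<le> 2 * cmod z"
      using abs_Re_le_cmod[of z] abs_Im_le_cmod[of z] by linarith
    finally show ?thesis .
  qed
  \<comment> \<open>The crude constant 2 in \<open>bound\<close> disappears under powers:
    \<open>h\<close> is multiplicative, so the ratio \<open>r\<close> satisfies
    \<open>r ^ k \<le> 2\<close> for every \<open>k\<close>, which excludes
    \<open>r > 1\<close>.\<close>
  have le: "norm (h z) \<le> cmod z" for z
  proof (rule ccontr)
    assume gt: "\<not> norm (h z) \<le> cmod z"
    then have "z \<noteq> 0"
      using bound[of z] by auto
    define r where "r = norm (h z) / cmod z"
    have "r > 1"
      using gt \<open>z \<noteq> 0\<close> by (simp add: r_def)
    have "r ^ k \<le> 2" for k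
      using bound[of "z ^ k"] \<open>z \<noteq> 0\<close>
      by (simp add: r_def pow norm_power power_divide divide_le_eq)
    moreover obtain k where "2 < r ^ k"
      using real_arch_pow[OF \<open>r > 1\<close>] by blast
    ultimately show False
      by (meson not_le)
  qed
  \<comment> \<open>The product of \<open>h z\<close> and \<open>h (cnj z)\<close> is the real
    number \<open>(cmod z)\<^sup>2\<close>; since neither factor exceeds \<open>cmod z\<close> in
    norm, both reach it.\<close>
  have norm: "norm (h z) = cmod z" for z
  proof (rule antisym[OF le])
    have "h z * h (cnj z) = of_real ((cmod z)\<^sup>2)"
      by (metis complex_norm_square mult real)
    then have "norm (h z) * norm (h (cnj z)) = (cmod z)\<^sup>2"
      by (metis norm_mult norm_of_real abs_power2)
    then have "cmod z * cmod z \<le> norm (h z) * cmod z"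
      using le[of "cnj z"] by (metis complex_mod_cnj mult_left_mono norm_ge_zero power2_eq_square)
    then show "cmod z \<le> norm (h z)"
      by (metis mult_le_cancel_right norm_ge_zero not_le zero_less_norm_iff norm_zero)
  qed
  have "inj h"
  proof (rule injI)
    fix x y assume "h x = h y"
    moreover have "h x = h (x - y) + h y"
      by (simp flip: add)
    ultimately have "h (x - y) = 0"
      by simp
    then show "x = y"
      using norm[of "x - y"] by simp
  qed
  moreover have "surj h"
  proof (rule surjI)
    fix x
    show "h (SOME z. h z = x) = x"
    proof (rule someI_ex)
      obtain a b where "x = a *\<^sub>R 1 + b *\<^sub>R i"
        using gen by blast
      then have "h (Complex a b) = x"
        by (simp add: h_def scaleR_conv_of_real)
      then show "\<exists>z. h z = x" ..
    qed
  qed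
  ultimately have "bij h"
    by (rule bijI)
  then show ?thesis
    using complex add mult one norm by blast
qed

text \<open>The fixed point lemma needs uniform convexity of the Euclidean norm on coordinate
  tuples, and this identity for scalars is its source. In the complex case it is carried over along
  the isometry \<open>h\<close>.\<close>

lemma parallelogram_real_or_complex:
  fixes x y :: "'k::real_or_complex"
  shows "(norm (x + y))\<^sup>2 + (norm (x - y))\<^sup>2 = 2 * (norm x)\<^sup>2 + 2 * (norm y)\<^sup>2"
proof (cases rule: real_or_complex_cases[where ?'k = 'k])
  case real
  obtain a b where [simp]: "x = of_real a" "y = of_real b"
    using real by metis
  have "norm (x + y) = \<bar>a + b\<bar>" "norm (x - y) = \<bar>a - b\<bar>"
    by (metis \<open>x = _\<close> \<open>y = _\<close> norm_of_real of_real_add)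
       (metis \<open>x = _\<close> \<open>y = _\<close> norm_of_real of_real_diff)
  then show ?thesis
    by (simp add: power2_eq_square algebra_simps)
next
  case (complex h)
  obtain a b where ab: "x = h a" "y = h b"
    using surjD[OF bij_is_surj[OF complex(1)]] by metis
  have "h (a + b) = x + y" "h (a - b) = x - y"
    using complex(2)[of a b] complex(2)[of "a - b" b] by (simp_all add: ab)
  then have "norm (x + y) = cmod (a + b)" "norm (x - y) = cmod (a - b)"
    by (metis complex(5))+
  moreover have "(cmod (a + b))\<^sup>2 + (cmod (a - b))\<^sup>2 = 2 * (cmod a)\<^sup>2 + 2 * (cmod b)\<^sup>2"
    unfolding cmod_power2 by (simp add: power2_eq_square algebra_simps)
  ultimately show ?thesis
    by (simp add: ab complex(5))
qed

text \<open>An isometric copy of a complete space is complete. Needed for the limit of a minimizing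
  sequence in the fixed point lemma.\<close>

lemma Cauchy_convergent_real_or_complex:
  fixes X :: "nat \<Rightarrow> 'k::real_or_complex"
  assumes "Cauchy X"
  shows "\<exists>l. X \<longlonglongrightarrow> l"
proof (cases rule: real_or_complex_cases[where ?'k = 'k])
  case real
  have "\<forall>n. \<exists>a. X n = of_real a"
    using real by blast
  then obtain a where a: "\<And>n. X n = of_real (a n)"
    by metis
  have "dist (X m) (X n) = dist (a m) (a n)" for m n
    unfolding a dist_norm by (metis norm_of_real of_real_diff real_norm_def)
  then have "Cauchy a"
    using assms by (simp add: Cauchy_def)
  then obtain l where "a \<longlonglongrightarrow> l"
    using Cauchy_convergent convergent_def by blast
  then show ?thesis
    unfolding a by (blast intro: tendsto_of_real)
next
  case (complex h)
  define a where "a n = inv_into UNIV h (X n)" for n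
  have a: "X n = h (a n)" for n
    using complex(1) by (simp add: a_def bij_is_surj surj_f_inv_f)
  have hd: "h x - h y = h (x - y)" for x y
    using complex(2)[of "x - y" y] by simp
  have "dist (X m) (X n) = dist (a m) (a n)" for m n
    by (simp only: a dist_norm hd complex(5))
  then have "Cauchy a"
    using assms by (simp add: Cauchy_def)
  then obtain l where "a \<longlonglongrightarrow> l"
    using Cauchy_convergent convergent_def by blast
  then have "(\<lambda>n. norm (X n - h l)) \<longlonglongrightarrow> 0"
    by (simp only: a hd complex(5) tendsto_norm_zero_iff LIM_zero_iff)
  then have "X \<longlonglongrightarrow> h l"
    using LIM_zero_cancel tendsto_norm_zero_iff by blast
  then show ?thesis ..
qed

section \<open>Convexity in place of integration over the group\<close>

section \<open>Fixed points and equivariant projections\<close>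

locale compact_topological_group =
  fixes G :: "('g, 'm) monoid_scheme" (structure) and TG :: "'g topology"
  assumes compact_group: "compact_group G TG"
begin

lemma is_group: "group G" and topspace_TG: "topspace TG = carrier G"
  and continuous_inv: "continuous_map TG TG (m_inv G)" and compact_space_TG: "compact_space TG"
  using compact_group by (auto simp: compact_group_def)

sublocale group G
  by (rule is_group)

lemma continuous_bounded:
  fixes f :: "'g \<Rightarrow> 'k::real_normed_vector"
  assumes "continuous_map TG euclidean f"
  obtains B where "\<And>g. g \<in> carrier G \<Longrightarrow> norm (f g) \<le> B"
proof -
  have "compactin euclidean (f ` carrier G)"
    using image_compactin[OF _ assms] compact_space_TG
    by (simp add: compact_space_def topspace_TG)
  then have "bounded (f ` carrier G)"
    by (simp add: compact_imp_bounded)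
  then show ?thesis
    using that by (auto simp: bounded_iff)
qed

text \<open>Linear actions are given by matrices \<open>a g\<close> whose rows and columns are indexed by a finite set
  \<open>S\<close>; entries outside of \<open>S \<times> S\<close> are irrelevant.\<close>

definition linear_action :: "'s set \<Rightarrow> ('g \<Rightarrow> 's \<Rightarrow> 's \<Rightarrow> 'k::real_or_complex) \<Rightarrow> bool" where
  "linear_action S a \<longleftrightarrow> finite S \<and>
     (\<forall>i\<in>S. \<forall>j\<in>S. continuous_map TG euclidean (\<lambda>g. a g i j)) \<and>
     (\<forall>i\<in>S. \<forall>j\<in>S. a \<one> i j = (if i = j then 1 else 0)) \<and>
     (\<forall>g\<in>carrier G. \<forall>h\<in>carrier G. \<forall>i\<in>S. \<forall>j\<in>S. a (g \<otimes> h) i j = (\<Sum>k\<in>S. a g i k * a h k j))"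

text \<open>Entries are continuous on a compact group and finite in number. Applied to an element
  and to its inverse, the bound makes the size of a vector comparable to that of each of its
  translates.\<close>

lemma linear_action_bounded:
  assumes "linear_action S a"
  obtains B where "B > 0" "\<And>g i j. g \<in> carrier G \<Longrightarrow> i \<in> S \<Longrightarrow> j \<in> S \<Longrightarrow> norm (a g i j) \<le> B"
proof -
  have "\<exists>B. \<forall>g\<in>carrier G. norm (a g i j) \<le> B" if "i \<in> S" "j \<in> S" for i j
    by (rule continuous_bounded[of "\<lambda>g. a g i j"]) (use assms that in \<open>auto simp: linear_action_def\<close>)
  then obtain b where b: "\<And>i j g. i \<in> S \<Longrightarrow> j \<in> S \<Longrightarrow> g \<in> carrier G \<Longrightarrow> norm (a g i j) \<le> b i j"
    by metis
  \<comment> \<open>The summand 1 guarantees \<open>B > 0\<close> even if all other terms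
    vanish.\<close>
  define B where "B = 1 + (\<Sum>i\<in>S. \<Sum>j\<in>S. \<bar>b i j\<bar>)"
  have fin: "finite S"
    using assms by (simp add: linear_action_def)
  have "\<bar>b i j\<bar> \<le> B" if "i \<in> S" "j \<in> S" for i j
  proof -
    have "\<bar>b i j\<bar> \<le> (\<Sum>j\<in>S. \<bar>b i j\<bar>)"
      using that fin by (intro member_le_sum) auto
    also have "\<dots> \<le> (\<Sum>i\<in>S. \<Sum>j\<in>S. \<bar>b i j\<bar>)"
      using that fin by (intro member_le_sum[of i S "\<lambda>i. \<Sum>j\<in>S. \<bar>b i j\<bar>"]) (auto intro: sum_nonneg)
    finally show ?thesis
      by (simp add: B_def)
  qed
  moreover have "B > 0"
    unfolding B_def by (intro add_pos_nonneg sum_nonneg) auto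
  ultimately show ?thesis
    using that[of B] b by (meson abs_ge_self order_trans)
qed

text \<open>Uniform convexity does the work of compactness of \<open>C\<close>: near-minimizers of
  the invariant size \<open>N\<close> are close to each other on \<open>S\<close>, so a minimizing
  sequence converges and two minimizers agree on \<open>S\<close>; a translate of a minimizer is a
  minimizer. Convexity is used in the form of midpoints and closedness in the form of sequential
  limits on \<open>S\<close>, so membership in \<open>C\<close> depends on the values on
  \<open>S\<close> alone.\<close>

lemma linear_action_fixed_point:
  fixes a :: "'g \<Rightarrow> 's \<Rightarrow> 's \<Rightarrow> 'k::real_or_complex" and C :: "('s \<Rightarrow> 'k) set"
  assumes act: "linear_action S a" and ne: "C \<noteq> {}"
    and closed: "\<And>F f. (\<And>n. F n \<in> C) \<Longrightarrow> (\<And>i. i \<in> S \<Longrightarrow> (\<lambda>n. F n i) \<longlonglongrightarrow> f i) \<Longrightarrow> f \<in> C"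
    and mid: "\<And>f f'. f \<in> C \<Longrightarrow> f' \<in> C \<Longrightarrow> (\<lambda>i. (f i + f' i) / 2) \<in> C"
    and inv: "\<And>f g. f \<in> C \<Longrightarrow> g \<in> carrier G \<Longrightarrow> (\<lambda>i. \<Sum>j\<in>S. a g i j * f j) \<in> C"
  obtains f where "f \<in> C" "\<And>g i. g \<in> carrier G \<Longrightarrow> i \<in> S \<Longrightarrow> (\<Sum>j\<in>S. a g i j * f j) = f i"
proof -
  have fin: "finite S"
    using act by (simp add: linear_action_def)
  obtain B where B: "B > 0"
    "\<And>g i j. g \<in> carrier G \<Longrightarrow> i \<in> S \<Longrightarrow> j \<in> S \<Longrightarrow> norm (a g i j) \<le> B"
    using linear_action_bounded[OF act] by blast
  define ac where "ac g f i = (\<Sum>j\<in>S. a g i j * f j)" for g f i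
  \<comment> \<open>\<open>q g f\<close> is the squared Euclidean norm of the translate of
    \<open>f\<close> by \<open>g\<close>. Its supremum \<open>N f\<close> over the group is
    invariant, and \<open>m\<close> is the value to be attained on \<open>C\<close>.\<close>
  define q where "q g f = (\<Sum>i\<in>S. (norm (ac g f i))\<^sup>2)" for g f
  define N where "N f = (SUP g\<in>carrier G. q g f)" for f
  define m where "m = (INF f\<in>C. N f)"
  have ac_ac: "ac g (ac h f) i = ac (g \<otimes> h) f i" if "g \<in> carrier G" "h \<in> carrier G" "i \<in> S" for g h f i
  proof -
    have "ac g (ac h f) i = (\<Sum>k\<in>S. \<Sum>j\<in>S. a g i k * a h k j * f j)"
      by (simp add: ac_def sum_distrib_left mult.assoc)
    also have "\<dots> = (\<Sum>j\<in>S. \<Sum>k\<in>S. a g i k * a h k j * f j)"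
      by (rule sum.swap)
    also have "\<dots> = ac (g \<otimes> h) f i"
      using act that by (simp add: ac_def linear_action_def sum_distrib_right)
    finally show ?thesis .
  qed
  have ac_one: "ac \<one> f i = f i" if "i \<in> S" for f i
  proof -
    have "ac \<one> f i = (\<Sum>j\<in>S. if j = i then f j else 0)"
      unfolding ac_def by (rule sum.cong) (use act that in \<open>auto simp: linear_action_def\<close>)
    then show ?thesis
      using that fin by simp
  qed
  have q_ge: "(norm (ac g f i))\<^sup>2 \<le> q g f" if "i \<in> S" for g f i
    unfolding q_def using that fin
    by (intro member_le_sum[of i S "\<lambda>i. (norm (ac g f i))\<^sup>2"]) auto
  have bound: "norm (ac g f i) \<le> real (card S) * B * R"
    if "g \<in> carrier G" "i \<in> S" "\<And>j. j \<in> S \<Longrightarrow> norm (f j) \<le> R" for g f i R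
  proof -
    have "norm (ac g f i) \<le> (\<Sum>j\<in>S. norm (a g i j * f j))"
      unfolding ac_def by (rule norm_sum)
    also have "\<dots> \<le> (\<Sum>j\<in>S. B * R)"
      by (rule sum_mono) (use B that in \<open>simp add: norm_mult mult_mono\<close>)
    finally show ?thesis
      by (simp add: mult.assoc)
  qed
  \<comment> \<open>A vector is controlled by any single one of its translates, because the inverse
    element brings it back.\<close>
  have small: "norm (f i) \<le> real (card S) * B * sqrt (q g f)" if "g \<in> carrier G" "i \<in> S" for g f i
  proof -
    have "f i = ac (inv g) (ac g f) i"
      using that by (simp add: ac_ac ac_one)
    then show ?thesis
      using bound[of "inv g" i "ac g f" "sqrt (q g f)"] that q_ge real_le_rsqrt by auto
  qed
  have bdd: "bdd_above ((\<lambda>g. q g f) ` carrier G)" for f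
  proof -
    define R where "R = (\<Sum>j\<in>S. norm (f j))"
    have R: "norm (f j) \<le> R" if "j \<in> S" for j
      unfolding R_def using that fin by (intro member_le_sum) auto
    have "q g f \<le> (\<Sum>i\<in>S. (real (card S) * B * R)\<^sup>2)" if "g \<in> carrier G" for g
      unfolding q_def by (intro sum_mono power_mono bound) (use that R in auto)
    then show ?thesis
      by (rule bdd_aboveI2)
  qed
  have N_ge: "q g f \<le> N f" if "g \<in> carrier G" for g f
    unfolding N_def by (rule cSUP_upper[OF that bdd])
  have q0: "q g f \<ge> 0" for g f
    by (simp add: q_def sum_nonneg)
  have N0: "N f \<ge> 0" for f
    using N_ge[OF one_closed, of f] q0[of \<one> f] by linarith
  have m_le: "m \<le> N f" if "f \<in> C" for f
    unfolding m_def by (rule cINF_lower[OF bdd_belowI2[where m = 0] that]) (rule N0)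
  \<comment> \<open>Choose \<open>g\<close> that nearly attains \<open>N\<close> at the midpoint,
    which lies in \<open>C\<close> and so has \<open>N\<close> at least \<open>m\<close>. The
    parallelogram law at this \<open>g\<close> leaves at most \<open>2 * \<delta>\<close> for the
    half difference, and \<open>small\<close> turns that into a bound on the entries.\<close>
  have close: "norm (f i - f' i) \<le> 2 * (real (card S) * B * sqrt (2 * \<delta>))"
    if f: "f \<in> C" "N f \<le> m + \<delta>" and f': "f' \<in> C" "N f' \<le> m + \<delta>" and "\<delta> > 0" and i: "i \<in> S"
    for f f' \<delta> i
  proof -
    let ?md = "\<lambda>i. (f i + f' i) / 2" and ?df = "\<lambda>i. (f i - f' i) / 2"
    have "m - \<delta> < N ?md"
      using m_le[OF mid[OF f(1) f'(1)]] \<open>\<delta> > 0\<close> by linarith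
    then obtain g where g: "g \<in> carrier G" "m - \<delta> < q g ?md"
      unfolding N_def by (subst (asm) less_cSUP_iff[OF _ bdd]) auto
    have lin: "ac g ?md k = (ac g f k + ac g f' k) / 2" "ac g ?df k = (ac g f k - ac g f' k) / 2" for k
      by (simp_all add: ac_def sum_divide_distrib distrib_left right_diff_distrib add_divide_distrib
          diff_divide_distrib sum.distrib sum_subtractf)
    have "q g ?md + q g ?df = (q g f + q g f') / 2"
    proof -
      have eq: "(norm (ac g ?md k))\<^sup>2 + (norm (ac g ?df k))\<^sup>2
          = ((norm (ac g f k))\<^sup>2 + (norm (ac g f' k))\<^sup>2) / 2" for k
        unfolding lin using parallelogram_real_or_complex[of "ac g f k" "ac g f' k"]
        by (simp add: norm_divide power_divide)
      show ?thesis
        by (simp only: q_def sum.distrib[symmetric] sum_divide_distrib[symmetric] eq)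
    qed
    moreover have "v \<le> 2 * \<delta>" if "u + v = (w + x) / 2" "w \<le> y" "x \<le> z" "y \<le> m + \<delta>"
      "z \<le> m + \<delta>" "m - \<delta> < u" for u v w x y z :: real
      using that by argo
    ultimately have "q g ?df \<le> 2 * \<delta>"
      using N_ge[OF g(1), of f] N_ge[OF g(1), of f'] f(2) f'(2) g(2) by blast
    then have "real (card S) * B * sqrt (q g ?df) \<le> real (card S) * B * sqrt (2 * \<delta>)"
      using B(1) by (intro mult_left_mono) auto
    then have "norm (?df i) \<le> real (card S) * B * sqrt (2 * \<delta>)"
      using small[OF g(1) i, of ?df] by linarith
    then show ?thesis
      by (simp add: norm_divide)
  qed
  have "\<exists>f\<in>C. N f \<le> m + 1 / real (Suc n)" for n
  proof -
    have "m < m + 1 / real (Suc n)"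
      by simp
    moreover have "bdd_below (N ` C)"
      using N0 by (intro bdd_belowI2[where m = 0])
    ultimately obtain f where "f \<in> C" "N f < m + 1 / real (Suc n)"
      unfolding m_def using cINF_less_iff[OF ne] by blast
    then show ?thesis
      using less_imp_le by blast
  qed
  \<comment> \<open>A minimizing sequence with error \<open>1 / real (Suc n)\<close>; the bound
    \<open>\<kappa> n\<close> defined next is the distance that \<open>close\<close> allows for this
    error.\<close>
  then obtain F where F: "\<And>n. F n \<in> C" "\<And>n. N (F n) \<le> m + 1 / real (Suc n)"
    by metis
  define \<kappa> where "\<kappa> n = 2 * (real (card S) * B * sqrt (2 * (1 / real (Suc n))))" for n
  have "(\<lambda>n. sqrt (2 * (1 / real (Suc n)))) \<longlonglongrightarrow> sqrt (2 * 0)"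
    by (intro tendsto_real_sqrt tendsto_mult tendsto_const LIMSEQ_Suc lim_1_over_n)
  then have "\<kappa> \<longlonglongrightarrow> 2 * (real (card S) * B * sqrt (2 * 0))"
    unfolding \<kappa>_def by (intro tendsto_mult tendsto_const)
  then have \<kappa>0: "\<kappa> \<longlonglongrightarrow> 0"
    by simp
  have "\<exists>l. (\<lambda>n. F n i) \<longlonglongrightarrow> l" if i: "i \<in> S" for i
  proof (rule Cauchy_convergent_real_or_complex, rule CauchyI)
    fix e :: real assume "e > 0"
    then have "eventually (\<lambda>n. \<kappa> n < e) sequentially"
      using \<kappa>0 by (simp add: order_tendstoD(2))
    then obtain M where M: "\<kappa> M < e"
      by (auto simp: eventually_sequentially)
    have "norm (F k i - F n i) < e" if "k \<ge> M" "n \<ge> M" for k n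
    proof -
      have "N (F k) \<le> m + 1 / real (Suc M)" "N (F n) \<le> m + 1 / real (Suc M)"
        using F(2)[of k] F(2)[of n] that frac_le[of 1 1 "real (Suc M)" "real (Suc k)"]
          frac_le[of 1 1 "real (Suc M)" "real (Suc n)"] by fastforce+
      then have "norm (F k i - F n i) \<le> \<kappa> M"
        unfolding \<kappa>_def by (intro close F(1) i) auto
      then show ?thesis
        using M by linarith
    qed
    then show "\<exists>M. \<forall>k\<ge>M. \<forall>n\<ge>M. norm (F k i - F n i) < e"
      by blast
  qed
  then obtain f where f: "\<And>i. i \<in> S \<Longrightarrow> (\<lambda>n. F n i) \<longlonglongrightarrow> f i"
    by metis
  have fC: "f \<in> C"
    using closed F(1) f by blast
  have qf: "q g f \<le> m" if "g \<in> carrier G" for g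
  proof -
    have "(\<lambda>n. q g (F n)) \<longlonglongrightarrow> q g f"
      unfolding q_def ac_def
      by (intro tendsto_sum tendsto_power tendsto_norm tendsto_mult tendsto_const f)
    moreover have "(\<lambda>n. m + 1 / real (Suc n)) \<longlonglongrightarrow> m + 0"
      by (intro tendsto_add tendsto_const LIMSEQ_Suc lim_1_over_n)
    ultimately have "q g f \<le> m + 0"
      by (rule LIMSEQ_le) (use N_ge[OF that] F(2) order_trans in blast)
    then show ?thesis
      by simp
  qed
  have "ac g f i = f i" if g: "g \<in> carrier G" and i: "i \<in> S" for g i
  proof -
    have acC: "ac g f \<in> C"
      unfolding ac_def by (rule inv[OF fC g])
    \<comment> \<open>Translating by \<open>g\<close> only permutes the family over which the
      supremum is taken, so \<open>ac g f\<close> is a minimizer as well; \<open>close\<close> with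
      arbitrarily small error identifies it with \<open>f\<close>.\<close>
    have "q h (ac g f) = q (h \<otimes> g) f" if "h \<in> carrier G" for h
      unfolding q_def using that g by (intro sum.cong) (auto simp: ac_ac)
    then have qacf: "q h (ac g f) \<le> m" if "h \<in> carrier G" for h
      using qf that g by auto
    have "N f \<le> m" "N (ac g f) \<le> m"
      unfolding N_def by (intro cSUP_least; use qf qacf in auto)+
    then have "norm (ac g f i - f i) \<le> \<kappa> n" for n
      unfolding \<kappa>_def by (intro close acC fC i) (auto intro: order_trans)
    then have "norm (ac g f i - f i) \<le> 0"
      using \<kappa>0 by (intro LIMSEQ_le_const) auto
    then show ?thesis
      by simp
  qed
  then show ?thesis
    using that fC by (auto simp: ac_def)
qed

end

section \<open>Coordinate spaces as functions supported on a finite set\<close>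

abbreviation (input) fun_scale :: "'k::field \<Rightarrow> ('s \<Rightarrow> 'k) \<Rightarrow> 's \<Rightarrow> 'k" where
  "fun_scale c f \<equiv> \<lambda>x. c * f x"

text \<open>The coordinate space over \<open>S\<close> is the subspace of functions that vanish
  outside \<open>S\<close>. Bases and extensions of linear maps are thus obtained in a space that is
  a whole type, and cut down afterwards.\<close>

interpretation fun_vs: vector_space "fun_scale :: 'k::field \<Rightarrow> ('s \<Rightarrow> 'k) \<Rightarrow> _"
  by unfold_locales (auto simp: fun_eq_iff algebra_simps)

interpretation fun_vs_pair: vector_space_pair "fun_scale :: 'k::field \<Rightarrow> ('s \<Rightarrow> 'k) \<Rightarrow> _"
  "fun_scale :: 'k \<Rightarrow> ('t \<Rightarrow> 'k) \<Rightarrow> _"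
  by unfold_locales

lemma sum_fun_apply: "sum F A x = (\<Sum>a\<in>A. F a x)"
  for F :: "'a \<Rightarrow> 'b \<Rightarrow> 'c::comm_monoid_add"
  by (induct A rule: infinite_finite_induct) auto

lemma independent_finite_support:
  fixes B :: "('s \<Rightarrow> 'k::field) set"
  assumes "finite S" "fun_vs.independent B" "B \<subseteq> {f. \<forall>i. i \<notin> S \<longrightarrow> f i = 0}"
  shows "finite B"
proof -
  define T where "T = (\<lambda>j i. if i = j then 1 else 0 :: 'k) ` S"
  have "f \<in> fun_vs.span T" if "f \<in> B" for f
  proof -
    have "f = (\<Sum>j\<in>S. (\<lambda>x. f j * (if x = j then 1 else 0)))"
    proof
      fix x
      have "(\<Sum>j\<in>S. f j * (if x = j then 1 else 0)) = (\<Sum>j\<in>S. if j = x then f j else 0)"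
        by (rule sum.cong) auto
      also have "\<dots> = f x"
        using assms(1,3) that by auto
      finally show "f x = (\<Sum>j\<in>S. (\<lambda>x. f j * (if x = j then 1 else 0))) x"
        by (simp add: sum_fun_apply)
    qed
    also have "\<dots> \<in> fun_vs.span T"
      by (intro fun_vs.span_sum fun_vs.span_scale fun_vs.span_base) (auto simp: T_def)
    finally show ?thesis .
  qed
  then have "B \<subseteq> fun_vs.span T"
    by auto
  moreover have "finite T"
    using assms(1) by (simp add: T_def)
  ultimately show ?thesis
    using fun_vs.independent_span_bound assms(2) by blast
qed

text \<open>The coordinate map \<open>L\<close> is extended linearly to all functions. It can be
  applied and moved through sums without membership conditions; only the expansion is confined to
  the span.\<close>

lemma finite_independent_coordinates:
  fixes B :: "('s \<Rightarrow> 'k::field) set"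
  assumes B: "finite B" "fun_vs.independent B"
  obtains d b L where "b ` {..<d} = B"
    "Vector_Spaces.linear fun_scale fun_scale (L :: ('s \<Rightarrow> 'k) \<Rightarrow> nat \<Rightarrow> 'k)"
    "\<And>j k. j < d \<Longrightarrow> L (b j) k = (if k = j then 1 else 0)"
    "\<And>f x. f \<in> fun_vs.span B \<Longrightarrow> f x = (\<Sum>k<d. L f k * b k x)"
proof -
  define d where "d = card B"
  obtain b where b: "bij_betw b {..<d} B"
    using ex_bij_betw_nat_finite[OF B(1)] by (auto simp: d_def lessThan_atLeast0)
  obtain L where L: "Vector_Spaces.linear fun_scale fun_scale L"
    "\<And>x. x \<in> B \<Longrightarrow> L x = (\<lambda>k. if k = the_inv_into {..<d} b x then 1 else 0)"
    using fun_vs_pair.linear_independent_extend[OF B(2), of "\<lambda>x k. if k = the_inv_into {..<d} b x then 1 else 0"]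
    by auto
  interpret L: Vector_Spaces.linear fun_scale fun_scale L
    by (rule L(1))
  have Lb: "L (b j) = (\<lambda>k. if k = j then 1 else 0)" if "j < d" for j
    using that b L(2) by (auto simp: bij_betw_def the_inv_into_f_f)
  define E :: "('s \<Rightarrow> 'k) \<Rightarrow> 's \<Rightarrow> 'k" where "E f = (\<lambda>x. \<Sum>k<d. L f k * b k x)" for f
  interpret EL: Vector_Spaces.linear fun_scale fun_scale E
    by unfold_locales (simp_all add: E_def L.add L.scale fun_eq_iff distrib_right sum.distrib
        sum_distrib_left mult.assoc)
  interpret idl: Vector_Spaces.linear fun_scale fun_scale "\<lambda>f :: 's \<Rightarrow> 'k. f"
    by unfold_locales auto
  have "E (b j) = b j" if "j < d" for j
  proof
    fix i
    have "E (b j) i = (\<Sum>k<d. if k = j then b j i else 0)"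
      unfolding E_def Lb[OF that] by (intro sum.cong) auto
    then show "E (b j) i = b j i"
      using that by simp
  qed
  then have "E x = x" if "x \<in> B" for x
    using that b unfolding bij_betw_def by (metis imageE lessThan_iff)
  then have Ef: "E f = f" if "f \<in> fun_vs.span B" for f
    using fun_vs_pair.linear_eq_on[OF EL.linear_axioms idl.linear_axioms] that by blast
  have "f x = (\<Sum>k<d. L f k * b k x)" if "f \<in> fun_vs.span B" for f x
    using fun_cong[OF Ef[OF that], of x] unfolding E_def by (rule sym)
  moreover have "b ` {..<d} = B"
    using b by (simp add: bij_betw_def)
  moreover have "L (b j) k = (if k = j then 1 else 0)" if "j < d" for j k
    using Lb[OF that] by simp
  ultimately show ?thesis
    using that L(1) by blast
qed

text \<open>Values outside \<open>S\<close> are reset to 0, so that the result lies in the copy of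
  the coordinate space that contains the subspaces \<open>W\<close>.\<close>

definition app :: "'s set \<Rightarrow> ('s \<Rightarrow> 's \<Rightarrow> 'k) \<Rightarrow> ('s \<Rightarrow> 'k) \<Rightarrow> 's \<Rightarrow> 'k::field" where
  "app S P f = (\<lambda>i. if i \<in> S then \<Sum>j\<in>S. P i j * f j else 0)"

lemma linear_functional_coordinates:
  fixes L :: "('s \<Rightarrow> 'k::field) \<Rightarrow> 't \<Rightarrow> 'k"
  assumes L: "Vector_Spaces.linear fun_scale fun_scale L" and fin: "finite S"
    and f: "\<And>i. i \<notin> S \<Longrightarrow> f i = 0"
  shows "L f t = (\<Sum>j\<in>S. L (\<lambda>i. if i = j then 1 else 0) t * f j)"
proof -
  interpret Vector_Spaces.linear fun_scale fun_scale L by (rule L)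
  have "f = (\<Sum>j\<in>S. (\<lambda>x. f j * (if x = j then 1 else 0)))"
  proof
    fix x
    have "(\<Sum>j\<in>S. f j * (if x = j then 1 else 0)) = (\<Sum>j\<in>S. if j = x then f j else 0)"
      by (rule sum.cong) auto
    also have "\<dots> = f x"
      using f[of x] fin by simp
    finally show "f x = (\<Sum>j\<in>S. (\<lambda>x. f j * (if x = j then 1 else 0))) x"
      by (simp add: sum_fun_apply)
  qed
  then have "L f = L (\<Sum>j\<in>S. (\<lambda>x. f j * (if x = j then 1 else 0)))"
    by (rule arg_cong)
  also have "\<dots> = (\<Sum>j\<in>S. L (\<lambda>x. f j * (if x = j then 1 else 0)))"
    by (rule sum)
  also have "\<dots> = (\<Sum>j\<in>S. (\<lambda>t. f j * L (\<lambda>i. if i = j then 1 else 0) t))"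
    by (simp only: scale)
  finally show ?thesis
    by (simp add: sum_fun_apply mult.commute)
qed

text \<open>A left inverse of the inclusion of \<open>W\<close>, read off as a matrix from the
  images of the unit vectors. Since \<open>app\<close> ignores \<open>f\<close> outside
  \<open>S\<close>, the first conclusion holds for every function.\<close>

lemma projection_exists:
  fixes W :: "('s \<Rightarrow> 'k::field) set"
  assumes fin: "finite S" and W: "fun_vs.subspace W" and supp: "W \<subseteq> {f. \<forall>i. i \<notin> S \<longrightarrow> f i = 0}"
  obtains P where "\<And>f. app S P f \<in> W" "\<And>f. f \<in> W \<Longrightarrow> app S P f = f"
proof -
  interpret idl: Vector_Spaces.linear fun_scale fun_scale "\<lambda>x :: 's \<Rightarrow> 'k. x"
    by unfold_locales auto
  obtain L where L: "range L \<subseteq> W" "Vector_Spaces.linear fun_scale fun_scale L"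
    "\<And>v. v \<in> W \<Longrightarrow> L v = v"
    using fun_vs_pair.linear_exists_left_inverse_on[OF idl.linear_axioms W] by auto
  define P where "P i j = L (\<lambda>i. if i = j then 1 else 0) i" for i j
  have eq: "app S P f = L (\<lambda>i. if i \<in> S then f i else 0)" for f
  proof
    fix t
    show "app S P f t = L (\<lambda>i. if i \<in> S then f i else 0) t"
    proof (cases "t \<in> S")
      case True
      have "L (\<lambda>i. if i \<in> S then f i else 0) t
          = (\<Sum>j\<in>S. L (\<lambda>i. if i = j then 1 else 0) t * (if j \<in> S then f j else 0))"
        by (rule linear_functional_coordinates[OF L(2) fin]) auto
      then show ?thesis
        using True by (simp add: app_def P_def)
    next
      case False
      then show ?thesis
        using supp L(1) by (auto simp: app_def)
    qed
  qed
  have "app S P f = f" if "f \<in> W" for f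
  proof -
    have "(\<lambda>i. if i \<in> S then f i else 0) = f"
      using supp that by (auto simp: fun_eq_iff)
    then show ?thesis
      using that L(3) by (simp add: eq)
  qed
  moreover have "app S P f \<in> W" for f
    using L(1) by (auto simp: eq)
  ultimately show ?thesis
    using that by blast
qed

section \<open>Continuity of sums and products of scalar functions\<close>

lemma continuous_map_euclidean_atin:
  "continuous_map X euclidean f \<longleftrightarrow> (\<forall>x\<in>topspace X. (f \<longlongrightarrow> f x) (atin X x))"
  by (simp add: continuous_map_atin limitin_canonical_iff)

lemma continuous_map_euclidean_mult:
  fixes f g :: "'a \<Rightarrow> 'k::real_normed_algebra"
  assumes "continuous_map X euclidean f" "continuous_map X euclidean g"
  shows "continuous_map X euclidean (\<lambda>x. f x * g x)"
  using assms by (auto simp: continuous_map_euclidean_atin intro: tendsto_mult)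

lemma continuous_map_euclidean_add:
  fixes f g :: "'a \<Rightarrow> 'k::real_normed_vector"
  assumes "continuous_map X euclidean f" "continuous_map X euclidean g"
  shows "continuous_map X euclidean (\<lambda>x. f x + g x)"
  using assms by (auto simp: continuous_map_euclidean_atin intro: tendsto_add)

lemma continuous_map_euclidean_sum:
  fixes f :: "'i \<Rightarrow> 'a \<Rightarrow> 'k::real_normed_vector"
  assumes "\<And>i. i \<in> I \<Longrightarrow> continuous_map X euclidean (f i)"
  shows "continuous_map X euclidean (\<lambda>x. \<Sum>i\<in>I. f i x)"
  using assms by (induct I rule: infinite_finite_induct) (auto intro: continuous_map_euclidean_add)

section \<open>Equivariant projections and the bicommutant theorem\<close>

context compact_topological_group
begin

lemma linear_action_inv:
  assumes "linear_action S a" "g \<in> carrier G" "i \<in> S" "j \<in> S"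
  shows "(\<Sum>k\<in>S. a g i k * a (inv g) k j) = (if i = j then 1 else 0)"
    and "(\<Sum>k\<in>S. a (inv g) i k * a g k j) = (if i = j then 1 else 0)"
proof -
  have one: "a \<one> i j = (if i = j then 1 else 0)"
    and mult: "\<And>g h. g \<in> carrier G \<Longrightarrow> h \<in> carrier G \<Longrightarrow> (\<Sum>k\<in>S. a g i k * a h k j) = a (g \<otimes> h) i j"
    using assms by (auto simp: linear_action_def)
  show "(\<Sum>k\<in>S. a g i k * a (inv g) k j) = (if i = j then 1 else 0)"
    and "(\<Sum>k\<in>S. a (inv g) i k * a g k j) = (if i = j then 1 else 0)"
    using \<open>g \<in> carrier G\<close> by (simp_all only: mult inv_closed r_inv l_inv one)
qed

lemma continuous_entry_inv:
  assumes "linear_action S a" "i \<in> S" "j \<in> S"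
  shows "continuous_map TG euclidean (\<lambda>g. a (inv g) i j)"
proof -
  have "continuous_map TG euclidean ((\<lambda>g. a g i j) \<circ> m_inv G)"
    using continuous_inv by (rule continuous_map_compose) (use assms in \<open>auto simp: linear_action_def\<close>)
  then show ?thesis
    by (simp add: o_def)
qed

text \<open>This is \<open>P \<mapsto> g P g^{-1}\<close> on matrices \<open>P\<close>, viewed as
  functions on pairs of indices. Its fixed points are the matrices that commute with the
  representation.\<close>

lemma linear_action_conjugation:
  assumes "linear_action S a"
  shows "linear_action (S \<times> S) (\<lambda>g (i, j) (k, l). a g i k * a (inv g) l j)"
proof -
  have "(a (g \<otimes> h) i k * a (inv (g \<otimes> h)) l j) =
      (\<Sum>(p, q)\<in>S \<times> S. (a g i p * a (inv g) q j) * (a h p k * a (inv h) l q))"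
    if "g \<in> carrier G" "h \<in> carrier G" "i \<in> S" "j \<in> S" "k \<in> S" "l \<in> S" for g h i j k l
  proof -
    have "a (g \<otimes> h) i k * a (inv (g \<otimes> h)) l j
        = (\<Sum>p\<in>S. a g i p * a h p k) * (\<Sum>q\<in>S. a (inv h) l q * a (inv g) q j)"
      using assms that by (simp add: inv_mult_group linear_action_def)
    also have "\<dots> = (\<Sum>(p, q)\<in>S \<times> S. (a g i p * a h p k) * (a (inv h) l q * a (inv g) q j))"
      by (simp add: sum_product sum.cartesian_product)
    also have "\<dots> = (\<Sum>(p, q)\<in>S \<times> S. (a g i p * a (inv g) q j) * (a h p k * a (inv h) l q))"
      by (intro sum.cong) auto
    finally show ?thesis .
  qed
  then show ?thesis
    using assms continuous_entry_inv[OF assms]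
    by (auto simp: linear_action_def case_prod_unfold intro!: continuous_map_euclidean_mult)
qed

text \<open>The matrices of projections onto \<open>W\<close> form a nonempty closed convex set,
  stable under conjugation because \<open>W\<close> is invariant. A fixed point of conjugation is an
  equivariant projection.\<close>

lemma equivariant_projection:
  fixes a :: "'g \<Rightarrow> 's \<Rightarrow> 's \<Rightarrow> 'k::real_or_complex" and W :: "('s \<Rightarrow> 'k) set"
  assumes act: "linear_action S a" and W: "fun_vs.subspace W"
    and supp: "W \<subseteq> {f. \<forall>i. i \<notin> S \<longrightarrow> f i = 0}"
    and inv: "\<And>f g. f \<in> W \<Longrightarrow> g \<in> carrier G \<Longrightarrow> app S (a g) f \<in> W"
  obtains P where "\<And>f. app S P f \<in> W" "\<And>f. f \<in> W \<Longrightarrow> app S P f = f"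
    "\<And>g i j. g \<in> carrier G \<Longrightarrow> i \<in> S \<Longrightarrow> j \<in> S \<Longrightarrow> (\<Sum>k\<in>S. P i k * a g k j) = (\<Sum>k\<in>S. a g i k * P k j)"
proof -
  have fin: "finite S"
    using act by (simp add: linear_action_def)
  obtain P0 where P0: "\<And>f. app S P0 f \<in> W" "\<And>f. f \<in> W \<Longrightarrow> app S P0 f = f"
    by (rule projection_exists[OF fin W supp]) blast
  \<comment> \<open>Matrices are functions on pairs here, the form in which the fixed point lemma
    accepts them; \<open>curry\<close> turns them back into matrices.\<close>
  define C :: "('s \<times> 's \<Rightarrow> 'k) set" where
    "C = {P. (\<forall>f. app S (curry P) f \<in> W) \<and> (\<forall>f\<in>W. app S (curry P) f = f)}"
  define c where "c = (\<lambda>g (i, j) (k, l). a g i k * a (m_inv G g) l j)"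
  have c: "linear_action (S \<times> S) c"
    unfolding c_def by (rule linear_action_conjugation[OF act])
  \<comment> \<open>Membership in \<open>W\<close> becomes a linear equation in finitely many
    coordinates; this is what makes \<open>C\<close> closed under limits.\<close>
  have in_W: "f \<in> W \<longleftrightarrow> app S P0 f = f" for f
    using P0 by metis
  obtain P where P: "P \<in> C"
    and fixed: "\<And>g i. g \<in> carrier G \<Longrightarrow> i \<in> S \<times> S \<Longrightarrow> (\<Sum>j\<in>S\<times>S. c g i j * P j) = P i"
  proof (rule linear_action_fixed_point[OF c, of C])
    show "C \<noteq> {}"
      using P0 by (auto simp: C_def intro!: exI[of _ "\<lambda>(i, j). P0 i j"])
  next
    fix F f assume F: "\<And>n::nat. F n \<in> C" and lim: "\<And>i. i \<in> S \<times> S \<Longrightarrow> (\<lambda>n. F n i) \<longlonglongrightarrow> f i"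
    have lim': "(\<lambda>n. app S (curry (F n)) u i) \<longlonglongrightarrow> app S (curry f) u i" for u i
      unfolding app_def using lim by (auto intro!: tendsto_sum tendsto_mult)
    have "app S P0 (app S (curry f) u) = app S (curry f) u" for u
    proof
      fix i
      have "(\<lambda>n. app S P0 (app S (curry (F n)) u) i) \<longlonglongrightarrow> app S P0 (app S (curry f) u) i"
        unfolding app_def[of S P0] using lim' by (auto intro!: tendsto_sum tendsto_mult)
      moreover have "app S P0 (app S (curry (F n)) u) = app S (curry (F n)) u" for n
        using F[of n] P0(2) by (auto simp: C_def)
      ultimately show "app S P0 (app S (curry f) u) i = app S (curry f) u i"
        using lim'[of u i] LIMSEQ_unique by auto
    qed
    then have "app S (curry f) u \<in> W" for u
      using in_W by blast
    moreover have "app S (curry f) u = u" if "u \<in> W" for u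
    proof
      fix i
      have "app S (curry (F n)) u = u" for n
        using F[of n] that by (auto simp: C_def)
      then show "app S (curry f) u i = u i"
        using lim'[of u i] LIMSEQ_unique[OF _ tendsto_const] by auto
    qed
    ultimately show "f \<in> C"
      by (auto simp: C_def)
  next
    fix f f' assume ff': "f \<in> C" "f' \<in> C"
    have eq: "app S (curry (\<lambda>i. (f i + f' i) / 2)) u = (\<lambda>i. 1 / 2 * (app S (curry f) u + app S (curry f') u) i)" for u
      by (auto simp: app_def fun_eq_iff distrib_right add_divide_distrib sum.distrib sum_divide_distrib)
    have "app S (curry (\<lambda>i. (f i + f' i) / 2)) u \<in> W" for u
      unfolding eq using ff' by (intro fun_vs.subspace_scale fun_vs.subspace_add W) (auto simp: C_def)
    moreover have "app S (curry (\<lambda>i. (f i + f' i) / 2)) u = u" if "u \<in> W" for u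
      unfolding eq using ff' that by (auto simp: C_def)
    ultimately show "(\<lambda>i. (f i + f' i) / 2) \<in> C"
      by (simp add: C_def)
  next
    fix f g assume f: "f \<in> C" and g: "g \<in> carrier G"
    \<comment> \<open>Conjugation is composition of maps. Hence the image stays in the invariant
      \<open>W\<close>, and vectors of \<open>W\<close> are fixed because \<open>g\<close> undoes
      its inverse.\<close>
    have eq: "app S (curry (\<lambda>i. \<Sum>j\<in>S\<times>S. c g i j * f j)) u
        = app S (a g) (app S (curry f) (app S (a (m_inv G g)) u))" for u
    proof
      fix i
      have "(\<Sum>j\<in>S. (\<Sum>p\<in>S\<times>S. c g (i, j) p * f p) * u j)
          = (\<Sum>j\<in>S. \<Sum>k\<in>S. \<Sum>l\<in>S. a g i k * a (m_inv G g) l j * f (k, l) * u j)"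
        by (simp add: c_def sum.cartesian_product' sum_distrib_right)
      also have "\<dots> = (\<Sum>k\<in>S. \<Sum>j\<in>S. \<Sum>l\<in>S. a g i k * a (m_inv G g) l j * f (k, l) * u j)"
        by (rule sum.swap)
      also have "\<dots> = (\<Sum>k\<in>S. \<Sum>l\<in>S. \<Sum>j\<in>S. a g i k * a (m_inv G g) l j * f (k, l) * u j)"
        by (rule sum.cong[OF refl], rule sum.swap)
      also have "\<dots> = (\<Sum>k\<in>S. a g i k * (\<Sum>l\<in>S. f (k, l) * (\<Sum>j\<in>S. a (m_inv G g) l j * u j)))"
        by (simp add: sum_distrib_left mult.assoc mult.left_commute)
      finally show "app S (curry (\<lambda>i. \<Sum>j\<in>S\<times>S. c g i j * f j)) u i
        = app S (a g) (app S (curry f) (app S (a (m_inv G g)) u)) i"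
        by (simp add: app_def)
    qed
    have inv_app: "app S (a g) (app S (a (m_inv G g)) u) = u" if "u \<in> W" for u
    proof
      fix i
      have "(\<Sum>k\<in>S. a g i k * (\<Sum>j\<in>S. a (m_inv G g) k j * u j)) = u i" if "i \<in> S"
      proof -
        have "(\<Sum>k\<in>S. a g i k * (\<Sum>j\<in>S. a (m_inv G g) k j * u j))
            = (\<Sum>k\<in>S. \<Sum>j\<in>S. a g i k * a (m_inv G g) k j * u j)"
          by (simp add: sum_distrib_left mult.assoc)
        also have "\<dots> = (\<Sum>j\<in>S. \<Sum>k\<in>S. a g i k * a (m_inv G g) k j * u j)"
          by (rule sum.swap)
        also have "\<dots> = (\<Sum>j\<in>S. (\<Sum>k\<in>S. a g i k * a (m_inv G g) k j) * u j)"
          by (simp add: sum_distrib_right)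
        also have "\<dots> = (\<Sum>j\<in>S. (if i = j then u j else 0))"
          by (rule sum.cong) (auto simp: linear_action_inv(1)[OF act g that])
        finally show ?thesis
          using that fin by simp
      qed
      then show "app S (a g) (app S (a (m_inv G g)) u) i = u i"
        using supp \<open>u \<in> W\<close> by (auto simp: app_def)
    qed
    show "(\<lambda>i. \<Sum>j\<in>S \<times> S. c g i j * f j) \<in> C"
      using f inv g inv_app by (auto simp: C_def eq)
  qed blast
  \<comment> \<open>Multiplying the fixed point equation by \<open>g\<close> from the right cancels
    the inverse of \<open>g\<close> inside the conjugation.\<close>
  have "(\<Sum>k\<in>S. curry P i k * a g k j) = (\<Sum>k\<in>S. a g i k * curry P k j)"
    if g: "g \<in> carrier G" and i: "i \<in> S" and j: "j \<in> S" for g i j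
  proof -
    have "(\<Sum>m\<in>S. P (i, m) * a g m j)
        = (\<Sum>m\<in>S. \<Sum>k\<in>S. \<Sum>l\<in>S. a g i k * a (m_inv G g) l m * P (k, l) * a g m j)"
    proof (rule sum.cong[OF refl])
      fix m assume "m \<in> S"
      then show "P (i, m) * a g m j = (\<Sum>k\<in>S. \<Sum>l\<in>S. a g i k * a (m_inv G g) l m * P (k, l) * a g m j)"
        using fixed[OF g, of "(i, m)"] i
        by (simp add: c_def sum.cartesian_product' flip: sum_distrib_right)
    qed
    also have "\<dots> = (\<Sum>k\<in>S. \<Sum>m\<in>S. \<Sum>l\<in>S. a g i k * a (m_inv G g) l m * P (k, l) * a g m j)"
      by (rule sum.swap)
    also have "\<dots> = (\<Sum>k\<in>S. \<Sum>l\<in>S. \<Sum>m\<in>S. a g i k * a (m_inv G g) l m * P (k, l) * a g m j)"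
      by (rule sum.cong[OF refl], rule sum.swap)
    also have "\<dots> = (\<Sum>k\<in>S. \<Sum>l\<in>S. a g i k * P (k, l) * (\<Sum>m\<in>S. a (m_inv G g) l m * a g m j))"
      by (simp add: sum_distrib_left mult.assoc mult.left_commute)
    also have "\<dots> = (\<Sum>k\<in>S. \<Sum>l\<in>S. if l = j then a g i k * P (k, l) else 0)"
      by (intro sum.cong refl) (simp add: linear_action_inv(2)[OF act g _ j])
    also have "\<dots> = (\<Sum>k\<in>S. a g i k * P (k, j))"
      using j fin by simp
    finally show ?thesis
      by simp
  qed
  then show ?thesis
    using that[of "curry P"] P by (auto simp: C_def)
qed

text \<open>Left multiplication makes the matrices over \<open>S\<close> a module; the blocks of an equivariant
  projection onto a submodule belong to the commutant of \<open>a\<close>.\<close>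

definition mat_fun :: "'s set \<Rightarrow> ('s \<Rightarrow> 's \<Rightarrow> 'k) \<Rightarrow> 's \<times> 's \<Rightarrow> 'k::zero" where
  "mat_fun S y = (\<lambda>(i, j). if i \<in> S \<and> j \<in> S then y i j else 0)"

definition bicommuting :: "'s set \<Rightarrow> ('g \<Rightarrow> 's \<Rightarrow> 's \<Rightarrow> 'k) \<Rightarrow> ('s \<Rightarrow> 's \<Rightarrow> 'k::real_or_complex) \<Rightarrow> bool" where
  "bicommuting S a y \<longleftrightarrow> (\<forall>q. (\<forall>g\<in>carrier G. \<forall>i\<in>S. \<forall>j\<in>S.
        (\<Sum>k\<in>S. q i k * a g k j) = (\<Sum>k\<in>S. a g i k * q k j)) \<longrightarrow>
      (\<forall>i\<in>S. \<forall>j\<in>S. (\<Sum>k\<in>S. q i k * y k j) = (\<Sum>k\<in>S. y i k * q k j)))"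

text \<open>In terms of matrices the last conclusion is \<open>P y = y (P 1)\<close> for every
  \<open>y\<close> in the bicommutant. If \<open>P 1 = 1\<close>, it puts \<open>y\<close> into the
  submodule; if \<open>P 1 = e\<close> and \<open>y\<close> lies in the submodule, it says
  \<open>y = y e\<close>.\<close>

lemma submodule_projection:
  fixes a :: "'g \<Rightarrow> 's \<Rightarrow> 's \<Rightarrow> 'k::real_or_complex" and W :: "('s \<times> 's \<Rightarrow> 'k) set"
  assumes act: "linear_action S a" and W: "fun_vs.subspace W"
    and supp: "W \<subseteq> {f. \<forall>p. p \<notin> S \<times> S \<longrightarrow> f p = 0}"
    and inv: "\<And>f g. f \<in> W \<Longrightarrow> g \<in> carrier G \<Longrightarrow> mat_fun S (\<lambda>i j. \<Sum>k\<in>S. a g i k * f (k, j)) \<in> W"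
  obtains P where "\<And>f. app (S \<times> S) P f \<in> W" "\<And>f. f \<in> W \<Longrightarrow> app (S \<times> S) P f = f"
    "\<And>y i b. bicommuting S a y \<Longrightarrow> i \<in> S \<Longrightarrow> b \<in> S \<Longrightarrow> app (S \<times> S) P (mat_fun S y) (i, b) =
      (\<Sum>k\<in>S. y i k * app (S \<times> S) P (mat_fun S (a \<one>)) (k, b))"
proof -
  have fin: "finite S"
    using act by (simp add: linear_action_def)
  \<comment> \<open>\<open>g\<close> acts on the first index only: a direct sum of copies of
    \<open>a\<close>, one for each column.\<close>
  define a' :: "'g \<Rightarrow> 's \<times> 's \<Rightarrow> 's \<times> 's \<Rightarrow> 'k" where
    "a' = (\<lambda>g (i, j) (k, l). if j = l then a g i k else 0)"
  have sum_a': "(\<Sum>p\<in>S\<times>S. a' g (i, j) p * f p) = (\<Sum>k\<in>S. a g i k * f (k, j))" if "j \<in> S" for g i j f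
  proof -
    have "(\<Sum>p\<in>S\<times>S. a' g (i, j) p * f p) = (\<Sum>k\<in>S. \<Sum>l\<in>S. if j = l then a g i k * f (k, l) else 0)"
      by (simp add: a'_def sum.cartesian_product' if_distrib[of "\<lambda>x. x * _"] cong: if_cong)
    then show ?thesis
      using fin that by simp
  qed
  have sum_a'2: "(\<Sum>p\<in>S\<times>S. f p * a' g p (k, l)) = (\<Sum>i\<in>S. f (i, l) * a g i k)" if "l \<in> S" for g k l f
  proof -
    have "(\<Sum>p\<in>S\<times>S. f p * a' g p (k, l)) = (\<Sum>i\<in>S. \<Sum>j\<in>S. if j = l then f (i, j) * a g i k else 0)"
      by (simp add: a'_def sum.cartesian_product' if_distrib[of "\<lambda>x. _ * x"] cong: if_cong)
    then show ?thesis
      using fin that by simp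
  qed
  have act': "linear_action (S \<times> S) a'"
    unfolding linear_action_def
  proof (intro conjI ballI)
    fix g h p r assume gh: "g \<in> carrier G" "h \<in> carrier G" and pr: "p \<in> S \<times> S" "r \<in> S \<times> S"
    obtain i j k l where [simp]: "p = (i, j)" "r = (k, l)"
      by (metis surj_pair)
    show "a' (g \<otimes> h) p r = (\<Sum>k\<in>S \<times> S. a' g p k * a' h k r)"
      using sum_a'[of j g i "\<lambda>q. a' h q r"] gh pr act
      by (auto simp: a'_def linear_action_def)
  next
    fix p r assume pr: "p \<in> S \<times> S" "r \<in> S \<times> S"
    have "a \<one> i k = (if i = k then 1 else 0)" if "i \<in> S" "k \<in> S" for i k
      using act that by (auto simp: linear_action_def)
    then show "a' \<one> p r = (if p = r then 1 else 0)"
      using pr by (auto simp: a'_def cong: if_cong split: if_splits)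
  qed (use act in \<open>auto simp: a'_def linear_action_def\<close>)
  have inv': "app (S \<times> S) (a' g) f \<in> W" if "f \<in> W" "g \<in> carrier G" for f g
  proof -
    have "app (S \<times> S) (a' g) f = mat_fun S (\<lambda>i j. \<Sum>k\<in>S. a g i k * f (k, j))"
      by (auto simp: app_def mat_fun_def sum_a' fun_eq_iff)
    then show ?thesis
      using inv[OF that] by simp
  qed
  obtain P where P: "\<And>f. app (S \<times> S) P f \<in> W" "\<And>f. f \<in> W \<Longrightarrow> app (S \<times> S) P f = f"
    and Peq: "\<And>g i j. g \<in> carrier G \<Longrightarrow> i \<in> S \<times> S \<Longrightarrow> j \<in> S \<times> S \<Longrightarrow>
      (\<Sum>k\<in>S\<times>S. P i k * a' g k j) = (\<Sum>k\<in>S\<times>S. a' g i k * P k j)"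
    by (rule equivariant_projection[OF act' W supp]) (auto simp: inv')
  have "app (S \<times> S) P (mat_fun S y) (i, b) = (\<Sum>k\<in>S. y i k * app (S \<times> S) P (mat_fun S (a \<one>)) (k, b))"
    if y: "bicommuting S a y" and ib: "i \<in> S" "b \<in> S" for y i b
  proof -
    \<comment> \<open>For fixed columns \<open>b\<close> and \<open>b'\<close> the block of
      \<open>P\<close> is a matrix over \<open>S\<close> that commutes with the group, so
      \<open>y\<close> commutes with it.\<close>
    have block: "(\<Sum>k\<in>S. P (i, b) (k, b') * y k j) = (\<Sum>k\<in>S. y i k * P (k, b) (j, b'))"
      if b: "b \<in> S" "b' \<in> S" and ij: "i \<in> S" "j \<in> S" for i j b b'
    proof -
      have "\<forall>g\<in>carrier G. \<forall>i\<in>S. \<forall>j\<in>S. (\<Sum>k\<in>S. P (i, b) (k, b') * a g k j) = (\<Sum>k\<in>S. a g i k * P (k, b) (j, b'))"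
      proof (intro ballI)
        fix g i j assume "g \<in> carrier G" "i \<in> S" "j \<in> S"
        then show "(\<Sum>k\<in>S. P (i, b) (k, b') * a g k j) = (\<Sum>k\<in>S. a g i k * P (k, b) (j, b'))"
          using Peq[of g "(i, b)" "(j, b')"] b by (simp add: sum_a' sum_a'2)
      qed
      then show ?thesis
        using y[unfolded bicommuting_def, rule_format, of "\<lambda>i k. P (i, b) (k, b')"] ij by blast
    qed
    have "app (S \<times> S) P (mat_fun S y) (i, b) = (\<Sum>k\<in>S. \<Sum>b'\<in>S. P (i, b) (k, b') * y k b')"
      using ib by (simp add: app_def sum.cartesian_product' mat_fun_def)
    also have "\<dots> = (\<Sum>b'\<in>S. \<Sum>k\<in>S. P (i, b) (k, b') * y k b')"
      by (rule sum.swap)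
    also have "\<dots> = (\<Sum>b'\<in>S. \<Sum>k\<in>S. y i k * P (k, b) (b', b'))"
      by (rule sum.cong[OF refl], rule block) (use ib in auto)
    also have "\<dots> = (\<Sum>k\<in>S. \<Sum>b'\<in>S. y i k * P (k, b) (b', b'))"
      by (rule sum.swap)
    also have "\<dots> = (\<Sum>k\<in>S. y i k * (\<Sum>b'\<in>S. P (k, b) (b', b')))"
      by (simp add: sum_distrib_left)
    also have "\<dots> = (\<Sum>k\<in>S. y i k * app (S \<times> S) P (mat_fun S (a \<one>)) (k, b))"
    proof (rule sum.cong[OF refl])
      fix k assume k: "k \<in> S"
      have "(\<Sum>b'\<in>S. P (k, b) (b', b')) = (\<Sum>j\<in>S. \<Sum>b'\<in>S. if b' = j then P (k, b) (j, b') else 0)"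
        using fin by simp
      also have "\<dots> = (\<Sum>q\<in>S\<times>S. P (k, b) q * mat_fun S (a \<one>) q)"
        unfolding sum.cartesian_product using act
        by (intro sum.cong) (auto simp: mat_fun_def linear_action_def)
      finally show "y i k * (\<Sum>b'\<in>S. P (k, b) (b', b')) = y i k * app (S \<times> S) P (mat_fun S (a \<one>)) (k, b)"
        using k ib by (simp add: app_def)
    qed
    finally show ?thesis .
  qed
  from P this show ?thesis
    by (rule that)
qed

text \<open>The span \<open>W\<close> of the group matrices is a submodule that contains the
  identity. The projection onto it fixes the identity, hence it fixes \<open>y\<close> too, and so
  \<open>y\<close> lies in \<open>W\<close>.\<close>

lemma bicommutant:
  fixes a :: "'g \<Rightarrow> 's \<Rightarrow> 's \<Rightarrow> 'k::real_or_complex"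
  assumes act: "linear_action S a" and y: "bicommuting S a y"
  obtains D c where "finite D" "D \<subseteq> carrier G"
    "\<And>i j. i \<in> S \<Longrightarrow> j \<in> S \<Longrightarrow> y i j = (\<Sum>g\<in>D. c g * a g i j)"
proof -
  have fin: "finite S"
    using act by (simp add: linear_action_def)
  define A where "A g = mat_fun S (a g)" for g
  define lm :: "'g \<Rightarrow> ('s \<times> 's \<Rightarrow> 'k) \<Rightarrow> 's \<times> 's \<Rightarrow> 'k" where
    "lm g f = mat_fun S (\<lambda>i j. \<Sum>k\<in>S. a g i k * f (k, j))" for g f
  define W where "W = fun_vs.span (A ` carrier G)"
  interpret lm: Vector_Spaces.linear fun_scale fun_scale "lm g" for g
    by unfold_locales (auto simp: lm_def mat_fun_def fun_eq_iff distrib_left sum.distrib sum_distrib_left mult.left_commute)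
  have lmA: "lm g (A h) = A (g \<otimes> h)" if "g \<in> carrier G" "h \<in> carrier G" for g h
    using act that by (auto simp: lm_def A_def mat_fun_def linear_action_def fun_eq_iff)
  have inv: "lm g f \<in> W" if "f \<in> W" "g \<in> carrier G" for f g
  proof -
    have "lm g f \<in> fun_vs.span (lm g ` A ` carrier G)"
      using that unfolding W_def by (simp add: lm.span_image)
    moreover have "lm g ` A ` carrier G \<subseteq> A ` carrier G"
      using that lmA by auto
    ultimately show ?thesis
      unfolding W_def using fun_vs.span_mono by blast
  qed
  have supp: "W \<subseteq> {f. \<forall>p. p \<notin> S \<times> S \<longrightarrow> f p = 0}"
    unfolding W_def
    by (rule fun_vs.span_minimal) (auto simp: A_def mat_fun_def fun_vs.subspace_def)
  obtain P where P: "\<And>f. app (S \<times> S) P f \<in> W" "\<And>f. f \<in> W \<Longrightarrow> app (S \<times> S) P f = f"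
    and Py: "\<And>y i b. bicommuting S a y \<Longrightarrow> i \<in> S \<Longrightarrow> b \<in> S \<Longrightarrow> app (S \<times> S) P (mat_fun S y) (i, b) =
      (\<Sum>k\<in>S. y i k * app (S \<times> S) P (mat_fun S (a \<one>)) (k, b))"
    by (rule submodule_projection[OF act _ supp]) (auto simp: W_def inv[unfolded W_def lm_def])
  define Y where "Y = mat_fun S y"
  have "A \<one> \<in> W"
    unfolding W_def by (auto intro: fun_vs.span_base)
  then have one: "app (S \<times> S) P (mat_fun S (a \<one>)) = mat_fun S (a \<one>)"
    using P(2) by (simp add: A_def)
  have "app (S \<times> S) P Y (i, b) = Y (i, b)" for i b
  proof (cases "i \<in> S \<and> b \<in> S")
    case True
    have "app (S \<times> S) P Y (i, b) = (\<Sum>k\<in>S. if k = b then y i k else 0)"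
      unfolding Y_def Py[OF y True[THEN conjunct1] True[THEN conjunct2]] one using act True
      by (intro sum.cong) (auto simp: mat_fun_def linear_action_def)
    then show ?thesis
      using True fin by (simp add: Y_def mat_fun_def)
  next
    case False
    then show ?thesis
      by (auto simp: app_def Y_def mat_fun_def)
  qed
  then have "app (S \<times> S) P Y = Y"
    by auto
  then have "Y \<in> W"
    using P(1) by metis
  then obtain t r where t: "finite t" "t \<subseteq> A ` carrier G" and Y: "Y = (\<Sum>v\<in>t. (\<lambda>x. r v * v x))"
    unfolding W_def fun_vs.span_explicit by auto
  obtain D where D: "D \<subseteq> carrier G" "inj_on A D" "t = A ` D"
    using t(2) subset_image_inj by metis
  have "y i j = (\<Sum>g\<in>D. r (A g) * a g i j)" if "i \<in> S" "j \<in> S" for i j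
  proof -
    have "y i j = Y (i, j)"
      using that by (simp add: Y_def mat_fun_def)
    also have "\<dots> = (\<Sum>v\<in>t. r v * v (i, j))"
      by (simp add: Y sum_fun_apply)
    also have "\<dots> = (\<Sum>g\<in>D. r (A g) * A g (i, j))"
      by (simp add: D sum.reindex)
    finally show ?thesis
      using that by (simp add: A_def mat_fun_def)
  qed
  moreover have "finite D"
    using t(1) D finite_imageD by blast
  ultimately show ?thesis
    using that[of D "\<lambda>g. r (A g)"] D(1) by blast
qed

end

section \<open>Schur's lemma and characters\<close>

section \<open>Matrix representations\<close>

lemma mult_mat_entry:
  fixes A B :: "'k::comm_semiring_0 mat"
  assumes "A \<in> carrier_mat m n" "B \<in> carrier_mat n p" "i < m" "j < p"
  shows "(A * B) $$ (i, j) = (\<Sum>k<n. A $$ (i, k) * B $$ (k, j))"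
  using assms by (auto simp: scalar_prod_def lessThan_atLeast0)

lemma mult_unit_vec_eq_col:
  fixes A :: "'k::comm_ring_1 mat"
  assumes "A \<in> carrier_mat m n" "j < n"
  shows "A *\<^sub>v unit_vec n j = col A j"
  using assms by (intro eq_vecI) (auto simp: scalar_prod_right_unit)

lemma mat_eq_mult_vecI:
  fixes A B :: "'k::comm_ring_1 mat"
  assumes "A \<in> carrier_mat m n" "B \<in> carrier_mat m n"
    and eq: "\<And>v. v \<in> carrier_vec n \<Longrightarrow> A *\<^sub>v v = B *\<^sub>v v"
  shows "A = B"
proof (rule mat_col_eqI)
  fix j assume "j < dim_col B"
  then show "col A j = col B j"
    using assms(1,2) eq[of "unit_vec n j"] by (simp add: mult_unit_vec_eq_col)
qed (use assms in auto)

lemma trace_mult_commute: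
  fixes A B :: "'k::comm_semiring_0 mat"
  assumes "A \<in> carrier_mat m n" "B \<in> carrier_mat n m"
  shows "(\<Sum>i<m. (A * B) $$ (i, i)) = (\<Sum>i<n. (B * A) $$ (i, i))"
proof -
  have "(\<Sum>i<m. (A * B) $$ (i, i)) = (\<Sum>i<m. \<Sum>k<n. A $$ (i, k) * B $$ (k, i))"
    by (rule sum.cong[OF refl], rule mult_mat_entry[OF assms]) auto
  also have "\<dots> = (\<Sum>k<n. \<Sum>i<m. A $$ (i, k) * B $$ (k, i))"
    by (rule sum.swap)
  also have "\<dots> = (\<Sum>k<n. (B * A) $$ (k, k))"
    by (rule sum.cong[OF refl]) (simp add: mult_mat_entry[OF assms(2,1)] mult.commute)
  finally show ?thesis .
qed

lemma subspace_module_vec_iff: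
  "VectorSpace.subspace class_ring U (module_vec TYPE('k::field) n) \<longleftrightarrow>
     U \<subseteq> carrier_vec n \<and> 0\<^sub>v n \<in> U \<and> (\<forall>v\<in>U. \<forall>w\<in>U. v + w \<in> U) \<and> (\<forall>c. \<forall>v\<in>U. c \<cdot>\<^sub>v v \<in> U)"
proof -
  interpret vectorspace class_ring "module_vec TYPE('k) n"
    by (rule vec_vs)
  show ?thesis
    using vectorspace_axioms module_axioms
    by (auto simp: VectorSpace.subspace_def submodule_def module_vec_simps)
qed

context compact_topological_group
begin

definition matrix_rep :: "nat \<Rightarrow> ('g \<Rightarrow> 'k::real_or_complex mat) \<Rightarrow> bool" where
  "matrix_rep n \<sigma> \<longleftrightarrow>
     (\<forall>g\<in>carrier G. \<sigma> g \<in> carrier_mat n n) \<and> \<sigma> \<one> = 1\<^sub>m n \<and>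
     (\<forall>g\<in>carrier G. \<forall>h\<in>carrier G. \<sigma> (g \<otimes> h) = \<sigma> g * \<sigma> h) \<and>
     (\<forall>i<n. \<forall>j<n. continuous_map TG euclidean (\<lambda>g. \<sigma> g $$ (i, j)))"

text \<open>The dimensions are listed as in \<open>carrier_mat m n\<close>: the map goes from the
  space of \<open>\<sigma>\<close>, of dimension \<open>n\<close>, to that of \<open>\<tau>\<close>,
  of dimension \<open>m\<close>.\<close>

definition intertwines :: "nat \<Rightarrow> nat \<Rightarrow> 'k mat \<Rightarrow> ('g \<Rightarrow> 'k mat) \<Rightarrow> ('g \<Rightarrow> 'k::real_or_complex mat) \<Rightarrow> bool" where
  "intertwines m n X \<sigma> \<tau> \<longleftrightarrow> X \<in> carrier_mat m n \<and> (\<forall>g\<in>carrier G. X * \<sigma> g = \<tau> g * X)"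

lemma matrix_rep_carrier: "matrix_rep n \<sigma> \<Longrightarrow> g \<in> carrier G \<Longrightarrow> \<sigma> g \<in> carrier_mat n n"
  by (simp add: matrix_rep_def)

lemma linear_action_matrix_rep:
  assumes "matrix_rep n \<sigma>"
  shows "linear_action {..<n} (\<lambda>g i j. \<sigma> g $$ (i, j))"
  unfolding linear_action_def
proof (intro conjI ballI)
  fix g h i j assume "g \<in> carrier G" "h \<in> carrier G" "i \<in> {..<n}" "j \<in> {..<n}"
  then show "\<sigma> (g \<otimes> h) $$ (i, j) = (\<Sum>k\<in>{..<n}. \<sigma> g $$ (i, k) * \<sigma> h $$ (k, j))"
    using assms by (auto simp: matrix_rep_def intro!: mult_mat_entry)
qed (use assms in \<open>auto simp: matrix_rep_def\<close>)

text \<open>The bicommutant theorem for the direct sum over \<open>F\<close>. As there are no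
  nonzero intertwiners between different summands, the commutant is block diagonal, and blocks
  \<open>y i\<close> that commute with the individual commutants form an element of the bicommutant.
  One combination of group elements then serves all summands at once.\<close>

lemma simultaneous_bicommutant:
  fixes \<sigma> :: "'i \<Rightarrow> 'g \<Rightarrow> 'k::real_or_complex mat" and y :: "'i \<Rightarrow> 'k mat"
  assumes fin: "finite F" and rep: "\<And>i. i \<in> F \<Longrightarrow> matrix_rep (n i) (\<sigma> i)"
    and disj: "\<And>i j X. i \<in> F \<Longrightarrow> j \<in> F \<Longrightarrow> i \<noteq> j \<Longrightarrow> intertwines (n i) (n j) X (\<sigma> j) (\<sigma> i) \<Longrightarrow>
      X = 0\<^sub>m (n i) (n j)"
    and y: "\<And>i. i \<in> F \<Longrightarrow> y i \<in> carrier_mat (n i) (n i)"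
    and comm: "\<And>i X. i \<in> F \<Longrightarrow> intertwines (n i) (n i) X (\<sigma> i) (\<sigma> i) \<Longrightarrow> X * y i = y i * X"
  obtains D c where "finite D" "D \<subseteq> carrier G"
    "\<And>i p r. i \<in> F \<Longrightarrow> p < n i \<Longrightarrow> r < n i \<Longrightarrow> y i $$ (p, r) = (\<Sum>g\<in>D. c g * \<sigma> i g $$ (p, r))"
proof -
  define S where "S = (SIGMA i:F. {..<n i})"
  define blk :: "('i \<Rightarrow> 'k mat) \<Rightarrow> 'i \<times> nat \<Rightarrow> 'i \<times> nat \<Rightarrow> 'k" where
    "blk B = (\<lambda>(i, p) (j, r). if i = j then B i $$ (p, r) else 0)" for B
  have sum_l: "(\<Sum>z\<in>S. blk B (i, p) z * f z) = (\<Sum>r<n i. B i $$ (p, r) * f (i, r))" if "i \<in> F" for B i p f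
  proof -
    have "(\<Sum>z\<in>S. blk B (i, p) z * f z) = (\<Sum>j\<in>F. \<Sum>r<n j. blk B (i, p) (j, r) * f (j, r))"
      unfolding S_def using fin by (subst sum.Sigma) (auto simp: case_prod_unfold)
    also have "\<dots> = (\<Sum>j\<in>F. if i = j then \<Sum>r<n i. B i $$ (p, r) * f (i, r) else 0)"
      by (rule sum.cong) (auto simp: blk_def)
    finally show ?thesis
      using that fin by simp
  qed
  have sum_r: "(\<Sum>z\<in>S. f z * blk B z (j, r)) = (\<Sum>p<n j. f (j, p) * B j $$ (p, r))" if "j \<in> F" for B j r f
  proof -
    have "(\<Sum>z\<in>S. f z * blk B z (j, r)) = (\<Sum>i\<in>F. \<Sum>p<n i. f (i, p) * blk B (i, p) (j, r))"
      unfolding S_def using fin by (subst sum.Sigma) (auto simp: case_prod_unfold)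
    also have "\<dots> = (\<Sum>i\<in>F. if i = j then \<Sum>p<n j. f (j, p) * B j $$ (p, r) else 0)"
      by (rule sum.cong) (auto simp: blk_def)
    finally show ?thesis
      using that fin by simp
  qed
  define a where "a g = blk (\<lambda>i. \<sigma> i g)" for g
  have la: "linear_action {..<n i} (\<lambda>g p r. \<sigma> i g $$ (p, r))" if "i \<in> F" for i
    by (rule linear_action_matrix_rep[OF rep[OF that]])
  have act: "linear_action S a"
    unfolding linear_action_def
  proof (intro conjI ballI)
    show "finite S"
      using fin by (simp add: S_def)
  next
    fix z w assume "z \<in> S" "w \<in> S"
    then show "continuous_map TG euclidean (\<lambda>g. a g z w)"
      using la by (cases "fst z = fst w") (auto simp: a_def blk_def S_def linear_action_def)
  next
    fix z w assume "z \<in> S" "w \<in> S"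
    then show "a \<one> z w = (if z = w then 1 else 0)"
      using rep by (auto simp: a_def blk_def S_def matrix_rep_def cong: if_cong split: if_splits)
  next
    fix g h z w assume gh: "g \<in> carrier G" "h \<in> carrier G" and zw: "z \<in> S" "w \<in> S"
    obtain i p j r where [simp]: "z = (i, p)" "w = (j, r)"
      by (metis surj_pair)
    have ij: "i \<in> F" "j \<in> F" "p < n i" "r < n j"
      using zw by (auto simp: S_def)
    show "a (g \<otimes> h) z w = (\<Sum>k\<in>S. a g z k * a h k w)"
    proof (cases "i = j")
      case True
      have "\<sigma> i (g \<otimes> h) $$ (p, r) = (\<Sum>k<n i. \<sigma> i g $$ (p, k) * \<sigma> i h $$ (k, r))"
        using la[OF ij(1)] gh ij True by (simp add: linear_action_def)
      then show ?thesis
        using True ij by (simp add: a_def sum_l) (simp add: blk_def)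
    next
      case False
      then show ?thesis
        using ij by (simp add: a_def sum_l) (simp add: blk_def)
    qed
  qed
  obtain D c where D: "finite D" "D \<subseteq> carrier G"
    "\<And>z w. z \<in> S \<Longrightarrow> w \<in> S \<Longrightarrow> blk y z w = (\<Sum>g\<in>D. c g * a g z w)"
  proof (rule bicommutant[OF act, of "blk y"], unfold bicommuting_def, intro allI impI ballI)
    fix q z w assume q': "\<forall>g\<in>carrier G. \<forall>z\<in>S. \<forall>w\<in>S.
        (\<Sum>k\<in>S. q z k * a g k w) = (\<Sum>k\<in>S. a g z k * q k w)"
      and zw: "z \<in> S" "w \<in> S"
    have q: "(\<Sum>k\<in>S. q z k * a g k w) = (\<Sum>k\<in>S. a g z k * q k w)"
      if "g \<in> carrier G" "z \<in> S" "w \<in> S" for g z w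
      using q' that by blast
    obtain i p j r where [simp]: "z = (i, p)" "w = (j, r)"
      by (metis surj_pair)
    have ij: "i \<in> F" "j \<in> F" "p < n i" "r < n j"
      using zw by (auto simp: S_def)
    \<comment> \<open>The block of \<open>q\<close> in position \<open>(i, j)\<close> is an
      intertwiner: zero by \<open>disj\<close> off the diagonal, and covered by \<open>comm\<close>
      on it.\<close>
    define X where "X = mat (n i) (n j) (\<lambda>(p, r). q (i, p) (j, r))"
    have X: "X \<in> carrier_mat (n i) (n j)"
      by (simp add: X_def)
    have inter: "intertwines (n i) (n j) X (\<sigma> j) (\<sigma> i)"
      unfolding intertwines_def
    proof (intro conjI ballI X eq_matI)
      fix g p r assume g: "g \<in> carrier G" and "p < dim_row (\<sigma> i g * X)" "r < dim_col (\<sigma> i g * X)"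
      then have pr: "p < n i" "r < n j"
        using rep[OF ij(1)] X by (auto simp: matrix_rep_def)
      have "(X * \<sigma> j g) $$ (p, r) = (\<Sum>k<n j. X $$ (p, k) * \<sigma> j g $$ (k, r))"
        using matrix_rep_carrier[OF rep[OF ij(2)] g] X pr by (intro mult_mat_entry)
      also have "\<dots> = (\<Sum>z\<in>S. q (i, p) z * a g z (j, r))"
        using pr ij by (simp add: a_def sum_r X_def)
      also have "\<dots> = (\<Sum>z\<in>S. a g (i, p) z * q z (j, r))"
        using pr ij g by (intro q) (auto simp: S_def)
      also have "\<dots> = (\<Sum>k<n i. \<sigma> i g $$ (p, k) * X $$ (k, r))"
        using pr ij by (simp add: a_def sum_l X_def)
      also have "\<dots> = (\<sigma> i g * X) $$ (p, r)"
        using matrix_rep_carrier[OF rep[OF ij(1)] g] X pr by (intro mult_mat_entry[symmetric])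
      finally show "(X * \<sigma> j g) $$ (p, r) = (\<sigma> i g * X) $$ (p, r)" .
    qed (use matrix_rep_carrier[OF rep] ij X in fastforce)+
    have "X * y j = y i * X"
    proof (cases "i = j")
      case True
      then show ?thesis
        using comm ij inter by blast
    next
      case False
      then have "X = 0\<^sub>m (n i) (n j)"
        using disj ij inter by blast
      then show ?thesis
        using left_mult_zero_mat[OF y[OF ij(2)]] right_mult_zero_mat[OF y[OF ij(1)]] by simp
    qed
    moreover have "(X * y j) $$ (p, r) = (\<Sum>k\<in>S. q z k * blk y k w)"
      using mult_mat_entry[OF X y[OF ij(2)] ij(3,4)] ij by (simp add: sum_r X_def)
    moreover have "(y i * X) $$ (p, r) = (\<Sum>k\<in>S. blk y z k * q k w)"
      using mult_mat_entry[OF y[OF ij(1)] X ij(3,4)] ij by (simp add: sum_l X_def)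
    ultimately show "(\<Sum>k\<in>S. q z k * blk y k w) = (\<Sum>k\<in>S. blk y z k * q k w)"
      by simp
  qed blast
  have "y i $$ (p, r) = (\<Sum>g\<in>D. c g * \<sigma> i g $$ (p, r))" if "i \<in> F" "p < n i" "r < n i" for i p r
    using D(3)[of "(i, p)" "(i, r)"] that by (simp add: S_def blk_def a_def)
  then show ?thesis
    using that D(1,2) by blast
qed

lemma irreducible_matrix_rep:
  assumes "irreducible_representation G TG n \<rho>"
  shows "matrix_rep n \<rho>"
proof -
  have hom: "\<rho> g \<in> carrier_mat n n" if "g \<in> carrier G" for g
    using assms that
    by (auto simp: irreducible_representation_def hom_def units_of_def Units_def module_mat_simps)
  have "\<rho> \<one> = 1\<^sub>m n"
    using assms hom[OF one_closed]
    by (intro mat_eq_mult_vecI)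
      (auto simp: irreducible_representation_def simple_group_module_def group_module_def module_vec_simps)
  moreover have "\<rho> (g \<otimes> h) = \<rho> g * \<rho> h" if "g \<in> carrier G" "h \<in> carrier G" for g h
    using assms that
    by (auto simp: irreducible_representation_def hom_def units_of_def module_mat_simps)
  ultimately show ?thesis
    using assms hom by (auto simp: matrix_rep_def irreducible_representation_def)
qed

lemma irreducible_pos:
  assumes "irreducible_representation G TG n \<rho>"
  shows "n > 0"
proof (rule ccontr)
  assume "\<not> n > 0"
  then have "carrier_vec n = {0\<^sub>v n}"
    by auto
  then show False
    using assms by (auto simp: irreducible_representation_def simple_group_module_def module_vec_simps)
qed

lemma irreducible_invariant_subspace:
  assumes "irreducible_representation G TG n \<rho>" "U \<subseteq> carrier_vec n" "0\<^sub>v n \<in> U"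
    "\<And>v w. v \<in> U \<Longrightarrow> w \<in> U \<Longrightarrow> v + w \<in> U" "\<And>c v. v \<in> U \<Longrightarrow> c \<cdot>\<^sub>v v \<in> U"
    "\<And>g v. g \<in> carrier G \<Longrightarrow> v \<in> U \<Longrightarrow> \<rho> g *\<^sub>v v \<in> U"
  shows "U = {0\<^sub>v n} \<or> U = carrier_vec n"
proof -
  have "VectorSpace.subspace class_ring U (module_vec TYPE('a) n)"
    using assms by (auto simp: subspace_module_vec_iff)
  then show ?thesis
    using assms(1,6)
    by (auto simp: irreducible_representation_def simple_group_module_def module_vec_simps)
qed

lemma irreducible_representationI:
  fixes \<rho> :: "'g \<Rightarrow> 'k::real_or_complex mat"
  assumes rep: "matrix_rep n \<rho>" and pos: "n > 0"
    and simple: "\<And>U. U \<subseteq> carrier_vec n \<Longrightarrow> 0\<^sub>v n \<in> U \<Longrightarrow>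
      (\<And>v w. v \<in> U \<Longrightarrow> w \<in> U \<Longrightarrow> v + w \<in> U) \<Longrightarrow> (\<And>c v. v \<in> U \<Longrightarrow> c \<cdot>\<^sub>v v \<in> U) \<Longrightarrow>
      (\<And>g v. g \<in> carrier G \<Longrightarrow> v \<in> U \<Longrightarrow> \<rho> g *\<^sub>v v \<in> U) \<Longrightarrow> U = {0\<^sub>v n} \<or> U = carrier_vec n"
  shows "irreducible_representation G TG n \<rho>"
proof -
  have car: "\<rho> g \<in> carrier_mat n n" if "g \<in> carrier G" for g
    using rep that by (rule matrix_rep_carrier)
  have "\<rho> g * \<rho> (inv g) = 1\<^sub>m n \<and> \<rho> (inv g) * \<rho> g = 1\<^sub>m n" if "g \<in> carrier G" for g
    using rep that by (metis matrix_rep_def inv_closed r_inv l_inv)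
  then have "\<rho> g \<in> Units (module_mat TYPE('k) n n)" if "g \<in> carrier G" for g
    unfolding Units_def module_mat_simps using car that inv_closed by blast
  then have "\<rho> \<in> hom G (units_of (module_mat TYPE('k) n n))"
    using rep by (simp add: hom_def units_of_def module_mat_simps matrix_rep_def)
  moreover have "carrier_vec n \<noteq> {0\<^sub>v n :: 'k vec}"
    using unit_vec_nonzero[OF pos, where ?'a = 'k] unit_vec_carrier[of n 0, where ?'a = 'k]
    by (metis singletonD)
  moreover have "group_module G (module_vec TYPE('k) n) (\<lambda>g v. \<rho> g *\<^sub>v v)"
    using rep vec_vs mult_add_distrib_mat_vec[OF car] mult_mat_vec[OF car] mult_mat_vec_carrier[OF car]
      assoc_mult_mat_vec[OF car car]
    by (auto simp: group_module_def module_hom_def module_vec_simps matrix_rep_def)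
  ultimately show ?thesis
    using rep simple
    by (auto simp: irreducible_representation_def simple_group_module_def matrix_rep_def
        subspace_module_vec_iff module_vec_simps)
qed

text \<open>Kernel and image of \<open>X\<close> are invariant subspaces, so \<open>X\<close> is
  bijective. The inverse is assembled from preimages of the unit vectors as its columns.\<close>

lemma schur:
  fixes \<rho> \<tau> :: "'g \<Rightarrow> 'k::real_or_complex mat"
  assumes irr: "irreducible_representation G TG n \<rho>" "irreducible_representation G TG m \<tau>"
    and int: "intertwines m n X \<rho> \<tau>" and nz: "X \<noteq> 0\<^sub>m m n"
  obtains Y where "intertwines n m Y \<tau> \<rho>" "X * Y = 1\<^sub>m m" "Y * X = 1\<^sub>m n"
proof -
  have X: "X \<in> carrier_mat m n" and XG: "\<And>g. g \<in> carrier G \<Longrightarrow> X * \<rho> g = \<tau> g * X"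
    using int by (auto simp: intertwines_def)
  have car: "\<And>g. g \<in> carrier G \<Longrightarrow> \<rho> g \<in> carrier_mat n n" "\<And>g. g \<in> carrier G \<Longrightarrow> \<tau> g \<in> carrier_mat m m"
    using irr irreducible_matrix_rep matrix_rep_carrier by blast+
  have XGv: "X *\<^sub>v (\<rho> g *\<^sub>v v) = \<tau> g *\<^sub>v (X *\<^sub>v v)" if "g \<in> carrier G" "v \<in> carrier_vec n" for g v
    using XG[OF that(1)] X car[OF that(1)] that(2) by (metis assoc_mult_mat_vec)
  have X0: "X *\<^sub>v 0\<^sub>v n = 0\<^sub>v m"
    using X by auto
  have \<tau>0: "\<tau> g *\<^sub>v 0\<^sub>v m = 0\<^sub>v m" if "g \<in> carrier G" for g
    using car(2)[OF that] by auto
  define U where "U = {v \<in> carrier_vec n. X *\<^sub>v v = 0\<^sub>v m}"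
  have "U = {0\<^sub>v n} \<or> U = carrier_vec n"
    using X X0 mult_mat_vec_carrier[OF car(1)] \<tau>0
    by (intro irreducible_invariant_subspace[OF irr(1)])
      (auto simp: U_def mult_add_distrib_mat_vec mult_mat_vec XGv)
  moreover have "U \<noteq> carrier_vec n"
  proof
    assume eq: "U = carrier_vec n"
    have "X = 0\<^sub>m m n"
    proof (rule mat_eq_mult_vecI[OF X])
      fix v :: "'k vec" assume "v \<in> carrier_vec n"
      moreover from this have "0\<^sub>m m n *\<^sub>v v = 0\<^sub>v m"
        by (intro eq_vecI) auto
      ultimately show "X *\<^sub>v v = 0\<^sub>m m n *\<^sub>v v"
        unfolding eq[symmetric] by (simp add: U_def)
    qed simp
    then show False
      using nz by simp
  qed
  ultimately have U: "U = {0\<^sub>v n}"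
    by blast
  define R where "R = (\<lambda>v. X *\<^sub>v v) ` carrier_vec n"
  have "R = {0\<^sub>v m} \<or> R = carrier_vec m"
  proof (rule irreducible_invariant_subspace[OF irr(2)])
    show "0\<^sub>v m \<in> R"
      unfolding R_def using X0 by (metis image_eqI zero_carrier_vec)
    show "v + w \<in> R" if "v \<in> R" "w \<in> R" for v w
      using that X unfolding R_def by (auto simp: mult_add_distrib_mat_vec[symmetric])
    show "c \<cdot>\<^sub>v v \<in> R" if "v \<in> R" for c v
      using that X unfolding R_def by (auto simp: mult_mat_vec[symmetric])
    show "\<tau> g *\<^sub>v v \<in> R" if "g \<in> carrier G" "v \<in> R" for g v
      using that mult_mat_vec_carrier[OF car(1)] unfolding R_def by (auto simp: XGv[symmetric])
  qed (use X in \<open>auto simp: R_def\<close>)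
  moreover have "R \<noteq> {0\<^sub>v m}"
  proof
    assume eq: "R = {0\<^sub>v m}"
    have "X = 0\<^sub>m m n"
    proof (rule mat_eq_mult_vecI[OF X])
      fix v :: "'k vec" assume "v \<in> carrier_vec n"
      moreover from this have "0\<^sub>m m n *\<^sub>v v = 0\<^sub>v m"
        by (intro eq_vecI) auto
      ultimately show "X *\<^sub>v v = 0\<^sub>m m n *\<^sub>v v"
        using eq by (auto simp: R_def)
    qed simp
    then show False
      using nz by simp
  qed
  ultimately have R: "R = carrier_vec m"
    by blast
  then have "\<forall>j. \<exists>w. w \<in> carrier_vec n \<and> X *\<^sub>v w = unit_vec m j"
    unfolding R_def by (metis (no_types, lifting) image_iff unit_vec_carrier)
  then obtain w where w: "\<And>j. w j \<in> carrier_vec n" "\<And>j. X *\<^sub>v w j = unit_vec m j"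
    by metis
  define Y where "Y = mat n m (\<lambda>(i, j). w j $ i)"
  have Y: "Y \<in> carrier_mat n m"
    by (simp add: Y_def)
  have colY: "col Y j = w j" if "j < m" for j
    using that w(1)[of j] by (intro eq_vecI) (auto simp: Y_def)
  have XY: "X * Y = 1\<^sub>m m"
  proof (rule mat_col_eqI)
    fix j assume "j < dim_col (1\<^sub>m m :: 'k mat)"
    then show "col (X * Y) j = col (1\<^sub>m m) j"
      using col_mult2[OF X Y, of j] colY w(2) by simp
  qed (use X Y in auto)
  have "Y * X = 1\<^sub>m n"
  proof (rule mat_eq_mult_vecI)
    fix v :: "'k vec" assume v: "v \<in> carrier_vec n"
    have YXv: "Y *\<^sub>v (X *\<^sub>v v) \<in> carrier_vec n"
      using X Y v by auto
    have "X *\<^sub>v (Y *\<^sub>v (X *\<^sub>v v)) = (X * Y) *\<^sub>v (X *\<^sub>v v)"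
      using X Y v by (metis assoc_mult_mat_vec mult_mat_vec_carrier)
    also have "\<dots> = X *\<^sub>v v"
      using X v by (simp add: XY)
    finally have "X *\<^sub>v (Y *\<^sub>v (X *\<^sub>v v) - v) = 0\<^sub>v m"
      using X v YXv by (simp add: mult_minus_distrib_mat_vec[of _ m n])
    then have "Y *\<^sub>v (X *\<^sub>v v) - v \<in> U"
      using v YXv by (simp add: U_def)
    then have "Y *\<^sub>v (X *\<^sub>v v) - v = 0\<^sub>v n"
      using U by simp
    then have "Y *\<^sub>v (X *\<^sub>v v) = v"
      using v Y YXv by (auto simp: vec_eq_iff)
    then show "Y * X *\<^sub>v v = 1\<^sub>m n *\<^sub>v v"
      using X Y v by simp
  qed (use X Y in auto)
  moreover have "Y * \<tau> g = \<rho> g * Y" if g: "g \<in> carrier G" for g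
  proof -
    have "Y * \<tau> g = Y * (\<tau> g * X) * Y"
      using X Y car[OF g] XY by (simp add: assoc_mult_mat[of _ _ m _ m _ m] assoc_mult_mat[of _ _ m _ n _ m])
    also have "\<dots> = Y * (X * \<rho> g) * Y"
      by (simp add: XG g)
    also have "\<dots> = (Y * X) * \<rho> g * Y"
      using X Y car[OF g] by simp
    also have "\<dots> = \<rho> g * Y"
      using Y car[OF g] \<open>Y * X = 1\<^sub>m n\<close> by simp
    finally show ?thesis .
  qed
  ultimately show ?thesis
    using that XY Y by (auto simp: intertwines_def)
qed

text \<open>With \<open>Y\<close> the inverse of \<open>X\<close>, the trace of
  \<open>\<rho> g\<close>, written as \<open>Y * (X * \<rho> g)\<close>, is that of
  \<open>X * \<rho> g * Y\<close>, which is \<open>\<tau> g\<close>.\<close>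

lemma character_eq_of_intertwiner:
  assumes irr: "irreducible_representation G TG n \<rho>" "irreducible_representation G TG m \<tau>"
    and int: "intertwines m n X \<rho> \<tau>" and nz: "X \<noteq> 0\<^sub>m m n"
  shows "character G n \<rho> = character G m \<tau>"
proof -
  obtain Y where Y: "intertwines n m Y \<tau> \<rho>" "X * Y = 1\<^sub>m m" "Y * X = 1\<^sub>m n"
    using schur[OF assms] by blast
  have car: "\<And>g. g \<in> carrier G \<Longrightarrow> \<rho> g \<in> carrier_mat n n" "\<And>g. g \<in> carrier G \<Longrightarrow> \<tau> g \<in> carrier_mat m m"
    "X \<in> carrier_mat m n" "Y \<in> carrier_mat n m"
    using matrix_rep_carrier[OF irreducible_matrix_rep[OF irr(1)]]
      matrix_rep_carrier[OF irreducible_matrix_rep[OF irr(2)]] int Y(1) by (auto simp: intertwines_def)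
  have "(\<Sum>i<n. \<rho> g $$ (i, i)) = (\<Sum>i<m. \<tau> g $$ (i, i))" if g: "g \<in> carrier G" for g
  proof -
    have "Y * (X * \<rho> g) = \<rho> g"
      unfolding assoc_mult_mat[OF car(4,3) car(1)[OF g], symmetric] Y(3)
      using car(1)[OF g] by simp
    moreover have "X * \<rho> g \<in> carrier_mat m n"
      using car(3) car(1)[OF g] by simp
    ultimately have "(\<Sum>i<n. \<rho> g $$ (i, i)) = (\<Sum>i<m. (X * \<rho> g * Y) $$ (i, i))"
      using trace_mult_commute[OF car(4), of "X * \<rho> g"] by simp
    also have "X * \<rho> g * Y = \<tau> g * X * Y"
      using int g by (simp add: intertwines_def)
    also have "\<dots> = \<tau> g * (X * Y)"
      by (rule assoc_mult_mat[OF car(2)[OF g] car(3,4)])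
    also have "\<dots> = \<tau> g"
      using right_mult_one_mat[OF car(2)[OF g]] Y(2) by simp
    finally show ?thesis .
  qed
  then show ?thesis
    by (auto simp: character_def)
qed

text \<open>Otherwise some combination of group elements acts as \<open>1\<close> in one representation and as \<open>0\<close> in
  the other, contradicting the equality of traces.\<close>

lemma intertwiner_of_character_eq:
  fixes \<rho> \<tau> :: "'g \<Rightarrow> 'k::real_or_complex mat"
  assumes irr: "irreducible_representation G TG n \<rho>" "irreducible_representation G TG m \<tau>"
    and eq: "character G n \<rho> = character G m \<tau>"
  obtains X where "intertwines m n X \<rho> \<tau>" "X \<noteq> 0\<^sub>m m n"
proof (rule ccontr)
  assume no: "\<not> thesis"
  note obtained = that
  have none: "X = 0\<^sub>m m n" if "intertwines m n X \<rho> \<tau>" for X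
    using no obtained that by blast
  have none': "X = 0\<^sub>m n m" if X: "intertwines n m X \<tau> \<rho>" for X
  proof (rule ccontr)
    assume "X \<noteq> 0\<^sub>m n m"
    then obtain Y where "intertwines m n Y \<rho> \<tau>" "X * Y = 1\<^sub>m n"
      using schur[OF irr(2,1) X] by blast
    moreover from this have "X * Y = 0\<^sub>m n n"
      using none[of Y] X right_mult_zero_mat[of X n m n] by (auto simp: intertwines_def)
    ultimately have "(1\<^sub>m n :: 'k mat) $$ (0, 0) = 0\<^sub>m n n $$ (0, 0)"
      by simp
    then show False
      using irreducible_pos[OF irr(1)] by simp
  qed
  \<comment> \<open>The booleans index the two summands: \<open>True\<close> stands for
    \<open>\<rho>\<close>, \<open>False\<close> for \<open>\<tau>\<close>.\<close>
  define dim where "dim = (\<lambda>b. if b then n else m)"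
  define \<sigma> where "\<sigma> = (\<lambda>b. if b then \<rho> else \<tau>)"
  define y :: "bool \<Rightarrow> 'k mat" where "y = (\<lambda>b. if b then 1\<^sub>m n else 0\<^sub>m m m)"
  obtain D c where D: "finite D" "D \<subseteq> carrier G"
    "\<And>i p r. i \<in> UNIV \<Longrightarrow> p < dim i \<Longrightarrow> r < dim i \<Longrightarrow> y i $$ (p, r) = (\<Sum>g\<in>D. c g * \<sigma> i g $$ (p, r))"
  proof (rule simultaneous_bicommutant[of UNIV dim \<sigma> y])
    show "X = 0\<^sub>m (dim i) (dim j)" if "i \<noteq> j" "intertwines (dim i) (dim j) X (\<sigma> j) (\<sigma> i)" for i j X
      using that none none' by (cases i; cases j) (auto simp: dim_def \<sigma>_def)
    show "matrix_rep (dim i) (\<sigma> i)" for i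
      using irr irreducible_matrix_rep by (auto simp: dim_def \<sigma>_def)
    show "X * y i = y i * X" if "intertwines (dim i) (dim i) X (\<sigma> i) (\<sigma> i)" for i X
      using that by (auto simp: dim_def y_def intertwines_def)
  qed (auto simp: y_def dim_def)
  have tr: "(\<Sum>p<dim b. y b $$ (p, p)) = (\<Sum>g\<in>D. c g * character G (dim b) (\<sigma> b) g)" for b
  proof -
    have "(\<Sum>p<dim b. y b $$ (p, p)) = (\<Sum>p<dim b. \<Sum>g\<in>D. c g * \<sigma> b g $$ (p, p))"
      using D(3) by simp
    also have "\<dots> = (\<Sum>g\<in>D. c g * (\<Sum>p<dim b. \<sigma> b g $$ (p, p)))"
      by (subst sum.swap) (simp add: sum_distrib_left)
    finally show ?thesis
      using D(2) by (auto simp: character_def intro!: sum.cong)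
  qed
  have "(\<Sum>p<dim True. y True $$ (p, p)) = (\<Sum>p<dim False. y False $$ (p, p))"
    unfolding tr using eq by (simp add: dim_def \<sigma>_def)
  \<comment> \<open>The trace of the identity on one side, of the zero matrix on the other; the
    characteristic is 0.\<close>
  then have "(of_nat n :: 'k) = 0"
    by (simp add: dim_def y_def)
  then show False
    using irreducible_pos[OF irr(1)] by simp
qed

end

section \<open>Complete reducibility and representative functions\<close>

section \<open>Matrix coefficients\<close>

lemma linear_app: "Vector_Spaces.linear fun_scale fun_scale (app S P)"
  by unfold_locales (auto simp: app_def fun_eq_iff distrib_left sum.distrib sum_distrib_left mult.left_commute)

lemma fun_vs_basis:
  fixes U :: "(nat \<Rightarrow> 'k::field) set"
  assumes "fun_vs.subspace U" "U \<subseteq> {f. \<forall>i. i \<notin> {..<n} \<longrightarrow> f i = 0}"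
    and "fun_vs.independent B'" "B' \<subseteq> U"
  obtains B where "B' \<subseteq> B" "finite B" "fun_vs.independent B" "fun_vs.span B = U" "card B = fun_vs.dim U"
proof -
  obtain B where B: "B' \<subseteq> B" "B \<subseteq> U" "fun_vs.independent B" "U \<subseteq> fun_vs.span B"
    using fun_vs.maximal_independent_subset_extend assms(3,4) by blast
  have "finite B"
    using independent_finite_support[OF finite_lessThan B(3)] B(2) assms(2) by blast
  moreover have "fun_vs.span B = U"
    using B(2,4) assms(1) fun_vs.span_minimal by blast
  moreover have "card B = fun_vs.dim U"
    using B by (intro fun_vs.basis_card_eq_dim)
  ultimately show ?thesis
    using that B by blast
qed

text \<open>A basis of the smaller subspace extends properly to one of the larger. This provides the
  measure for the induction on invariant subspaces.\<close>

lemma fun_vs_dim_less: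
  fixes U U' :: "(nat \<Rightarrow> 'k::field) set"
  assumes "fun_vs.subspace U" "U \<subseteq> {f. \<forall>i. i \<notin> {..<n} \<longrightarrow> f i = 0}" "fun_vs.subspace U'" "U' \<subset> U"
  shows "fun_vs.dim U' < fun_vs.dim U"
proof -
  obtain B' where B': "finite B'" "fun_vs.independent B'" "fun_vs.span B' = U'" "card B' = fun_vs.dim U'"
    using fun_vs_basis[OF assms(3) _ fun_vs.independent_empty, of n] assms(2,4) by blast
  have "B' \<subseteq> U"
    using B'(3) assms(4) fun_vs.span_superset by blast
  then obtain B where B: "B' \<subseteq> B" "finite B" "fun_vs.span B = U" "card B = fun_vs.dim U"
    using fun_vs_basis[OF assms(1,2) B'(2)] by blast
  have "B' \<noteq> B"
    using B(3) B'(3) assms(4) by auto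
  then have "card B' < card B"
    using B by (intro psubset_card_mono) auto
  then show ?thesis
    using B B' by simp
qed

locale chosen_representations = compact_topological_group G TG
  for G :: "('g, 'm) monoid_scheme" (structure) and TG :: "'g topology" +
  fixes dimE :: "('g \<Rightarrow> 'k::real_or_complex) \<Rightarrow> nat" and \<rho> :: "('g \<Rightarrow> 'k) \<Rightarrow> 'g \<Rightarrow> 'k mat"
  assumes chosen: "\<epsilon> \<in> irreducible_characters G TG \<Longrightarrow>
    irreducible_representation G TG (dimE \<epsilon>) (\<rho> \<epsilon>) \<and> character G (dimE \<epsilon>) (\<rho> \<epsilon>) = \<epsilon>"
begin

abbreviation "chars \<equiv> irreducible_characters G TG :: ('g \<Rightarrow> 'k) set"

lemma irr: "\<epsilon> \<in> chars \<Longrightarrow> irreducible_representation G TG (dimE \<epsilon>) (\<rho> \<epsilon>)"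
  and char: "\<epsilon> \<in> chars \<Longrightarrow> character G (dimE \<epsilon>) (\<rho> \<epsilon>) = \<epsilon>"
  using chosen by auto

lemma rep: "\<epsilon> \<in> chars \<Longrightarrow> matrix_rep (dimE \<epsilon>) (\<rho> \<epsilon>)"
  using irr irreducible_matrix_rep by blast

definition entry_indices :: "(('g \<Rightarrow> 'k) \<times> nat \<times> nat) set" where
  "entry_indices = (SIGMA \<epsilon>:chars. {..<dimE \<epsilon>} \<times> {..<dimE \<epsilon>})"

text \<open>Extension by 0 makes agreement on \<open>G\<close> the same as equality, and allows
  spans to be formed in the space of all functions on the type.\<close>

definition on_G :: "('g \<Rightarrow> 'k) \<Rightarrow> 'g \<Rightarrow> 'k" where
  "on_G f = (\<lambda>g. if g \<in> carrier G then f g else 0)"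

text \<open>By complete reducibility this is the space of representative functions of
  \<open>G\<close>; \<open>matrix_coefficients\<close> shows that it contains the entries of every
  matrix representation.\<close>

definition coefficient_space :: "('g \<Rightarrow> 'k) set" where
  "coefficient_space = fun_vs.span ((\<lambda>(\<epsilon>, i, j). on_G (\<lambda>g. \<rho> \<epsilon> g $$ (i, j))) ` entry_indices)"

lemma coefficient_space_sum:
  assumes "\<And>i. i \<in> I \<Longrightarrow> on_G (f i) \<in> coefficient_space"
  shows "on_G (\<lambda>g. \<Sum>i\<in>I. c i * f i g) \<in> coefficient_space"
proof -
  have "on_G (\<lambda>g. \<Sum>i\<in>I. c i * f i g) = (\<Sum>i\<in>I. (\<lambda>g. c i * on_G (f i) g))"
    by (auto simp: on_G_def fun_eq_iff sum_fun_apply)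
  also have "\<dots> \<in> coefficient_space"
    unfolding coefficient_space_def
    by (intro fun_vs.span_sum fun_vs.span_scale) (use assms in \<open>auto simp: coefficient_space_def\<close>)
  finally show ?thesis .
qed

lemma coefficient_space_add:
  assumes "on_G f \<in> coefficient_space" "on_G f' \<in> coefficient_space"
  shows "on_G (\<lambda>g. f g + f' g) \<in> coefficient_space"
proof -
  have "on_G (\<lambda>g. f g + f' g) = on_G f + on_G f'"
    by (auto simp: on_G_def fun_eq_iff)
  then show ?thesis
    using assms by (simp add: coefficient_space_def fun_vs.span_add)
qed

lemma coefficient_space_cong:
  assumes "on_G f \<in> coefficient_space" "\<And>g. g \<in> carrier G \<Longrightarrow> f' g = f g"
  shows "on_G f' \<in> coefficient_space"
proof -
  have "on_G f' = on_G f"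
    using assms(2) by (auto simp: on_G_def)
  then show ?thesis
    using assms(1) by simp
qed

lemma coefficient_space_expand:
  assumes "on_G f \<in> coefficient_space"
  obtains F c where "finite F" "F \<subseteq> entry_indices"
    "\<And>g. g \<in> carrier G \<Longrightarrow> f g = (\<Sum>(\<epsilon>, i, j)\<in>F. c (\<epsilon>, i, j) * \<rho> \<epsilon> g $$ (i, j))"
proof -
  define ent where "ent = (\<lambda>(\<epsilon>, i, j). on_G (\<lambda>g. \<rho> \<epsilon> g $$ (i, j)))"
  obtain t r where t: "finite t" "t \<subseteq> ent ` entry_indices" and f: "on_G f = (\<Sum>v\<in>t. (\<lambda>x. r v * v x))"
    using assms unfolding coefficient_space_def ent_def[symmetric] fun_vs.span_explicit by auto
  obtain F where F: "F \<subseteq> entry_indices" "inj_on ent F" "t = ent ` F"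
    using t(2) subset_image_inj by metis
  have "f g = (\<Sum>(\<epsilon>, i, j)\<in>F. r (ent (\<epsilon>, i, j)) * \<rho> \<epsilon> g $$ (i, j))" if "g \<in> carrier G" for g
  proof -
    have "f g = on_G f g"
      using that by (simp add: on_G_def)
    also have "\<dots> = (\<Sum>p\<in>F. r (ent p) * ent p g)"
      by (simp add: f sum_fun_apply F sum.reindex)
    also have "\<dots> = (\<Sum>(\<epsilon>, i, j)\<in>F. r (ent (\<epsilon>, i, j)) * \<rho> \<epsilon> g $$ (i, j))"
      by (rule sum.cong[OF refl]) (use that in \<open>auto simp: ent_def on_G_def\<close>)
    finally show ?thesis .
  qed
  moreover have "finite F"
    using t(1) F finite_imageD by blast
  ultimately show ?thesis
    using that[of F "\<lambda>p. r (ent p)"] F(1) by blast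
qed

text \<open>An irreducible representation is equivalent to the chosen one with the same character,
  \<open>\<tau> g = X * \<rho> \<epsilon> g * Y\<close>, so its entries are combinations of entries
  of \<open>\<rho> \<epsilon>\<close>.\<close>

lemma irreducible_coefficients:
  assumes \<tau>: "irreducible_representation G TG d \<tau>" and kj: "k < d" "j < d"
  shows "on_G (\<lambda>g. \<tau> g $$ (k, j)) \<in> coefficient_space"
proof -
  define \<epsilon> where "\<epsilon> = character G d \<tau>"
  have \<epsilon>: "\<epsilon> \<in> chars"
    using \<tau> by (auto simp: irreducible_characters_def \<epsilon>_def)
  obtain X where X: "intertwines d (dimE \<epsilon>) X (\<rho> \<epsilon>) \<tau>" "X \<noteq> 0\<^sub>m d (dimE \<epsilon>)"
    using intertwiner_of_character_eq[OF irr[OF \<epsilon>] \<tau>] char[OF \<epsilon>] \<epsilon>_def by metis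
  obtain Y where Y: "intertwines (dimE \<epsilon>) d Y \<tau> (\<rho> \<epsilon>)" "X * Y = 1\<^sub>m d"
    using schur[OF irr[OF \<epsilon>] \<tau> X] by metis
  have car: "X \<in> carrier_mat d (dimE \<epsilon>)" "Y \<in> carrier_mat (dimE \<epsilon>) d"
    using X Y by (auto simp: intertwines_def)
  have eq: "\<tau> g $$ (k, j) = (\<Sum>(p, r)\<in>{..<dimE \<epsilon>}\<times>{..<dimE \<epsilon>}. X $$ (k, p) * Y $$ (r, j) * \<rho> \<epsilon> g $$ (p, r))"
    if g: "g \<in> carrier G" for g
  proof -
    have \<rho>g: "\<rho> \<epsilon> g \<in> carrier_mat (dimE \<epsilon>) (dimE \<epsilon>)" and \<tau>g: "\<tau> g \<in> carrier_mat d d"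
      using rep[OF \<epsilon>] irreducible_matrix_rep[OF \<tau>] g matrix_rep_carrier by blast+
    have "\<tau> g = \<tau> g * (X * Y)"
      unfolding Y(2) using right_mult_one_mat[OF \<tau>g] by simp
    also have "\<dots> = \<tau> g * X * Y"
      by (rule assoc_mult_mat[OF \<tau>g car, symmetric])
    also have "\<tau> g * X = X * \<rho> \<epsilon> g"
      using X(1) g by (simp add: intertwines_def)
    also have "X * \<rho> \<epsilon> g * Y = X * (\<rho> \<epsilon> g * Y)"
      by (rule assoc_mult_mat[OF car(1) \<rho>g car(2)])
    finally have "\<tau> g $$ (k, j) = (\<Sum>p<dimE \<epsilon>. X $$ (k, p) * (\<rho> \<epsilon> g * Y) $$ (p, j))"
      using mult_mat_entry[OF car(1) mult_carrier_mat[OF \<rho>g car(2)] kj] by simp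
    also have "\<dots> = (\<Sum>p<dimE \<epsilon>. \<Sum>r<dimE \<epsilon>. X $$ (k, p) * Y $$ (r, j) * \<rho> \<epsilon> g $$ (p, r))"
      using mult_mat_entry[OF \<rho>g car(2) _ kj(2)] by (auto simp: sum_distrib_left mult_ac intro!: sum.cong)
    finally show ?thesis
      by (simp add: sum.cartesian_product)
  qed
  have "on_G (\<lambda>g. \<Sum>pr\<in>{..<dimE \<epsilon>}\<times>{..<dimE \<epsilon>}. (X $$ (k, fst pr) * Y $$ (snd pr, j)) * \<rho> \<epsilon> g $$ (fst pr, snd pr))
      \<in> coefficient_space"
  proof (rule coefficient_space_sum)
    fix pr assume "pr \<in> {..<dimE \<epsilon>} \<times> {..<dimE \<epsilon>}"
    then show "on_G (\<lambda>g. \<rho> \<epsilon> g $$ (fst pr, snd pr)) \<in> coefficient_space"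
      unfolding coefficient_space_def using \<epsilon>
      by (intro fun_vs.span_base image_eqI[of _ _ "(\<epsilon>, fst pr, snd pr)"]) (auto simp: entry_indices_def)
  qed
  then show ?thesis
    by (rule coefficient_space_cong) (simp add: eq case_prod_unfold)
qed

definition invariant_subspace :: "nat \<Rightarrow> ('g \<Rightarrow> 'k mat) \<Rightarrow> (nat \<Rightarrow> 'k) set \<Rightarrow> bool" where
  "invariant_subspace n \<sigma> U \<longleftrightarrow> fun_vs.subspace U \<and> U \<subseteq> {f. \<forall>i. i \<notin> {..<n} \<longrightarrow> f i = 0} \<and>
     (\<forall>g\<in>carrier G. \<forall>f\<in>U. app {..<n} (\<lambda>i j. \<sigma> g $$ (i, j)) f \<in> U)"

text \<open>In coordinates with respect to a basis of \<open>U\<close> the group acts by an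
  irreducible matrix representation \<open>\<tau>\<close>, to which
  \<open>irreducible_coefficients\<close> applies. The entries of the translates of \<open>v\<close>
  are combinations of entries of \<open>\<tau>\<close>.\<close>

lemma simple_subspace_coefficients:
  assumes \<sigma>: "matrix_rep n \<sigma>" and U: "invariant_subspace n \<sigma> U" and ne: "U \<noteq> {0}"
    and simple: "\<And>U'. invariant_subspace n \<sigma> U' \<Longrightarrow> U' \<subseteq> U \<Longrightarrow> U' = {0} \<or> U' = U"
    and v: "v \<in> U"
  shows "on_G (\<lambda>g. app {..<n} (\<lambda>i j. \<sigma> g $$ (i, j)) v i) \<in> coefficient_space"
proof -
  define act where "act g = app {..<n} (\<lambda>i j. \<sigma> g $$ (i, j))" for g
  interpret act: Vector_Spaces.linear fun_scale fun_scale "act g" for g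
    unfolding act_def by (rule linear_app)
  have U1: "fun_vs.subspace U" and U2: "U \<subseteq> {f. \<forall>i. i \<notin> {..<n} \<longrightarrow> f i = 0}"
    and U3: "\<And>g f. g \<in> carrier G \<Longrightarrow> f \<in> U \<Longrightarrow> act g f \<in> U"
    using U by (auto simp: invariant_subspace_def act_def)
  have la: "linear_action {..<n} (\<lambda>g i j. \<sigma> g $$ (i, j))"
    by (rule linear_action_matrix_rep[OF \<sigma>])
  have act_one: "act \<one> f = f" if "f \<in> U" for f
  proof
    fix i
    have "(\<Sum>j<n. \<sigma> \<one> $$ (i, j) * f j) = f i" if "i < n"
    proof -
      have "(\<Sum>j<n. \<sigma> \<one> $$ (i, j) * f j) = (\<Sum>j<n. if j = i then f j else 0)"
        using la that by (intro sum.cong) (auto simp: linear_action_def)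
      then show ?thesis
        using that by simp
    qed
    then show "act \<one> f i = f i"
      using U2 that by (auto simp: act_def app_def)
  qed
  have act_mult: "act (g \<otimes> h) f = act g (act h f)" if "g \<in> carrier G" "h \<in> carrier G" for g h f
  proof
    fix i
    have "(\<Sum>j<n. \<sigma> (g \<otimes> h) $$ (i, j) * f j) = (\<Sum>j<n. \<Sum>k<n. \<sigma> g $$ (i, k) * \<sigma> h $$ (k, j) * f j)" if "i < n"
      using la that \<open>g \<in> carrier G\<close> \<open>h \<in> carrier G\<close> by (simp add: linear_action_def sum_distrib_right)
    also have "\<dots> = (\<Sum>k<n. \<Sum>j<n. \<sigma> g $$ (i, k) * \<sigma> h $$ (k, j) * f j)"
      by (rule sum.swap)
    finally show "act (g \<otimes> h) f i = act g (act h f) i"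
      by (auto simp: act_def app_def sum_distrib_left mult.assoc)
  qed
  obtain B where B: "finite B" "fun_vs.independent B" "fun_vs.span B = U"
    using fun_vs_basis[OF U1 U2 fun_vs.independent_empty] by auto
  obtain d b L where bB: "b ` {..<d} = B"
    and L: "Vector_Spaces.linear fun_scale fun_scale (L :: (nat \<Rightarrow> 'k) \<Rightarrow> nat \<Rightarrow> 'k)"
    and Lb: "\<And>j k. j < d \<Longrightarrow> L (b j) k = (if k = j then 1 else 0)"
    and coord: "\<And>f x. f \<in> fun_vs.span B \<Longrightarrow> f x = (\<Sum>k<d. L f k * b k x)"
    by (rule finite_independent_coordinates[OF B(1,2)]) (rule that)
  have bU: "b k \<in> U" if "k < d" for k
  proof -
    have "b k \<in> B"
      using that bB by blast
    then show ?thesis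
      using B(3) fun_vs.span_base by blast
  qed
  interpret L: Vector_Spaces.linear fun_scale fun_scale L
    by (rule L)
  \<comment> \<open>\<open>E\<close> goes back from coordinates to vectors; \<open>L\<close> and
    \<open>E\<close> are inverse to each other between \<open>U\<close> and the first
    \<open>d\<close> coordinates.\<close>
  define E :: "(nat \<Rightarrow> 'k) \<Rightarrow> nat \<Rightarrow> 'k" where "E c = (\<Sum>k<d. (\<lambda>i. c k * b k i))" for c
  have EU: "E c \<in> U" for c
    unfolding E_def by (intro fun_vs.subspace_sum[OF U1] fun_vs.subspace_scale[OF U1] bU) auto
  have LE: "L (E c) k = c k" if "k < d" for c k
  proof -
    have "L (E c) k = (\<Sum>j<d. c j * L (b j) k)"
      by (simp add: E_def L.sum L.scale sum_fun_apply)
    also have "\<dots> = (\<Sum>j<d. if j = k then c j else 0)"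
      by (rule sum.cong) (auto simp: Lb)
    finally show ?thesis
      using that by simp
  qed
  have E_app: "E c i = (\<Sum>k<d. c k * b k i)" for c i
    by (simp only: E_def sum_fun_apply)
  have EL: "E (L f) = f" if "f \<in> U" for f
  proof
    fix i
    have "f \<in> fun_vs.span B"
      using that B(3) by simp
    then show "E (L f) i = f i"
      unfolding E_app by (rule coord[symmetric])
  qed
  have act_E: "act g (E c) = E (\<lambda>k. \<Sum>j<d. L (act g (b j)) k * c j)" if "g \<in> carrier G" for g c
  proof -
    have "act g (E c) = (\<Sum>j<d. (\<lambda>i. c j * act g (b j) i))"
      by (simp add: E_def act.sum act.scale)
    also have "\<dots> = (\<Sum>j<d. (\<lambda>i. c j * E (L (act g (b j))) i))"
      by (intro sum.cong) (auto simp: EL U3 bU that)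
    also have "\<dots> = E (\<lambda>k. \<Sum>j<d. L (act g (b j)) k * c j)"
    proof
      fix i
      have "(\<Sum>j<d. \<Sum>k<d. c j * (L (act g (b j)) k * b k i)) = (\<Sum>k<d. \<Sum>j<d. c j * (L (act g (b j)) k * b k i))"
        by (rule sum.swap)
      then show "(\<Sum>j<d. (\<lambda>i. c j * E (L (act g (b j))) i)) i = E (\<lambda>k. \<Sum>j<d. L (act g (b j)) k * c j) i"
        by (simp add: E_app sum_fun_apply sum_distrib_left sum_distrib_right mult_ac)
    qed
    finally show ?thesis .
  qed
  define \<tau> where "\<tau> g = mat d d (\<lambda>(k, j). L (act g (b j)) k)" for g
  have \<tau>v: "(\<tau> g *\<^sub>v w) $ k = L (act g (E (\<lambda>j. w $ j))) k" if "g \<in> carrier G" "w \<in> carrier_vec d" "k < d" for g w k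
    using that by (simp add: act_E LE) (simp add: \<tau>_def scalar_prod_def lessThan_atLeast0)
  have \<tau>rep: "matrix_rep d \<tau>"
    unfolding matrix_rep_def
  proof (intro conjI ballI allI impI)
    show "\<tau> g \<in> carrier_mat d d" for g
      by (simp add: \<tau>_def)
    show "\<tau> \<one> = 1\<^sub>m d"
      by (rule eq_matI) (auto simp: \<tau>_def act_one bU Lb)
    show "\<tau> (g \<otimes> h) = \<tau> g * \<tau> h" if "g \<in> carrier G" "h \<in> carrier G" for g h
    proof (rule eq_matI)
      fix k j assume "k < dim_row (\<tau> g * \<tau> h)" "j < dim_col (\<tau> g * \<tau> h)"
      then have kj: "k < d" "j < d"
        by (auto simp: \<tau>_def)
      have "\<tau> (g \<otimes> h) $$ (k, j) = L (act g (act h (b j))) k"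
        using kj that by (simp add: \<tau>_def act_mult)
      also have "act h (b j) = E (L (act h (b j)))"
        using kj that by (simp add: EL U3 bU)
      also have "L (act g (E (L (act h (b j))))) k = (\<Sum>i<d. L (act g (b i)) k * L (act h (b j)) i)"
        using kj that by (simp add: act_E LE)
      also have "\<dots> = (\<Sum>i<d. \<tau> g $$ (k, i) * \<tau> h $$ (i, j))"
        using kj by (simp add: \<tau>_def)
      also have "\<dots> = (\<tau> g * \<tau> h) $$ (k, j)"
        using kj by (intro mult_mat_entry[symmetric]) (auto simp: \<tau>_def)
      finally show "\<tau> (g \<otimes> h) $$ (k, j) = (\<tau> g * \<tau> h) $$ (k, j)" .
    qed (auto simp: \<tau>_def)
    show "continuous_map TG euclidean (\<lambda>g. \<tau> g $$ (k, j))" if "k < d" "j < d" for k j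
    proof -
      have "\<tau> g $$ (k, j) = (\<Sum>i<n. L (\<lambda>i'. if i' = i then 1 else 0) k * (\<Sum>l<n. \<sigma> g $$ (i, l) * b j l))" for g
      proof -
        have "L (act g (b j)) k = (\<Sum>i<n. L (\<lambda>i'. if i' = i then 1 else 0) k * act g (b j) i)"
          by (rule linear_functional_coordinates[OF L]) (auto simp: act_def app_def)
        then show ?thesis
          using that by (simp add: \<tau>_def act_def app_def)
      qed
      then show ?thesis
        using la by (auto simp: linear_action_def
            intro!: continuous_map_euclidean_sum continuous_map_euclidean_mult)
    qed
  qed
  have "d > 0"
  proof (rule ccontr)
    assume "\<not> d > 0"
    then have "B = {}"
      using bB by simp
    then show False
      using B(3) ne by simp
  qed
  have \<tau>irr: "irreducible_representation G TG d \<tau>"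
  proof (rule irreducible_representationI[OF \<tau>rep \<open>d > 0\<close>])
    fix V :: "'k vec set"
    assume V: "V \<subseteq> carrier_vec d" "0\<^sub>v d \<in> V" "\<And>v w. v \<in> V \<Longrightarrow> w \<in> V \<Longrightarrow> v + w \<in> V"
      "\<And>c v. v \<in> V \<Longrightarrow> c \<cdot>\<^sub>v v \<in> V" "\<And>g v. g \<in> carrier G \<Longrightarrow> v \<in> V \<Longrightarrow> \<tau> g *\<^sub>v v \<in> V"
    \<comment> \<open>A subspace \<open>V\<close> of the coordinate space is transported into
      \<open>U\<close>, where the simplicity of \<open>U\<close> can be applied.\<close>
    define EV where "EV = (\<lambda>w. E (\<lambda>j. w $ j)) ` V"
    have inv: "act g (E (\<lambda>j. w $ j)) = E (\<lambda>j. (\<tau> g *\<^sub>v w) $ j)" if "g \<in> carrier G" "w \<in> V" for g w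
    proof -
      have "E (\<lambda>j. (\<tau> g *\<^sub>v w) $ j) = E (L (act g (E (\<lambda>j. w $ j))))"
        unfolding E_def[of "\<lambda>j. (\<tau> g *\<^sub>v w) $ j"] E_def[of "L _"]
        using that V(1) by (intro sum.cong refl) (auto simp: \<tau>v)
      then show ?thesis
        using that by (simp add: EL U3 EU)
    qed
    have "invariant_subspace n \<sigma> EV"
      unfolding invariant_subspace_def
    proof (intro conjI ballI)
      show "fun_vs.subspace EV"
        unfolding fun_vs.subspace_def
      proof (intro conjI ballI allI)
        have "E (\<lambda>j. 0\<^sub>v d $ j) = 0"
          by (intro ext) (simp add: E_app)
        then show "0 \<in> EV"
          unfolding EV_def using V(2) by (metis image_eqI)
      next
        fix x y assume "x \<in> EV" "y \<in> EV"
        then obtain v w where vw: "v \<in> V" "w \<in> V" "x = E (\<lambda>j. v $ j)" "y = E (\<lambda>j. w $ j)"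
          by (auto simp: EV_def)
        moreover have "dim_vec v = d" "dim_vec w = d"
          using vw V(1) by auto
        then have "E (\<lambda>j. (v + w) $ j) = E (\<lambda>j. v $ j) + E (\<lambda>j. w $ j)"
          by (intro ext) (simp add: E_app distrib_right sum.distrib)
        ultimately show "x + y \<in> EV"
          unfolding EV_def using V(3) by (metis image_eqI)
      next
        fix c x assume "x \<in> EV"
        then obtain v where v: "v \<in> V" "x = E (\<lambda>j. v $ j)"
          by (auto simp: EV_def)
        moreover have "dim_vec v = d"
          using v V(1) by auto
        then have "E (\<lambda>j. (c \<cdot>\<^sub>v v) $ j) = (\<lambda>i. c * E (\<lambda>j. v $ j) i)"
          by (intro ext) (simp add: E_app sum_distrib_left mult.assoc)
        ultimately show "(\<lambda>i. c * x i) \<in> EV"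
          unfolding EV_def using V(4) by (metis image_eqI)
      qed
      show "EV \<subseteq> {f. \<forall>i. i \<notin> {..<n} \<longrightarrow> f i = 0}"
        using EU U2 by (auto simp: EV_def)
      show "app {..<n} (\<lambda>i j. \<sigma> g $$ (i, j)) f \<in> EV" if "g \<in> carrier G" "f \<in> EV" for g f
        using that inv V(5) unfolding act_def[symmetric] by (auto simp: EV_def)
    qed
    then have "EV = {0} \<or> EV = U"
      by (rule simple) (auto simp: EV_def EU)
    then show "V = {0\<^sub>v d} \<or> V = carrier_vec d"
    proof
      assume "EV = {0}"
      have "w = 0\<^sub>v d" if "w \<in> V" for w
      proof (rule eq_vecI)
        fix k assume "k < dim_vec (0\<^sub>v d :: 'k vec)"
        moreover have "E (\<lambda>j. w $ j) = 0"
          using imageI[OF that, of "\<lambda>w. E (\<lambda>j. w $ j)"] \<open>EV = {0}\<close> unfolding EV_def by (metis singletonD)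
        ultimately show "w $ k = 0\<^sub>v d $ k"
          using LE[of k "\<lambda>j. w $ j"] L.zero by simp
      qed (use that V(1) in auto)
      then show ?thesis
        using V(2) by blast
    next
      assume "EV = U"
      have "w \<in> V" if w: "w \<in> carrier_vec d" for w
      proof -
        have "E (\<lambda>j. w $ j) \<in> EV"
          using EU \<open>EV = U\<close> by simp
        then obtain w' where w': "w' \<in> V" "E (\<lambda>j. w $ j) = E (\<lambda>j. w' $ j)"
          by (auto simp: EV_def)
        have "w = w'"
        proof (rule eq_vecI)
          fix k assume "k < dim_vec w'"
          then show "w $ k = w' $ k"
            using LE[of k "\<lambda>j. w $ j"] LE[of k "\<lambda>j. w' $ j"] w' V(1) by auto
        qed (use w w' V(1) in auto)
        then show ?thesis
          using w' by simp
      qed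
      then show ?thesis
        using V(1) by blast
    qed
  qed
  have eq: "app {..<n} (\<lambda>i j. \<sigma> g $$ (i, j)) v i = (\<Sum>k<d. b k i * (\<Sum>j<d. L v j * \<tau> g $$ (k, j)))"
    if g: "g \<in> carrier G" for g
  proof -
    have "act g v = E (\<lambda>k. \<Sum>j<d. L (act g (b j)) k * L v j)"
      using act_E[OF g, of "L v"] EL[OF v] by simp
    then show ?thesis
      by (simp add: act_def[symmetric]) (simp add: E_app \<tau>_def mult_ac)
  qed
  have "on_G (\<lambda>g. \<Sum>k<d. b k i * (\<Sum>j<d. L v j * \<tau> g $$ (k, j))) \<in> coefficient_space"
    by (intro coefficient_space_sum irreducible_coefficients[OF \<tau>irr]) auto
  then show ?thesis
    by (rule coefficient_space_cong) (rule eq)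
qed

text \<open>Complete reducibility as an induction on the dimension. An invariant subspace that is
  neither zero nor simple splits into a smaller one \<open>U'\<close> and the kernel
  \<open>U''\<close> of an equivariant projection onto it, and \<open>v\<close> splits
  accordingly.\<close>

lemma invariant_subspace_coefficients:
  assumes \<sigma>: "matrix_rep n \<sigma>" and "invariant_subspace n \<sigma> U" "v \<in> U"
  shows "on_G (\<lambda>g. app {..<n} (\<lambda>i j. \<sigma> g $$ (i, j)) v i) \<in> coefficient_space"
  using assms(2,3)
proof (induction "fun_vs.dim U" arbitrary: U v rule: less_induct)
  case less
  note U = less.prems(1)
  define act where "act g = app {..<n} (\<lambda>i j. \<sigma> g $$ (i, j))" for g
  interpret act: Vector_Spaces.linear fun_scale fun_scale "act g" for g
    unfolding act_def by (rule linear_app)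
  have U1: "fun_vs.subspace U" and U2: "U \<subseteq> {f. \<forall>i. i \<notin> {..<n} \<longrightarrow> f i = 0}"
    and U3: "\<And>g f. g \<in> carrier G \<Longrightarrow> f \<in> U \<Longrightarrow> act g f \<in> U"
    using U by (auto simp: invariant_subspace_def act_def)
  have zero: "on_G (\<lambda>g. act g 0 i) \<in> coefficient_space" for i
    using coefficient_space_sum[of "{}"] by (auto simp: act.zero)
  show ?case
  proof (cases "U = {0}")
    case True
    then show ?thesis
      using less.prems(2) zero by (simp add: act_def)
  next
    case ne: False
    show ?thesis
    proof (cases "\<forall>U'. invariant_subspace n \<sigma> U' \<longrightarrow> U' \<subseteq> U \<longrightarrow> U' = {0} \<or> U' = U")
      case True
      then show ?thesis
        using simple_subspace_coefficients[OF \<sigma> U ne _ less.prems(2)] by blast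
    next
      case False
      then obtain U' where U': "invariant_subspace n \<sigma> U'" "U' \<subset> U" "U' \<noteq> {0}"
        by blast
      have U'1: "fun_vs.subspace U'" and U'2: "U' \<subseteq> {f. \<forall>i. i \<notin> {..<n} \<longrightarrow> f i = 0}"
        and U'3: "\<And>g f. f \<in> U' \<Longrightarrow> g \<in> carrier G \<Longrightarrow> act g f \<in> U'"
        using U'(1) by (auto simp: invariant_subspace_def act_def)
      obtain P where P: "\<And>f. app {..<n} P f \<in> U'" "\<And>f. f \<in> U' \<Longrightarrow> app {..<n} P f = f"
        and PG: "\<And>g i j. g \<in> carrier G \<Longrightarrow> i \<in> {..<n} \<Longrightarrow> j \<in> {..<n} \<Longrightarrow>
          (\<Sum>k\<in>{..<n}. P i k * \<sigma> g $$ (k, j)) = (\<Sum>k\<in>{..<n}. \<sigma> g $$ (i, k) * P k j)"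
        by (rule equivariant_projection[OF linear_action_matrix_rep[OF \<sigma>] U'1 U'2])
          (use U'3 in \<open>auto simp: act_def\<close>)
      interpret P: Vector_Spaces.linear fun_scale fun_scale "app {..<n} P"
        by (rule linear_app)
      have PG': "app {..<n} P (act g f) = act g (app {..<n} P f)" if "g \<in> carrier G" for g f
      proof
        fix i
        have "(\<Sum>k<n. P i k * (\<Sum>j<n. \<sigma> g $$ (k, j) * f j)) = (\<Sum>k<n. \<sigma> g $$ (i, k) * (\<Sum>j<n. P k j * f j))"
          if i: "i < n"
        proof -
          have "(\<Sum>k<n. P i k * (\<Sum>j<n. \<sigma> g $$ (k, j) * f j)) = (\<Sum>k<n. \<Sum>j<n. P i k * \<sigma> g $$ (k, j) * f j)"
            by (simp add: sum_distrib_left mult.assoc)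
          also have "\<dots> = (\<Sum>j<n. \<Sum>k<n. P i k * \<sigma> g $$ (k, j) * f j)"
            by (rule sum.swap)
          also have "\<dots> = (\<Sum>j<n. \<Sum>k<n. \<sigma> g $$ (i, k) * P k j * f j)"
            using PG[OF \<open>g \<in> carrier G\<close>, of i] i by (simp flip: sum_distrib_right)
          also have "\<dots> = (\<Sum>k<n. \<Sum>j<n. \<sigma> g $$ (i, k) * P k j * f j)"
            by (rule sum.swap)
          finally show ?thesis
            by (simp add: sum_distrib_left mult.assoc)
        qed
        then show "app {..<n} P (act g f) i = act g (app {..<n} P f) i"
          by (simp add: act_def app_def)
      qed
      define U'' where "U'' = {f \<in> U. app {..<n} P f = 0}"
      have U'': "invariant_subspace n \<sigma> U''"
        unfolding invariant_subspace_def
      proof (intro conjI ballI)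
        show "fun_vs.subspace U''"
          using U1 by (auto simp: fun_vs.subspace_def U''_def P.zero P.add P.scale P.zero[unfolded zero_fun_def] zero_fun_def)
        show "U'' \<subseteq> {f. \<forall>i. i \<notin> {..<n} \<longrightarrow> f i = 0}"
          using U2 by (auto simp: U''_def)
        show "app {..<n} (\<lambda>i j. \<sigma> g $$ (i, j)) f \<in> U''" if "g \<in> carrier G" "f \<in> U''" for g f
          using that U3 PG' unfolding act_def[symmetric] by (auto simp: U''_def act.zero)
      qed
      have "U'' \<noteq> U"
      proof
        assume eq: "U'' = U"
        have "f = 0" if "f \<in> U'" for f
        proof -
          have "f \<in> U''"
            using that U'(2) eq by blast
          then show ?thesis
            using P(2)[OF that] by (simp add: U''_def)
        qed
        then show False
          using U'(3) fun_vs.subspace_0[OF U'1] by blast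
      qed
      then have "U'' \<subset> U"
        by (auto simp: U''_def)
      have dims: "fun_vs.dim U' < fun_vs.dim U" "fun_vs.dim U'' < fun_vs.dim U"
        using fun_vs_dim_less[OF U1 U2] U'1 U'(2) U'' \<open>U'' \<subset> U\<close>
        by (auto simp: invariant_subspace_def)
      define v' where "v' = app {..<n} P v"
      have v': "v' \<in> U'"
        by (simp add: v'_def P)
      have "v - v' \<in> U''"
        using less.prems(2) v' U'(2) fun_vs.subspace_diff[OF U1, of v v'] P(2)[OF v']
        by (auto simp: U''_def P.diff) (simp add: v'_def)
      then have "on_G (\<lambda>g. act g (v - v') i) \<in> coefficient_space"
        unfolding act_def by (rule less.hyps[OF dims(2) U''])
      moreover have "on_G (\<lambda>g. act g v' i) \<in> coefficient_space"
        unfolding act_def by (rule less.hyps[OF dims(1) U'(1) v'])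
      ultimately have "on_G (\<lambda>g. act g (v - v') i + act g v' i) \<in> coefficient_space"
        by (rule coefficient_space_add)
      moreover have "act g (v - v') i + act g v' i = act g v i" for g
        by (simp add: act.diff)
      ultimately show ?thesis
        by (simp add: act_def)
    qed
  qed
qed

text \<open>Column \<open>j\<close> of \<open>\<sigma> g\<close> is the translate by
  \<open>g\<close> of the unit vector with index \<open>j\<close>.\<close>

lemma matrix_coefficients:
  assumes "matrix_rep n \<sigma>" "i < n" "j < n"
  shows "on_G (\<lambda>g. \<sigma> g $$ (i, j)) \<in> coefficient_space"
proof -
  let ?U = "{f :: nat \<Rightarrow> 'k. \<forall>i. i \<notin> {..<n} \<longrightarrow> f i = 0}"
  have "invariant_subspace n \<sigma> ?U"
    by (auto simp: invariant_subspace_def fun_vs.subspace_def app_def)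
  then have "on_G (\<lambda>g. app {..<n} (\<lambda>i j. \<sigma> g $$ (i, j)) (\<lambda>k. if k = j then 1 else 0) i) \<in> coefficient_space"
    by (rule invariant_subspace_coefficients[OF assms(1)]) (use assms in auto)
  then show ?thesis
    using assms by (simp add: app_def if_distrib[of "\<lambda>x. _ * x"] cong: if_cong)
qed

end

section \<open>The universal property for matrix algebras\<close>

section \<open>Matrix algebras as test algebras\<close>

text \<open>A copy of the algebra of \<open>n \<times> n\<close> matrices inside the type \<open>('g \<Rightarrow> 'k) \<Rightarrow> 'k\<close> of the test
  algebras: the entry \<open>(i, j)\<close> is the value at the constant function \<open>code i j\<close>.\<close>

definition code :: "nat \<Rightarrow> nat \<Rightarrow> 'g \<Rightarrow> 'k::real_or_complex" where
  "code i j = (\<lambda>_. of_nat (prod_encode (i, j)))"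

lemma code_inject: "code i j = (code i' j' :: 'g \<Rightarrow> 'k::real_or_complex) \<longleftrightarrow> i = i' \<and> j = j'"
proof
  assume "code i j = (code i' j' :: 'g \<Rightarrow> 'k)"
  then have "(of_nat (prod_encode (i, j)) :: 'k) = of_nat (prod_encode (i', j'))"
    unfolding code_def by meson
  then show "i = i' \<and> j = j'"
    by (simp add: prod_encode_eq)
qed simp

definition enc :: "nat \<Rightarrow> 'k::real_or_complex mat \<Rightarrow> ('g \<Rightarrow> 'k) \<Rightarrow> 'k" where
  "enc n A = (\<lambda>f. \<Sum>i<n. \<Sum>j<n. if f = code i j then A $$ (i, j) else 0)"

definition dec :: "nat \<Rightarrow> (('g \<Rightarrow> 'k) \<Rightarrow> 'k) \<Rightarrow> 'k::real_or_complex mat" where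
  "dec n z = mat n n (\<lambda>(i, j). z (code i j))"

lemma enc_code: "enc n A (code i j) = (if i < n \<and> j < n then A $$ (i, j) else 0)"
proof -
  have "enc n A (code i j) = (\<Sum>i'<n. if i' = i then \<Sum>j'<n. if j' = j then A $$ (i, j) else 0 else 0)"
    unfolding enc_def code_inject by (intro sum.cong refl) auto
  then show ?thesis
    by (cases "i < n"; cases "j < n") simp_all
qed

lemma enc_not_code: "(\<And>i j. i < n \<Longrightarrow> j < n \<Longrightarrow> f \<noteq> code i j) \<Longrightarrow> enc n A f = 0"
  unfolding enc_def by (intro sum.neutral ballI) auto

lemma dec_carrier [simp]: "dec n z \<in> carrier_mat n n"
  by (simp add: dec_def)

lemma dec_enc [simp]: "A \<in> carrier_mat n n \<Longrightarrow> dec n (enc n A) = A"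
  by (rule eq_matI) (auto simp: dec_def enc_code)

definition mat_test_algebra :: "nat \<Rightarrow> ('k::real_or_complex, ('g \<Rightarrow> 'k) \<Rightarrow> 'k) module" where
  "mat_test_algebra n =
     \<lparr>carrier = enc n ` carrier_mat n n,
      monoid.mult = (\<lambda>x y. enc n (dec n x * dec n y)),
      one = enc n (1\<^sub>m n),
      zero = enc n (0\<^sub>m n n),
      add = (\<lambda>x y. enc n (dec n x + dec n y)),
      module.smult = (\<lambda>c x. enc n (c \<cdot>\<^sub>m dec n x))\<rparr>"

definition mat_test_topology :: "nat \<Rightarrow> (('g \<Rightarrow> 'k) \<Rightarrow> 'k::real_or_complex) topology" where
  "mat_test_topology n =
     subtopology (product_topology (\<lambda>_. euclidean) UNIV) (enc n ` carrier_mat n n)"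

lemma mat_test_algebra_simps:
  "carrier (mat_test_algebra n) = enc n ` carrier_mat n n"
  "x \<otimes>\<^bsub>mat_test_algebra n\<^esub> y = enc n (dec n x * dec n y)"
  "\<one>\<^bsub>mat_test_algebra n\<^esub> = enc n (1\<^sub>m n)"
  "\<zero>\<^bsub>mat_test_algebra n\<^esub> = enc n (0\<^sub>m n n)"
  "x \<oplus>\<^bsub>mat_test_algebra n\<^esub> y = enc n (dec n x + dec n y)"
  "c \<odot>\<^bsub>mat_test_algebra n\<^esub> x = enc n (c \<cdot>\<^sub>m dec n x)"
  by (simp_all add: mat_test_algebra_def)

lemma abelian_group_mat_test_algebra: "abelian_group (mat_test_algebra n)"
proof (rule abelian_groupI)
  fix x :: "('g \<Rightarrow> 'k::real_or_complex) \<Rightarrow> 'k" assume "x \<in> carrier (mat_test_algebra n)"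
  then obtain A where "A \<in> carrier_mat n n" "x = enc n A"
    by (auto simp: mat_test_algebra_simps)
  then show "\<exists>y\<in>carrier (mat_test_algebra n). y \<oplus>\<^bsub>mat_test_algebra n\<^esub> x = \<zero>\<^bsub>mat_test_algebra n\<^esub>"
    by (intro bexI[of _ "enc n (- A)"]) (auto simp: mat_test_algebra_simps uminus_l_inv_mat)
qed (auto simp: mat_test_algebra_simps assoc_add_mat intro!: arg_cong[of _ _ "enc n"] comm_add_mat)

lemma unital_algebra_mat_test_algebra: "unital_algebra (mat_test_algebra n)"
proof -
  have "monoid (mat_test_algebra n)"
    by (rule monoidI) (auto simp: mat_test_algebra_simps)
  then have ring: "ring (mat_test_algebra n)"
    by (rule ringI[OF abelian_group_mat_test_algebra])
      (auto simp: mat_test_algebra_simps add_mult_distrib_mat mult_add_distrib_mat)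
  have "module class_ring (mat_test_algebra n)"
    by (intro module.intro module_axioms.intro abelian_group_mat_test_algebra class_cring.is_cring)
      (auto simp: mat_test_algebra_simps add_smult_distrib_left_mat add_smult_distrib_right_mat
        intro!: arg_cong[of _ _ "enc n"] eq_matI)
  then have "vectorspace class_ring (mat_test_algebra n)"
    by (intro vectorspace.intro class_field)
  then show ?thesis
    using ring by (auto simp: unital_algebra_def mat_test_algebra_simps mult_smult_assoc_mat mult_smult_distrib)
qed

lemma topspace_mat_test_topology: "topspace (mat_test_topology n) = enc n ` carrier_mat n n"
  by (simp add: mat_test_topology_def)

text \<open>Only the finitely many arguments \<open>code i j\<close> carry information; encoded
  matrices vanish at all others.\<close>

lemma continuous_map_into_mat_test:
  fixes F :: "'x \<Rightarrow> ('g \<Rightarrow> 'k::real_or_complex) \<Rightarrow> 'k"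
  assumes "\<And>x. x \<in> topspace X \<Longrightarrow> F x \<in> enc n ` carrier_mat n n"
    and "\<And>i j. i < n \<Longrightarrow> j < n \<Longrightarrow> continuous_map X euclidean (\<lambda>x. F x (code i j))"
  shows "continuous_map X (mat_test_topology n) F"
proof -
  have "continuous_map X euclidean (\<lambda>x. F x f)" for f
  proof (cases "\<exists>i j. i < n \<and> j < n \<and> f = code i j")
    case True
    then show ?thesis
      using assms(2) by auto
  next
    case False
    have z: "F x f = 0" if x: "x \<in> topspace X" for x
    proof -
      obtain A where "F x = enc n A"
        using assms(1)[OF x] by blast
      moreover have "enc n A f = 0"
        by (rule enc_not_code) (use False in blast)
      ultimately show ?thesis
        by simp
    qed
    have "continuous_map X euclidean (\<lambda>x. 0 :: 'k)"
      by simp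
    then show ?thesis
      by (rule continuous_map_eq) (simp add: z)
  qed
  then show ?thesis
    using assms(1) by (auto simp: mat_test_topology_def continuous_map_in_subtopology
        continuous_map_componentwise_UNIV)
qed

lemma continuous_map_mat_test_entry: "continuous_map (mat_test_topology n) euclidean (\<lambda>x. x f)"
  unfolding mat_test_topology_def
  by (intro continuous_map_from_subtopology continuous_map_product_projection) simp

lemma func_space_simps:
  fixes f g :: "'j \<Rightarrow> 'k::field"
  shows "carrier (ring.func_space class_ring J) = J \<rightarrow>\<^sub>E (UNIV :: 'k set)"
  "f \<oplus>\<^bsub>ring.func_space class_ring J\<^esub> g = (\<lambda>v\<in>J. f v + g v)"
  "c \<odot>\<^bsub>ring.func_space class_ring J\<^esub> f = (\<lambda>v\<in>J. c * f v)"
  by (simp_all add: class_ring.func_space_def)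

text \<open>The index set \<open>J\<close> of the isomorphism with a power of \<open>'k\<close> has
  to be a set in the type of the elements of the algebra. The constant functions \<open>u p\<close>
  in this type stand for the index pairs \<open>p\<close>.\<close>

lemma weakly_complete_mat_test_algebra:
  "weakly_complete_algebra (mat_test_algebra n :: ('k::real_or_complex, ('g \<Rightarrow> 'k) \<Rightarrow> 'k) module) (mat_test_topology n)"
proof -
  let ?I = "{..<n} \<times> {..<n}"
  define u :: "nat \<times> nat \<Rightarrow> ('g \<Rightarrow> 'k) \<Rightarrow> 'k" where "u = (\<lambda>p _. of_nat (prod_encode p))"
  define J where "J = u ` ?I"
  define \<phi> :: "(('g \<Rightarrow> 'k) \<Rightarrow> 'k) \<Rightarrow> (('g \<Rightarrow> 'k) \<Rightarrow> 'k) \<Rightarrow> 'k" where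
    "\<phi> x = (\<lambda>z\<in>J. x (case_prod code (the_inv u z)))" for x
  define \<psi> :: "((('g \<Rightarrow> 'k) \<Rightarrow> 'k) \<Rightarrow> 'k) \<Rightarrow> ('g \<Rightarrow> 'k) \<Rightarrow> 'k" where
    "\<psi> y = enc n (mat n n (\<lambda>p. y (u p)))" for y
  have u: "inj u"
  proof (rule injI)
    fix p q assume "u p = u q"
    then have "(of_nat (prod_encode p) :: 'k) = of_nat (prod_encode q)"
      unfolding u_def by meson
    then show "p = q"
      by (simp add: prod_encode_eq)
  qed
  have \<phi>_u: "\<phi> x (u (i, j)) = x (code i j)" if "i < n" "j < n" for x i j
    using that u by (auto simp: \<phi>_def J_def the_inv_f_f)
  have \<phi>_E: "\<phi> x \<in> J \<rightarrow>\<^sub>E UNIV" for x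
    by (simp add: \<phi>_def)
  have ext: "y = y'" if "y \<in> J \<rightarrow>\<^sub>E UNIV" "y' \<in> J \<rightarrow>\<^sub>E UNIV" "\<And>i j. i < n \<Longrightarrow> j < n \<Longrightarrow> y (u (i, j)) = y' (u (i, j))" for y y'
    by (rule PiE_ext[OF that(1,2)]) (use that(3) in \<open>auto simp: J_def\<close>)
  have hom: "\<phi> \<in> module_hom class_ring (mat_test_algebra n) (ring.func_space class_ring J)"
    unfolding module_hom_def
  proof (intro CollectI conjI allI impI; (elim conjE)?)
    fix x y :: "('g \<Rightarrow> 'k) \<Rightarrow> 'k"
    assume "x \<in> carrier (mat_test_algebra n)" "y \<in> carrier (mat_test_algebra n)"
    then obtain A B where AB: "A \<in> carrier_mat n n" "x = enc n A" "B \<in> carrier_mat n n" "y = enc n B"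
      by (auto simp: mat_test_algebra_simps)
    show "\<phi> (x \<oplus>\<^bsub>mat_test_algebra n\<^esub> y) = \<phi> x \<oplus>\<^bsub>ring.func_space class_ring J\<^esub> \<phi> y"
    proof (rule ext)
      show "\<phi> (x \<oplus>\<^bsub>mat_test_algebra n\<^esub> y) (u (i, j)) = (\<phi> x \<oplus>\<^bsub>ring.func_space class_ring J\<^esub> \<phi> y) (u (i, j))"
        if "i < n" "j < n" for i j
        using AB that by (simp add: func_space_simps \<phi>_u mat_test_algebra_simps enc_code J_def)
    qed (use \<phi>_E in \<open>auto simp: func_space_simps\<close>)
  next
    fix c :: 'k and x :: "('g \<Rightarrow> 'k) \<Rightarrow> 'k"
    assume "c \<in> carrier class_ring" "x \<in> carrier (mat_test_algebra n)"
    then obtain A where A: "A \<in> carrier_mat n n" "x = enc n A"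
      by (auto simp: mat_test_algebra_simps)
    show "\<phi> (c \<odot>\<^bsub>mat_test_algebra n\<^esub> x) = c \<odot>\<^bsub>ring.func_space class_ring J\<^esub> \<phi> x"
    proof (rule ext)
      show "\<phi> (c \<odot>\<^bsub>mat_test_algebra n\<^esub> x) (u (i, j)) = (c \<odot>\<^bsub>ring.func_space class_ring J\<^esub> \<phi> x) (u (i, j))"
        if "i < n" "j < n" for i j
        using A that by (simp add: func_space_simps \<phi>_u mat_test_algebra_simps enc_code J_def)
    qed (use \<phi>_E in \<open>auto simp: func_space_simps\<close>)
  qed (use \<phi>_E in \<open>auto simp: func_space_simps\<close>)
  have "homeomorphic_maps (mat_test_topology n) (product_topology (\<lambda>j. euclidean) J) \<phi> \<psi>"
    unfolding homeomorphic_maps_def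
  proof (intro conjI ballI)
    show "continuous_map (mat_test_topology n) (product_topology (\<lambda>j. euclidean) J) \<phi>"
      unfolding continuous_map_componentwise
    proof (intro conjI ballI)
      fix k assume "k \<in> J"
      then have "(\<lambda>x. \<phi> x k) = (\<lambda>x. x (case_prod code (the_inv u k)))"
        by (auto simp: \<phi>_def)
      then show "continuous_map (mat_test_topology n) euclidean (\<lambda>x. \<phi> x k)"
        by (simp add: continuous_map_mat_test_entry)
    qed (auto simp: \<phi>_def)
    show "continuous_map (product_topology (\<lambda>j. euclidean) J) (mat_test_topology n) \<psi>"
    proof (rule continuous_map_into_mat_test)
      fix i j assume ij: "i < n" "j < n"
      have "(\<lambda>x. \<psi> x (code i j)) = (\<lambda>x. x (u (i, j)))"
        using ij by (auto simp: \<psi>_def enc_code)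
      then show "continuous_map (product_topology (\<lambda>j. euclidean) J) euclidean (\<lambda>x. \<psi> x (code i j))"
        using continuous_map_product_projection[of "u (i, j)" J "\<lambda>_. euclidean"] ij by (auto simp: J_def)
    qed (auto simp: \<psi>_def)
    show "\<psi> (\<phi> x) = x" if x: "x \<in> topspace (mat_test_topology n)" for x
    proof -
      obtain A where A: "A \<in> carrier_mat n n" "x = enc n A"
        using x by (auto simp: topspace_mat_test_topology)
      have "mat n n (\<lambda>p. \<phi> x (u p)) = A"
        by (rule eq_matI) (use A in \<open>auto simp: \<phi>_u enc_code\<close>)
      then show ?thesis
        by (simp add: \<psi>_def A)
    qed
    show "\<phi> (\<psi> y) = y" if "y \<in> topspace (product_topology (\<lambda>j. euclidean) J)" for y
      using that by (intro ext \<phi>_E) (auto simp: \<phi>_u \<psi>_def enc_code)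
  qed
  then have "homeomorphic_map (mat_test_topology n) (product_topology (\<lambda>j. euclidean) J) \<phi>"
    using homeomorphic_map_maps by blast
  then have "weakly_complete_space (mat_test_algebra n :: ('k, ('g \<Rightarrow> 'k) \<Rightarrow> 'k) module) (mat_test_topology n)"
    using hom unital_algebra_mat_test_algebra[of n]
    by (auto simp: weakly_complete_space_def unital_algebra_def topspace_mat_test_topology mat_test_algebra_simps)
  moreover have "continuous_map (prod_topology (mat_test_topology n) (mat_test_topology n)) (mat_test_topology n)
      (\<lambda>(x, y). x \<otimes>\<^bsub>mat_test_algebra n\<^esub> (y :: ('g \<Rightarrow> 'k) \<Rightarrow> 'k))"
  proof (rule continuous_map_into_mat_test)
    let ?X = "prod_topology (mat_test_topology n :: (('g \<Rightarrow> 'k) \<Rightarrow> 'k) topology) (mat_test_topology n :: (('g \<Rightarrow> 'k) \<Rightarrow> 'k) topology)"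
    fix i j assume ij: "i < n" "j < n"
    have "(\<lambda>z :: (('g \<Rightarrow> 'k) \<Rightarrow> 'k) \<times> (('g \<Rightarrow> 'k) \<Rightarrow> 'k). (case z of (x, y) \<Rightarrow> x \<otimes>\<^bsub>mat_test_algebra n\<^esub> y) (code i j))
        = (\<lambda>z. \<Sum>k<n. fst z (code i k) * snd z (code k j))"
      using ij mult_mat_entry[OF dec_carrier dec_carrier ij]
      by (auto simp: mat_test_algebra_simps enc_code fun_eq_iff) (simp add: dec_def)
    moreover have "continuous_map ?X euclidean (\<lambda>z. fst z f)" "continuous_map ?X euclidean (\<lambda>z. snd z f)" for f
      using continuous_map_compose[OF continuous_map_fst continuous_map_mat_test_entry]
        continuous_map_compose[OF continuous_map_snd continuous_map_mat_test_entry]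
      by (auto simp: o_def)
    ultimately show "continuous_map ?X euclidean
        (\<lambda>z. (case z of (x, y) \<Rightarrow> x \<otimes>\<^bsub>mat_test_algebra n\<^esub> y) (code i j))"
      by (simp add: continuous_map_euclidean_sum continuous_map_euclidean_mult)
  qed (auto simp: mat_test_algebra_simps intro!: imageI mult_carrier_mat[of _ n n])
  ultimately show ?thesis
    using unital_algebra_mat_test_algebra by (simp add: weakly_complete_algebra_def)
qed

locale group_algebra = chosen_representations G TG dimE \<rho>
  for G :: "('g, 'm) monoid_scheme" (structure) and TG :: "'g topology"
    and dimE :: "('g \<Rightarrow> 'k::real_or_complex) \<Rightarrow> nat" and \<rho> :: "('g \<Rightarrow> 'k) \<Rightarrow> 'g \<Rightarrow> 'k mat" +
  fixes KG :: "('k, 'a) module" and T :: "'a topology" and \<eta> :: "'g \<Rightarrow> 'a"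
  assumes group_algebra: "weakly_complete_group_algebra G TG KG T \<eta>"
begin

lemma weakly_complete: "weakly_complete_algebra KG T"
  using group_algebra by (simp add: weakly_complete_group_algebra_def)

lemma topspace_T: "topspace T = carrier KG"
  and continuous_mult: "continuous_map (prod_topology T T) T (\<lambda>(x, y). x \<otimes>\<^bsub>KG\<^esub> y)"
  using weakly_complete by (simp_all add: weakly_complete_algebra_def weakly_complete_space_def)

sublocale A: ring KG
  using weakly_complete by (simp add: weakly_complete_algebra_def unital_algebra_def)

lemma vectorspace_KG: "vectorspace class_ring KG"
  using weakly_complete by (simp add: weakly_complete_algebra_def unital_algebra_def)

lemma smult_closed: "x \<in> carrier KG \<Longrightarrow> c \<odot>\<^bsub>KG\<^esub> x \<in> carrier KG"
  and smult_mult: "x \<in> carrier KG \<Longrightarrow> y \<in> carrier KG \<Longrightarrow> (c \<odot>\<^bsub>KG\<^esub> x) \<otimes>\<^bsub>KG\<^esub> y = c \<odot>\<^bsub>KG\<^esub> (x \<otimes>\<^bsub>KG\<^esub> y)"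
  and mult_smult: "x \<in> carrier KG \<Longrightarrow> y \<in> carrier KG \<Longrightarrow> x \<otimes>\<^bsub>KG\<^esub> (c \<odot>\<^bsub>KG\<^esub> y) = c \<odot>\<^bsub>KG\<^esub> (x \<otimes>\<^bsub>KG\<^esub> y)"
proof -
  interpret vectorspace class_ring KG
    by (rule vectorspace_KG)
  show "x \<in> carrier KG \<Longrightarrow> c \<odot>\<^bsub>KG\<^esub> x \<in> carrier KG"
    by (rule smult_closed) auto
qed (use weakly_complete in \<open>auto simp: weakly_complete_algebra_def unital_algebra_def\<close>)

lemma eta_units: "g \<in> carrier G \<Longrightarrow> \<eta> g \<in> Units KG"
  and eta_carrier: "g \<in> carrier G \<Longrightarrow> \<eta> g \<in> carrier KG"
  and eta_mult: "g \<in> carrier G \<Longrightarrow> h \<in> carrier G \<Longrightarrow> \<eta> (g \<otimes> h) = \<eta> g \<otimes>\<^bsub>KG\<^esub> \<eta> h"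
  and eta_continuous: "continuous_map TG T \<eta>"
  using group_algebra
  by (auto simp: weakly_complete_group_algebra_def continuous_homs_def hom_def units_of_def
      continuous_map_in_subtopology)

text \<open>An invertible idempotent is the identity.\<close>

lemma eta_one: "\<eta> \<one> = \<one>\<^bsub>KG\<^esub>"
proof -
  have "\<eta> \<one> \<otimes>\<^bsub>KG\<^esub> \<eta> \<one> = \<eta> \<one> \<otimes>\<^bsub>KG\<^esub> \<one>\<^bsub>KG\<^esub>"
    using eta_mult[of \<one> \<one>] eta_carrier[of \<one>] by simp
  then show ?thesis
    using A.Units_l_cancel[OF eta_units eta_carrier A.one_closed, of \<one> \<one>] by blast
qed

lemma eta_inv: "g \<in> carrier G \<Longrightarrow> inv\<^bsub>KG\<^esub> (\<eta> g) = \<eta> (inv g)"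
  using eta_mult[of "inv g" g] eta_mult[of g "inv g"] eta_one eta_carrier
  by (intro A.inv_unique'[symmetric]) auto

text \<open>A continuous representation of \<open>KG\<close> on a coordinate space, stated without
  the encoding that the test algebras require.\<close>

definition mat_hom :: "nat \<Rightarrow> ('a \<Rightarrow> 'k mat) \<Rightarrow> bool" where
  "mat_hom n m \<longleftrightarrow> (\<forall>x\<in>carrier KG. m x \<in> carrier_mat n n) \<and> m \<one>\<^bsub>KG\<^esub> = 1\<^sub>m n \<and>
     (\<forall>x\<in>carrier KG. \<forall>y\<in>carrier KG. m (x \<oplus>\<^bsub>KG\<^esub> y) = m x + m y \<and> m (x \<otimes>\<^bsub>KG\<^esub> y) = m x * m y) \<and>
     (\<forall>c. \<forall>x\<in>carrier KG. m (c \<odot>\<^bsub>KG\<^esub> x) = c \<cdot>\<^sub>m m x) \<and>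
     (\<forall>i<n. \<forall>j<n. continuous_map T euclidean (\<lambda>x. m x $$ (i, j)))"

lemma matrix_rep_mat_hom:
  assumes "mat_hom n m"
  shows "matrix_rep n (\<lambda>g. m (\<eta> g))"
proof -
  have "continuous_map TG euclidean (\<lambda>g. m (\<eta> g) $$ (i, j))" if "i < n" "j < n" for i j
    using continuous_map_compose[OF eta_continuous, of euclidean "\<lambda>x. m x $$ (i, j)"] assms that
    by (simp add: mat_hom_def o_def)
  then show ?thesis
    using assms by (auto simp: matrix_rep_def mat_hom_def eta_one eta_mult eta_carrier)
qed

lemma matrix_rep_continuous_hom:
  assumes "matrix_rep n \<sigma>"
  shows "(\<lambda>g. enc n (\<sigma> g)) \<in> continuous_homs G TG (units_of (mat_test_algebra n))
    (subtopology (mat_test_topology n) (Units (mat_test_algebra n)) :: (('g \<Rightarrow> 'k) \<Rightarrow> 'k) topology)"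
proof -
  have car: "\<sigma> g \<in> carrier_mat n n" if "g \<in> carrier G" for g
    using assms that by (rule matrix_rep_carrier)
  have mult: "\<sigma> (g \<otimes> h) = \<sigma> g * \<sigma> h" if "g \<in> carrier G" "h \<in> carrier G" for g h
    using assms that by (auto simp: matrix_rep_def)
  have "\<sigma> g * \<sigma> (inv g) = 1\<^sub>m n" "\<sigma> (inv g) * \<sigma> g = 1\<^sub>m n" if "g \<in> carrier G" for g
    using that assms mult[of g "inv g"] mult[of "inv g" g] by (simp_all add: matrix_rep_def)
  then have units: "enc n (\<sigma> g) \<in> Units (mat_test_algebra n :: ('k, ('g \<Rightarrow> 'k) \<Rightarrow> 'k) module)" if "g \<in> carrier G" for g
    using that car unfolding Units_def
    by (auto simp: mat_test_algebra_simps intro!: bexI[of _ "\<sigma> (inv g)"])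
  have "continuous_map TG (mat_test_topology n) (\<lambda>g. enc n (\<sigma> g) :: ('g \<Rightarrow> 'k) \<Rightarrow> 'k)"
    by (rule continuous_map_into_mat_test)
      (use assms car in \<open>auto simp: topspace_TG enc_code matrix_rep_def\<close>)
  then show ?thesis
    using units car by (auto simp: continuous_homs_def hom_def units_of_def continuous_map_in_subtopology
        topspace_TG mult mat_test_algebra_simps)
qed

lemma matrix_rep_universal:
  assumes "matrix_rep n \<sigma>"
  shows "\<exists>!F :: 'a \<Rightarrow> ('g \<Rightarrow> 'k) \<Rightarrow> 'k.
    F \<in> wc_morphisms KG T (mat_test_algebra n) (mat_test_topology n) \<and>
    (\<forall>g\<in>carrier G. enc n (\<sigma> g) = F (\<eta> g))"
  using group_algebra weakly_complete_mat_test_algebra matrix_rep_continuous_hom[OF assms]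
  unfolding weakly_complete_group_algebra_def by blast

text \<open>The existence half of the universal property, decoded into matrices.\<close>

lemma mat_hom_extension:
  assumes "matrix_rep n \<sigma>"
  obtains m where "mat_hom n m" "\<And>g. g \<in> carrier G \<Longrightarrow> m (\<eta> g) = \<sigma> g"
proof -
  obtain F :: "'a \<Rightarrow> ('g \<Rightarrow> 'k) \<Rightarrow> 'k" where
    F: "F \<in> wc_morphisms KG T (mat_test_algebra n) (mat_test_topology n)"
    and Fg: "\<And>g. g \<in> carrier G \<Longrightarrow> enc n (\<sigma> g) = F (\<eta> g)"
    using matrix_rep_universal[OF assms] by blast
  have rh: "F \<in> Ring.ring_hom KG (mat_test_algebra n)"
    and mh: "F \<in> module_hom class_ring KG (mat_test_algebra n)"
    and cont: "continuous_map T (mat_test_topology n) F"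
    using F by (auto simp: wc_morphisms_def algebra_homs_def)
  have "continuous_map T euclidean (\<lambda>x. dec n (F x) $$ (i, j))" if "i < n" "j < n" for i j
    using continuous_map_compose[OF cont continuous_map_mat_test_entry, of "code i j"] that
    by (simp add: o_def dec_def)
  moreover have "F x \<in> enc n ` carrier_mat n n" if "x \<in> carrier KG" for x
    using ring_hom_closed[OF rh that] by (simp add: mat_test_algebra_simps)
  ultimately have "mat_hom n (\<lambda>x. dec n (F x))"
    using ring_hom_memE[OF rh] mh
    by (auto simp: mat_hom_def module_hom_def mat_test_algebra_simps intro!: dec_enc mult_carrier_mat[of _ n n])
  moreover have "dec n (F (\<eta> g)) = \<sigma> g" if "g \<in> carrier G" for g
    using Fg[OF that] matrix_rep_carrier[OF assms that] by (metis dec_enc)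
  ultimately show ?thesis
    using that by blast
qed

lemma mat_hom_morphism:
  assumes "mat_hom n m"
  shows "(\<lambda>x\<in>carrier KG. enc n (m x) :: ('g \<Rightarrow> 'k) \<Rightarrow> 'k) \<in> wc_morphisms KG T (mat_test_algebra n) (mat_test_topology n)"
proof -
  let ?F = "\<lambda>x\<in>carrier KG. enc n (m x) :: ('g \<Rightarrow> 'k) \<Rightarrow> 'k"
  have "continuous_map T euclidean (\<lambda>x. ?F x (code i j))" if "i < n" "j < n" for i j
  proof -
    have "continuous_map T euclidean (\<lambda>x. m x $$ (i, j))"
      using assms that by (simp add: mat_hom_def)
    then show ?thesis
      by (rule continuous_map_eq) (use that in \<open>auto simp: topspace_T enc_code\<close>)
  qed
  then have "continuous_map T (mat_test_topology n) ?F"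
    using assms by (intro continuous_map_into_mat_test) (auto simp: topspace_T mat_hom_def)
  moreover have "?F \<in> Ring.ring_hom KG (mat_test_algebra n)"
    using assms by (intro ring_hom_memI) (auto simp: mat_hom_def mat_test_algebra_simps)
  moreover have "?F \<in> module_hom class_ring KG (mat_test_algebra n)"
    using assms by (auto simp: module_hom_def mat_hom_def mat_test_algebra_simps smult_closed)
  ultimately show ?thesis
    by (simp add: wc_morphisms_def algebra_homs_def)
qed

text \<open>The uniqueness half of the universal property. Encoding, and restriction to the carrier
  because morphisms are extensional, turn both maps into morphisms that extend the same homomorphism
  on \<open>G\<close>.\<close>

lemma mat_hom_unique:
  assumes m: "mat_hom n m" and m': "mat_hom n m'"
    and eq: "\<And>g. g \<in> carrier G \<Longrightarrow> m (\<eta> g) = m' (\<eta> g)" and x: "x \<in> carrier KG"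
  shows "m x = m' x"
proof -
  define F where "F m = (\<lambda>x\<in>carrier KG. enc n (m x) :: ('g \<Rightarrow> 'k) \<Rightarrow> 'k)" for m
  have mor: "F m \<in> wc_morphisms KG T (mat_test_algebra n) (mat_test_topology n)"
    "F m' \<in> wc_morphisms KG T (mat_test_algebra n) (mat_test_topology n)"
    unfolding F_def using mat_hom_morphism m m' by blast+
  have val: "\<forall>g\<in>carrier G. enc n (m (\<eta> g)) = F m (\<eta> g)" "\<forall>g\<in>carrier G. enc n (m (\<eta> g)) = F m' (\<eta> g)"
    using eta_carrier eq by (simp_all add: F_def)
  obtain F0 where F0: "H = F0" if "H \<in> wc_morphisms KG T (mat_test_algebra n) (mat_test_topology n)"
    "\<forall>g\<in>carrier G. enc n (m (\<eta> g)) = H (\<eta> g)" for H :: "'a \<Rightarrow> ('g \<Rightarrow> 'k) \<Rightarrow> 'k"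
    by (rule ex1E[OF matrix_rep_universal[OF matrix_rep_mat_hom[OF m]]]) blast
  have "F m x = F m' x"
    by (simp only: F0[OF mor(1) val(1)] F0[OF mor(2) val(2)])
  then have "enc n (m x) = (enc n (m' x) :: ('g \<Rightarrow> 'k) \<Rightarrow> 'k)"
    using x by (simp add: F_def)
  then have "dec n (enc n (m x) :: ('g \<Rightarrow> 'k) \<Rightarrow> 'k) = dec n (enc n (m' x) :: ('g \<Rightarrow> 'k) \<Rightarrow> 'k)"
    by simp
  then show ?thesis
    using m m' x by (simp add: mat_hom_def)
qed

end

section \<open>Continuous functionals as matrix coefficients of KG\<close>

section \<open>Continuous linear functionals on the group algebra\<close>

context group_algebra
begin

definition functional :: "('a \<Rightarrow> 'k) \<Rightarrow> bool" where
  "functional \<phi> \<longleftrightarrow> (\<forall>x\<in>carrier KG. \<forall>y\<in>carrier KG. \<phi> (x \<oplus>\<^bsub>KG\<^esub> y) = \<phi> x + \<phi> y) \<and>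
     (\<forall>c. \<forall>x\<in>carrier KG. \<phi> (c \<odot>\<^bsub>KG\<^esub> x) = c * \<phi> x) \<and> continuous_map T euclidean \<phi>"

lemma functional_add: "functional \<phi> \<Longrightarrow> x \<in> carrier KG \<Longrightarrow> y \<in> carrier KG \<Longrightarrow> \<phi> (x \<oplus>\<^bsub>KG\<^esub> y) = \<phi> x + \<phi> y"
  and functional_smult: "functional \<phi> \<Longrightarrow> x \<in> carrier KG \<Longrightarrow> \<phi> (c \<odot>\<^bsub>KG\<^esub> x) = c * \<phi> x"
  and functional_continuous: "functional \<phi> \<Longrightarrow> continuous_map T euclidean \<phi>"
  by (auto simp: functional_def)

lemma functional_combination:
  assumes "\<And>i. i \<in> I \<Longrightarrow> functional (f i)"
  shows "functional (\<lambda>x. \<Sum>i\<in>I. c i * f i x)"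
  using assms unfolding functional_def
  by (auto simp: distrib_left sum.distrib sum_distrib_left mult.left_commute
      intro!: continuous_map_euclidean_sum continuous_map_euclidean_mult)

lemma functional_diff:
  assumes "functional \<phi>" "functional \<psi>"
  shows "functional (\<lambda>x. \<phi> x - \<psi> x)"
proof -
  have "functional (\<lambda>x. \<Sum>i\<in>UNIV. (if i then 1 else - 1) * (if i then \<phi> else \<psi>) x)"
    by (rule functional_combination) (use assms in auto)
  then show ?thesis
    by (simp add: UNIV_bool)
qed

lemma continuous_right_mult:
  assumes "a \<in> carrier KG"
  shows "continuous_map T T (\<lambda>x. x \<otimes>\<^bsub>KG\<^esub> a)"
proof -
  have "continuous_map T (prod_topology T T) (\<lambda>x. (x, a))"
    using assms by (simp add: continuous_map_pairwise o_def topspace_T)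
  from continuous_map_compose[OF this continuous_mult] show ?thesis
    by (simp add: o_def)
qed

lemma functional_right_mult:
  assumes "functional \<phi>" "a \<in> carrier KG"
  shows "functional (\<lambda>x. \<phi> (x \<otimes>\<^bsub>KG\<^esub> a))"
proof -
  have "continuous_map T euclidean (\<lambda>x. \<phi> (x \<otimes>\<^bsub>KG\<^esub> a))"
    using continuous_map_compose[OF continuous_right_mult[OF assms(2)] functional_continuous[OF assms(1)]]
    by (simp add: o_def)
  then show ?thesis
    using assms by (auto simp: functional_def A.l_distr smult_mult)
qed

text \<open>Coordinates \<open>h\<close> on \<open>KG\<close> with values in \<open>K\<^sup>J\<close>, and the inverse \<open>k\<close> of \<open>h\<close>.\<close>

definition coordinate_system :: "'a set \<Rightarrow> ('a \<Rightarrow> 'a \<Rightarrow> 'k) \<Rightarrow> (('a \<Rightarrow> 'k) \<Rightarrow> 'a) \<Rightarrow> bool" where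
  "coordinate_system J h k \<longleftrightarrow>
     (\<forall>x\<in>carrier KG. k (h x) = x) \<and> (\<forall>a. k a \<in> carrier KG) \<and> (\<forall>a. \<forall>j\<in>J. h (k a) j = a j) \<and>
     (\<forall>x\<in>carrier KG. \<forall>y\<in>carrier KG. (\<forall>j\<in>J. h x j = h y j) \<longrightarrow> x = y) \<and>
     (\<forall>j\<in>J. functional (\<lambda>x. h x j)) \<and>
     (\<forall>V. openin T V \<longrightarrow> (\<forall>v\<in>V. \<exists>F N. finite F \<and> F \<subseteq> J \<and> (\<forall>j\<in>F. open (N j) \<and> h v j \<in> N j) \<and>
        (\<forall>y\<in>carrier KG. (\<forall>j\<in>F. h y j \<in> N j) \<longrightarrow> y \<in> V)))"

lemma coordinate_system_exists:
  obtains J h k where "coordinate_system J h k"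
proof -
  obtain J :: "'a set" and h where hom: "h \<in> module_hom class_ring KG (ring.func_space class_ring J)"
    and homeo: "homeomorphic_map T (product_topology (\<lambda>j. euclidean) J) h"
    using weakly_complete by (auto simp: weakly_complete_algebra_def weakly_complete_space_def)
  have bij: "bij_betw h (carrier KG) (J \<rightarrow>\<^sub>E UNIV)"
    using homeomorphic_imp_injective_map[OF homeo] homeomorphic_imp_surjective_map[OF homeo]
    by (simp add: bij_betw_def topspace_T)
  \<comment> \<open>Restriction to \<open>J\<close> makes \<open>k\<close> total: it accepts every
    function and depends on its values on \<open>J\<close> alone.\<close>
  define k where "k a = the_inv_into (carrier KG) h (restrict a J)" for a
  have hE: "h x \<in> J \<rightarrow>\<^sub>E UNIV" if "x \<in> carrier KG" for x
    using bij that by (auto simp: bij_betw_def)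
  have hk: "h (k a) = restrict a J" and kA: "k a \<in> carrier KG" for a
    using bij by (auto simp: k_def bij_betw_def f_the_inv_into_f intro!: the_inv_into_into)
  have kh: "k (h x) = x" if "x \<in> carrier KG" for x
    using bij hE[OF that] that by (auto simp: k_def bij_betw_def the_inv_into_f_f PiE_restrict)
  have inj: "x = y" if "x \<in> carrier KG" "y \<in> carrier KG" "\<forall>j\<in>J. h x j = h y j" for x y
  proof -
    have "h x = h y"
      by (rule PiE_ext[OF hE[OF that(1)] hE[OF that(2)]]) (use that(3) in auto)
    then show ?thesis
      using kh that(1,2) by metis
  qed
  have fnl: "functional (\<lambda>x. h x j)" if "j \<in> J" for j
  proof -
    have "continuous_map T euclidean (\<lambda>x. h x j)"
      using homeomorphic_imp_continuous_map[OF homeo] that by (auto simp: continuous_map_componentwise)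
    then show ?thesis
      using hom that by (auto simp: functional_def module_hom_def func_space_simps)
  qed
  have "\<exists>F N. finite F \<and> F \<subseteq> J \<and> (\<forall>j\<in>F. open (N j) \<and> h v j \<in> N j) \<and>
      (\<forall>y\<in>carrier KG. (\<forall>j\<in>F. h y j \<in> N j) \<longrightarrow> y \<in> V)" if V: "openin T V" "v \<in> V" for V v
  proof -
    have "openin (product_topology (\<lambda>j. euclidean) J) (h ` V)"
      using homeomorphic_imp_open_map[OF homeo] V(1) by (simp add: open_map_def)
    then obtain N where N: "finite {i \<in> J. N i \<noteq> UNIV}" "\<And>i. i \<in> J \<Longrightarrow> open (N i)"
      "h v \<in> PiE J N" "PiE J N \<subseteq> h ` V"
      using V(2) by (auto simp: openin_product_topology_alt)
    have VA: "V \<subseteq> carrier KG"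
      using openin_subset[OF V(1)] by (simp add: topspace_T)
    have "y \<in> V" if y: "y \<in> carrier KG" "\<forall>j\<in>{i \<in> J. N i \<noteq> UNIV}. h y j \<in> N j" for y
    proof -
      have "h y \<in> PiE J N"
      proof (rule PiE_I)
        show "h y j \<in> N j" if "j \<in> J" for j
          using y(2) that by (cases "N j = UNIV") auto
      qed (rule PiE_arb[OF hE[OF y(1)]])
      then obtain z where "z \<in> V" "h y = h z"
        using N(4) by auto
      then show ?thesis
        using y(1) VA kh by (metis subsetD)
    qed
    moreover have "\<forall>j\<in>{i \<in> J. N i \<noteq> UNIV}. open (N j) \<and> h v j \<in> N j"
      using N(2,3) by (auto simp: PiE_iff)
    moreover have "{i \<in> J. N i \<noteq> UNIV} \<subseteq> J"
      by blast
    ultimately show ?thesis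
      using N(1) by blast
  qed
  then have "coordinate_system J h k"
    using kh kA inj fnl by (simp add: coordinate_system_def hk)
  then show ?thesis
    using that by blast
qed

lemma functional_zero: "functional \<phi> \<Longrightarrow> \<phi> \<zero>\<^bsub>KG\<^esub> = 0"
  using functional_add[of \<phi> "\<zero>\<^bsub>KG\<^esub>" "\<zero>\<^bsub>KG\<^esub>"] by simp

text \<open>Continuity of \<open>\<phi> (x y)\<close> at the origin gives neighbourhoods
  \<open>U\<close> and \<open>V\<close> of zero on whose product its norm stays below 1.
  \<open>V\<close> contains every \<open>y\<close> whose coordinates in a certain finite
  \<open>F\<close> vanish, together with all multiples of \<open>y\<close>, and every
  \<open>x\<close> has a small nonzero multiple in \<open>U\<close>. A nonzero value could therefore
  be scaled up to 1.\<close>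

lemma functional_mult_finite_support:
  assumes cs: "coordinate_system J h k" and \<phi>: "functional \<phi>"
  obtains F where "finite F" "F \<subseteq> J"
    "\<And>x y. x \<in> carrier KG \<Longrightarrow> y \<in> carrier KG \<Longrightarrow> \<forall>j\<in>F. h y j = 0 \<Longrightarrow> \<phi> (x \<otimes>\<^bsub>KG\<^esub> y) = 0"
proof -
  have hf: "\<And>j. j \<in> J \<Longrightarrow> functional (\<lambda>x. h x j)"
    using cs by (simp add: coordinate_system_def)
  define W where "W = {p \<in> topspace (prod_topology T T). (\<lambda>(x, y). \<phi> (x \<otimes>\<^bsub>KG\<^esub> y)) p \<in> ball 0 1}"
  have "continuous_map (prod_topology T T) euclidean (\<lambda>(x, y). \<phi> (x \<otimes>\<^bsub>KG\<^esub> y))"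
    using continuous_map_compose[OF continuous_mult functional_continuous[OF \<phi>]]
    by (simp add: o_def case_prod_unfold)
  then have op: "openin (prod_topology T T) W"
    unfolding W_def by (rule openin_continuous_map_preimage) simp
  have zW: "(\<zero>\<^bsub>KG\<^esub>, \<zero>\<^bsub>KG\<^esub>) \<in> W"
    using functional_zero[OF \<phi>] by (simp add: W_def topspace_T)
  obtain U V where UV: "openin T U" "openin T V" "\<zero>\<^bsub>KG\<^esub> \<in> U" "\<zero>\<^bsub>KG\<^esub> \<in> V" "U \<times> V \<subseteq> W"
    using op[unfolded openin_prod_topology_alt, rule_format, OF zW] by (elim exE conjE) (rule that)
  have nbhd: "\<exists>F N. finite F \<and> F \<subseteq> J \<and> (\<forall>j\<in>F. open (N j) \<and> h v j \<in> N j) \<and>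
        (\<forall>y\<in>carrier KG. (\<forall>j\<in>F. h y j \<in> N j) \<longrightarrow> y \<in> V)" if "openin T V" "v \<in> V" for V v
    using cs that by (simp add: coordinate_system_def)
  obtain F N where F: "finite F" "F \<subseteq> J" "\<forall>j\<in>F. open (N j) \<and> h \<zero>\<^bsub>KG\<^esub> j \<in> N j"
    "\<forall>y\<in>carrier KG. (\<forall>j\<in>F. h y j \<in> N j) \<longrightarrow> y \<in> V"
    using nbhd[OF UV(2,4)] by (elim exE conjE) (rule that)
  obtain F' N' where F': "finite F'" "F' \<subseteq> J" "\<forall>j\<in>F'. open (N' j) \<and> h \<zero>\<^bsub>KG\<^esub> j \<in> N' j"
    "\<forall>y\<in>carrier KG. (\<forall>j\<in>F'. h y j \<in> N' j) \<longrightarrow> y \<in> U"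
    using nbhd[OF UV(1,3)] by (elim exE conjE) (rule that)
  have h0: "h \<zero>\<^bsub>KG\<^esub> j = 0" if "j \<in> J" for j
    using functional_zero[OF hf[OF that]] .
  have "\<phi> (x \<otimes>\<^bsub>KG\<^esub> y) = 0" if x: "x \<in> carrier KG" and y: "y \<in> carrier KG" "\<forall>j\<in>F. h y j = 0" for x y
  proof (rule ccontr)
    assume nz: "\<phi> (x \<otimes>\<^bsub>KG\<^esub> y) \<noteq> 0"
    have "open (\<Inter>j\<in>F'. (\<lambda>c. c * h x j) -` N' j)"
      using F'(1,3) by (intro open_INT ballI open_vimage) (auto intro: continuous_intros)
    moreover have "0 \<in> (\<Inter>j\<in>F'. (\<lambda>c. c * h x j) -` N' j)"
      using F'(2,3) h0 by force
    ultimately obtain e where e: "e > 0" "ball 0 e \<subseteq> (\<Inter>j\<in>F'. (\<lambda>c. c * h x j) -` N' j)"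
      by (metis open_contains_ball)
    \<comment> \<open>Half the radius: a nonzero scalar inside the ball.\<close>
    define s :: 'k where "s = of_real (e / 2)"
    have "s \<noteq> 0" "s \<in> ball 0 e"
      using e(1) by (auto simp: s_def)
    then have "s * h x j \<in> N' j" if "j \<in> F'" for j
      using e(2) that by auto
    then have sx: "s \<odot>\<^bsub>KG\<^esub> x \<in> U"
      using F'(2,4) functional_smult[OF hf x] smult_closed[OF x] by (metis subsetD)
    \<comment> \<open>Chosen so that \<open>\<phi>\<close> takes the value 1, just outside the open
      unit ball, at the scaled product.\<close>
    define t where "t = 1 / (s * \<phi> (x \<otimes>\<^bsub>KG\<^esub> y))"
    have "h (t \<odot>\<^bsub>KG\<^esub> y) j = h \<zero>\<^bsub>KG\<^esub> j" if "j \<in> F" for j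
      using functional_smult[OF hf y(1), of j t] that F(2) bspec[OF y(2) that] h0 by (metis mult_zero_right subsetD)
    then have ty: "t \<odot>\<^bsub>KG\<^esub> y \<in> V"
      using F(3,4) smult_closed[OF y(1)] by metis
    have "\<phi> ((s \<odot>\<^bsub>KG\<^esub> x) \<otimes>\<^bsub>KG\<^esub> (t \<odot>\<^bsub>KG\<^esub> y)) = s * (t * \<phi> (x \<otimes>\<^bsub>KG\<^esub> y))"
      using x y(1) by (simp add: functional_smult[OF \<phi>] smult_mult mult_smult smult_closed mult.left_commute)
    also have "\<dots> = 1"
      using nz \<open>s \<noteq> 0\<close> by (simp add: t_def)
    finally have "(s \<odot>\<^bsub>KG\<^esub> x, t \<odot>\<^bsub>KG\<^esub> y) \<notin> W"
      by (simp add: W_def)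
    then show False
      using UV(5) sx ty by blast
  qed
  with F(1,2) show ?thesis
    by (rule that)
qed

text \<open>By finite support only the coordinates of \<open>y\<close> in \<open>F\<close>
  contribute; \<open>u j\<close> is the unit vector for the coordinate \<open>j\<close>. The
  elements \<open>u j\<close> are independent of \<open>x\<close>, which is what later bounds the
  dimension of the space of translates of \<open>\<phi>\<close>.\<close>

lemma functional_mult_expansion:
  assumes cs: "coordinate_system J h k" and \<phi>: "functional \<phi>"
  obtains F u where "finite F" "F \<subseteq> J" "\<And>j. j \<in> F \<Longrightarrow> u j \<in> carrier KG"
    "\<And>x y. x \<in> carrier KG \<Longrightarrow> y \<in> carrier KG \<Longrightarrow> \<phi> (x \<otimes>\<^bsub>KG\<^esub> y) = (\<Sum>j\<in>F. h y j * \<phi> (x \<otimes>\<^bsub>KG\<^esub> u j))"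
proof -
  obtain F where F: "finite F" "F \<subseteq> J" and zero: "\<And>x y. x \<in> carrier KG \<Longrightarrow> y \<in> carrier KG \<Longrightarrow>
      \<forall>j\<in>F. h y j = 0 \<Longrightarrow> \<phi> (x \<otimes>\<^bsub>KG\<^esub> y) = 0"
    by (rule functional_mult_finite_support[OF assms]) (rule that)
  have hf: "\<And>j. j \<in> J \<Longrightarrow> functional (\<lambda>x. h x j)" and kA: "\<And>a. k a \<in> carrier KG"
    and hk: "\<And>a j. j \<in> J \<Longrightarrow> h (k a) j = a j"
    and inj: "\<And>x y. x \<in> carrier KG \<Longrightarrow> y \<in> carrier KG \<Longrightarrow> (\<And>j. j \<in> J \<Longrightarrow> h x j = h y j) \<Longrightarrow> x = y"
    using cs by (auto simp: coordinate_system_def)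
  have k_add: "k (\<lambda>j. a j + b j) = k a \<oplus>\<^bsub>KG\<^esub> k b" for a b
    by (rule inj) (simp_all add: kA hk functional_add[OF hf])
  have k_smult: "k (\<lambda>j. c * a j) = c \<odot>\<^bsub>KG\<^esub> k a" for a c
    by (rule inj) (simp_all add: kA hk functional_smult[OF hf] smult_closed)
  define u where "u j = k (\<lambda>i. if i = j then 1 else 0)" for j
  have exp: "\<phi> (x \<otimes>\<^bsub>KG\<^esub> k (\<lambda>i. if i \<in> F' then a i else 0)) = (\<Sum>j\<in>F'. a j * \<phi> (x \<otimes>\<^bsub>KG\<^esub> u j))"
    if "finite F'" and x: "x \<in> carrier KG" for F' a x
    using that(1)
  proof (induction F' rule: finite_induct)
    case empty
    show ?case
      using x by (intro zero[THEN trans]) (use F in \<open>auto simp: kA hk\<close>)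
  next
    case (insert j F')
    have "(\<lambda>i. if i \<in> insert j F' then a i else 0)
        = (\<lambda>i. a j * (if i = j then 1 else 0) + (if i \<in> F' then a i else 0))"
      using insert.hyps by (auto simp: fun_eq_iff)
    then have "k (\<lambda>i. if i \<in> insert j F' then a i else 0) = a j \<odot>\<^bsub>KG\<^esub> u j \<oplus>\<^bsub>KG\<^esub> k (\<lambda>i. if i \<in> F' then a i else 0)"
      by (simp only: k_add k_smult u_def)
    then show ?case
      using insert x kA
      by (simp add: A.r_distr mult_smult functional_add[OF \<phi>] functional_smult[OF \<phi>] smult_closed u_def)
  qed
  have main: "\<phi> (x \<otimes>\<^bsub>KG\<^esub> y) = (\<Sum>j\<in>F. h y j * \<phi> (x \<otimes>\<^bsub>KG\<^esub> u j))"
    if x: "x \<in> carrier KG" and y: "y \<in> carrier KG" for x y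
  proof -
    have "y = k (\<lambda>i. if i \<in> F then h y i else 0) \<oplus>\<^bsub>KG\<^esub> k (\<lambda>i. if i \<in> F then 0 else h y i)"
      by (rule inj) (use y in \<open>simp_all add: kA hk functional_add[OF hf]\<close>)
    then have "\<phi> (x \<otimes>\<^bsub>KG\<^esub> y) = \<phi> (x \<otimes>\<^bsub>KG\<^esub> k (\<lambda>i. if i \<in> F then h y i else 0))
        + \<phi> (x \<otimes>\<^bsub>KG\<^esub> k (\<lambda>i. if i \<in> F then 0 else h y i))"
      using x kA by (metis (no_types, lifting) A.r_distr A.m_closed functional_add[OF \<phi>])
    also have "\<phi> (x \<otimes>\<^bsub>KG\<^esub> k (\<lambda>i. if i \<in> F then 0 else h y i)) = 0"
      by (rule zero) (use x F(2) in \<open>auto simp: kA hk\<close>)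
    also have "\<phi> (x \<otimes>\<^bsub>KG\<^esub> k (\<lambda>i. if i \<in> F then h y i else 0)) = (\<Sum>j\<in>F. h y j * \<phi> (x \<otimes>\<^bsub>KG\<^esub> u j))"
      by (rule exp[OF F(1) x])
    finally show ?thesis
      by simp
  qed
  have "u j \<in> carrier KG" if "j \<in> F" for j
    by (simp add: u_def kA)
  from F this main show ?thesis
    by (rule that)
qed

text \<open>A continuous functional on a power of \<open>'k\<close> involves finitely many
  coordinates; here this is the case \<open>x = 1\<close> of the preceding expansion.\<close>

lemma functional_expansion:
  assumes cs: "coordinate_system J h k" and \<phi>: "functional \<phi>"
  obtains F e where "finite F" "F \<subseteq> J" "\<And>y. y \<in> carrier KG \<Longrightarrow> \<phi> y = (\<Sum>j\<in>F. h y j * e j)"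
proof -
  obtain F u where F: "finite F" "F \<subseteq> J" "\<And>x y. x \<in> carrier KG \<Longrightarrow> y \<in> carrier KG \<Longrightarrow>
      \<phi> (x \<otimes>\<^bsub>KG\<^esub> y) = (\<Sum>j\<in>F. h y j * \<phi> (x \<otimes>\<^bsub>KG\<^esub> u j))"
    by (rule functional_mult_expansion[OF assms]) (rule that)
  have "\<phi> y = (\<Sum>j\<in>F. h y j * \<phi> (\<one>\<^bsub>KG\<^esub> \<otimes>\<^bsub>KG\<^esub> u j))" if "y \<in> carrier KG" for y
    using F(3)[OF A.one_closed that] that by simp
  with F(1,2) show ?thesis
    by (rule that)
qed

text \<open>The functionals \<open>x \<mapsto> \<phi> (x b)\<close> form a finite dimensional space, on which \<open>KG\<close> acts by right
  translation; \<open>\<phi>\<close> is a matrix coefficient of this representation.\<close>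

lemma functional_matrix_coefficient:
  assumes \<phi>: "functional \<phi>"
  obtains n m t where "mat_hom n m"
    "\<And>x. x \<in> carrier KG \<Longrightarrow> \<phi> x = (\<Sum>(l, k)\<in>{..<n} \<times> {..<n}. t l k * m x $$ (l, k))"
proof -
  obtain J h k where cs: "coordinate_system J h k"
    by (rule coordinate_system_exists)
  obtain F u where F: "finite F" "F \<subseteq> J" and u: "\<And>j. j \<in> F \<Longrightarrow> u j \<in> carrier KG"
    and exp: "\<And>x y. x \<in> carrier KG \<Longrightarrow> y \<in> carrier KG \<Longrightarrow>
      \<phi> (x \<otimes>\<^bsub>KG\<^esub> y) = (\<Sum>j\<in>F. h y j * \<phi> (x \<otimes>\<^bsub>KG\<^esub> u j))"
    by (rule functional_mult_expansion[OF cs \<phi>]) (rule that)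
  have hf: "\<And>j. j \<in> J \<Longrightarrow> functional (\<lambda>x. h x j)"
    using cs by (simp add: coordinate_system_def)
  \<comment> \<open>The functional \<open>x \<mapsto> \<phi> (x b)\<close>, set to 0 outside the
    carrier so that equality of such functionals is equality of functions.\<close>
  define \<psi> where "\<psi> b = (\<lambda>x. if x \<in> carrier KG then \<phi> (x \<otimes>\<^bsub>KG\<^esub> b) else 0)" for b
  \<comment> \<open>All \<open>\<psi> b\<close> lie in the span of the finitely many
    \<open>\<psi> (u j)\<close>; this is the finite dimension of the space of translates.\<close>
  have \<psi>_exp: "\<psi> b = (\<Sum>j\<in>F. (\<lambda>x. h b j * \<psi> (u j) x))" if "b \<in> carrier KG" for b
    using exp[OF _ that] by (auto simp: \<psi>_def fun_eq_iff sum_fun_apply)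
  obtain B where B: "B \<subseteq> \<psi> ` u ` F" "fun_vs.independent B" "\<psi> ` u ` F \<subseteq> fun_vs.span B"
    using fun_vs.maximal_independent_subset by blast
  have "finite B"
    using B(1) F(1) finite_subset by blast
  obtain n b L where b: "b ` {..<n} = B"
    and L: "Vector_Spaces.linear fun_scale fun_scale (L :: ('a \<Rightarrow> 'k) \<Rightarrow> nat \<Rightarrow> 'k)"
    and Lb: "\<And>j k. j < n \<Longrightarrow> L (b j) k = (if k = j then 1 else 0)"
    and Lexp: "\<And>f x. f \<in> fun_vs.span B \<Longrightarrow> f x = (\<Sum>k<n. L f k * b k x)"
    by (rule finite_independent_coordinates[OF \<open>finite B\<close> B(2)]) (rule that)
  interpret L: Vector_Spaces.linear fun_scale fun_scale L
    by (rule L)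
  have "\<forall>j\<in>{..<n}. \<exists>w. w \<in> carrier KG \<and> b j = \<psi> w"
  proof
    fix j assume "j \<in> {..<n}"
    then have "b j \<in> \<psi> ` u ` F"
      using b B(1) by blast
    then show "\<exists>w. w \<in> carrier KG \<and> b j = \<psi> w"
      using u by blast
  qed
  then obtain w where w: "\<And>j. j < n \<Longrightarrow> w j \<in> carrier KG" "\<And>j. j < n \<Longrightarrow> b j = \<psi> (w j)"
    by (metis lessThan_iff)
  \<comment> \<open>Coordinates of \<open>\<psi> a\<close> in the chosen basis. As functions of
    \<open>a\<close> they are again continuous functionals, being combinations of the coordinates
    \<open>h a j\<close>.\<close>
  define \<beta> where "\<beta> l a = L (\<psi> a) l" for l a
  have \<psi>_span: "\<psi> a \<in> fun_vs.span B" if "a \<in> carrier KG" for a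
    unfolding \<psi>_exp[OF that]
    by (intro fun_vs.span_sum fun_vs.span_scale) (use B(3) in blast)
  have \<beta>: "functional (\<beta> l)" for l
  proof -
    have eq: "\<beta> l a = (\<Sum>j\<in>F. L (\<psi> (u j)) l * h a j)" if "a \<in> carrier KG" for a
      unfolding \<beta>_def \<psi>_exp[OF that] by (simp add: L.sum L.scale sum_fun_apply mult.commute)
    have f: "functional (\<lambda>a. \<Sum>j\<in>F. L (\<psi> (u j)) l * h a j)"
      by (rule functional_combination) (use hf F(2) in blast)
    have "continuous_map T euclidean (\<beta> l)"
      using functional_continuous[OF f] by (rule continuous_map_eq) (simp add: topspace_T eq)
    then show ?thesis
      using f by (simp add: functional_def eq smult_closed)
  qed
  have \<beta>_exp: "\<phi> (x \<otimes>\<^bsub>KG\<^esub> a) = (\<Sum>l<n. \<beta> l a * \<phi> (x \<otimes>\<^bsub>KG\<^esub> w l))" if "x \<in> carrier KG" "a \<in> carrier KG" for x a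
    using Lexp[OF \<psi>_span[OF that(2)], of x] that(1) w(2) by (simp add: \<beta>_def) (simp add: \<psi>_def)
  have \<beta>_mult: "\<beta> i (c \<otimes>\<^bsub>KG\<^esub> a) = (\<Sum>l<n. \<beta> i (c \<otimes>\<^bsub>KG\<^esub> w l) * \<beta> l a)"
    if c: "c \<in> carrier KG" and a: "a \<in> carrier KG" for i c a
  proof -
    have "\<psi> (c \<otimes>\<^bsub>KG\<^esub> a) = (\<Sum>l<n. (\<lambda>x. \<beta> l a * \<psi> (c \<otimes>\<^bsub>KG\<^esub> w l) x))"
    proof
      fix x
      show "\<psi> (c \<otimes>\<^bsub>KG\<^esub> a) x = (\<Sum>l<n. (\<lambda>x. \<beta> l a * \<psi> (c \<otimes>\<^bsub>KG\<^esub> w l) x)) x"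
        using \<beta>_exp[of "x \<otimes>\<^bsub>KG\<^esub> c" a] c a w(1)
        by (auto simp: \<psi>_def sum_fun_apply A.m_assoc)
    qed
    then show ?thesis
      unfolding \<beta>_def by (simp add: L.sum L.scale sum_fun_apply mult.commute)
  qed
  \<comment> \<open>Right translation by \<open>c\<close> sends \<open>\<psi> a\<close> to
    \<open>\<psi> (c a)\<close>; this is its matrix in the basis
    \<open>\<psi> (w j)\<close>.\<close>
  define m where "m c = mat n n (\<lambda>(i, j). \<beta> i (c \<otimes>\<^bsub>KG\<^esub> w j))" for c
  have "mat_hom n m"
    unfolding mat_hom_def
  proof (intro conjI ballI allI impI)
    show "m x \<in> carrier_mat n n" for x
      by (simp add: m_def)
    show "m \<one>\<^bsub>KG\<^esub> = 1\<^sub>m n"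
      by (rule eq_matI) (auto simp: m_def w(1) \<beta>_def w(2)[symmetric] Lb)
    show "m (x \<oplus>\<^bsub>KG\<^esub> y) = m x + m y" if "x \<in> carrier KG" "y \<in> carrier KG" for x y
      using that w(1) by (intro eq_matI) (auto simp: m_def A.l_distr functional_add[OF \<beta>])
    show "m (c \<odot>\<^bsub>KG\<^esub> x) = c \<cdot>\<^sub>m m x" if "x \<in> carrier KG" for c x
      using that w(1) by (intro eq_matI) (auto simp: m_def smult_mult functional_smult[OF \<beta>])
    show "m (x \<otimes>\<^bsub>KG\<^esub> y) = m x * m y" if "x \<in> carrier KG" "y \<in> carrier KG" for x y
    proof (rule eq_matI)
      fix i j assume "i < dim_row (m x * m y)" "j < dim_col (m x * m y)"
      then have ij: "i < n" "j < n"
        by (auto simp: m_def)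
      have "(m x * m y) $$ (i, j) = (\<Sum>l<n. m x $$ (i, l) * m y $$ (l, j))"
        by (rule mult_mat_entry) (use ij in \<open>auto simp: m_def\<close>)
      then show "m (x \<otimes>\<^bsub>KG\<^esub> y) $$ (i, j) = (m x * m y) $$ (i, j)"
        using ij that w(1) \<beta>_mult[of x "y \<otimes>\<^bsub>KG\<^esub> w j" i] by (simp add: m_def A.m_assoc)
    qed (auto simp: m_def)
    show "continuous_map T euclidean (\<lambda>x. m x $$ (i, j))" if "i < n" "j < n" for i j
      using functional_continuous[OF functional_right_mult[OF \<beta> w(1)[OF that(2)]], of i] that
      by (simp add: m_def)
  qed
  \<comment> \<open>On the carrier \<open>\<phi>\<close> is \<open>\<psi> 1\<close>. It is expanded
    in the basis, and each of the resulting values \<open>\<phi> (x w_k)\<close>, read as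
    \<open>\<psi> (x w_k)\<close> at 1, is expanded once more.\<close>
  moreover have "\<phi> x = (\<Sum>(l, k)\<in>{..<n} \<times> {..<n}. \<beta> k \<one>\<^bsub>KG\<^esub> * \<phi> (w l) * m x $$ (l, k))" if x: "x \<in> carrier KG" for x
  proof -
    have "\<phi> x = (\<Sum>k<n. \<beta> k \<one>\<^bsub>KG\<^esub> * \<phi> (x \<otimes>\<^bsub>KG\<^esub> w k))"
      using \<beta>_exp[OF x A.one_closed] x by simp
    also have "\<dots> = (\<Sum>k<n. \<Sum>l<n. \<beta> k \<one>\<^bsub>KG\<^esub> * \<phi> (w l) * m x $$ (l, k))"
    proof (rule sum.cong[OF refl])
      fix k assume "k \<in> {..<n}"
      then show "\<beta> k \<one>\<^bsub>KG\<^esub> * \<phi> (x \<otimes>\<^bsub>KG\<^esub> w k) = (\<Sum>l<n. \<beta> k \<one>\<^bsub>KG\<^esub> * \<phi> (w l) * m x $$ (l, k))"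
        using \<beta>_exp[OF A.one_closed, of "x \<otimes>\<^bsub>KG\<^esub> w k"] x w(1)
        by (simp add: m_def sum_distrib_left mult_ac)
    qed
    also have "\<dots> = (\<Sum>l<n. \<Sum>k<n. \<beta> k \<one>\<^bsub>KG\<^esub> * \<phi> (w l) * m x $$ (l, k))"
      by (rule sum.swap)
    finally show ?thesis
      by (simp add: sum.cartesian_product)
  qed
  ultimately show ?thesis
    by (rule that)
qed

end

section \<open>Matrix images of KG in the span of G, and the family of the maps \<Phi>\<close>

section \<open>Density of the group and the Fourier transform\<close>

lemma nonzero_det_inverse:
  fixes A :: "'k::field mat"
  assumes "A \<in> carrier_mat n n" "det A \<noteq> 0"
  obtains B where "B \<in> carrier_mat n n" "A * B = 1\<^sub>m n" "B * A = 1\<^sub>m n"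
  using det_non_zero_imp_unit[OF assms, of n] by (auto simp: Units_def ring_mat_simps)

lemma mult_mat_vec_entry:
  assumes "A \<in> carrier_mat m n" "v \<in> carrier_vec n" "i < m"
  shows "(A *\<^sub>v v) $ i = (\<Sum>k<n. A $$ (i, k) * v $ k)"
  using assms by (auto simp: scalar_prod_def lessThan_atLeast0)

text \<open>A matrix has finitely many eigenvalues, and the field is infinite.\<close>

lemma invertible_shift:
  fixes q :: "'k::field_char_0 mat"
  assumes q: "q \<in> carrier_mat n n"
  obtains t B where "B \<in> carrier_mat n n" "(t \<cdot>\<^sub>m 1\<^sub>m n - q) * B = 1\<^sub>m n" "B * (t \<cdot>\<^sub>m 1\<^sub>m n - q) = 1\<^sub>m n"
proof -
  have "char_poly q \<noteq> 0"
    using degree_monic_char_poly[OF q] by auto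
  then have "finite {t. poly (char_poly q) t = 0}"
    by (rule poly_roots_finite)
  then obtain t where "poly (char_poly q) t \<noteq> 0"
    using ex_new_if_finite[OF infinite_UNIV_char_0] by blast
  then have ev: "\<not> eigenvalue q t"
    using eigenvalue_root_char_poly[OF q] by simp
  have car: "t \<cdot>\<^sub>m 1\<^sub>m n - q \<in> carrier_mat n n"
    using q by (intro minus_carrier_mat)
  have "det (t \<cdot>\<^sub>m 1\<^sub>m n - q) \<noteq> 0"
  proof
    assume "det (t \<cdot>\<^sub>m 1\<^sub>m n - q) = 0"
    then obtain v where v: "v \<in> carrier_vec n" "v \<noteq> 0\<^sub>v n" "(t \<cdot>\<^sub>m 1\<^sub>m n - q) *\<^sub>v v = 0\<^sub>v n"
      using det_0_iff_vec_prod_zero[OF car] by auto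
    have "(t \<cdot>\<^sub>m 1\<^sub>m n - q) *\<^sub>v v = t \<cdot>\<^sub>v v - q *\<^sub>v v"
    proof (rule eq_vecI)
      fix i assume "i < dim_vec (t \<cdot>\<^sub>v v - q *\<^sub>v v)"
      then have i: "i < n"
        using q by simp
      have "((t \<cdot>\<^sub>m 1\<^sub>m n - q) *\<^sub>v v) $ i = (\<Sum>k<n. (if k = i then t * v $ k else 0) - q $$ (i, k) * v $ k)"
        unfolding mult_mat_vec_entry[OF car v(1) i]
        using q i by (intro sum.cong refl) (auto simp: left_diff_distrib)
      also have "\<dots> = (t \<cdot>\<^sub>v v - q *\<^sub>v v) $ i"
        using q v(1) i mult_mat_vec_entry[OF q v(1) i] by (simp add: sum_subtractf del: index_mult_mat_vec)
      finally show "((t \<cdot>\<^sub>m 1\<^sub>m n - q) *\<^sub>v v) $ i = (t \<cdot>\<^sub>v v - q *\<^sub>v v) $ i" .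
    qed (use q v(1) in auto)
    then have "t \<cdot>\<^sub>v v - q *\<^sub>v v = 0\<^sub>v n"
      using v(3) by simp
    moreover have "q *\<^sub>v v \<in> carrier_vec n" "t \<cdot>\<^sub>v v \<in> carrier_vec n"
      using q v(1) by auto
    ultimately have "q *\<^sub>v v = t \<cdot>\<^sub>v v"
      by (intro eq_vecI) (auto simp: vec_eq_iff)
    then show False
      using ev q v(1,2) by (auto simp: eigenvalue_def eigenvector_def)
  qed
  then show ?thesis
    using nonzero_det_inverse[OF car] that by blast
qed

context chosen_representations
begin

text \<open>The bicommutant of \<open>\<rho> \<epsilon>\<close>, phrased with intertwiners;
  \<open>carrier_End_over\<close> identifies it with the endomorphisms of \<open>E\<close> over its
  commutant.\<close>

definition block :: "('g \<Rightarrow> 'k) \<Rightarrow> 'k mat set" where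
  "block \<epsilon> = {Y \<in> carrier_mat (dimE \<epsilon>) (dimE \<epsilon>).
     \<forall>X. intertwines (dimE \<epsilon>) (dimE \<epsilon>) X (\<rho> \<epsilon>) (\<rho> \<epsilon>) \<longrightarrow> X * Y = Y * X}"

text \<open>Different characters exclude nonzero intertwiners, so the simultaneous bicommutant
  theorem applies to every finite set of characters.\<close>

lemma block_span:
  assumes F: "finite F" "F \<subseteq> chars" and y: "\<And>\<epsilon>. \<epsilon> \<in> F \<Longrightarrow> y \<epsilon> \<in> block \<epsilon>"
  obtains D c where "finite D" "D \<subseteq> carrier G"
    "\<And>\<epsilon> p r. \<epsilon> \<in> F \<Longrightarrow> p < dimE \<epsilon> \<Longrightarrow> r < dimE \<epsilon> \<Longrightarrow> y \<epsilon> $$ (p, r) = (\<Sum>g\<in>D. c g * \<rho> \<epsilon> g $$ (p, r))"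
proof (rule simultaneous_bicommutant[OF F(1), of dimE \<rho> y])
  show "X = 0\<^sub>m (dimE \<epsilon>) (dimE \<epsilon>')"
    if "\<epsilon> \<in> F" "\<epsilon>' \<in> F" "\<epsilon> \<noteq> \<epsilon>'" "intertwines (dimE \<epsilon>) (dimE \<epsilon>') X (\<rho> \<epsilon>') (\<rho> \<epsilon>)" for \<epsilon> \<epsilon>' X
    using character_eq_of_intertwiner[OF irr irr that(4)] that(1-3) F(2) char by (metis subsetD)
qed (use that y F rep in \<open>auto simp: block_def\<close>)

end

context group_algebra
begin

lemma mat_hom_carrier: "mat_hom n m \<Longrightarrow> x \<in> carrier KG \<Longrightarrow> m x \<in> carrier_mat n n"
  and mat_hom_mult: "mat_hom n m \<Longrightarrow> x \<in> carrier KG \<Longrightarrow> y \<in> carrier KG \<Longrightarrow> m (x \<otimes>\<^bsub>KG\<^esub> y) = m x * m y"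
  and mat_hom_add: "mat_hom n m \<Longrightarrow> x \<in> carrier KG \<Longrightarrow> y \<in> carrier KG \<Longrightarrow> m (x \<oplus>\<^bsub>KG\<^esub> y) = m x + m y"
  and mat_hom_smult: "mat_hom n m \<Longrightarrow> x \<in> carrier KG \<Longrightarrow> m (c \<odot>\<^bsub>KG\<^esub> x) = c \<cdot>\<^sub>m m x"
  and mat_hom_one: "mat_hom n m \<Longrightarrow> m \<one>\<^bsub>KG\<^esub> = 1\<^sub>m n"
  by (auto simp: mat_hom_def)

lemma functional_mat_hom_entry:
  assumes "mat_hom n m" "i < n" "j < n"
  shows "functional (\<lambda>x. m x $$ (i, j))"
proof -
  have "dim_row (m x) = n" "dim_col (m x) = n" if "x \<in> carrier KG" for x
    using mat_hom_carrier[OF assms(1) that] by auto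
  then show ?thesis
    using assms by (auto simp: functional_def mat_hom_def)
qed

lemma mat_hom_conjugate:
  assumes m: "mat_hom n m" and B: "B \<in> carrier_mat n n" and A: "A \<in> carrier_mat n n"
    and BA: "B * A = 1\<^sub>m n" and AB: "A * B = 1\<^sub>m n"
  shows "mat_hom n (\<lambda>x. B * (m x * A))"
  unfolding mat_hom_def
proof (intro conjI ballI allI impI)
  show "B * (m x * A) \<in> carrier_mat n n" if "x \<in> carrier KG" for x
    using mat_hom_carrier[OF m that] A B by simp
  show "B * (m \<one>\<^bsub>KG\<^esub> * A) = 1\<^sub>m n"
    using A BA by (simp add: mat_hom_one[OF m])
  show "B * (m (x \<oplus>\<^bsub>KG\<^esub> y) * A) = B * (m x * A) + B * (m y * A)" if "x \<in> carrier KG" "y \<in> carrier KG" for x y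
    using mat_hom_carrier[OF m that(1)] mat_hom_carrier[OF m that(2)] A B
    by (simp add: mat_hom_add[OF m that] add_mult_distrib_mat[of _ n n]
        mult_add_distrib_mat[of B n n "m x * A" n "m y * A"])
  show "B * (m (x \<otimes>\<^bsub>KG\<^esub> y) * A) = B * (m x * A) * (B * (m y * A))" if "x \<in> carrier KG" "y \<in> carrier KG" for x y
  proof -
    have x: "m x \<in> carrier_mat n n" and y: "m y \<in> carrier_mat n n"
      using mat_hom_carrier[OF m] that by auto
    have "B * (m x * A) * (B * (m y * A)) = B * (m x * (A * B) * (m y * A))"
      using A B x y by (simp add: assoc_mult_mat[of _ n n _ n _ n])
    also have "\<dots> = B * (m x * m y * A)"
      using A B x y right_mult_one_mat[OF x] by (simp add: AB assoc_mult_mat[of _ n n _ n _ n])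
    finally show ?thesis
      by (simp add: mat_hom_mult[OF m that])
  qed
  show "B * (m (c \<odot>\<^bsub>KG\<^esub> x) * A) = c \<cdot>\<^sub>m (B * (m x * A))" if "x \<in> carrier KG" for c x
    using mat_hom_carrier[OF m that] A B
    by (simp add: mat_hom_smult[OF m that] mult_smult_assoc_mat[of _ n n] mult_smult_distrib[of B n n "m x * A" n])
  show "continuous_map T euclidean (\<lambda>x. (B * (m x * A)) $$ (i, j))" if ij: "i < n" "j < n" for i j
  proof -
    have eq: "(B * (m x * A)) $$ (i, j) = (\<Sum>k<n. B $$ (i, k) * (\<Sum>l<n. m x $$ (k, l) * A $$ (l, j)))"
      if "x \<in> carrier KG" for x
      using mult_mat_entry[OF B _ ij, of "m x * A"] mult_mat_entry[OF mat_hom_carrier[OF m that] A _ ij(2)]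
        mat_hom_carrier[OF m that] A by simp
    have "continuous_map T euclidean (\<lambda>x. \<Sum>k<n. B $$ (i, k) * (\<Sum>l<n. m x $$ (k, l) * A $$ (l, j)))"
      using m by (auto simp: mat_hom_def intro!: continuous_map_euclidean_sum continuous_map_euclidean_mult)
    then show ?thesis
      by (rule continuous_map_eq) (simp add: topspace_T eq)
  qed
qed

text \<open>Conjugating by an invertible matrix that commutes with the image of \<open>G\<close>
  yields a second homomorphism with the same values on \<open>G\<close>, hence the same
  homomorphism. If \<open>q\<close> is not invertible, some shift \<open>t - q\<close> is, and
  commuting with the shift amounts to commuting with \<open>q\<close>.\<close>

lemma mat_hom_commutant:
  assumes m: "mat_hom n m" and q: "q \<in> carrier_mat n n"
    and comm: "\<And>g. g \<in> carrier G \<Longrightarrow> q * m (\<eta> g) = m (\<eta> g) * q" and x: "x \<in> carrier KG"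
  shows "q * m x = m x * q"
proof -
  obtain t B where B: "B \<in> carrier_mat n n" "(t \<cdot>\<^sub>m 1\<^sub>m n - q) * B = 1\<^sub>m n" "B * (t \<cdot>\<^sub>m 1\<^sub>m n - q) = 1\<^sub>m n"
    using invertible_shift[OF q] by blast
  define A where "A = t \<cdot>\<^sub>m 1\<^sub>m n - q"
  have A: "A \<in> carrier_mat n n"
    unfolding A_def using q by (intro minus_carrier_mat)
  have BA: "B * A = 1\<^sub>m n" and AB: "A * B = 1\<^sub>m n"
    using B by (simp_all add: A_def)
  have Y1: "Y * A = t \<cdot>\<^sub>m Y - Y * q" and Y2: "A * Y = t \<cdot>\<^sub>m Y - q * Y" if Y: "Y \<in> carrier_mat n n" for Y
  proof -
    show "Y * A = t \<cdot>\<^sub>m Y - Y * q"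
      unfolding A_def using q Y
      by (simp add: mult_minus_distrib_mat[of _ n n _ n] mult_smult_distrib[of _ n n _ n])
    show "A * Y = t \<cdot>\<^sub>m Y - q * Y"
      unfolding A_def using q Y
      by (simp add: minus_mult_distrib_mat[of _ n n _ _ n] mult_smult_assoc_mat[of _ n n _ n])
  qed
  have eq: "B * (m (\<eta> g) * A) = m (\<eta> g)" if g: "g \<in> carrier G" for g
  proof -
    have mg: "m (\<eta> g) \<in> carrier_mat n n"
      using m eta_carrier[OF g] by (rule mat_hom_carrier)
    have "m (\<eta> g) * A = A * m (\<eta> g)"
      by (simp only: Y1[OF mg] Y2[OF mg] comm[OF g])
    then have "B * (m (\<eta> g) * A) = B * A * m (\<eta> g)"
      using assoc_mult_mat[OF B(1) A mg] by simp
    then show ?thesis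
      using mg by (simp add: BA)
  qed
  have mx: "m x \<in> carrier_mat n n"
    using m x by (rule mat_hom_carrier)
  have "B * (m x * A) = m x"
    by (rule mat_hom_unique[OF mat_hom_conjugate[OF m B(1) A BA AB] m eq x])
  then have "A * m x = A * (B * (m x * A))"
    by simp
  also have "\<dots> = A * B * (m x * A)"
    using A B(1) mx by (simp add: assoc_mult_mat[of _ n n _ n _ n])
  also have "\<dots> = m x * A"
    using A mx by (simp add: AB)
  finally have "t \<cdot>\<^sub>m m x - q * m x = t \<cdot>\<^sub>m m x - m x * q"
    by (simp only: Y1[OF mx] Y2[OF mx])
  then have eq: "(t \<cdot>\<^sub>m m x - q * m x) $$ (i, j) = (t \<cdot>\<^sub>m m x - m x * q) $$ (i, j)" for i j
    by simp
  show ?thesis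
  proof (rule eq_matI)
    fix i j assume "i < dim_row (m x * q)" "j < dim_col (m x * q)"
    then show "(q * m x) $$ (i, j) = (m x * q) $$ (i, j)"
      using eq[of i j] carrier_matD[OF q] carrier_matD[OF mx] by (simp del: index_mult_mat(1))
  qed (use q mx in auto)
qed

text \<open>\<open>m x\<close> commutes with everything that commutes with the image of
  \<open>G\<close>, so it lies in the bicommutant; the theorem is used with a single summand,
  indexed by \<open>()\<close>.\<close>

lemma mat_hom_span:
  assumes m: "mat_hom n m" and x: "x \<in> carrier KG"
  obtains D c where "finite D" "D \<subseteq> carrier G"
    "\<And>p r. p < n \<Longrightarrow> r < n \<Longrightarrow> m x $$ (p, r) = (\<Sum>g\<in>D. c g * m (\<eta> g) $$ (p, r))"
proof -
  obtain D c where D: "finite D" "D \<subseteq> carrier G" "\<And>i p r. i \<in> {()} \<Longrightarrow> p < n \<Longrightarrow> r < n \<Longrightarrow>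
      m x $$ (p, r) = (\<Sum>g\<in>D. c g * m (\<eta> g) $$ (p, r))"
  proof (rule simultaneous_bicommutant[of "{()}" "\<lambda>_. n" "\<lambda>_ g. m (\<eta> g)" "\<lambda>_. m x"])
    show "X * m x = m x * X" if "intertwines n n X (\<lambda>g. m (\<eta> g)) (\<lambda>g. m (\<eta> g))" for X
      using that by (intro mat_hom_commutant[OF m _ _ x]) (auto simp: intertwines_def)
  qed (use matrix_rep_mat_hom[OF m] mat_hom_carrier[OF m x] in auto)
  then show ?thesis
    using that by blast
qed

text \<open>\<open>\<phi>\<close> is a matrix coefficient of some \<open>m\<close>, and
  \<open>m x\<close> is a combination of matrices \<open>m (\<eta> g)\<close>. The value
  \<open>\<phi> x\<close> is therefore the same combination of values of \<open>\<phi>\<close> on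
  \<open>G\<close>.\<close>

lemma functional_eq_zero:
  assumes \<phi>: "functional \<phi>" and zero: "\<And>g. g \<in> carrier G \<Longrightarrow> \<phi> (\<eta> g) = 0" and x: "x \<in> carrier KG"
  shows "\<phi> x = 0"
proof -
  obtain n m t where m: "mat_hom n m"
    and \<phi>m: "\<And>x. x \<in> carrier KG \<Longrightarrow> \<phi> x = (\<Sum>(l, k)\<in>{..<n} \<times> {..<n}. t l k * m x $$ (l, k))"
    by (rule functional_matrix_coefficient[OF \<phi>]) (rule that)
  obtain D c where D: "finite D" "D \<subseteq> carrier G"
    "\<And>p r. p < n \<Longrightarrow> r < n \<Longrightarrow> m x $$ (p, r) = (\<Sum>g\<in>D. c g * m (\<eta> g) $$ (p, r))"
    by (rule mat_hom_span[OF m x]) (rule that)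
  have "\<phi> x = (\<Sum>(l, k)\<in>{..<n} \<times> {..<n}. \<Sum>g\<in>D. c g * (t l k * m (\<eta> g) $$ (l, k)))"
    unfolding \<phi>m[OF x] by (intro sum.cong refl) (auto simp: D(3) sum_distrib_left mult_ac)
  also have "\<dots> = (\<Sum>g\<in>D. \<Sum>(l, k)\<in>{..<n} \<times> {..<n}. c g * (t l k * m (\<eta> g) $$ (l, k)))"
    unfolding case_prod_unfold by (rule sum.swap)
  also have "\<dots> = (\<Sum>g\<in>D. c g * \<phi> (\<eta> g))"
    using D(2) by (intro sum.cong refl) (auto simp: \<phi>m eta_carrier sum_distrib_left case_prod_unfold)
  also have "\<dots> = 0"
    using D(2) zero by (intro sum.neutral) auto
  finally show ?thesis .
qed

lemma functional_eqI:
  assumes "functional \<phi>" "functional \<psi>" "\<And>g. g \<in> carrier G \<Longrightarrow> \<phi> (\<eta> g) = \<psi> (\<eta> g)" "x \<in> carrier KG"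
  shows "\<phi> x = \<psi> x"
  using functional_eq_zero[OF functional_diff[OF assms(1,2)]] assms(3,4) by simp

definition \<Phi> :: "('g \<Rightarrow> 'k) \<Rightarrow> 'a \<Rightarrow> 'k mat" where
  "\<Phi> \<epsilon> = (SOME m. mat_hom (dimE \<epsilon>) m \<and> (\<forall>g\<in>carrier G. m (\<eta> g) = \<rho> \<epsilon> g))"

lemma \<Phi>_hom: "\<epsilon> \<in> chars \<Longrightarrow> mat_hom (dimE \<epsilon>) (\<Phi> \<epsilon>)"
  and \<Phi>_eta: "\<epsilon> \<in> chars \<Longrightarrow> g \<in> carrier G \<Longrightarrow> \<Phi> \<epsilon> (\<eta> g) = \<rho> \<epsilon> g"
proof -
  assume \<epsilon>: "\<epsilon> \<in> chars"
  have "\<exists>m. mat_hom (dimE \<epsilon>) m \<and> (\<forall>g\<in>carrier G. m (\<eta> g) = \<rho> \<epsilon> g)"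
    by (rule mat_hom_extension[OF rep[OF \<epsilon>]]) blast
  then have "mat_hom (dimE \<epsilon>) (\<Phi> \<epsilon>) \<and> (\<forall>g\<in>carrier G. \<Phi> \<epsilon> (\<eta> g) = \<rho> \<epsilon> g)"
    unfolding \<Phi>_def by (rule someI_ex)
  then show "mat_hom (dimE \<epsilon>) (\<Phi> \<epsilon>)" "g \<in> carrier G \<Longrightarrow> \<Phi> \<epsilon> (\<eta> g) = \<rho> \<epsilon> g"
    by auto
qed

lemma functional_\<Phi>: "\<epsilon> \<in> chars \<Longrightarrow> i < dimE \<epsilon> \<Longrightarrow> j < dimE \<epsilon> \<Longrightarrow> functional (\<lambda>x. \<Phi> \<epsilon> x $$ (i, j))"
  using \<Phi>_hom functional_mat_hom_entry by blast

text \<open>On \<open>G\<close> the functional is a combination of entries of the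
  \<open>\<rho> \<epsilon>\<close>. The same combination with \<open>\<Phi>\<close> in place of
  \<open>\<rho>\<close> is a functional that agrees with \<open>\<phi>\<close> on \<open>G\<close>,
  hence everywhere.\<close>

lemma functional_entries:
  assumes \<phi>: "functional \<phi>"
  obtains F c where "finite F" "F \<subseteq> entry_indices"
    "\<And>x. x \<in> carrier KG \<Longrightarrow> \<phi> x = (\<Sum>(\<epsilon>, i, j)\<in>F. c (\<epsilon>, i, j) * \<Phi> \<epsilon> x $$ (i, j))"
proof -
  obtain n m t where m: "mat_hom n m"
    and \<phi>m: "\<And>x. x \<in> carrier KG \<Longrightarrow> \<phi> x = (\<Sum>(l, k)\<in>{..<n} \<times> {..<n}. t l k * m x $$ (l, k))"
    by (rule functional_matrix_coefficient[OF \<phi>]) (rule that)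
  have "on_G (\<lambda>g. \<Sum>p\<in>{..<n} \<times> {..<n}. t (fst p) (snd p) * m (\<eta> g) $$ (fst p, snd p)) \<in> coefficient_space"
    by (rule coefficient_space_sum, rule matrix_coefficients[OF matrix_rep_mat_hom[OF m]]) auto
  then have "on_G (\<lambda>g. \<phi> (\<eta> g)) \<in> coefficient_space"
    by (rule coefficient_space_cong) (simp add: \<phi>m eta_carrier case_prod_unfold)
  then obtain F c where F: "finite F" "F \<subseteq> entry_indices"
    "\<And>g. g \<in> carrier G \<Longrightarrow> \<phi> (\<eta> g) = (\<Sum>(\<epsilon>, i, j)\<in>F. c (\<epsilon>, i, j) * \<rho> \<epsilon> g $$ (i, j))"
    by (rule coefficient_space_expand) (rule that)
  define \<psi> where "\<psi> x = (\<Sum>p\<in>F. c p * \<Phi> (fst p) x $$ snd p)" for x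
  have "functional \<psi>"
    unfolding \<psi>_def using F(2) functional_\<Phi>
    by (intro functional_combination) (auto simp: entry_indices_def)
  then have "\<phi> x = \<psi> x" if "x \<in> carrier KG" for x
  proof (rule functional_eqI[OF \<phi> _ _ that])
    fix g assume g: "g \<in> carrier G"
    show "\<phi> (\<eta> g) = \<psi> (\<eta> g)"
      unfolding F(3)[OF g] \<psi>_def
      by (intro sum.cong refl) (use F(2) g in \<open>auto simp: entry_indices_def \<Phi>_eta\<close>)
  qed
  then have "\<phi> x = (\<Sum>(\<epsilon>, i, j)\<in>F. c (\<epsilon>, i, j) * \<Phi> \<epsilon> x $$ (i, j))" if "x \<in> carrier KG" for x
    using that by (simp add: \<psi>_def case_prod_unfold)
  with F(1,2) show ?thesis
    by (rule that)
qed

lemma \<Phi>_block: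
  assumes "\<epsilon> \<in> chars" "x \<in> carrier KG"
  shows "\<Phi> \<epsilon> x \<in> block \<epsilon>"
  unfolding block_def
proof (intro CollectI conjI allI impI)
  show "\<Phi> \<epsilon> x \<in> carrier_mat (dimE \<epsilon>) (dimE \<epsilon>)"
    using \<Phi>_hom[OF assms(1)] assms(2) by (rule mat_hom_carrier)
  show "X * \<Phi> \<epsilon> x = \<Phi> \<epsilon> x * X" if "intertwines (dimE \<epsilon>) (dimE \<epsilon>) X (\<rho> \<epsilon>) (\<rho> \<epsilon>)" for X
    using that by (intro mat_hom_commutant[OF \<Phi>_hom[OF assms(1)] _ _ assms(2)])
      (simp_all add: intertwines_def \<Phi>_eta[OF assms(1)])
qed

text \<open>As \<open>KG\<close> is a full power of \<open>'k\<close>, an element may be prescribed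
  by arbitrary coordinates. Each coordinate is a finite combination of entries of the
  \<open>\<Phi> \<epsilon>\<close>, and \<open>x\<close> receives the coordinates that result from
  putting \<open>y \<epsilon>\<close> in place of \<open>\<Phi> \<epsilon>\<close>. That a given
  entry of \<open>\<Phi> \<epsilon> x\<close> comes out right involves finitely many characters, and
  on those \<open>y\<close> looks like a combination of group elements.\<close>

lemma \<Phi>_surj:
  assumes y: "\<And>\<epsilon>. \<epsilon> \<in> chars \<Longrightarrow> y \<epsilon> \<in> block \<epsilon>"
  obtains x where "x \<in> carrier KG" "\<And>\<epsilon>. \<epsilon> \<in> chars \<Longrightarrow> \<Phi> \<epsilon> x = y \<epsilon>"
proof -
  obtain J h k where cs: "coordinate_system J h k"
    by (rule coordinate_system_exists)
  have hf: "\<And>j. j \<in> J \<Longrightarrow> functional (\<lambda>x. h x j)" and kA: "\<And>a. k a \<in> carrier KG"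
    and hk: "\<And>a j. j \<in> J \<Longrightarrow> h (k a) j = a j"
    using cs by (auto simp: coordinate_system_def)
  have "\<forall>j\<in>J. \<exists>F c. finite F \<and> F \<subseteq> entry_indices \<and>
      (\<forall>x\<in>carrier KG. h x j = (\<Sum>(\<epsilon>, i, l)\<in>F. c (\<epsilon>, i, l) * \<Phi> \<epsilon> x $$ (i, l)))"
  proof
    fix j assume "j \<in> J"
    show "\<exists>F c. finite F \<and> F \<subseteq> entry_indices \<and>
      (\<forall>x\<in>carrier KG. h x j = (\<Sum>(\<epsilon>, i, l)\<in>F. c (\<epsilon>, i, l) * \<Phi> \<epsilon> x $$ (i, l)))"
      by (rule functional_entries[OF hf[OF \<open>j \<in> J\<close>]]) blast
  qed
  then obtain F c where Fc: "\<forall>j\<in>J. finite (F j) \<and> F j \<subseteq> entry_indices \<and>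
      (\<forall>x\<in>carrier KG. h x j = (\<Sum>(\<epsilon>, i, l)\<in>F j. c j (\<epsilon>, i, l) * \<Phi> \<epsilon> x $$ (i, l)))"
    unfolding bchoice_iff by (elim exE) (rule that)
  have F: "finite (F j)" "F j \<subseteq> entry_indices" if "j \<in> J" for j
    using Fc that by auto
  have hF: "h x j = (\<Sum>(\<epsilon>, i, l)\<in>F j. c j (\<epsilon>, i, l) * \<Phi> \<epsilon> x $$ (i, l))" if "j \<in> J" "x \<in> carrier KG" for j x
    using Fc that by blast
  define x where "x = k (\<lambda>j. \<Sum>(\<epsilon>, i, l)\<in>F j. c j (\<epsilon>, i, l) * y \<epsilon> $$ (i, l))"
  have "\<Phi> \<epsilon> x = y \<epsilon>" if \<epsilon>: "\<epsilon> \<in> chars" for \<epsilon>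
  proof (rule eq_matI)
    fix p r assume "p < dim_row (y \<epsilon>)" "r < dim_col (y \<epsilon>)"
    then have pr: "p < dimE \<epsilon>" "r < dimE \<epsilon>"
      using y[OF \<epsilon>] by (auto simp: block_def)
    obtain F0 e where F0: "finite F0" "F0 \<subseteq> J"
      and e: "\<And>z. z \<in> carrier KG \<Longrightarrow> \<Phi> \<epsilon> z $$ (p, r) = (\<Sum>j\<in>F0. h z j * e j)"
      by (rule functional_expansion[OF cs functional_\<Phi>[OF \<epsilon> pr]]) (rule that)
    \<comment> \<open>One entry of \<open>\<Phi> \<epsilon>\<close> depends on the coordinates in
      the finite set \<open>F0\<close>, and these involve finitely many characters; \<open>E\<close>
      collects them together with \<open>\<epsilon>\<close>.\<close>
    define E where "E = insert \<epsilon> (\<Union>j\<in>F0. fst ` F j)"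
    have "fst ` F j \<subseteq> chars \<and> finite (fst ` F j)" if "j \<in> F0" for j
    proof -
      have "j \<in> J"
        using that F0(2) by blast
      from F[OF this] show ?thesis
        by (auto simp: entry_indices_def)
    qed
    then have E: "finite E" "E \<subseteq> chars"
      using F0(1) \<epsilon> by (auto simp: E_def)
    \<comment> \<open>On \<open>E\<close> the family \<open>y\<close> coincides with the image of a
      combination of elements of \<open>G\<close>, for which the claim is mere linearity.\<close>
    obtain D d where D: "finite D" "D \<subseteq> carrier G"
      and yD: "\<And>\<epsilon> p r. \<epsilon> \<in> E \<Longrightarrow> p < dimE \<epsilon> \<Longrightarrow> r < dimE \<epsilon> \<Longrightarrow> y \<epsilon> $$ (p, r) = (\<Sum>g\<in>D. d g * \<rho> \<epsilon> g $$ (p, r))"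
      by (rule block_span[OF E, of y]) (use y E in blast, rule that)
    have "(\<Sum>(\<epsilon>, i, l)\<in>F j. c j (\<epsilon>, i, l) * y \<epsilon> $$ (i, l)) = (\<Sum>g\<in>D. d g * h (\<eta> g) j)" if j: "j \<in> F0" for j
    proof -
      have jJ: "j \<in> J"
        using j F0 by auto
      have "(\<Sum>(\<epsilon>, i, l)\<in>F j. c j (\<epsilon>, i, l) * y \<epsilon> $$ (i, l))
          = (\<Sum>q\<in>F j. \<Sum>g\<in>D. d g * (c j q * \<Phi> (fst q) (\<eta> g) $$ snd q))"
      proof (rule sum.cong[OF refl])
        fix q assume q: "q \<in> F j"
        obtain \<epsilon>' i l where ql: "q = (\<epsilon>', i, l)"
          by (metis surj_pair)
        have "\<epsilon>' \<in> E" "\<epsilon>' \<in> chars" "i < dimE \<epsilon>'" "l < dimE \<epsilon>'"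
          using q j F(2)[OF jJ] by (force simp: ql E_def entry_indices_def)+
        then show "(case q of (\<epsilon>, i, l) \<Rightarrow> c j (\<epsilon>, i, l) * y \<epsilon> $$ (i, l))
            = (\<Sum>g\<in>D. d g * (c j q * \<Phi> (fst q) (\<eta> g) $$ snd q))"
          using D(2) by (auto simp: ql yD sum_distrib_left \<Phi>_eta mult.left_commute intro!: sum.cong)
      qed
      also have "\<dots> = (\<Sum>g\<in>D. \<Sum>q\<in>F j. d g * (c j q * \<Phi> (fst q) (\<eta> g) $$ snd q))"
        by (rule sum.swap)
      also have "\<dots> = (\<Sum>g\<in>D. d g * h (\<eta> g) j)"
        using D(2) by (intro sum.cong refl) (auto simp: hF[OF jJ] eta_carrier sum_distrib_left case_prod_unfold)
      finally show ?thesis .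
    qed
    then have "\<Phi> \<epsilon> x $$ (p, r) = (\<Sum>j\<in>F0. (\<Sum>g\<in>D. d g * h (\<eta> g) j) * e j)"
      using F0(2) by (auto simp: e x_def kA hk intro!: sum.cong)
    also have "\<dots> = (\<Sum>j\<in>F0. \<Sum>g\<in>D. d g * (h (\<eta> g) j * e j))"
      by (simp add: sum_distrib_right mult.assoc)
    also have "\<dots> = (\<Sum>g\<in>D. \<Sum>j\<in>F0. d g * (h (\<eta> g) j * e j))"
      by (rule sum.swap)
    also have "\<dots> = (\<Sum>g\<in>D. d g * \<rho> \<epsilon> g $$ (p, r))"
      using D(2) e[OF eta_carrier] \<Phi>_eta[OF \<epsilon>] by (intro sum.cong refl) (auto simp flip: sum_distrib_left)
    also have "\<dots> = y \<epsilon> $$ (p, r)"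
      using yD[of \<epsilon> p r] pr by (simp add: E_def)
    finally show "\<Phi> \<epsilon> x $$ (p, r) = y \<epsilon> $$ (p, r)" .
  qed (use mat_hom_carrier[OF \<Phi>_hom[OF \<epsilon>], of x] y[OF \<epsilon>] in \<open>auto simp: x_def kA block_def\<close>)
  moreover have "x \<in> carrier KG"
    by (simp add: x_def kA)
  ultimately show ?thesis
    using that by blast
qed

text \<open>Coordinates separate points, and they are combinations of entries of the
  \<open>\<Phi> \<epsilon>\<close>.\<close>

lemma \<Phi>_inj:
  assumes "x \<in> carrier KG" "x' \<in> carrier KG" "\<And>\<epsilon>. \<epsilon> \<in> chars \<Longrightarrow> \<Phi> \<epsilon> x = \<Phi> \<epsilon> x'"
  shows "x = x'"
proof -
  obtain J h k where cs: "coordinate_system J h k"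
    by (rule coordinate_system_exists)
  have "h x j = h x' j" if "j \<in> J" for j
  proof -
    have "functional (\<lambda>x. h x j)"
      using cs that by (simp add: coordinate_system_def)
    then obtain F c where "F \<subseteq> entry_indices"
      "\<And>x. x \<in> carrier KG \<Longrightarrow> h x j = (\<Sum>(\<epsilon>, i, l)\<in>F. c (\<epsilon>, i, l) * \<Phi> \<epsilon> x $$ (i, l))"
      by (rule functional_entries) (rule that)
    then show ?thesis
      using assms by (auto simp: entry_indices_def intro!: sum.cong)
  qed
  then show ?thesis
    using cs assms(1,2) by (auto simp: coordinate_system_def)
qed

text \<open>Coordinates are finite combinations of entries of the \<open>\<Phi> \<epsilon>\<close>,
  so these entries generate the topology of \<open>KG\<close>. From this follow the continuity of
  the projections onto the ideals and that of the inverse of the product map.\<close>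

lemma continuous_map_into_T:
  assumes f: "\<And>z. z \<in> topspace X \<Longrightarrow> f z \<in> carrier KG"
    and cont: "\<And>\<epsilon> i j. \<epsilon> \<in> chars \<Longrightarrow> i < dimE \<epsilon> \<Longrightarrow> j < dimE \<epsilon> \<Longrightarrow>
      continuous_map X euclidean (\<lambda>z. \<Phi> \<epsilon> (f z) $$ (i, j))"
  shows "continuous_map X T f"
proof -
  obtain J h k where cs: "coordinate_system J h k"
    by (rule coordinate_system_exists)
  have conth: "continuous_map X euclidean (\<lambda>z. h (f z) j)" if "j \<in> J" for j
  proof -
    have "functional (\<lambda>x. h x j)"
      using cs that by (simp add: coordinate_system_def)
    then obtain F c where F: "F \<subseteq> entry_indices"
      "\<And>x. x \<in> carrier KG \<Longrightarrow> h x j = (\<Sum>(\<epsilon>, i, l)\<in>F. c (\<epsilon>, i, l) * \<Phi> \<epsilon> x $$ (i, l))"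
      by (rule functional_entries) (rule that)
    have "continuous_map X euclidean (\<lambda>z. \<Sum>(\<epsilon>, i, l)\<in>F. c (\<epsilon>, i, l) * \<Phi> \<epsilon> (f z) $$ (i, l))"
      unfolding case_prod_unfold
      by (intro continuous_map_euclidean_sum continuous_map_euclidean_mult)
        (use F(1) cont in \<open>auto simp: entry_indices_def\<close>)
    then show ?thesis
      by (rule continuous_map_eq) (simp add: F(2) f)
  qed
  have nbhd: "\<exists>F N. finite F \<and> F \<subseteq> J \<and> (\<forall>j\<in>F. open (N j) \<and> h v j \<in> N j) \<and>
        (\<forall>y\<in>carrier KG. (\<forall>j\<in>F. h y j \<in> N j) \<longrightarrow> y \<in> V)" if "openin T V" "v \<in> V" for V v
    using cs that by (simp add: coordinate_system_def)
  show ?thesis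
    unfolding continuous_map_def
  proof (intro conjI allI impI)
    show "f \<in> topspace X \<rightarrow> topspace T"
      using f by (simp add: topspace_T)
    fix U assume U: "openin T U"
    show "openin X {z \<in> topspace X. f z \<in> U}"
    proof (subst openin_subopen, intro ballI)
      fix z assume "z \<in> {z \<in> topspace X. f z \<in> U}"
      then have z: "z \<in> topspace X" "f z \<in> U"
        by auto
      obtain F N where F: "finite F" "F \<subseteq> J" "\<forall>j\<in>F. open (N j) \<and> h (f z) j \<in> N j"
        "\<forall>y\<in>carrier KG. (\<forall>j\<in>F. h y j \<in> N j) \<longrightarrow> y \<in> U"
        using nbhd[OF U z(2)] by (elim exE conjE) (rule that)
      define V where "V = {z' \<in> topspace X. \<forall>j\<in>F. h (f z') j \<in> N j}"
      have "openin X {z' \<in> topspace X. h (f z') j \<in> N j}" if "j \<in> F" for j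
        using that F by (intro openin_continuous_map_preimage[OF conth]) auto
      then have "openin X (topspace X \<inter> (\<Inter>j\<in>F. {z' \<in> topspace X. h (f z') j \<in> N j}))"
        using F(1) by (cases "F = {}") (auto intro!: openin_Int openin_INT2)
      also have "topspace X \<inter> (\<Inter>j\<in>F. {z' \<in> topspace X. h (f z') j \<in> N j}) = V"
        by (auto simp: V_def)
      finally have "openin X V" .
      moreover have "z \<in> V"
        using z(1) F(3) by (auto simp: V_def)
      moreover have "V \<subseteq> {z \<in> topspace X. f z \<in> U}"
        using F(4) f by (auto simp: V_def)
      ultimately show "\<exists>V. openin X V \<and> z \<in> V \<and> V \<subseteq> {z \<in> topspace X. f z \<in> U}"
        by blast
    qed
  qed
qed

end

section \<open>Simplicity and finite dimension of the blocks\<close>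

section \<open>The blocks\<close>

lemma linear_map_matrix:
  fixes F :: "'k::field vec \<Rightarrow> 'k vec"
  assumes F: "\<And>v. v \<in> carrier_vec n \<Longrightarrow> F v \<in> carrier_vec m"
    and add: "\<And>v w. v \<in> carrier_vec n \<Longrightarrow> w \<in> carrier_vec n \<Longrightarrow> F (v + w) = F v + F w"
    and smult: "\<And>c v. v \<in> carrier_vec n \<Longrightarrow> F (c \<cdot>\<^sub>v v) = c \<cdot>\<^sub>v F v"
  obtains Y where "Y \<in> carrier_mat m n" "\<And>v. v \<in> carrier_vec n \<Longrightarrow> Y *\<^sub>v v = F v"
proof -
  define Y where "Y = mat m n (\<lambda>(p, q). F (unit_vec n q) $ p)"
  have Y: "Y \<in> carrier_mat m n"
    by (simp add: Y_def)
  have "Y *\<^sub>v v = F v" if v: "v \<in> carrier_vec n" for v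
  proof (rule eq_vecI)
    fix p assume "p < dim_vec (F v)"
    then have p: "p < m"
      using F[OF v] by simp
    \<comment> \<open>Additivity handles two vectors at a time, so \<open>v\<close> is built up by
      truncations to its first \<open>k\<close> entries.\<close>
    have part: "F (vec n (\<lambda>i. if i < k then v $ i else 0)) $ p = (\<Sum>q<k. v $ q * F (unit_vec n q) $ p)"
      if "k \<le> n" for k
      using that
    proof (induction k)
      case 0
      have "F (0 \<cdot>\<^sub>v 0\<^sub>v n) $ p = 0"
        using smult[of "0\<^sub>v n" 0] F[of "0\<^sub>v n"] p by simp
      moreover have "vec n (\<lambda>i. if i < 0 then v $ i else 0) = 0 \<cdot>\<^sub>v 0\<^sub>v n"
        by (rule eq_vecI) auto
      ultimately show ?case
        by simp
    next
      case (Suc k)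
      have "vec n (\<lambda>i. if i < Suc k then v $ i else 0)
          = vec n (\<lambda>i. if i < k then v $ i else 0) + v $ k \<cdot>\<^sub>v unit_vec n k"
        using Suc.prems by (intro eq_vecI) (auto simp: less_Suc_eq)
      moreover have "F (unit_vec n k) \<in> carrier_vec m"
        by (rule F) simp
      ultimately show ?case
        using Suc p F[of "v $ k \<cdot>\<^sub>v unit_vec n k"] by (simp add: add smult)
    qed
    have "vec n (\<lambda>i. if i < n then v $ i else 0) = v"
      using v by (intro eq_vecI) auto
    then have "F v $ p = (\<Sum>q<n. v $ q * F (unit_vec n q) $ p)"
      using part[of n] by simp
    then show "(Y *\<^sub>v v) $ p = F v $ p"
      unfolding mult_mat_vec_entry[OF Y v p] using p by (simp add: Y_def mult.commute)
  qed (use Y F[OF v] in auto)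
  with Y show ?thesis
    by (rule that)
qed

lemma zero_mult_mat_vec:
  fixes v :: "'k::comm_ring_1 vec"
  assumes "v \<in> carrier_vec n"
  shows "0\<^sub>m m n *\<^sub>v v = 0\<^sub>v m"
  using assms by (intro eq_vecI) auto

context chosen_representations
begin

definition commutant :: "('g \<Rightarrow> 'k) \<Rightarrow> 'k mat set" where
  "commutant \<epsilon> = {X. intertwines (dimE \<epsilon>) (dimE \<epsilon>) X (\<rho> \<epsilon>) (\<rho> \<epsilon>)}"

lemma commutant_carrier: "X \<in> commutant \<epsilon> \<Longrightarrow> X \<in> carrier_mat (dimE \<epsilon>) (dimE \<epsilon>)"
  and commutant_commutes: "X \<in> commutant \<epsilon> \<Longrightarrow> g \<in> carrier G \<Longrightarrow> X * \<rho> \<epsilon> g = \<rho> \<epsilon> g * X"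
  and block_carrier: "Y \<in> block \<epsilon> \<Longrightarrow> Y \<in> carrier_mat (dimE \<epsilon>) (dimE \<epsilon>)"
  and block_commutes: "Y \<in> block \<epsilon> \<Longrightarrow> X \<in> commutant \<epsilon> \<Longrightarrow> X * Y = Y * X"
  by (auto simp: commutant_def block_def intertwines_def)

lemma \<rho>_carrier: "\<epsilon> \<in> chars \<Longrightarrow> g \<in> carrier G \<Longrightarrow> \<rho> \<epsilon> g \<in> carrier_mat (dimE \<epsilon>) (dimE \<epsilon>)"
  using rep matrix_rep_carrier by blast

text \<open>Translates between the two descriptions of the bicommutant, by matrices and by their
  entries.\<close>

lemma bicommuting_block:
  assumes "y \<in> block \<epsilon>" "\<epsilon> \<in> chars"
  shows "bicommuting {..<dimE \<epsilon>} (\<lambda>g i j. \<rho> \<epsilon> g $$ (i, j)) (\<lambda>i j. y $$ (i, j))"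
  unfolding bicommuting_def
proof (intro allI impI ballI)
  fix q i j
  assume q: "\<forall>g\<in>carrier G. \<forall>i\<in>{..<dimE \<epsilon>}. \<forall>j\<in>{..<dimE \<epsilon>}.
      (\<Sum>k<dimE \<epsilon>. q i k * \<rho> \<epsilon> g $$ (k, j)) = (\<Sum>k<dimE \<epsilon>. \<rho> \<epsilon> g $$ (i, k) * q k j)"
    and ij: "i \<in> {..<dimE \<epsilon>}" "j \<in> {..<dimE \<epsilon>}"
  define X where "X = mat (dimE \<epsilon>) (dimE \<epsilon>) (\<lambda>(i, k). q i k)"
  have X: "X \<in> carrier_mat (dimE \<epsilon>) (dimE \<epsilon>)"
    by (simp add: X_def)
  have "X * \<rho> \<epsilon> g = \<rho> \<epsilon> g * X" if g: "g \<in> carrier G" for g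
  proof (rule eq_matI)
    note \<rho>g = \<rho>_carrier[OF assms(2) g]
    fix i j assume "i < dim_row (\<rho> \<epsilon> g * X)" "j < dim_col (\<rho> \<epsilon> g * X)"
    then have ij: "i < dimE \<epsilon>" "j < dimE \<epsilon>"
      using X \<rho>g by auto
    show "(X * \<rho> \<epsilon> g) $$ (i, j) = (\<rho> \<epsilon> g * X) $$ (i, j)"
      unfolding mult_mat_entry[OF X \<rho>g ij] mult_mat_entry[OF \<rho>g X ij]
      using q g ij by (simp add: X_def)
  qed (use X \<rho>_carrier[OF assms(2) g] in auto)
  then have "X \<in> commutant \<epsilon>"
    using X by (simp add: commutant_def intertwines_def)
  then have "X * y = y * X"
    by (rule block_commutes[OF assms(1)])
  then have "(X * y) $$ (i, j) = (y * X) $$ (i, j)"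
    by simp
  then show "(\<Sum>k<dimE \<epsilon>. q i k * y $$ (k, j)) = (\<Sum>k<dimE \<epsilon>. y $$ (i, k) * q k j)"
    using mult_mat_entry[OF X block_carrier[OF assms(1)], of i j]
      mult_mat_entry[OF block_carrier[OF assms(1)] X, of i j] ij
    by (simp add: X_def)
qed

text \<open>Induction over the terms of a combination of group matrices, for any set closed under
  adding one term. It is used for a two-sided submodule of a block and for the image of a linear
  span.\<close>

lemma combination_in:
  assumes \<epsilon>: "\<epsilon> \<in> chars" and D: "finite D" "D \<subseteq> carrier G"
    and J0: "0\<^sub>m (dimE \<epsilon>) (dimE \<epsilon>) \<in> J"
    and J: "\<And>g c Y. g \<in> D \<Longrightarrow> Y \<in> J \<Longrightarrow> Y \<in> carrier_mat (dimE \<epsilon>) (dimE \<epsilon>) \<Longrightarrow> c \<cdot>\<^sub>m \<rho> \<epsilon> g + Y \<in> J"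
  shows "mat (dimE \<epsilon>) (dimE \<epsilon>) (\<lambda>(p, r). \<Sum>g\<in>D. c g * \<rho> \<epsilon> g $$ (p, r)) \<in> J"
  using D J
proof (induction D rule: finite_induct)
  case empty
  have "mat (dimE \<epsilon>) (dimE \<epsilon>) (\<lambda>(p, r). \<Sum>g\<in>{}. c g * \<rho> \<epsilon> g $$ (p, r)) = 0\<^sub>m (dimE \<epsilon>) (dimE \<epsilon>)"
    by (rule eq_matI) auto
  then show ?case
    by (rule ssubst) (rule J0)
next
  case (insert g D)
  let ?M = "\<lambda>D. mat (dimE \<epsilon>) (dimE \<epsilon>) (\<lambda>(p, r). \<Sum>g\<in>D. c g * \<rho> \<epsilon> g $$ (p, r))"
  have "?M (insert g D) = c g \<cdot>\<^sub>m \<rho> \<epsilon> g + ?M D"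
    using insert.hyps \<rho>_carrier[OF \<epsilon>, of g] insert.prems(1) by (intro eq_matI) auto
  moreover have "?M D \<in> J"
    using insert.prems by (intro insert.IH) auto
  then have "c g \<cdot>\<^sub>m \<rho> \<epsilon> g + ?M D \<in> J"
    by (intro insert.prems(2)) auto
  ultimately show ?case
    by (simp only:)
qed

text \<open>With \<open>e\<close> the image of \<open>1\<close> under an equivariant projection onto \<open>J\<close>, all \<open>y \<in> J\<close> satisfy \<open>y = y e\<close>.
  Hence \<open>(1 - e) v\<close> is annihilated by \<open>J\<close>; but the vectors annihilated by \<open>J\<close> form an invariant
  subspace.\<close>

lemma block_simple:
  assumes \<epsilon>: "\<epsilon> \<in> chars" and J: "J \<subseteq> block \<epsilon>" and nz: "Y0 \<in> J" "Y0 \<noteq> 0\<^sub>m (dimE \<epsilon>) (dimE \<epsilon>)"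
    and add: "\<And>Y Z. Y \<in> J \<Longrightarrow> Z \<in> J \<Longrightarrow> Y + Z \<in> J" and smult: "\<And>c Y. Y \<in> J \<Longrightarrow> c \<cdot>\<^sub>m Y \<in> J"
    and left: "\<And>g Y. g \<in> carrier G \<Longrightarrow> Y \<in> J \<Longrightarrow> \<rho> \<epsilon> g * Y \<in> J"
    and right: "\<And>g Y. g \<in> carrier G \<Longrightarrow> Y \<in> J \<Longrightarrow> Y * \<rho> \<epsilon> g \<in> J"
  shows "J = block \<epsilon>"
proof -
  define n where "n = dimE \<epsilon>"
  define a where "a = (\<lambda>g i j. \<rho> \<epsilon> g $$ (i, j))"
  define fn :: "'k mat \<Rightarrow> nat \<times> nat \<Rightarrow> 'k" where "fn Y = mat_fun {..<n} (\<lambda>i j. Y $$ (i, j))" for Y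
  have car: "Y \<in> carrier_mat n n" if "Y \<in> J" for Y
    using J that block_carrier by (auto simp: n_def)
  have \<rho>car: "\<rho> \<epsilon> g \<in> carrier_mat n n" if "g \<in> carrier G" for g
    using \<rho>_carrier[OF \<epsilon> that] by (simp add: n_def)
  have act: "linear_action {..<n} a"
    unfolding a_def n_def by (rule linear_action_matrix_rep[OF rep[OF \<epsilon>]])
  have "0 \<cdot>\<^sub>m Y0 = 0\<^sub>m n n"
    using car[OF nz(1)] by (intro eq_matI) auto
  then have J0: "0\<^sub>m n n \<in> J"
    using smult[OF nz(1), of 0] by simp
  have fn_zero: "fn (0\<^sub>m n n) = 0"
    by (auto simp: fn_def mat_fun_def fun_eq_iff)
  have fn_add: "fn (Y + Z) = fn Y + fn Z" if "Y \<in> J" "Z \<in> J" for Y Z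
    using car[OF that(1)] car[OF that(2)] by (auto simp: fn_def mat_fun_def fun_eq_iff)
  have fn_smult: "fn (c \<cdot>\<^sub>m Y) = (\<lambda>p. c * fn Y p)" if "Y \<in> J" for c Y
    using car[OF that] by (auto simp: fn_def mat_fun_def fun_eq_iff)
  have sub: "fun_vs.subspace (fn ` J)"
    unfolding fun_vs.subspace_def
  proof (intro conjI ballI allI)
    show "0 \<in> fn ` J"
      using J0 fn_zero by (metis image_eqI)
  next
    fix x y assume "x \<in> fn ` J" "y \<in> fn ` J"
    then obtain Y Z where YZ: "Y \<in> J" "Z \<in> J" "x = fn Y" "y = fn Z"
      by blast
    show "x + y \<in> fn ` J"
      by (rule image_eqI[OF _ add[OF YZ(1,2)]]) (simp add: YZ fn_add)
  next
    fix c x assume "x \<in> fn ` J"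
    then obtain Y where Y: "Y \<in> J" "x = fn Y"
      by blast
    show "(\<lambda>p. c * x p) \<in> fn ` J"
      by (rule image_eqI[OF _ smult[OF Y(1), of c]]) (simp add: Y fn_smult)
  qed
  have supp: "fn ` J \<subseteq> {f. \<forall>p. p \<notin> {..<n} \<times> {..<n} \<longrightarrow> f p = 0}"
    by (auto simp: fn_def mat_fun_def)
  have inv: "mat_fun {..<n} (\<lambda>i j. \<Sum>k<n. a g i k * f (k, j)) \<in> fn ` J"
    if f: "f \<in> fn ` J" and g: "g \<in> carrier G" for f g
  proof -
    obtain Y where Y: "Y \<in> J" "f = fn Y"
      using f by blast
    have "mat_fun {..<n} (\<lambda>i j. \<Sum>k<n. a g i k * f (k, j)) = fn (\<rho> \<epsilon> g * Y)"
      using mult_mat_entry[OF \<rho>car[OF g] car[OF Y(1)]]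
      by (auto simp: fn_def mat_fun_def fun_eq_iff a_def Y(2))
    then show ?thesis
      using left[OF g Y(1)] by simp
  qed
  obtain P where P: "\<And>f. app ({..<n} \<times> {..<n}) P f \<in> fn ` J"
      "\<And>f. f \<in> fn ` J \<Longrightarrow> app ({..<n} \<times> {..<n}) P f = f"
    and Py: "\<And>y i b. bicommuting {..<n} a y \<Longrightarrow> i \<in> {..<n} \<Longrightarrow> b \<in> {..<n} \<Longrightarrow>
      app ({..<n} \<times> {..<n}) P (mat_fun {..<n} y) (i, b) =
      (\<Sum>k\<in>{..<n}. y i k * app ({..<n} \<times> {..<n}) P (mat_fun {..<n} (a \<one>)) (k, b))"
    by (rule submodule_projection[OF act sub supp]) (use inv in auto)
  obtain e where e: "e \<in> J" "app ({..<n} \<times> {..<n}) P (mat_fun {..<n} (a \<one>)) = fn e"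
    using P(1)[of "mat_fun {..<n} (a \<one>)"] by blast
  \<comment> \<open>The projection fixes \<open>fn y\<close> because \<open>y\<close> is in
    \<open>J\<close>, and it computes it as \<open>y * e\<close> because \<open>y\<close> is in the
    bicommutant.\<close>
  have ye: "y * e = y" if y: "y \<in> J" for y
  proof (rule eq_matI)
    fix i b assume "i < dim_row y" "b < dim_col y"
    then have ib: "i < n" "b < n"
      using car[OF y] by auto
    have bic: "bicommuting {..<n} a (\<lambda>i j. y $$ (i, j))"
      unfolding a_def n_def using bicommuting_block y J \<epsilon> by blast
    have "y $$ (i, b) = fn y (i, b)"
      using ib by (simp add: fn_def mat_fun_def)
    also have "\<dots> = app ({..<n} \<times> {..<n}) P (mat_fun {..<n} (\<lambda>i j. y $$ (i, j))) (i, b)"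
      using P(2)[of "fn y"] y by (simp add: fn_def)
    also have "\<dots> = (\<Sum>k\<in>{..<n}. y $$ (i, k) * fn e (k, b))"
      using Py[OF bic] ib by (simp add: e(2))
    also have "\<dots> = (y * e) $$ (i, b)"
      unfolding mult_mat_entry[OF car[OF y] car[OF e(1)] ib]
      using ib by (simp add: fn_def mat_fun_def)
    finally show "(y * e) $$ (i, b) = y $$ (i, b)" ..
  qed (use car[OF y] car[OF e(1)] in auto)
  define N where "N = {v \<in> carrier_vec n. \<forall>Y\<in>J. Y *\<^sub>v v = 0\<^sub>v n}"
  have "N = {0\<^sub>v n} \<or> N = carrier_vec n"
  proof (rule irreducible_invariant_subspace[of n "\<rho> \<epsilon>"])
    show "irreducible_representation G TG n (\<rho> \<epsilon>)"
      using irr[OF \<epsilon>] by (simp add: n_def)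
    have "Y *\<^sub>v 0\<^sub>v n = 0\<^sub>v n" if "Y \<in> J" for Y
      using car[OF that] by auto
    then show "0\<^sub>v n \<in> N"
      by (simp add: N_def)
    show "v + w \<in> N" if "v \<in> N" "w \<in> N" for v w
      using that car by (auto simp: N_def mult_add_distrib_mat_vec[of _ n n])
    show "c \<cdot>\<^sub>v v \<in> N" if "v \<in> N" for c v
      using that car by (auto simp: N_def mult_mat_vec[of _ n n])
    show "\<rho> \<epsilon> g *\<^sub>v v \<in> N" if g: "g \<in> carrier G" and v: "v \<in> N" for g v
    proof -
      have "Y *\<^sub>v (\<rho> \<epsilon> g *\<^sub>v v) = 0\<^sub>v n" if "Y \<in> J" for Y
        using assoc_mult_mat_vec[OF car[OF that] \<rho>car[OF g], of v] right[OF g that] v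
        by (auto simp: N_def)
      moreover have "\<rho> \<epsilon> g *\<^sub>v v \<in> carrier_vec n"
        using mult_mat_vec_carrier[OF \<rho>car[OF g]] v by (simp add: N_def)
      ultimately show ?thesis
        by (simp add: N_def)
    qed
  qed (auto simp: N_def)
  moreover have "N \<noteq> carrier_vec n"
  proof
    assume N: "N = carrier_vec n"
    have "Y0 = 0\<^sub>m n n"
    proof (rule mat_eq_mult_vecI[OF car[OF nz(1)] zero_carrier_mat])
      fix v :: "'k vec" assume v: "v \<in> carrier_vec n"
      then have "Y0 *\<^sub>v v = 0\<^sub>v n"
        using nz(1) unfolding N[symmetric] by (simp add: N_def)
      then show "Y0 *\<^sub>v v = 0\<^sub>m n n *\<^sub>v v"
        using zero_mult_mat_vec[OF v] by simp
    qed
    then show False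
      using nz(2) by (simp add: n_def)
  qed
  ultimately have N: "N = {0\<^sub>v n}"
    by blast
  have "e = 1\<^sub>m n"
  proof (rule mat_eq_mult_vecI[OF car[OF e(1)] one_carrier_mat])
    fix v :: "'k vec" assume v: "v \<in> carrier_vec n"
    have ev: "e *\<^sub>v v \<in> carrier_vec n"
      using car[OF e(1)] v by (rule mult_mat_vec_carrier)
    have "Y *\<^sub>v (v - e *\<^sub>v v) = 0\<^sub>v n" if Y: "Y \<in> J" for Y
    proof -
      have "Y *\<^sub>v (v - e *\<^sub>v v) = Y *\<^sub>v v - Y *\<^sub>v (e *\<^sub>v v)"
        by (rule mult_minus_distrib_mat_vec[OF car[OF Y] v ev])
      also have "Y *\<^sub>v (e *\<^sub>v v) = Y *\<^sub>v v"
        using assoc_mult_mat_vec[OF car[OF Y] car[OF e(1)] v] ye[OF Y] by simp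
      finally show ?thesis
        using mult_mat_vec_carrier[OF car[OF Y] v] by simp
    qed
    then have "v - e *\<^sub>v v \<in> N"
      using v ev by (simp add: N_def)
    then have "v - e *\<^sub>v v = 0\<^sub>v n"
      using N by simp
    then have "e *\<^sub>v v = v"
      using v ev by (intro eq_vecI) (auto simp: vec_eq_iff)
    then show "e *\<^sub>v v = 1\<^sub>m n *\<^sub>v v"
      using v by simp
  qed
  \<comment> \<open>Once the identity is in \<open>J\<close>, so are all group matrices, and these
    span the block.\<close>
  then have one: "1\<^sub>m n \<in> J"
    using e(1) by simp
  have \<rho>J: "\<rho> \<epsilon> g \<in> J" if "g \<in> carrier G" for g
    using left[OF that one] \<rho>car[OF that] by simp
  have "y \<in> J" if y: "y \<in> block \<epsilon>" for y
  proof -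
    obtain D c where D: "finite D" "D \<subseteq> carrier G" and yD: "\<And>\<epsilon>' p r. \<epsilon>' \<in> {\<epsilon>} \<Longrightarrow> p < dimE \<epsilon>' \<Longrightarrow> r < dimE \<epsilon>' \<Longrightarrow>
        y $$ (p, r) = (\<Sum>g\<in>D. c g * \<rho> \<epsilon>' g $$ (p, r))"
      by (rule block_span[of "{\<epsilon>}" "\<lambda>_. y"]) (use y \<epsilon> in \<open>auto intro: that\<close>)
    have "y = mat (dimE \<epsilon>) (dimE \<epsilon>) (\<lambda>(p, r). \<Sum>g\<in>D. c g * \<rho> \<epsilon> g $$ (p, r))"
      using block_carrier[OF y] yD by (intro eq_matI) auto
    also have "\<dots> \<in> J"
      using J0 \<rho>J D by (intro combination_in[OF \<epsilon>] add smult) (auto simp: n_def)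
    finally show ?thesis .
  qed
  then show ?thesis
    using J by blast
qed

text \<open>In contrast to \<open>block_span\<close>, one set \<open>D\<close> serves all
  \<open>y\<close>: it indexes a maximal independent set of group matrices.\<close>

lemma block_finite_span:
  assumes \<epsilon>: "\<epsilon> \<in> chars"
  obtains D where "finite D" "D \<subseteq> carrier G"
    "\<And>y. y \<in> block \<epsilon> \<Longrightarrow> \<exists>c. y = mat (dimE \<epsilon>) (dimE \<epsilon>) (\<lambda>(p, r). \<Sum>g\<in>D. c g * \<rho> \<epsilon> g $$ (p, r))"
proof -
  define n where "n = dimE \<epsilon>"
  define A where "A g = mat_fun {..<n} (\<lambda>i j. \<rho> \<epsilon> g $$ (i, j))" for g
  obtain B where B: "B \<subseteq> A ` carrier G" "fun_vs.independent B" "A ` carrier G \<subseteq> fun_vs.span B"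
    using fun_vs.maximal_independent_subset by blast
  have fin: "finite B"
    using B(1) by (intro independent_finite_support[OF _ B(2), of "{..<n} \<times> {..<n}"])
      (auto simp: A_def mat_fun_def)
  obtain D where D: "D \<subseteq> carrier G" "inj_on A D" "B = A ` D"
    using B(1) subset_image_inj by metis
  have "\<exists>c. y = mat (dimE \<epsilon>) (dimE \<epsilon>) (\<lambda>(p, r). \<Sum>g\<in>D. c g * \<rho> \<epsilon> g $$ (p, r))" if y: "y \<in> block \<epsilon>" for y
  proof -
    obtain D' c where D': "finite D'" "D' \<subseteq> carrier G" and yD: "\<And>\<epsilon>' p r. \<epsilon>' \<in> {\<epsilon>} \<Longrightarrow> p < dimE \<epsilon>' \<Longrightarrow> r < dimE \<epsilon>' \<Longrightarrow>
        y $$ (p, r) = (\<Sum>g\<in>D'. c g * \<rho> \<epsilon>' g $$ (p, r))"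
      by (rule block_span[of "{\<epsilon>}" "\<lambda>_. y"]) (use y \<epsilon> in \<open>auto intro: that\<close>)
    define f where "f = (\<Sum>g\<in>D'. (\<lambda>x. c g * A g x))"
    have "f \<in> fun_vs.span B"
      unfolding f_def using D'(2) B(3) by (intro fun_vs.span_sum fun_vs.span_scale) blast
    then obtain u where u: "f = (\<Sum>v\<in>B. (\<lambda>x. u v * v x))"
      using fun_vs.span_finite[OF fin] by auto
    have "y $$ (p, r) = (\<Sum>g\<in>D. u (A g) * \<rho> \<epsilon> g $$ (p, r))" if "p < n" "r < n" for p r
    proof -
      have "y $$ (p, r) = f (p, r)"
        using yD[of \<epsilon> p r] that by (simp add: f_def sum_fun_apply A_def mat_fun_def n_def)
      also have "\<dots> = (\<Sum>g\<in>D. u (A g) * A g (p, r))"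
        by (simp add: u sum_fun_apply D(3) sum.reindex[OF D(2)])
      finally show ?thesis
        using that by (simp add: A_def mat_fun_def)
    qed
    then have "y = mat (dimE \<epsilon>) (dimE \<epsilon>) (\<lambda>(p, r). \<Sum>g\<in>D. u (A g) * \<rho> \<epsilon> g $$ (p, r))"
      using block_carrier[OF y] by (intro eq_matI) (auto simp: n_def)
    then show ?thesis
      by (rule exI[of _ "\<lambda>g. u (A g)"])
  qed
  moreover have "finite D"
    using fin D(2,3) finite_imageD by blast
  ultimately show ?thesis
    using that D(1) by blast
qed

end

section \<open>Anti-automorphisms of the commutant\<close>

section \<open>The commutants and their opposites\<close>

text \<open>The fundamental theorem of algebra, carried along the field isomorphism
  \<open>h\<close>: the coefficients are pulled back by its inverse, and the root is pushed
  forward.\<close>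

lemma root_exists_of_complex:
  fixes h :: "complex \<Rightarrow> 'k::field" and p :: "'k poly"
  assumes h: "bij h" "\<And>x y. h (x + y) = h x + h y" "\<And>x y. h (x * y) = h x * h y" "h 1 = 1"
    and deg: "degree p > 0"
  shows "\<exists>x. poly p x = 0"
proof -
  define h' where "h' = inv_into UNIV h"
  have hh': "h (h' x) = x" for x
    using h(1) by (simp add: h'_def bij_is_surj surj_f_inv_f)
  have h0: "h 0 = 0"
    using h(2)[of 0 0] by (metis add.right_neutral add_cancel_right_right)
  have inj: "inj h"
    using h(1) by (rule bij_is_inj)
  have h'0: "h' x = 0 \<longleftrightarrow> x = 0" for x
    using hh'[of x] h0 inj by (metis injD)
  define q where "q = map_poly h' p"
  have cq: "coeff q i = h' (coeff p i)" for i
    unfolding q_def by (rule coeff_map_poly) (simp add: h'0)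
  have "degree q = degree p"
    unfolding q_def by (rule degree_map_poly) (simp add: h'0)
  then have "\<not> constant (poly q)"
    using deg by (simp add: constant_degree)
  then obtain z where z: "poly q z = 0"
    using fundamental_theorem_of_algebra by blast
  have hpow: "h (x ^ i) = h x ^ i" for x i
    by (induction i) (auto simp: h)
  have hsum: "h (\<Sum>i\<le>d. f i) = (\<Sum>i\<le>d. h (f i))" for f and d :: nat
    by (induction d) (auto simp: h)
  have "h (poly q z) = poly p (h z)"
    unfolding poly_altdef \<open>degree q = degree p\<close> by (simp add: hsum h(3) hpow cq hh')
  then show ?thesis
    using z h0 by auto
qed

context chosen_representations
begin

lemma commutant_add: "X \<in> commutant \<epsilon> \<Longrightarrow> Y \<in> commutant \<epsilon> \<Longrightarrow> \<epsilon> \<in> chars \<Longrightarrow> X + Y \<in> commutant \<epsilon>"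
  and commutant_smult: "X \<in> commutant \<epsilon> \<Longrightarrow> \<epsilon> \<in> chars \<Longrightarrow> c \<cdot>\<^sub>m X \<in> commutant \<epsilon>"
  and commutant_mult: "X \<in> commutant \<epsilon> \<Longrightarrow> Y \<in> commutant \<epsilon> \<Longrightarrow> \<epsilon> \<in> chars \<Longrightarrow> X * Y \<in> commutant \<epsilon>"
  and commutant_one: "\<epsilon> \<in> chars \<Longrightarrow> 1\<^sub>m (dimE \<epsilon>) \<in> commutant \<epsilon>"
  and commutant_zero: "\<epsilon> \<in> chars \<Longrightarrow> 0\<^sub>m (dimE \<epsilon>) (dimE \<epsilon>) \<in> commutant \<epsilon>"
proof -
  let ?n = "dimE \<epsilon>"
  assume \<epsilon>: "\<epsilon> \<in> chars"
  note \<rho>c = \<rho>_carrier[OF \<epsilon>]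
  show "1\<^sub>m ?n \<in> commutant \<epsilon>" "0\<^sub>m ?n ?n \<in> commutant \<epsilon>"
    using left_mult_one_mat[OF \<rho>c] right_mult_one_mat[OF \<rho>c] left_mult_zero_mat[OF \<rho>c] right_mult_zero_mat[OF \<rho>c]
    by (auto simp: commutant_def intertwines_def)
  assume X: "X \<in> commutant \<epsilon>"
  note Xc = commutant_carrier[OF X]
  show "c \<cdot>\<^sub>m X \<in> commutant \<epsilon>"
    using Xc commutant_commutes[OF X] mult_smult_assoc_mat[OF Xc \<rho>c] mult_smult_distrib[OF \<rho>c Xc]
    by (auto simp: commutant_def intertwines_def)
  assume Y: "Y \<in> commutant \<epsilon>"
  note Yc = commutant_carrier[OF Y]
  show "X + Y \<in> commutant \<epsilon>"
    using Xc Yc commutant_commutes[OF X] commutant_commutes[OF Y] add_mult_distrib_mat[OF Xc Yc \<rho>c]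
      mult_add_distrib_mat[OF \<rho>c Xc Yc]
    by (auto simp: commutant_def intertwines_def)
  have "X * Y * \<rho> \<epsilon> g = \<rho> \<epsilon> g * (X * Y)" if g: "g \<in> carrier G" for g
  proof -
    have "X * Y * \<rho> \<epsilon> g = X * (\<rho> \<epsilon> g * Y)"
      using assoc_mult_mat[OF Xc Yc \<rho>c[OF g]] commutant_commutes[OF Y g] by simp
    also have "\<dots> = X * \<rho> \<epsilon> g * Y"
      by (rule assoc_mult_mat[OF Xc \<rho>c[OF g] Yc, symmetric])
    also have "\<dots> = \<rho> \<epsilon> g * X * Y"
      using commutant_commutes[OF X g] by simp
    also have "\<dots> = \<rho> \<epsilon> g * (X * Y)"
      by (rule assoc_mult_mat[OF \<rho>c[OF g] Xc Yc])
    finally show ?thesis .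
  qed
  then show "X * Y \<in> commutant \<epsilon>"
    using Xc Yc by (auto simp: commutant_def intertwines_def)
qed

text \<open>By Schur's lemma the commutant is a division ring.\<close>

lemma commutant_inverse:
  assumes "X \<in> commutant \<epsilon>" "\<epsilon> \<in> chars" "X \<noteq> 0\<^sub>m (dimE \<epsilon>) (dimE \<epsilon>)"
  obtains Y where "Y \<in> commutant \<epsilon>" "X * Y = 1\<^sub>m (dimE \<epsilon>)" "Y * X = 1\<^sub>m (dimE \<epsilon>)"
  using schur[OF irr[OF assms(2)] irr[OF assms(2)] _ assms(3)] assms(1)
  unfolding commutant_def by blast

definition opposite_iso :: "('g \<Rightarrow> 'k) \<Rightarrow> ('k mat \<Rightarrow> 'k mat) \<Rightarrow> bool" where
  "opposite_iso \<epsilon> \<tau> \<longleftrightarrow> bij_betw \<tau> (commutant \<epsilon>) (commutant \<epsilon>) \<and> \<tau> (1\<^sub>m (dimE \<epsilon>)) = 1\<^sub>m (dimE \<epsilon>) \<and>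
     (\<forall>X\<in>commutant \<epsilon>. \<forall>Y\<in>commutant \<epsilon>. \<tau> (X + Y) = \<tau> X + \<tau> Y \<and> \<tau> (X * Y) = \<tau> Y * \<tau> X) \<and>
     (\<forall>c. \<forall>X\<in>commutant \<epsilon>. \<tau> (c \<cdot>\<^sub>m X) = c \<cdot>\<^sub>m \<tau> X)"

text \<open>Over an algebraically closed field the commutant consists of scalars: subtracting an
  eigenvalue leaves an element with nontrivial kernel, which Schur's lemma makes zero. In a
  commutative algebra the identity map reverses products.\<close>

lemma opposite_iso_complex:
  fixes h :: "complex \<Rightarrow> 'k"
  assumes \<epsilon>: "\<epsilon> \<in> chars"
    and h: "bij h" "\<And>x y. h (x + y) = h x + h y" "\<And>x y. h (x * y) = h x * h y" "h 1 = 1"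
  shows "opposite_iso \<epsilon> (\<lambda>X. X)"
proof -
  let ?n = "dimE \<epsilon>"
  have scalar: "\<exists>c. X = c \<cdot>\<^sub>m 1\<^sub>m ?n" if X: "X \<in> commutant \<epsilon>" for X
  proof -
    note Xc = commutant_carrier[OF X]
    have "degree (char_poly X) > 0"
      using degree_monic_char_poly[OF Xc] irreducible_pos[OF irr[OF \<epsilon>]] by simp
    then obtain c where "poly (char_poly X) c = 0"
      using root_exists_of_complex[OF h] by blast
    then obtain v where v: "v \<in> carrier_vec ?n" "v \<noteq> 0\<^sub>v ?n" "X *\<^sub>v v = c \<cdot>\<^sub>v v"
      using eigenvalue_root_char_poly[OF Xc, of c] Xc by (auto simp: eigenvalue_def eigenvector_def)
    define q where "q = X + (- c) \<cdot>\<^sub>m 1\<^sub>m ?n"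
    have q: "q \<in> commutant \<epsilon>"
      unfolding q_def by (intro commutant_add commutant_smult commutant_one X \<epsilon>)
    have "((- c) \<cdot>\<^sub>m 1\<^sub>m ?n) *\<^sub>v v = (- c) \<cdot>\<^sub>v v"
    proof (rule eq_vecI)
      fix i assume "i < dim_vec ((- c) \<cdot>\<^sub>v v)"
      then have i: "i < ?n"
        using v(1) by simp
      have "(((- c) \<cdot>\<^sub>m 1\<^sub>m ?n) *\<^sub>v v) $ i = (\<Sum>k<?n. if k = i then - c * v $ k else 0)"
        unfolding mult_mat_vec_entry[OF smult_carrier_mat[OF one_carrier_mat] v(1) i]
        using i by (intro sum.cong) auto
      then show "(((- c) \<cdot>\<^sub>m 1\<^sub>m ?n) *\<^sub>v v) $ i = ((- c) \<cdot>\<^sub>v v) $ i"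
        using i v(1) by simp
    qed (use v(1) in auto)
    then have "q *\<^sub>v v = c \<cdot>\<^sub>v v + (- c) \<cdot>\<^sub>v v"
      unfolding q_def using add_mult_distrib_mat_vec[OF Xc _ v(1), of "(- c) \<cdot>\<^sub>m 1\<^sub>m ?n"] v(3) by simp
    also have "\<dots> = 0\<^sub>v ?n"
      using v(1) by (intro eq_vecI) auto
    finally have qv: "q *\<^sub>v v = 0\<^sub>v ?n" .
    have q0: "q = 0\<^sub>m ?n ?n"
    proof (rule ccontr)
      assume "q \<noteq> 0\<^sub>m ?n ?n"
      then obtain Y where Y: "Y \<in> commutant \<epsilon>" "Y * q = 1\<^sub>m ?n"
        using commutant_inverse[OF q \<epsilon>] by blast
      have "v = Y *\<^sub>v (q *\<^sub>v v)"
        using assoc_mult_mat_vec[OF commutant_carrier[OF Y(1)] commutant_carrier[OF q] v(1)] Y(2) v(1) by simp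
      also have "\<dots> = 0\<^sub>v ?n"
        unfolding qv using commutant_carrier[OF Y(1)] by auto
      finally show False
        using v(2) by simp
    qed
    have "X $$ (i, j) = (c \<cdot>\<^sub>m 1\<^sub>m ?n) $$ (i, j)" if "i < ?n" "j < ?n" for i j
    proof -
      have "q $$ (i, j) = X $$ (i, j) - (c \<cdot>\<^sub>m 1\<^sub>m ?n) $$ (i, j)"
        using that Xc by (simp add: q_def)
      then show ?thesis
        using that q0 by simp
    qed
    then have "X = c \<cdot>\<^sub>m 1\<^sub>m ?n"
      using Xc by (intro eq_matI) auto
    then show ?thesis ..
  qed
  have "X * Y = Y * X" if X: "X \<in> commutant \<epsilon>" and Y: "Y \<in> commutant \<epsilon>" for X Y
  proof -
    obtain c where c: "X = c \<cdot>\<^sub>m 1\<^sub>m ?n"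
      using scalar[OF X] by blast
    show ?thesis
      unfolding c using commutant_carrier[OF Y]
      by (simp add: mult_smult_assoc_mat[of _ ?n ?n _ ?n] mult_smult_distrib[of _ ?n ?n _ ?n])
  qed
  then show ?thesis
    by (auto simp: opposite_iso_def bij_betw_def)
qed

text \<open>An invariant bilinear form, as a fixed point in the convex set of all bilinear forms that are
  at least \<open>1\<close> on the orbit of a vector (on the diagonal).\<close>

lemma invariant_form_exists:
  assumes \<epsilon>: "\<epsilon> \<in> chars" and real: "\<And>x::'k. \<exists>a. x = of_real a"
  obtains S where "S \<in> carrier_mat (dimE \<epsilon>) (dimE \<epsilon>)" "S \<noteq> 0\<^sub>m (dimE \<epsilon>) (dimE \<epsilon>)"
    "\<And>g. g \<in> carrier G \<Longrightarrow> S * \<rho> \<epsilon> g = (\<rho> \<epsilon> (inv g))\<^sup>T * S"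
proof -
  define n where "n = dimE \<epsilon>"
  define r where "r g i j = \<rho> \<epsilon> g $$ (i, j)" for g i j
  have n: "n > 0"
    using irreducible_pos[OF irr[OF \<epsilon>]] by (simp add: n_def)
  have la: "linear_action {..<n} r"
    unfolding r_def n_def by (rule linear_action_matrix_rep[OF rep[OF \<epsilon>]])
  have r_mult: "r (g \<otimes> h) i j = (\<Sum>k<n. r g i k * r h k j)"
    if "g \<in> carrier G" "h \<in> carrier G" "i < n" "j < n" for g h i j
    using la that by (simp add: linear_action_def)
  have r_one: "r \<one> i j = (if i = j then 1 else 0)" if "i < n" "j < n" for i j
    using la that by (simp add: linear_action_def)
  \<comment> \<open>\<open>w g\<close> is the image under \<open>g\<close> of the first unit vector,
    which exists because \<open>n > 0\<close>.\<close>
  define w where "w g p = r g p 0" for g p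
  \<comment> \<open>The action on bilinear forms: the inverse of \<open>g\<close> is applied to both
    arguments.\<close>
  define c where "c = (\<lambda>g (i, j) (k, l). r (inv g) k i * r (inv g) l j)"
  let ?S = "{..<n} \<times> {..<n}"
  have act: "linear_action ?S c"
    unfolding linear_action_def
  proof (intro conjI ballI)
    fix g h z z' assume g: "g \<in> carrier G" "h \<in> carrier G" and zz: "z \<in> ?S" "z' \<in> ?S"
    obtain i j k l where z: "z = (i, j)" "z' = (k, l)"
      by (metis surj_pair)
    have ij: "i < n" "j < n" "k < n" "l < n"
      using zz by (auto simp: z)
    have "c (g \<otimes> h) z z' = (\<Sum>p<n. r (inv h) k p * r (inv g) p i) * (\<Sum>q<n. r (inv h) l q * r (inv g) q j)"
      using g ij by (simp add: c_def z inv_mult_group r_mult)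
    also have "\<dots> = (\<Sum>(p, q)\<in>?S. (r (inv h) k p * r (inv g) p i) * (r (inv h) l q * r (inv g) q j))"
      by (simp add: sum_product sum.cartesian_product)
    also have "\<dots> = (\<Sum>x\<in>?S. c g z x * c h x z')"
      by (intro sum.cong) (auto simp: c_def z mult_ac)
    finally show "c (g \<otimes> h) z z' = (\<Sum>x\<in>?S. c g z x * c h x z')" .
  next
    fix z z' assume "z \<in> ?S" "z' \<in> ?S"
    then show "c \<one> z z' = (if z = z' then 1 else 0)"
      by (auto simp: c_def r_one split: if_splits)
  next
    fix z z' assume "z \<in> ?S" "z' \<in> ?S"
    then show "continuous_map TG euclidean (\<lambda>g. c g z z')"
      using continuous_entry_inv[OF la]
      by (auto simp: c_def case_prod_unfold intro!: continuous_map_euclidean_mult)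
  qed auto
  define Q where "Q f v = (\<Sum>(p, q)\<in>?S. f (p, q) * v p * v q)" for f :: "nat \<times> nat \<Rightarrow> 'k" and v
  \<comment> \<open>Unlike mere positivity, the lower bound 1 survives limits, and it still excludes
    the zero form.\<close>
  define C where "C = {f. \<forall>g\<in>carrier G. \<exists>a\<ge>1. Q f (w g) = of_real a}"
  have Qc: "Q (\<lambda>z. \<Sum>z'\<in>?S. c g z z' * f z') v = Q f (\<lambda>k. \<Sum>i<n. r (inv g) k i * v i)" for g f v
  proof -
    have "Q (\<lambda>z. \<Sum>z'\<in>?S. c g z z' * f z') v = (\<Sum>z\<in>?S. \<Sum>z'\<in>?S. c g z z' * f z' * v (fst z) * v (snd z))"
      by (simp add: Q_def case_prod_unfold sum_distrib_right)
    also have "\<dots> = (\<Sum>z'\<in>?S. \<Sum>z\<in>?S. c g z z' * f z' * v (fst z) * v (snd z))"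
      by (rule sum.swap)
    also have "\<dots> = (\<Sum>z'\<in>?S. f z' * ((\<Sum>i<n. r (inv g) (fst z') i * v i) * (\<Sum>j<n. r (inv g) (snd z') j * v j)))"
    proof (rule sum.cong[OF refl])
      fix z' :: "nat \<times> nat"
      have "(\<Sum>z\<in>?S. c g z z' * f z' * v (fst z) * v (snd z))
          = (\<Sum>(i, j)\<in>?S. f z' * ((r (inv g) (fst z') i * v i) * (r (inv g) (snd z') j * v j)))"
      proof (rule sum.cong[OF refl])
        fix z :: "nat \<times> nat"
        obtain i j k l where z: "z = (i, j)" "z' = (k, l)"
          by (metis surj_pair)
        show "c g z z' * f z' * v (fst z) * v (snd z)
          = (case z of (i, j) \<Rightarrow> f z' * ((r (inv g) (fst z') i * v i) * (r (inv g) (snd z') j * v j)))"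
          unfolding z c_def by (simp only: case_prod_conv fst_conv snd_conv mult_ac)
      qed
      also have "\<dots> = f z' * (\<Sum>(i, j)\<in>?S. (r (inv g) (fst z') i * v i) * (r (inv g) (snd z') j * v j))"
        by (simp only: case_prod_unfold sum_distrib_left)
      also have "\<dots> = f z' * ((\<Sum>i<n. r (inv g) (fst z') i * v i) * (\<Sum>j<n. r (inv g) (snd z') j * v j))"
        by (simp only: sum_product sum.cartesian_product)
      finally show "(\<Sum>z\<in>?S. c g z z' * f z' * v (fst z) * v (snd z))
          = f z' * ((\<Sum>i<n. r (inv g) (fst z') i * v i) * (\<Sum>j<n. r (inv g) (snd z') j * v j))" .
    qed
    finally show ?thesis
      by (simp add: Q_def case_prod_unfold mult.assoc)
  qed
  have w_mult: "(\<Sum>i<n. r g k i * w h i) = w (g \<otimes> h) k" if "g \<in> carrier G" "h \<in> carrier G" "k < n" for g h k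
    using that n by (simp add: w_def r_mult)
  obtain B where B: "B > 0" "\<And>g i j. g \<in> carrier G \<Longrightarrow> i \<in> {..<n} \<Longrightarrow> j \<in> {..<n} \<Longrightarrow> norm (r g i j) \<le> B"
    by (rule linear_action_bounded[OF la]) (rule that)
  obtain f where f: "f \<in> C" "\<And>g z. g \<in> carrier G \<Longrightarrow> z \<in> ?S \<Longrightarrow> (\<Sum>z'\<in>?S. c g z z' * f z') = f z"
  proof (rule linear_action_fixed_point[OF act, of C])
    \<comment> \<open>A multiple of the standard form lies in \<open>C\<close>. With
      \<open>R\<close> the squared length of \<open>w g\<close>, the inverse of \<open>g\<close>
      recovers the first unit vector, so \<open>1 \<le> B * n * sqrt R\<close>; this is where the
      factor \<open>(B * n)\<^sup>2\<close> comes from.\<close>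
    have "\<exists>a\<ge>1. Q (\<lambda>(p, q). if p = q then of_real ((B * real n)\<^sup>2) else 0) (w g) = of_real a"
      if g: "g \<in> carrier G" for g
    proof -
      have sq: "x * x = of_real ((norm x)\<^sup>2)" for x :: 'k
      proof -
        obtain a where "x = of_real a"
          using real by blast
        then show ?thesis
          by (simp add: power2_eq_square)
      qed
      have "Q (\<lambda>(p, q). if p = q then of_real ((B * real n)\<^sup>2) else 0) (w g)
          = (\<Sum>p<n. \<Sum>q<n. if q = p then of_real ((B * real n)\<^sup>2) * (w g p * w g p) else 0)"
        unfolding Q_def sum.cartesian_product by (rule sum.cong) (auto simp: mult.assoc)
      also have "\<dots> = (\<Sum>p<n. of_real ((B * real n)\<^sup>2) * (w g p * w g p))"
        by simp
      also have "\<dots> = of_real ((B * real n)\<^sup>2 * (\<Sum>p<n. (norm (w g p))\<^sup>2))"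
        by (simp only: sq of_real_mult of_real_sum sum_distrib_left)
      finally have eq: "Q (\<lambda>(p, q). if p = q then of_real ((B * real n)\<^sup>2) else 0) (w g)
        = of_real ((B * real n)\<^sup>2 * (\<Sum>p<n. (norm (w g p))\<^sup>2))" .
      define R where "R = (\<Sum>p<n. (norm (w g p))\<^sup>2)"
      have R0: "R \<ge> 0"
        by (simp add: R_def sum_nonneg)
      have wR: "norm (w g p) \<le> sqrt R" if "p < n" for p
        unfolding R_def using that
        by (intro real_le_rsqrt member_le_sum[of p "{..<n}" "\<lambda>p. (norm (w g p))\<^sup>2"]) auto
      have "1 = norm (w (inv g \<otimes> g) 0)"
        using g n by (simp add: w_def r_one)
      also have "\<dots> = norm (\<Sum>i<n. r (inv g) 0 i * w g i)"
        using w_mult[of "inv g" g 0] g n by simp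
      also have "\<dots> \<le> (\<Sum>i<n. norm (r (inv g) 0 i * w g i))"
        by (rule norm_sum)
      also have "\<dots> \<le> (\<Sum>i<n. B * sqrt R)"
        by (rule sum_mono) (use B wR g n in \<open>auto simp: norm_mult intro!: mult_mono\<close>)
      also have "\<dots> = B * real n * sqrt R"
        by simp
      finally have "1\<^sup>2 \<le> (B * real n * sqrt R)\<^sup>2"
        by (intro power_mono) auto
      then have "1 \<le> (B * real n)\<^sup>2 * R"
        using R0 by (simp add: power_mult_distrib)
      then show ?thesis
        using eq by (auto simp: R_def)
    qed
    then show "C \<noteq> {}"
      unfolding C_def by blast
  next
    fix F f assume F: "\<And>m::nat. F m \<in> C" and lim: "\<And>z. z \<in> ?S \<Longrightarrow> (\<lambda>m. F m z) \<longlonglongrightarrow> f z"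
    have "\<exists>a\<ge>1. Q f (w g) = of_real a" if g: "g \<in> carrier G" for g
    proof -
      have "\<forall>m. \<exists>a\<ge>1. Q (F m) (w g) = of_real a"
        using F g by (simp add: C_def)
      then obtain a where a: "\<And>m. a m \<ge> 1" "\<And>m. Q (F m) (w g) = of_real (a m)"
        by metis
      obtain b where b: "Q f (w g) = of_real b"
        using real by blast
      have "(\<lambda>m. Q (F m) (w g)) \<longlonglongrightarrow> Q f (w g)"
        unfolding Q_def case_prod_unfold
        by (intro tendsto_sum tendsto_mult tendsto_const lim) auto
      then have "(\<lambda>m. of_real (a m) :: 'k) \<longlonglongrightarrow> of_real b"
        by (simp only: a(2) b)
      then have "a \<longlonglongrightarrow> b"
        by (simp only: tendsto_of_real_iff)
      then have "1 \<le> b"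
        using a(1) by (intro LIMSEQ_le_const) auto
      then show ?thesis
        using b by blast
    qed
    then show "f \<in> C"
      by (simp add: C_def)
  next
    fix f f' assume ff: "f \<in> C" "f' \<in> C"
    have "\<exists>a\<ge>1. Q (\<lambda>i. (f i + f' i) / 2) (w g) = of_real a" if g: "g \<in> carrier G" for g
    proof -
      obtain a a' where a: "a \<ge> 1" "Q f (w g) = of_real a" "a' \<ge> 1" "Q f' (w g) = of_real a'"
        using ff g unfolding C_def by blast
      have "Q (\<lambda>i. (f i + f' i) / 2) (w g) = (Q f (w g) + Q f' (w g)) / 2"
        unfolding Q_def case_prod_unfold
        by (simp add: distrib_right add_divide_distrib sum.distrib sum_divide_distrib)
      also have "\<dots> = of_real ((a + a') / 2)"
        by (simp add: a)
      finally show ?thesis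
        using a by (intro exI[of _ "(a + a') / 2"]) auto
    qed
    then show "(\<lambda>i. (f i + f' i) / 2) \<in> C"
      by (simp add: C_def)
  next
    fix f g assume f: "f \<in> C" and g: "g \<in> carrier G"
    have "\<exists>a\<ge>1. Q (\<lambda>z. \<Sum>z'\<in>?S. c g z z' * f z') (w h) = of_real a" if h: "h \<in> carrier G" for h
    proof -
      have "Q f (\<lambda>k. \<Sum>i<n. r (inv g) k i * w h i) = Q f (w (inv g \<otimes> h))"
        unfolding Q_def by (intro sum.cong) (auto simp: w_mult g h)
      moreover have "\<exists>a\<ge>1. Q f (w (inv g \<otimes> h)) = of_real a"
        using f g h by (simp add: C_def)
      ultimately show ?thesis
        by (simp add: Qc)
    qed
    then show "(\<lambda>z. \<Sum>z'\<in>?S. c g z z' * f z') \<in> C"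
      by (simp add: C_def)
  qed blast
  define S where "S = mat n n f"
  have S: "S \<in> carrier_mat n n"
    by (simp add: S_def)
  have "S \<noteq> 0\<^sub>m n n"
  proof
    assume S0: "S = 0\<^sub>m n n"
    have "f (p, q) = 0" if "p < n" "q < n" for p q
      using arg_cong[OF S0, of "\<lambda>M. M $$ (p, q)"] that by (simp add: S_def)
    then have "Q f (w \<one>) = 0"
      by (auto simp: Q_def intro!: sum.neutral)
    then show False
      using f(1) by (auto simp: C_def dest!: bspec[OF _ one_closed])
  qed
  moreover have "S * \<rho> \<epsilon> g = (\<rho> \<epsilon> (inv g))\<^sup>T * S" if g: "g \<in> carrier G" for g
  proof -
    have \<rho>g: "\<rho> \<epsilon> g \<in> carrier_mat n n" and \<rho>i: "\<rho> \<epsilon> (inv g) \<in> carrier_mat n n"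
      using \<rho>_carrier[OF \<epsilon>] g by (simp_all add: n_def)
    have mult: "\<forall>g\<in>carrier G. \<forall>h\<in>carrier G. \<rho> \<epsilon> (g \<otimes> h) = \<rho> \<epsilon> g * \<rho> \<epsilon> h"
      and one: "\<rho> \<epsilon> \<one> = 1\<^sub>m n"
      using rep[OF \<epsilon>] by (auto simp: matrix_rep_def n_def)
    have inv: "\<rho> \<epsilon> (inv g) * \<rho> \<epsilon> g = 1\<^sub>m n"
      unfolding bspec[OF bspec[OF mult inv_closed[OF g]] g, symmetric] using g by (simp add: one)
    \<comment> \<open>The fixed point equation in matrix form; multiplication by
      \<open>\<rho> \<epsilon> g\<close> from the right gives the claim.\<close>
    have "S = (\<rho> \<epsilon> (inv g))\<^sup>T * (S * \<rho> \<epsilon> (inv g))"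
    proof (rule eq_matI)
      fix i j assume "i < dim_row ((\<rho> \<epsilon> (inv g))\<^sup>T * (S * \<rho> \<epsilon> (inv g)))" "j < dim_col ((\<rho> \<epsilon> (inv g))\<^sup>T * (S * \<rho> \<epsilon> (inv g)))"
      then have ij: "i < n" "j < n"
        using \<rho>i by auto
      have "S $$ (i, j) = (\<Sum>z\<in>?S. c g (i, j) z * f z)"
        using f(2)[OF g, of "(i, j)"] ij by (simp add: S_def)
      also have "\<dots> = (\<Sum>k<n. r (inv g) k i * (\<Sum>l<n. f (k, l) * r (inv g) l j))"
        by (simp add: sum.cartesian_product' c_def sum_distrib_left mult_ac)
      also have "\<dots> = ((\<rho> \<epsilon> (inv g))\<^sup>T * (S * \<rho> \<epsilon> (inv g))) $$ (i, j)"
        unfolding mult_mat_entry[OF transpose_carrier_mat[THEN iffD2, OF \<rho>i] mult_carrier_mat[OF S \<rho>i] ij]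
        using \<rho>i ij mult_mat_entry[OF S \<rho>i _ ij(2)]
        by (intro sum.cong refl) (auto simp: r_def S_def)
      finally show "S $$ (i, j) = ((\<rho> \<epsilon> (inv g))\<^sup>T * (S * \<rho> \<epsilon> (inv g))) $$ (i, j)" .
    qed (use S \<rho>i in auto)
    then have "S * \<rho> \<epsilon> g = (\<rho> \<epsilon> (inv g))\<^sup>T * (S * \<rho> \<epsilon> (inv g)) * \<rho> \<epsilon> g"
      by simp
    also have "\<dots> = (\<rho> \<epsilon> (inv g))\<^sup>T * (S * (\<rho> \<epsilon> (inv g) * \<rho> \<epsilon> g))"
      using S \<rho>g \<rho>i by (simp add: assoc_mult_mat[of _ n n _ n _ n])
    also have "\<dots> = (\<rho> \<epsilon> (inv g))\<^sup>T * S"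
      using right_mult_one_mat[OF S] by (simp add: inv)
    finally show ?thesis .
  qed
  ultimately show ?thesis
    using that S by (simp add: n_def)
qed

text \<open>\<open>S\<close> intertwines \<open>\<rho> \<epsilon>\<close> with its dual, so its
  kernel is invariant, and as \<open>S\<close> is not zero it is invertible. The adjoint
  \<open>R * (X\<^sup>T * S)\<close> with respect to the form, where \<open>R\<close> is the inverse
  of \<open>S\<close>, reverses products and preserves the commutant.\<close>

lemma opposite_iso_real:
  assumes \<epsilon>: "\<epsilon> \<in> chars" and real: "\<And>x::'k. \<exists>a. x = of_real a"
  obtains \<tau> where "opposite_iso \<epsilon> \<tau>"
proof -
  define n where "n = dimE \<epsilon>"
  obtain S where S: "S \<in> carrier_mat n n" "S \<noteq> 0\<^sub>m n n"
    and SG: "\<And>g. g \<in> carrier G \<Longrightarrow> S * \<rho> \<epsilon> g = (\<rho> \<epsilon> (inv g))\<^sup>T * S"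
    by (rule invariant_form_exists[OF assms, folded n_def]) (rule that)
  have \<rho>c: "\<rho> \<epsilon> g \<in> carrier_mat n n" if "g \<in> carrier G" for g
    using \<rho>_carrier[OF \<epsilon> that] by (simp add: n_def)
  have Lc: "X \<in> carrier_mat n n" if "X \<in> commutant \<epsilon>" for X
    using commutant_carrier[OF that] by (simp add: n_def)
  define K where "K = {v \<in> carrier_vec n. S *\<^sub>v v = 0\<^sub>v n}"
  have "K = {0\<^sub>v n} \<or> K = carrier_vec n"
  proof (rule irreducible_invariant_subspace[of n "\<rho> \<epsilon>"])
    show "irreducible_representation G TG n (\<rho> \<epsilon>)"
      using irr[OF \<epsilon>] by (simp add: n_def)
    show "\<rho> \<epsilon> g *\<^sub>v v \<in> K" if g: "g \<in> carrier G" and v: "v \<in> K" for g v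
    proof -
      have vc: "v \<in> carrier_vec n" and Sv: "S *\<^sub>v v = 0\<^sub>v n"
        using v by (auto simp: K_def)
      have T: "(\<rho> \<epsilon> (inv g))\<^sup>T \<in> carrier_mat n n"
        using \<rho>c[of "inv g"] g by simp
      have "S *\<^sub>v (\<rho> \<epsilon> g *\<^sub>v v) = (\<rho> \<epsilon> (inv g))\<^sup>T *\<^sub>v (S *\<^sub>v v)"
        using assoc_mult_mat_vec[OF S(1) \<rho>c[OF g] vc] assoc_mult_mat_vec[OF T S(1) vc] SG[OF g] by simp
      also have "\<dots> = 0\<^sub>v n"
        unfolding Sv using T by auto
      finally show ?thesis
        using mult_mat_vec_carrier[OF \<rho>c[OF g] vc] by (simp add: K_def)
    qed
  qed (use S(1) in \<open>auto simp: K_def mult_add_distrib_mat_vec mult_mat_vec\<close>)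
  moreover have "K \<noteq> carrier_vec n"
  proof
    assume K: "K = carrier_vec n"
    have "S = 0\<^sub>m n n"
    proof (rule mat_eq_mult_vecI[OF S(1) zero_carrier_mat])
      fix v :: "'k vec" assume v: "v \<in> carrier_vec n"
      then have "S *\<^sub>v v = 0\<^sub>v n"
        unfolding K[symmetric] by (simp add: K_def)
      then show "S *\<^sub>v v = 0\<^sub>m n n *\<^sub>v v"
        using zero_mult_mat_vec[OF v] by simp
    qed
    then show False
      using S(2) by simp
  qed
  ultimately have K: "K = {0\<^sub>v n}"
    by blast
  have "det S \<noteq> 0"
  proof
    assume "det S = 0"
    then obtain v where "v \<in> carrier_vec n" "v \<noteq> 0\<^sub>v n" "S *\<^sub>v v = 0\<^sub>v n"
      using det_0_iff_vec_prod_zero[OF S(1)] by auto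
    then have "v \<in> K" "v \<noteq> 0\<^sub>v n"
      by (auto simp: K_def)
    then show False
      using K by blast
  qed
  then obtain R where R: "R \<in> carrier_mat n n" "S * R = 1\<^sub>m n" "R * S = 1\<^sub>m n"
    using nonzero_det_inverse[OF S(1)] by blast
  have assoc: "(A * B) * C = A * (B * C)" if "A \<in> carrier_mat n n" "B \<in> carrier_mat n n" "C \<in> carrier_mat n n" for A B C :: "'k mat"
    using that by (rule assoc_mult_mat)
  have mc: "A * B \<in> carrier_mat n n" if "A \<in> carrier_mat n n" "B \<in> carrier_mat n n" for A B :: "'k mat"
    using that by (rule mult_carrier_mat)
  have RS: "R * (S * A) = A" and SR: "S * (R * A) = A" if A: "A \<in> carrier_mat n n" for A
    using assoc[OF R(1) S(1) A] assoc[OF S(1) R(1) A] R(2,3) left_mult_one_mat[OF A] by simp_all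
  have tc: "A\<^sup>T \<in> carrier_mat n n" if "A \<in> carrier_mat n n" for A :: "'k mat"
    using that by simp
  have tm: "(A * B)\<^sup>T = B\<^sup>T * A\<^sup>T" if "A \<in> carrier_mat n n" "B \<in> carrier_mat n n" for A B :: "'k mat"
    using that by (rule transpose_mult)
  have RG: "R * (\<rho> \<epsilon> (inv g))\<^sup>T = \<rho> \<epsilon> g * R" if g: "g \<in> carrier G" for g
  proof -
    have T: "(\<rho> \<epsilon> (inv g))\<^sup>T \<in> carrier_mat n n"
      using \<rho>c[of "inv g"] g by simp
    have "R * (\<rho> \<epsilon> (inv g))\<^sup>T = R * ((\<rho> \<epsilon> (inv g))\<^sup>T * (S * R))"
      using right_mult_one_mat[OF T] R(2) by simp
    also have "\<dots> = R * (S * \<rho> \<epsilon> g * R)"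
      using assoc[OF T S(1) R(1)] SG[OF g] by simp
    also have "\<dots> = R * (S * (\<rho> \<epsilon> g * R))"
      using assoc[OF S(1) \<rho>c[OF g] R(1)] by simp
    also have "\<dots> = \<rho> \<epsilon> g * R"
      by (rule RS[OF mc[OF \<rho>c[OF g] R(1)]])
    finally show ?thesis .
  qed
  define \<tau> where "\<tau> X = R * (X\<^sup>T * S)" for X
  \<comment> \<open>The inverse of \<open>\<tau>\<close>: the adjoint with respect to the transposed
    form, which coincides with \<open>\<tau>\<close> for symmetric \<open>S\<close>.\<close>
  define \<sigma> where "\<sigma> X = (S * (X * R))\<^sup>T" for X
  have \<tau>c: "\<tau> X \<in> carrier_mat n n" and \<sigma>c: "\<sigma> X \<in> carrier_mat n n" if "X \<in> carrier_mat n n" for X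
    unfolding \<tau>_def \<sigma>_def using R(1) S(1) that by (simp_all add: mc tc)
  have \<tau>L: "\<tau> X \<in> commutant \<epsilon>" if X: "X \<in> commutant \<epsilon>" for X
  proof -
    note Xc = Lc[OF X]
    have "\<tau> X * \<rho> \<epsilon> g = \<rho> \<epsilon> g * \<tau> X" if g: "g \<in> carrier G" for g
    proof -
      have gi: "inv g \<in> carrier G"
        using g by simp
      note T = tc[OF \<rho>c[OF gi]]
      have "\<tau> X * \<rho> \<epsilon> g = R * (X\<^sup>T * (S * \<rho> \<epsilon> g))"
        unfolding \<tau>_def using R(1) S(1) tc[OF Xc] \<rho>c[OF g] by (simp add: assoc mc)
      also have "\<dots> = R * ((\<rho> \<epsilon> (inv g) * X)\<^sup>T * S)"
        using tc[OF Xc] T S(1) by (simp add: SG[OF g] assoc tm[OF \<rho>c[OF gi] Xc])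
      also have "\<dots> = R * ((X * \<rho> \<epsilon> (inv g))\<^sup>T * S)"
        using commutant_commutes[OF X gi] by simp
      also have "\<dots> = R * (\<rho> \<epsilon> (inv g))\<^sup>T * (X\<^sup>T * S)"
        using tc[OF Xc] T S(1) R(1) by (simp add: assoc mc tm[OF Xc \<rho>c[OF gi]])
      also have "\<dots> = \<rho> \<epsilon> g * \<tau> X"
        unfolding RG[OF g] \<tau>_def using \<rho>c[OF g] R(1) tc[OF Xc] S(1) by (simp add: assoc mc)
      finally show ?thesis .
    qed
    then show ?thesis
      using \<tau>c[OF Xc] by (simp add: commutant_def intertwines_def n_def)
  qed
  have \<sigma>L: "\<sigma> X \<in> commutant \<epsilon>" if X: "X \<in> commutant \<epsilon>" for X
  proof -
    note Xc = Lc[OF X]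
    have "\<sigma> X * \<rho> \<epsilon> g = \<rho> \<epsilon> g * \<sigma> X" if g: "g \<in> carrier G" for g
    proof -
      have gi: "inv g \<in> carrier G"
        using g by simp
      note T = tc[OF \<rho>c[OF g]]
      have "\<rho> \<epsilon> (inv g) * R = R * (\<rho> \<epsilon> g)\<^sup>T" "S * \<rho> \<epsilon> (inv g) = (\<rho> \<epsilon> g)\<^sup>T * S"
        using RG[OF gi] SG[OF gi] g by simp_all
      then have eq: "(\<rho> \<epsilon> g)\<^sup>T * (S * (X * R)) = S * (X * R) * (\<rho> \<epsilon> g)\<^sup>T"
      proof -
        have "(\<rho> \<epsilon> g)\<^sup>T * (S * (X * R)) = S * \<rho> \<epsilon> (inv g) * (X * R)"
          using T S(1) Xc R(1) \<open>S * \<rho> \<epsilon> (inv g) = (\<rho> \<epsilon> g)\<^sup>T * S\<close> by (simp add: assoc mc)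
        also have "\<dots> = S * (\<rho> \<epsilon> (inv g) * X * R)"
          using S(1) Xc R(1) \<rho>c[OF gi] by (simp add: assoc mc)
        also have "\<dots> = S * (X * \<rho> \<epsilon> (inv g) * R)"
          using commutant_commutes[OF X gi] by simp
        also have "\<dots> = S * (X * (R * (\<rho> \<epsilon> g)\<^sup>T))"
          using Xc R(1) \<rho>c[OF gi] \<open>\<rho> \<epsilon> (inv g) * R = R * (\<rho> \<epsilon> g)\<^sup>T\<close> by (simp add: assoc mc)
        also have "\<dots> = S * (X * R) * (\<rho> \<epsilon> g)\<^sup>T"
          using S(1) Xc R(1) T by (simp add: assoc mc)
        finally show ?thesis .
      qed
      have M: "S * (X * R) \<in> carrier_mat n n"
        using S(1) Xc R(1) by (simp add: mc)
      have "\<sigma> X * \<rho> \<epsilon> g = ((\<rho> \<epsilon> g)\<^sup>T * (S * (X * R)))\<^sup>T"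
        unfolding \<sigma>_def using tm[OF T M] by simp
      also have "\<dots> = \<rho> \<epsilon> g * \<sigma> X"
        unfolding \<sigma>_def eq using tm[OF M T] by simp
      finally show ?thesis .
    qed
    then show ?thesis
      using \<sigma>c[OF Xc] by (simp add: commutant_def intertwines_def n_def)
  qed
  have \<tau>\<sigma>: "\<tau> (\<sigma> X) = X" and \<sigma>\<tau>: "\<sigma> (\<tau> X) = X" if Xc: "X \<in> carrier_mat n n" for X
  proof -
    have "\<tau> (\<sigma> X) = R * (S * (X * R) * S)"
      by (simp add: \<tau>_def \<sigma>_def)
    also have "\<dots> = R * (S * (X * (R * S)))"
      using S(1) R(1) Xc by (simp add: assoc mc)
    also have "\<dots> = X"
      using RS[OF Xc] R(3) right_mult_one_mat[OF Xc] by simp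
    finally show "\<tau> (\<sigma> X) = X" .
    have "S * (\<tau> X * R) = S * (R * (X\<^sup>T * (S * R)))"
      unfolding \<tau>_def using S(1) R(1) tc[OF Xc] by (simp add: assoc mc)
    also have "\<dots> = X\<^sup>T"
      using SR[OF tc[OF Xc]] R(2) right_mult_one_mat[OF tc[OF Xc]] by simp
    finally show "\<sigma> (\<tau> X) = X"
      by (simp add: \<sigma>_def)
  qed
  have "bij_betw \<tau> (commutant \<epsilon>) (commutant \<epsilon>)"
    by (rule bij_betwI[where g = \<sigma>]) (use \<tau>L \<sigma>L \<tau>\<sigma> \<sigma>\<tau> Lc in auto)
  moreover have "\<tau> (1\<^sub>m n) = 1\<^sub>m n"
    using S(1) R(3) by (simp add: \<tau>_def)
  moreover have "\<tau> (X + Y) = \<tau> X + \<tau> Y \<and> \<tau> (X * Y) = \<tau> Y * \<tau> X"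
    if X: "X \<in> carrier_mat n n" and Y: "Y \<in> carrier_mat n n" for X Y
  proof
    have "(X + Y)\<^sup>T = X\<^sup>T + Y\<^sup>T"
      using X Y by (intro eq_matI) auto
    then show "\<tau> (X + Y) = \<tau> X + \<tau> Y"
      unfolding \<tau>_def using add_mult_distrib_mat[OF tc[OF X] tc[OF Y] S(1)]
        mult_add_distrib_mat[OF R(1) mc[OF tc[OF X] S(1)] mc[OF tc[OF Y] S(1)]] by simp
    have "\<tau> Y * \<tau> X = R * (Y\<^sup>T * (S * (R * (X\<^sup>T * S))))"
      unfolding \<tau>_def using R(1) S(1) tc[OF X] tc[OF Y] by (simp add: assoc mc)
    also have "\<dots> = R * (Y\<^sup>T * (X\<^sup>T * S))"
      using SR[OF mc[OF tc[OF X] S(1)]] by simp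
    also have "\<dots> = \<tau> (X * Y)"
      unfolding \<tau>_def tm[OF X Y] using assoc[OF tc[OF Y] tc[OF X] S(1)] by simp
    finally show "\<tau> (X * Y) = \<tau> Y * \<tau> X" ..
  qed
  moreover have "\<tau> (c \<cdot>\<^sub>m X) = c \<cdot>\<^sub>m \<tau> X" if X: "X \<in> carrier_mat n n" for c X
  proof -
    have "(c \<cdot>\<^sub>m X)\<^sup>T = c \<cdot>\<^sub>m X\<^sup>T"
      using X by (intro eq_matI) auto
    then show ?thesis
      unfolding \<tau>_def using mult_smult_assoc_mat[OF tc[OF X] S(1)]
        mult_smult_distrib[OF R(1) mc[OF tc[OF X] S(1)]] by simp
  qed
  ultimately have "opposite_iso \<epsilon> \<tau>"
    using Lc by (auto simp: opposite_iso_def n_def)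
  then show ?thesis
    by (rule that)
qed

lemma opposite_iso_exists:
  assumes \<epsilon>: "\<epsilon> \<in> chars"
  obtains \<tau> where "opposite_iso \<epsilon> \<tau>"
proof (cases rule: real_or_complex_cases[where ?'k = 'k])
  case real
  then show ?thesis
    using opposite_iso_real[OF \<epsilon>] that by blast
next
  case (complex h)
  then show ?thesis
    using opposite_iso_complex[OF \<epsilon> complex(1-4)] that by blast
qed

end

section \<open>Linear algebra over the commutant, a division ring\<close>

section \<open>Bases over the commutant\<close>

context chosen_representations
begin

text \<open>The commutant acts from the left, which makes \<open>E\<close> a left vector space over
  it; this is the linear combination in that space, summed entrywise.\<close>

definition combination :: "('g \<Rightarrow> 'k) \<Rightarrow> ('k vec \<Rightarrow> 'k mat) \<Rightarrow> 'k vec set \<Rightarrow> 'k vec" where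
  "combination \<epsilon> X B = vec (dimE \<epsilon>) (\<lambda>p. \<Sum>b\<in>B. (X b *\<^sub>v b) $ p)"

lemma combination_carrier [simp]: "combination \<epsilon> X B \<in> carrier_vec (dimE \<epsilon>)"
  by (simp add: combination_def)

lemma combination_cong: "(\<And>b. b \<in> B \<Longrightarrow> X b = Y b) \<Longrightarrow> combination \<epsilon> X B = combination \<epsilon> Y B"
  by (auto simp: combination_def intro!: eq_vecI sum.cong)

lemma combination_add:
  assumes "B \<subseteq> carrier_vec (dimE \<epsilon>)" "\<And>b. b \<in> B \<Longrightarrow> X b \<in> commutant \<epsilon>" "\<And>b. b \<in> B \<Longrightarrow> Y b \<in> commutant \<epsilon>"
  shows "combination \<epsilon> (\<lambda>b. X b + Y b) B = combination \<epsilon> X B + combination \<epsilon> Y B"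
proof (rule eq_vecI)
  fix p assume "p < dim_vec (combination \<epsilon> X B + combination \<epsilon> Y B)"
  then have p: "p < dimE \<epsilon>"
    by (simp add: combination_def)
  have "((X b + Y b) *\<^sub>v b) $ p = (X b *\<^sub>v b) $ p + (Y b *\<^sub>v b) $ p" if "b \<in> B" for b
  proof -
    have "b \<in> carrier_vec (dimE \<epsilon>)"
      using assms(1) that by blast
    then show ?thesis
      using add_mult_distrib_mat_vec[OF commutant_carrier[OF assms(2)[OF that]] commutant_carrier[OF assms(3)[OF that]]]
        p carrier_matD[OF commutant_carrier[OF assms(3)[OF that]]] by simp
  qed
  then show "combination \<epsilon> (\<lambda>b. X b + Y b) B $ p = (combination \<epsilon> X B + combination \<epsilon> Y B) $ p"
    using p by (simp add: combination_def sum.distrib)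
qed (simp add: combination_def)

lemma combination_mult:
  assumes B: "B \<subseteq> carrier_vec (dimE \<epsilon>)" and X: "\<And>b. b \<in> B \<Longrightarrow> X b \<in> commutant \<epsilon>"
    and W: "W \<in> carrier_mat (dimE \<epsilon>) (dimE \<epsilon>)"
  shows "W *\<^sub>v combination \<epsilon> X B = combination \<epsilon> (\<lambda>b. W * X b) B"
proof (rule eq_vecI)
  fix p assume "p < dim_vec (combination \<epsilon> (\<lambda>b. W * X b) B)"
  then have p: "p < dimE \<epsilon>"
    by (simp add: combination_def)
  have "(W *\<^sub>v combination \<epsilon> X B) $ p = (\<Sum>q<dimE \<epsilon>. \<Sum>b\<in>B. W $$ (p, q) * (X b *\<^sub>v b) $ q)"
    unfolding mult_mat_vec_entry[OF W combination_carrier p]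
    by (simp add: combination_def sum_distrib_left)
  also have "\<dots> = (\<Sum>b\<in>B. \<Sum>q<dimE \<epsilon>. W $$ (p, q) * (X b *\<^sub>v b) $ q)"
    by (rule sum.swap)
  also have "\<dots> = (\<Sum>b\<in>B. (W * X b *\<^sub>v b) $ p)"
  proof (rule sum.cong[OF refl])
    fix b assume b: "b \<in> B"
    then have bc: "b \<in> carrier_vec (dimE \<epsilon>)"
      using B by blast
    note Xc = commutant_carrier[OF X[OF b]]
    show "(\<Sum>q<dimE \<epsilon>. W $$ (p, q) * (X b *\<^sub>v b) $ q) = (W * X b *\<^sub>v b) $ p"
      unfolding assoc_mult_mat_vec[OF W Xc bc]
      using mult_mat_vec_entry[OF W mult_mat_vec_carrier[OF Xc bc] p] by simp
  qed
  finally show "(W *\<^sub>v combination \<epsilon> X B) $ p = combination \<epsilon> (\<lambda>b. W * X b) B $ p"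
    using p by (simp add: combination_def)
qed (use W in \<open>simp add: combination_def\<close>)

definition commutant_basis :: "('g \<Rightarrow> 'k) \<Rightarrow> 'k vec set \<Rightarrow> bool" where
  "commutant_basis \<epsilon> B \<longleftrightarrow> finite B \<and> B \<subseteq> carrier_vec (dimE \<epsilon>) \<and>
     (\<forall>v\<in>carrier_vec (dimE \<epsilon>). \<exists>X. (\<forall>b\<in>B. X b \<in> commutant \<epsilon>) \<and> combination \<epsilon> X B = v) \<and>
     (\<forall>X. (\<forall>b\<in>B. X b \<in> commutant \<epsilon>) \<and> combination \<epsilon> X B = 0\<^sub>v (dimE \<epsilon>) \<longrightarrow>
        (\<forall>b\<in>B. X b = 0\<^sub>m (dimE \<epsilon>) (dimE \<epsilon>)))"

text \<open>A spanning set of least size is independent: a nonzero coefficient in a relation is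
  invertible, so the vector it belongs to could be dropped.\<close>

lemma commutant_basis_exists:
  assumes \<epsilon>: "\<epsilon> \<in> chars"
  obtains B where "commutant_basis \<epsilon> B"
proof -
  define n where "n = dimE \<epsilon>"
  define spans where "spans B \<longleftrightarrow> finite B \<and> B \<subseteq> carrier_vec n \<and>
     (\<forall>v\<in>carrier_vec n. \<exists>X. (\<forall>b\<in>B. X b \<in> commutant \<epsilon>) \<and> combination \<epsilon> X B = v)" for B
  \<comment> \<open>The standard basis spans already with scalar multiples of the identity as
    coefficients.\<close>
  have "spans (unit_vec n ` {..<n})"
    unfolding spans_def
  proof (intro conjI ballI)
    fix v :: "'k vec" assume v: "v \<in> carrier_vec n"
    define X where "X b = v $ (the_inv_into {..<n} (unit_vec n) b) \<cdot>\<^sub>m 1\<^sub>m n" for b :: "'k vec"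
    have inj: "inj_on (unit_vec n :: nat \<Rightarrow> 'k vec) {..<n}"
      by (auto simp: inj_on_def)
    have "combination \<epsilon> X (unit_vec n ` {..<n}) = v"
    proof (rule eq_vecI)
      fix p assume "p < dim_vec v"
      then have p: "p < n"
        using v by simp
      have "(X (unit_vec n q) *\<^sub>v unit_vec n q) $ p = (if q = p then v $ q else 0)" if "q < n" for q
        using that p inj mult_unit_vec_eq_col[of "X (unit_vec n q)" n n q]
        by (auto simp: X_def the_inv_into_f_f)
      then show "combination \<epsilon> X (unit_vec n ` {..<n}) $ p = v $ p"
        using p by (simp add: combination_def n_def[symmetric] sum.reindex[OF inj])
    qed (use v in \<open>simp add: combination_def n_def\<close>)
    moreover have "X b \<in> commutant \<epsilon>" for b
      unfolding X_def n_def by (intro commutant_smult commutant_one \<epsilon>)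
    ultimately show "\<exists>X. (\<forall>b\<in>unit_vec n ` {..<n}. X b \<in> commutant \<epsilon>) \<and> combination \<epsilon> X (unit_vec n ` {..<n}) = v"
      by (intro exI[of _ X]) simp
  qed auto
  then obtain B where B: "spans B" "\<And>B'. spans B' \<Longrightarrow> card B \<le> card B'"
    using ex_has_least_nat[of spans _ card] by blast
  have fin: "finite B" and Bc: "B \<subseteq> carrier_vec n"
    using B(1) by (auto simp: spans_def)
  have "X b = 0\<^sub>m n n" if X: "\<forall>b\<in>B. X b \<in> commutant \<epsilon>" and X0: "combination \<epsilon> X B = 0\<^sub>v n" and b: "b \<in> B" for X b
  proof (rule ccontr)
    assume "X b \<noteq> 0\<^sub>m n n"
    then obtain Y where Y: "Y \<in> commutant \<epsilon>" "Y * X b = 1\<^sub>m n"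
      using commutant_inverse[of "X b" \<epsilon>] X b \<epsilon> by (auto simp: n_def)
    have "\<exists>Z. (\<forall>b'\<in>B - {b}. Z b' \<in> commutant \<epsilon>) \<and> combination \<epsilon> Z (B - {b}) = v" if v: "v \<in> carrier_vec n" for v
    proof -
      obtain Z where Z: "\<forall>b\<in>B. Z b \<in> commutant \<epsilon>" "combination \<epsilon> Z B = v"
        using B(1) v unfolding spans_def by blast
      \<comment> \<open>Adding \<open>W\<close> times the relation to an expansion of
        \<open>v\<close> cancels the coefficient at \<open>b\<close>, since \<open>Y\<close> inverts
        \<open>X b\<close> and so \<open>W * X b\<close> is the negative of
        \<open>Z b\<close>.\<close>
      define W where "W = (- 1) \<cdot>\<^sub>m (Z b * Y)"
      have W: "W \<in> commutant \<epsilon>"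
        unfolding W_def using Z(1) b Y(1) by (intro commutant_smult commutant_mult \<epsilon>) auto
      have Wc: "W \<in> carrier_mat n n"
        using commutant_carrier[OF W] by (simp add: n_def)
      define V where "V b' = Z b' + W * X b'" for b'
      have VL: "V b' \<in> commutant \<epsilon>" if "b' \<in> B" for b'
        unfolding V_def using Z(1) X that W by (intro commutant_add commutant_mult \<epsilon>) auto
      have "combination \<epsilon> V B = combination \<epsilon> Z B + W *\<^sub>v combination \<epsilon> X B"
        unfolding V_def using Z(1) X W Bc Wc commutant_mult \<epsilon>
        by (subst combination_add) (auto simp: combination_mult n_def)
      also have "\<dots> = v + W *\<^sub>v 0\<^sub>v n"
        by (simp only: Z(2) X0)
      also have "\<dots> = v"
        using Wc v by auto
      finally have VB: "combination \<epsilon> V B = v" .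
      have "Z b \<in> carrier_mat n n" "Y \<in> carrier_mat n n" "X b \<in> carrier_mat n n"
        using Z(1) Y(1) X b commutant_carrier by (auto simp: n_def)
      then have "W * X b = (- 1) \<cdot>\<^sub>m Z b"
        unfolding W_def using assoc_mult_mat[of "Z b" n n Y n "X b" n] Y(2)
        by (simp add: mult_smult_assoc_mat[of "Z b * Y" n n "X b" n])
      then have "V b = 0\<^sub>m n n"
        unfolding V_def using \<open>Z b \<in> carrier_mat n n\<close> by (intro eq_matI) auto
      then have "(V b *\<^sub>v b) $ p = 0" if "p < n" for p
        using zero_mult_mat_vec[of b n n] Bc b that by auto
      then have "(\<Sum>b\<in>B - {b}. (V b *\<^sub>v b) $ p) = (\<Sum>b\<in>B. (V b *\<^sub>v b) $ p)" if "p < n" for p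
        using that by (simp add: sum.remove[OF fin b])
      then have "combination \<epsilon> V (B - {b}) = combination \<epsilon> V B"
        unfolding combination_def by (intro eq_vecI) (simp_all add: n_def)
      then show ?thesis
        using VB VL by blast
    qed
    then have "spans (B - {b})"
      using fin Bc by (auto simp: spans_def)
    then have "card B \<le> card (B - {b})"
      by (rule B(2))
    then show False
      using b fin by (metis card_Diff1_less not_le)
  qed
  then have "commutant_basis \<epsilon> B"
    using B(1) by (auto simp: commutant_basis_def spans_def n_def)
  then show ?thesis
    by (rule that)
qed

definition coordinate :: "('g \<Rightarrow> 'k) \<Rightarrow> 'k vec set \<Rightarrow> 'k vec \<Rightarrow> 'k vec \<Rightarrow> 'k mat" where
  "coordinate \<epsilon> B v = (SOME X. (\<forall>b\<in>B. X b \<in> commutant \<epsilon>) \<and> combination \<epsilon> X B = v)"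

lemma coordinate:
  assumes "commutant_basis \<epsilon> B" "v \<in> carrier_vec (dimE \<epsilon>)"
  shows coordinate_commutant: "b \<in> B \<Longrightarrow> coordinate \<epsilon> B v b \<in> commutant \<epsilon>"
    and combination_coordinate: "combination \<epsilon> (coordinate \<epsilon> B v) B = v"
proof -
  have "\<exists>X. (\<forall>b\<in>B. X b \<in> commutant \<epsilon>) \<and> combination \<epsilon> X B = v"
    using assms by (auto simp: commutant_basis_def)
  then have "(\<forall>b\<in>B. coordinate \<epsilon> B v b \<in> commutant \<epsilon>) \<and> combination \<epsilon> (coordinate \<epsilon> B v) B = v"
    unfolding coordinate_def by (rule someI_ex)
  then show "b \<in> B \<Longrightarrow> coordinate \<epsilon> B v b \<in> commutant \<epsilon>" "combination \<epsilon> (coordinate \<epsilon> B v) B = v"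
    by auto
qed

text \<open>Two expansions differ by a relation, which independence makes trivial.\<close>

lemma coordinate_unique:
  assumes \<epsilon>: "\<epsilon> \<in> chars" and B: "commutant_basis \<epsilon> B" and X: "\<And>b. b \<in> B \<Longrightarrow> X b \<in> commutant \<epsilon>"
    and v: "combination \<epsilon> X B = v" and b: "b \<in> B"
  shows "coordinate \<epsilon> B v b = X b"
proof -
  define n where "n = dimE \<epsilon>"
  have Bc: "B \<subseteq> carrier_vec (dimE \<epsilon>)"
    using B by (simp add: commutant_basis_def)
  have vc: "v \<in> carrier_vec (dimE \<epsilon>)"
    using v combination_carrier by blast
  define Z where "Z b = coordinate \<epsilon> B v b + (- 1) \<cdot>\<^sub>m X b" for b
  note C = coordinate_commutant[OF B vc]
  have ZL: "\<forall>b\<in>B. Z b \<in> commutant \<epsilon>"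
    unfolding Z_def using C X by (intro ballI commutant_add commutant_smult \<epsilon>) auto
  have "(- 1) \<cdot>\<^sub>m X b = (- 1) \<cdot>\<^sub>m 1\<^sub>m n * X b" if "b \<in> B" for b
    using commutant_carrier[OF X[OF that]] by (simp add: mult_smult_assoc_mat[of _ n n _ n] n_def)
  then have "combination \<epsilon> (\<lambda>b. (- 1) \<cdot>\<^sub>m X b) B = combination \<epsilon> (\<lambda>b. (- 1) \<cdot>\<^sub>m 1\<^sub>m n * X b) B"
    by (rule combination_cong)
  also have "\<dots> = ((- 1) \<cdot>\<^sub>m 1\<^sub>m n) *\<^sub>v combination \<epsilon> X B"
    using X by (intro combination_mult[symmetric] Bc) (auto simp: n_def)
  finally have "combination \<epsilon> Z B = v + ((- 1) \<cdot>\<^sub>m 1\<^sub>m n) *\<^sub>v v"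
    unfolding Z_def using C X Bc \<epsilon>
    by (subst combination_add) (auto simp: combination_coordinate[OF B vc] v commutant_smult)
  also have "\<dots> = (1\<^sub>m n + (- 1) \<cdot>\<^sub>m 1\<^sub>m n) *\<^sub>v v"
    using vc by (subst add_mult_distrib_mat_vec[of _ n n]) (auto simp: n_def)
  also have "1\<^sub>m n + (- 1) \<cdot>\<^sub>m 1\<^sub>m n = (0\<^sub>m n n :: 'k mat)"
    by (intro eq_matI) auto
  finally have "combination \<epsilon> Z B = 0\<^sub>v (dimE \<epsilon>)"
    using vc by (simp add: zero_mult_mat_vec n_def)
  then have "Z b = 0\<^sub>m n n"
    using B ZL b unfolding commutant_basis_def n_def by blast
  moreover have "coordinate \<epsilon> B v b \<in> carrier_mat n n" "X b \<in> carrier_mat n n"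
    using C[OF b] X[OF b] commutant_carrier by (auto simp: n_def)
  moreover from this have "Z b $$ (i, j) = coordinate \<epsilon> B v b $$ (i, j) - X b $$ (i, j)" if "i < n" "j < n" for i j
    using that by (simp add: Z_def)
  ultimately have "coordinate \<epsilon> B v b $$ (i, j) = X b $$ (i, j)" if "i < n" "j < n" for i j
    using that by simp
  then show ?thesis
    using \<open>coordinate \<epsilon> B v b \<in> carrier_mat n n\<close> \<open>X b \<in> carrier_mat n n\<close> by (intro eq_matI) auto
qed

lemma coordinate_add:
  assumes "\<epsilon> \<in> chars" "commutant_basis \<epsilon> B" "v \<in> carrier_vec (dimE \<epsilon>)" "w \<in> carrier_vec (dimE \<epsilon>)" "b \<in> B"
  shows "coordinate \<epsilon> B (v + w) b = coordinate \<epsilon> B v b + coordinate \<epsilon> B w b"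
proof (rule coordinate_unique[OF assms(1,2)])
  show "combination \<epsilon> (\<lambda>b. coordinate \<epsilon> B v b + coordinate \<epsilon> B w b) B = v + w"
    using assms coordinate_commutant[OF assms(2)]
    by (subst combination_add) (auto simp: combination_coordinate commutant_basis_def)
qed (use assms coordinate_commutant[OF assms(2)] commutant_add in auto)

lemma coordinate_mult:
  assumes "\<epsilon> \<in> chars" "commutant_basis \<epsilon> B" "v \<in> carrier_vec (dimE \<epsilon>)" "Z \<in> commutant \<epsilon>" "b \<in> B"
  shows "coordinate \<epsilon> B (Z *\<^sub>v v) b = Z * coordinate \<epsilon> B v b"
proof (rule coordinate_unique[OF assms(1,2)])
  show "combination \<epsilon> (\<lambda>b. Z * coordinate \<epsilon> B v b) B = Z *\<^sub>v v"
    using assms coordinate_commutant[OF assms(2,3)] commutant_carrier[OF assms(4)]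
    by (subst combination_mult[symmetric]) (auto simp: combination_coordinate commutant_basis_def)
qed (use assms coordinate_commutant[OF assms(2)] commutant_mult in auto)

lemma smult_as_mult_mat_vec:
  fixes v :: "'k vec"
  assumes "v \<in> carrier_vec n"
  shows "(c \<cdot>\<^sub>m 1\<^sub>m n) *\<^sub>v v = c \<cdot>\<^sub>v v"
proof (rule eq_vecI)
  fix i assume "i < dim_vec (c \<cdot>\<^sub>v v)"
  then have i: "i < n"
    using assms by simp
  have "((c \<cdot>\<^sub>m 1\<^sub>m n) *\<^sub>v v) $ i = (\<Sum>k<n. if k = i then c * v $ k else 0)"
    unfolding mult_mat_vec_entry[OF smult_carrier_mat[OF one_carrier_mat] assms i]
    using i by (intro sum.cong) auto
  then show "((c \<cdot>\<^sub>m 1\<^sub>m n) *\<^sub>v v) $ i = (c \<cdot>\<^sub>v v) $ i"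
    using i assms by simp
qed (use assms in auto)

text \<open>\<open>Y\<close> commutes with the coefficients, so it passes through to the basis
  vectors, and the coefficients of \<open>v\<close> stay to the left of the matrix entries of
  \<open>Y\<close>. This order is what brings in the opposite of the commutant.\<close>

lemma block_mult_combination:
  assumes \<epsilon>: "\<epsilon> \<in> chars" and B: "commutant_basis \<epsilon> B" and v: "v \<in> carrier_vec (dimE \<epsilon>)"
    and Y: "Y \<in> block \<epsilon>" and b: "b \<in> B"
  shows "coordinate \<epsilon> B (Y *\<^sub>v v) b =
    mat (dimE \<epsilon>) (dimE \<epsilon>) (\<lambda>ij. \<Sum>b'\<in>B. (coordinate \<epsilon> B v b' * coordinate \<epsilon> B (Y *\<^sub>v b') b) $$ ij)"
proof -
  define n where "n = dimE \<epsilon>"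
  have fin: "finite B" and Bc: "B \<subseteq> carrier_vec n"
    using B by (auto simp: commutant_basis_def n_def)
  have Yc: "Y \<in> carrier_mat n n"
    using block_carrier[OF Y] by (simp add: n_def)
  have Ybc: "Y *\<^sub>v b' \<in> carrier_vec n" if "b' \<in> B" for b'
    using Yc Bc that by (intro mult_mat_vec_carrier) auto
  define X where "X = coordinate \<epsilon> B v"
  have XL: "X b' \<in> commutant \<epsilon>" if "b' \<in> B" for b'
    unfolding X_def by (rule coordinate_commutant[OF B v that])
  have CL: "coordinate \<epsilon> B (Y *\<^sub>v b') b'' \<in> commutant \<epsilon>" if "b' \<in> B" "b'' \<in> B" for b' b''
    using coordinate_commutant[OF B _ that(2)] Ybc[OF that(1)] by (simp add: n_def)
  define M where "M A b'' = mat n n (\<lambda>ij. \<Sum>b'\<in>A. (X b' * coordinate \<epsilon> B (Y *\<^sub>v b') b'') $$ ij)" for A b''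
  have McL: "M A b'' \<in> commutant \<epsilon>" if "A \<subseteq> B" "b'' \<in> B" for A b''
    using finite_subset[OF that(1) fin] that(1)
  proof (induction A rule: finite_induct)
    case empty
    have "M {} b'' = 0\<^sub>m n n"
      by (rule eq_matI) (auto simp: M_def)
    then show ?case
      using commutant_zero[OF \<epsilon>] by (simp add: n_def)
  next
    case (insert a A)
    have P: "X a * coordinate \<epsilon> B (Y *\<^sub>v a) b'' \<in> commutant \<epsilon>"
      using insert.prems that(2) by (intro commutant_mult XL CL \<epsilon>) auto
    have "M (insert a A) b'' = X a * coordinate \<epsilon> B (Y *\<^sub>v a) b'' + M A b''"
      using insert.hyps commutant_carrier[OF P] by (intro eq_matI) (auto simp: M_def n_def)
    then show ?case
      using insert P by (auto intro: commutant_add[OF _ _ \<epsilon>])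
  qed
  have "combination \<epsilon> (M B) B = Y *\<^sub>v v"
  proof -
    have "combination \<epsilon> (M B) B $ p = (Y *\<^sub>v v) $ p" if p: "p < n" for p
    proof -
      have "(M B b'' *\<^sub>v b'') $ p = (\<Sum>b'\<in>B. (X b' * coordinate \<epsilon> B (Y *\<^sub>v b') b'' *\<^sub>v b'') $ p)" if b'': "b'' \<in> B" for b''
      proof -
        have b''c: "b'' \<in> carrier_vec n"
          using Bc b'' by blast
        have Pc: "X b' * coordinate \<epsilon> B (Y *\<^sub>v b') b'' \<in> carrier_mat n n" if "b' \<in> B" for b'
          using commutant_carrier[OF commutant_mult[OF XL[OF that] CL[OF that b''] \<epsilon>]] by (simp add: n_def)
        have "(M B b'' *\<^sub>v b'') $ p = (\<Sum>q<n. (\<Sum>b'\<in>B. (X b' * coordinate \<epsilon> B (Y *\<^sub>v b') b'') $$ (p, q)) * b'' $ q)"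
          using mult_mat_vec_entry[of "M B b''" n n b'' p] b''c p by (simp add: M_def)
        also have "\<dots> = (\<Sum>b'\<in>B. \<Sum>q<n. (X b' * coordinate \<epsilon> B (Y *\<^sub>v b') b'') $$ (p, q) * b'' $ q)"
          by (simp only: sum_distrib_right) (rule sum.swap)
        also have "\<dots> = (\<Sum>b'\<in>B. (X b' * coordinate \<epsilon> B (Y *\<^sub>v b') b'' *\<^sub>v b'') $ p)"
          using mult_mat_vec_entry[OF Pc b''c p] by simp
        finally show ?thesis .
      qed
      then have "combination \<epsilon> (M B) B $ p
          = (\<Sum>b''\<in>B. \<Sum>b'\<in>B. (X b' * coordinate \<epsilon> B (Y *\<^sub>v b') b'' *\<^sub>v b'') $ p)"
        using p by (simp add: combination_def n_def[symmetric])
      also have "\<dots> = (\<Sum>b'\<in>B. \<Sum>b''\<in>B. (X b' * coordinate \<epsilon> B (Y *\<^sub>v b') b'' *\<^sub>v b'') $ p)"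
        by (rule sum.swap)
      also have "\<dots> = (\<Sum>b'\<in>B. (Y * X b' *\<^sub>v b') $ p)"
      proof (rule sum.cong[OF refl])
        fix b' assume b': "b' \<in> B"
        have b'c: "b' \<in> carrier_vec n"
          using Bc b' by blast
        note Xc = commutant_carrier[OF XL[OF b'], folded n_def]
        have "(\<Sum>b''\<in>B. (X b' * coordinate \<epsilon> B (Y *\<^sub>v b') b'' *\<^sub>v b'') $ p)
            = combination \<epsilon> (\<lambda>b''. X b' * coordinate \<epsilon> B (Y *\<^sub>v b') b'') B $ p"
          using p by (simp add: combination_def n_def)
        also have "\<dots> = (X b' *\<^sub>v (Y *\<^sub>v b')) $ p"
          using combination_mult[of B \<epsilon> "coordinate \<epsilon> B (Y *\<^sub>v b')" "X b'"] Bc CL[OF b'] Xc Ybc[OF b']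
            combination_coordinate[OF B, of "Y *\<^sub>v b'"] by (simp add: n_def)
        also have "X b' *\<^sub>v (Y *\<^sub>v b') = Y * X b' *\<^sub>v b'"
          using assoc_mult_mat_vec[OF Xc Yc b'c] block_commutes[OF Y XL[OF b']] by simp
        finally show "(\<Sum>b''\<in>B. (X b' * coordinate \<epsilon> B (Y *\<^sub>v b') b'' *\<^sub>v b'') $ p) = (Y * X b' *\<^sub>v b') $ p" .
      qed
      also have "\<dots> = (Y *\<^sub>v combination \<epsilon> X B) $ p"
        using combination_mult[of B \<epsilon> X Y] Bc XL Yc p by (simp add: combination_def n_def)
      also have "combination \<epsilon> X B = v"
        unfolding X_def by (rule combination_coordinate[OF B v])
      finally show ?thesis .
    qed
    then show ?thesis
      using Yc by (intro eq_vecI) (auto simp: combination_def n_def)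
  qed
  then have "coordinate \<epsilon> B (Y *\<^sub>v v) b = M B b"
    using McL b by (intro coordinate_unique[OF \<epsilon> B]) auto
  then show ?thesis
    by (simp add: M_def X_def n_def)
qed

abbreviation EndG :: "('g \<Rightarrow> 'k) \<Rightarrow> ('k, 'k mat) module" where
  "EndG \<epsilon> \<equiv> End_G G (dimE \<epsilon>) (\<rho> \<epsilon>)"

lemma carrier_EndG: "carrier (EndG \<epsilon>) = commutant \<epsilon>"
  by (auto simp: End_G_def commutant_def intertwines_def)

lemma carrier_End_over: "carrier (End_over (EndG \<epsilon>) (dimE \<epsilon>)) = block \<epsilon>"
proof -
  have "carrier (End_over (EndG \<epsilon>) (dimE \<epsilon>)) = {Y \<in> carrier_mat (dimE \<epsilon>) (dimE \<epsilon>). \<forall>X\<in>commutant \<epsilon>. Y * X = X * Y}"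
    by (simp add: End_over_def carrier_EndG)
  also have "\<dots> = block \<epsilon>"
    unfolding block_def commutant_def mem_Collect_eq Ball_def by metis
  finally show ?thesis .
qed

lemma EndG_simps:
  "x \<otimes>\<^bsub>EndG \<epsilon>\<^esub> y = x * y" "x \<oplus>\<^bsub>EndG \<epsilon>\<^esub> y = x + y" "\<one>\<^bsub>EndG \<epsilon>\<^esub> = 1\<^sub>m (dimE \<epsilon>)"
  "\<zero>\<^bsub>EndG \<epsilon>\<^esub> = 0\<^sub>m (dimE \<epsilon>) (dimE \<epsilon>)" "c \<odot>\<^bsub>EndG \<epsilon>\<^esub> x = c \<cdot>\<^sub>m x"
  by (simp_all add: End_G_def module_mat_simps)

lemma End_over_simps:
  "x \<otimes>\<^bsub>End_over L n\<^esub> y = x * y" "x \<oplus>\<^bsub>End_over L n\<^esub> y = x + y" "\<one>\<^bsub>End_over L n\<^esub> = 1\<^sub>m n"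
  "\<zero>\<^bsub>End_over L n\<^esub> = 0\<^sub>m n n" "c \<odot>\<^bsub>End_over L n\<^esub> x = c \<cdot>\<^sub>m x"
  by (simp_all add: End_over_def module_mat_simps)

text \<open>The size is fixed in advance so that the empty sum makes sense. On the commutant these
  sums agree with the \<open>finsum\<close> that occurs in \<open>full_matrix_algebra\<close>, see
  \<open>finsum_EndG\<close>.\<close>

definition mat_sum :: "('g \<Rightarrow> 'k) \<Rightarrow> ('i \<Rightarrow> 'k mat) \<Rightarrow> 'i set \<Rightarrow> 'k mat" where
  "mat_sum \<epsilon> f A = mat (dimE \<epsilon>) (dimE \<epsilon>) (\<lambda>ij. \<Sum>a\<in>A. f a $$ ij)"

lemma mat_sum_carrier [simp]: "mat_sum \<epsilon> f A \<in> carrier_mat (dimE \<epsilon>) (dimE \<epsilon>)"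
  by (simp add: mat_sum_def)

lemma mat_sum_empty: "mat_sum \<epsilon> f {} = 0\<^sub>m (dimE \<epsilon>) (dimE \<epsilon>)"
  by (rule eq_matI) (auto simp: mat_sum_def)

lemma mat_sum_insert:
  assumes "finite A" "a \<notin> A" "\<And>b. b \<in> insert a A \<Longrightarrow> f b \<in> carrier_mat (dimE \<epsilon>) (dimE \<epsilon>)"
  shows "mat_sum \<epsilon> f (insert a A) = f a + mat_sum \<epsilon> f A"
  using assms by (intro eq_matI) (auto simp: mat_sum_def)

lemma mat_sum_cong: "(\<And>a. a \<in> A \<Longrightarrow> f a = g a) \<Longrightarrow> mat_sum \<epsilon> f A = mat_sum \<epsilon> g A"
  by (simp add: mat_sum_def)

lemma mat_sum_commutant:
  assumes "\<epsilon> \<in> chars" "finite A" "\<And>a. a \<in> A \<Longrightarrow> f a \<in> commutant \<epsilon>"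
  shows "mat_sum \<epsilon> f A \<in> commutant \<epsilon>"
  using assms(2,3)
proof (induction A rule: finite_induct)
  case empty
  then show ?case
    by (simp add: mat_sum_empty commutant_zero[OF assms(1)])
next
  case (insert a A)
  then show ?case
    using commutant_carrier[OF insert.prems]
    by (subst mat_sum_insert) (auto intro: commutant_add[OF _ _ assms(1)])
qed

lemma mat_sum_add:
  assumes "\<And>a. a \<in> A \<Longrightarrow> f a \<in> carrier_mat (dimE \<epsilon>) (dimE \<epsilon>)" "\<And>a. a \<in> A \<Longrightarrow> g a \<in> carrier_mat (dimE \<epsilon>) (dimE \<epsilon>)"
  shows "mat_sum \<epsilon> (\<lambda>a. f a + g a) A = mat_sum \<epsilon> f A + mat_sum \<epsilon> g A"
proof (rule eq_matI)
  fix i j assume "i < dim_row (mat_sum \<epsilon> f A + mat_sum \<epsilon> g A)" "j < dim_col (mat_sum \<epsilon> f A + mat_sum \<epsilon> g A)"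
  then have ij: "i < dimE \<epsilon>" "j < dimE \<epsilon>"
    by (auto simp: mat_sum_def)
  have "(f a + g a) $$ (i, j) = f a $$ (i, j) + g a $$ (i, j)" if "a \<in> A" for a
    using assms(2)[OF that] ij by simp
  then show "mat_sum \<epsilon> (\<lambda>a. f a + g a) A $$ (i, j) = (mat_sum \<epsilon> f A + mat_sum \<epsilon> g A) $$ (i, j)"
    using ij by (simp add: mat_sum_def sum.distrib)
qed (auto simp: mat_sum_def)

lemma mat_sum_mult:
  assumes "\<And>a. a \<in> A \<Longrightarrow> f a \<in> carrier_mat (dimE \<epsilon>) (dimE \<epsilon>)" "Z \<in> carrier_mat (dimE \<epsilon>) (dimE \<epsilon>)"
  shows "mat_sum \<epsilon> (\<lambda>a. Z * f a) A = Z * mat_sum \<epsilon> f A"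
proof (rule eq_matI)
  fix i j assume "i < dim_row (Z * mat_sum \<epsilon> f A)" "j < dim_col (Z * mat_sum \<epsilon> f A)"
  then have ij: "i < dimE \<epsilon>" "j < dimE \<epsilon>"
    using assms(2) by (auto simp: mat_sum_def)
  have "mat_sum \<epsilon> (\<lambda>a. Z * f a) A $$ (i, j) = (\<Sum>a\<in>A. \<Sum>k<dimE \<epsilon>. Z $$ (i, k) * f a $$ (k, j))"
    using ij mult_mat_entry[OF assms(2,1) ij] by (simp add: mat_sum_def)
  also have "\<dots> = (\<Sum>k<dimE \<epsilon>. \<Sum>a\<in>A. Z $$ (i, k) * f a $$ (k, j))"
    by (rule sum.swap)
  also have "\<dots> = (Z * mat_sum \<epsilon> f A) $$ (i, j)"
    unfolding mult_mat_entry[OF assms(2) mat_sum_carrier ij]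
    using ij by (simp add: mat_sum_def sum_distrib_left)
  finally show "mat_sum \<epsilon> (\<lambda>a. Z * f a) A $$ (i, j) = (Z * mat_sum \<epsilon> f A) $$ (i, j)" .
qed (use assms(2) in \<open>auto simp: mat_sum_def\<close>)

lemma finsum_EndG:
  assumes "\<epsilon> \<in> chars" "finite A" "\<And>a. a \<in> A \<Longrightarrow> f a \<in> commutant \<epsilon>"
  shows "finsum (EndG \<epsilon>) f A = mat_sum \<epsilon> f A"
proof -
  interpret R: abelian_monoid "EndG \<epsilon>"
  proof (rule abelian_monoidI)
    fix x y z assume "x \<in> carrier (EndG \<epsilon>)" "y \<in> carrier (EndG \<epsilon>)" "z \<in> carrier (EndG \<epsilon>)"
    then have c: "x \<in> commutant \<epsilon>" "y \<in> commutant \<epsilon>" "z \<in> commutant \<epsilon>"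
      by (simp_all add: carrier_EndG)
    note cm = c[THEN commutant_carrier]
    show "x \<oplus>\<^bsub>EndG \<epsilon>\<^esub> y \<in> carrier (EndG \<epsilon>)"
      by (simp only: EndG_simps carrier_EndG) (intro commutant_add c assms(1))
    show "x \<oplus>\<^bsub>EndG \<epsilon>\<^esub> y \<oplus>\<^bsub>EndG \<epsilon>\<^esub> z = x \<oplus>\<^bsub>EndG \<epsilon>\<^esub> (y \<oplus>\<^bsub>EndG \<epsilon>\<^esub> z)"
      unfolding EndG_simps by (rule assoc_add_mat[OF cm])
    show "x \<oplus>\<^bsub>EndG \<epsilon>\<^esub> y = y \<oplus>\<^bsub>EndG \<epsilon>\<^esub> x"
      unfolding EndG_simps by (rule comm_add_mat[OF cm(1,2)])
    show "\<zero>\<^bsub>EndG \<epsilon>\<^esub> \<oplus>\<^bsub>EndG \<epsilon>\<^esub> x = x"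
      unfolding EndG_simps by (rule left_add_zero_mat[OF cm(1)])
  qed (simp add: EndG_simps carrier_EndG commutant_zero[OF assms(1)])
  show ?thesis
    using assms(2,3)
  proof (induction A rule: finite_induct)
    case empty
    then show ?case
      by (simp add: EndG_simps mat_sum_empty)
  next
    case (insert a A)
    then have "finsum (EndG \<epsilon>) f (insert a A) = f a + mat_sum \<epsilon> f A"
      by (subst R.finsum_insert) (auto simp: carrier_EndG EndG_simps)
    then show ?case
      using insert.hyps mat_sum_insert[of A a f \<epsilon>] commutant_carrier[OF insert.prems] by simp
  qed
qed

lemma opposite_iso_mat_sum:
  assumes "\<epsilon> \<in> chars" "opposite_iso \<epsilon> \<tau>" "finite A" "\<And>a. a \<in> A \<Longrightarrow> f a \<in> commutant \<epsilon>"
  shows "\<tau> (mat_sum \<epsilon> f A) = mat_sum \<epsilon> (\<lambda>a. \<tau> (f a)) A"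
  using assms(3,4)
proof (induction A rule: finite_induct)
  case empty
  \<comment> \<open>The value of \<open>\<tau>\<close> at zero is obtained from homogeneity.\<close>
  have "0 \<cdot>\<^sub>m 1\<^sub>m (dimE \<epsilon>) = (0\<^sub>m (dimE \<epsilon>) (dimE \<epsilon>) :: 'k mat)"
    by (rule eq_matI) auto
  then have "\<tau> (0\<^sub>m (dimE \<epsilon>) (dimE \<epsilon>)) = 0\<^sub>m (dimE \<epsilon>) (dimE \<epsilon>)"
    using assms(2) commutant_one[OF assms(1)] unfolding opposite_iso_def by metis
  then show ?case
    by (simp add: mat_sum_empty)
next
  case (insert a A)
  have \<tau>c: "\<tau> X \<in> carrier_mat (dimE \<epsilon>) (dimE \<epsilon>)" if "X \<in> commutant \<epsilon>" for X
    using assms(2) that commutant_carrier by (auto simp: opposite_iso_def bij_betw_def)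
  have "mat_sum \<epsilon> f (insert a A) = f a + mat_sum \<epsilon> f A"
    using insert.hyps commutant_carrier[OF insert.prems] by (intro mat_sum_insert) auto
  moreover have "mat_sum \<epsilon> (\<lambda>a. \<tau> (f a)) (insert a A) = \<tau> (f a) + mat_sum \<epsilon> (\<lambda>a. \<tau> (f a)) A"
    using insert \<tau>c by (intro mat_sum_insert) auto
  moreover have "mat_sum \<epsilon> f A \<in> commutant \<epsilon>"
    using insert by (intro mat_sum_commutant[OF assms(1)]) auto
  ultimately show ?case
    using insert assms(2) by (simp add: opposite_iso_def)
qed

lemma full_matrix_algebra_carrier:
  "A \<in> carrier (full_matrix_algebra m (EndG \<epsilon>)) \<longleftrightarrow>
    A \<in> carrier_mat m m \<and> (\<forall>i<m. \<forall>j<m. A $$ (i, j) \<in> commutant \<epsilon>)"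
  by (auto simp: full_matrix_algebra_def elements_mat_def carrier_EndG UN_subset_iff image_subset_iff)

lemma coordinate_basis:
  assumes \<epsilon>: "\<epsilon> \<in> chars" and B: "commutant_basis \<epsilon> B" and b: "b \<in> B" "b' \<in> B"
  shows "coordinate \<epsilon> B b b' = (if b' = b then 1\<^sub>m (dimE \<epsilon>) else 0\<^sub>m (dimE \<epsilon>) (dimE \<epsilon>))"
proof (rule coordinate_unique[OF \<epsilon> B _ _ b(2)])
  let ?X = "\<lambda>b'. if b' = b then 1\<^sub>m (dimE \<epsilon>) else 0\<^sub>m (dimE \<epsilon>) (dimE \<epsilon>) :: 'k mat"
  have fin: "finite B" and Bc: "B \<subseteq> carrier_vec (dimE \<epsilon>)"
    using B by (auto simp: commutant_basis_def)
  show "combination \<epsilon> ?X B = b"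
  proof (rule eq_vecI)
    have bc: "b \<in> carrier_vec (dimE \<epsilon>)"
      using b(1) Bc by blast
    fix p assume "p < dim_vec b"
    then have p: "p < dimE \<epsilon>"
      using bc by simp
    have "(?X b' *\<^sub>v b') $ p = (if b' = b then b $ p else 0)" if "b' \<in> B" for b'
    proof -
      have "b' \<in> carrier_vec (dimE \<epsilon>)"
        using that Bc by blast
      then show ?thesis
        using p by (cases "b' = b") (simp_all add: zero_mult_mat_vec del: index_mult_mat_vec)
    qed
    then show "combination \<epsilon> ?X B $ p = b $ p"
      using p b(1) fin by (simp add: combination_def)
  qed (use b(1) Bc in \<open>auto simp: combination_def\<close>)
qed (auto simp: commutant_one[OF \<epsilon>] commutant_zero[OF \<epsilon>])

text \<open>An endomorphism that commutes with the commutant \<open>L\<close> corresponds to its matrix with respect to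
  an \<open>L\<close>-basis; composition of endomorphisms yields the product over the opposite of \<open>L\<close>, whence the
  use of \<open>\<tau>\<close>.\<close>

lemma block_full_matrix_iso:
  assumes \<epsilon>: "\<epsilon> \<in> chars"
  obtains m \<theta> where "m > 0" "\<theta> \<in> algebra_isos (End_over (EndG \<epsilon>) (dimE \<epsilon>)) (full_matrix_algebra m (EndG \<epsilon>))"
proof -
  define n where "n = dimE \<epsilon>"
  obtain \<tau> where \<tau>: "opposite_iso \<epsilon> \<tau>"
    by (rule opposite_iso_exists[OF \<epsilon>])
  obtain B where B: "commutant_basis \<epsilon> B"
    by (rule commutant_basis_exists[OF \<epsilon>])
  have fin: "finite B" and Bc: "B \<subseteq> carrier_vec n"
    using B by (auto simp: commutant_basis_def n_def)
  have \<tau>_bij: "bij_betw \<tau> (commutant \<epsilon>) (commutant \<epsilon>)" and \<tau>_one: "\<tau> (1\<^sub>m n) = 1\<^sub>m n"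
    and \<tau>_add: "\<And>X Y. X \<in> commutant \<epsilon> \<Longrightarrow> Y \<in> commutant \<epsilon> \<Longrightarrow> \<tau> (X + Y) = \<tau> X + \<tau> Y"
    and \<tau>_mult: "\<And>X Y. X \<in> commutant \<epsilon> \<Longrightarrow> Y \<in> commutant \<epsilon> \<Longrightarrow> \<tau> (X * Y) = \<tau> Y * \<tau> X"
    and \<tau>_smult: "\<And>c X. X \<in> commutant \<epsilon> \<Longrightarrow> \<tau> (c \<cdot>\<^sub>m X) = c \<cdot>\<^sub>m \<tau> X"
    using \<tau> by (auto simp: opposite_iso_def n_def)
  have \<tau>_in: "\<tau> X \<in> commutant \<epsilon>" if "X \<in> commutant \<epsilon>" for X
    using \<tau>_bij that by (auto simp: bij_betw_def)
  define m where "m = card B"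
  obtain e where e: "bij_betw e {..<m} B"
    using ex_bij_betw_nat_finite[OF fin] by (auto simp: m_def lessThan_atLeast0)
  have eB: "e i \<in> B" if "i < m" for i
    using e that by (auto simp: bij_betw_def)
  have ec: "e i \<in> carrier_vec n" if "i < m" for i
    using eB[OF that] Bc by blast
  have e_eq: "e i = e j \<longleftrightarrow> i = j" if "i < m" "j < m" for i j
    using e that by (auto simp: bij_betw_def inj_on_def)
  have n: "n > 0"
    using irreducible_pos[OF irr[OF \<epsilon>]] by (simp add: n_def)
  \<comment> \<open>\<open>E\<close> is not zero, so its basis is not empty.\<close>
  have "m > 0"
  proof (rule ccontr)
    assume "\<not> m > 0"
    then have "B = {}"
      using fin by (simp add: m_def)
    have "combination \<epsilon> X {} = 0\<^sub>v n" for X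
      by (rule eq_vecI) (auto simp: combination_def n_def)
    moreover have "\<exists>X. combination \<epsilon> X B = unit_vec n 0"
      using B unfolding commutant_basis_def n_def by (metis unit_vec_carrier)
    ultimately show False
      using n \<open>B = {}\<close> by (metis unit_vec_nonzero)
  qed
  define \<kappa> where "\<kappa> v i = coordinate \<epsilon> B v (e i)" for v i
  have \<kappa>L: "\<kappa> v i \<in> commutant \<epsilon>" if "v \<in> carrier_vec n" "i < m" for v i
    unfolding \<kappa>_def using coordinate_commutant[OF B _ eB] that by (simp add: n_def)
  have \<kappa>_add: "\<kappa> (v + w) i = \<kappa> v i + \<kappa> w i" if "v \<in> carrier_vec n" "w \<in> carrier_vec n" "i < m" for v w i
    unfolding \<kappa>_def using coordinate_add[OF \<epsilon> B _ _ eB] that by (simp add: n_def)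
  have \<kappa>_mult: "\<kappa> (Z *\<^sub>v v) i = Z * \<kappa> v i" if "v \<in> carrier_vec n" "Z \<in> commutant \<epsilon>" "i < m" for v Z i
    unfolding \<kappa>_def using coordinate_mult[OF \<epsilon> B _ _ eB] that by (simp add: n_def)
  have scal: "c \<cdot>\<^sub>m 1\<^sub>m n \<in> commutant \<epsilon>" for c
    unfolding n_def by (intro commutant_smult commutant_one \<epsilon>)
  have \<kappa>_smult: "\<kappa> (c \<cdot>\<^sub>v v) i = c \<cdot>\<^sub>m \<kappa> v i" if "v \<in> carrier_vec n" "i < m" for c v i
    using \<kappa>_mult[OF that(1) scal that(2), of c] commutant_carrier[OF \<kappa>L[OF that]] that(1)
    by (simp add: smult_as_mult_mat_vec mult_smult_assoc_mat[of _ n n _ n] n_def[symmetric])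
  have \<kappa>_inj: "v = w" if "v \<in> carrier_vec n" "w \<in> carrier_vec n" "\<And>i. i < m \<Longrightarrow> \<kappa> v i = \<kappa> w i" for v w
  proof -
    have "coordinate \<epsilon> B v b = coordinate \<epsilon> B w b" if "b \<in> B" for b
    proof -
      obtain i where "i < m" "b = e i"
        using e \<open>b \<in> B\<close> by (auto simp: bij_betw_def)
      then show ?thesis
        using \<open>\<And>i. i < m \<Longrightarrow> \<kappa> v i = \<kappa> w i\<close> by (simp add: \<kappa>_def)
    qed
    then have "combination \<epsilon> (coordinate \<epsilon> B v) B = combination \<epsilon> (coordinate \<epsilon> B w) B"
      by (rule combination_cong)
    then show ?thesis
      using combination_coordinate[OF B] that(1,2) by (simp add: n_def)
  qed
  have \<kappa>_e: "\<kappa> (e j) i = (if i = j then 1\<^sub>m n else 0\<^sub>m n n)" if "i < m" "j < m" for i j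
    unfolding \<kappa>_def coordinate_basis[OF \<epsilon> B eB[OF that(2)] eB[OF that(1)]]
    using e_eq that by (simp add: n_def)
  have Yv: "Y *\<^sub>v v \<in> carrier_vec n" if "Y \<in> block \<epsilon>" "v \<in> carrier_vec n" for Y v
    using block_carrier[OF that(1)] that(2) by (intro mult_mat_vec_carrier) (auto simp: n_def)
  have \<kappa>_block: "\<kappa> (Y *\<^sub>v v) i = mat_sum \<epsilon> (\<lambda>k. \<kappa> v k * \<kappa> (Y *\<^sub>v e k) i) {..<m}"
    if "Y \<in> block \<epsilon>" "v \<in> carrier_vec n" "i < m" for Y v i
  proof -
    have "(\<Sum>b\<in>B. (coordinate \<epsilon> B v b * coordinate \<epsilon> B (Y *\<^sub>v b) (e i)) $$ pq)
        = (\<Sum>k<m. (\<kappa> v k * \<kappa> (Y *\<^sub>v e k) i) $$ pq)" for pq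
      unfolding \<kappa>_def by (rule sum.reindex_bij_betw[OF e, symmetric])
    then show ?thesis
      using block_mult_combination[OF \<epsilon> B _ that(1) eB[OF that(3)], of v] that(2)
      by (simp add: mat_sum_def \<kappa>_def n_def)
  qed
  have \<kappa>_mult_in: "\<kappa> v k * \<kappa> w i \<in> commutant \<epsilon>" if "v \<in> carrier_vec n" "w \<in> carrier_vec n" "k < m" "i < m" for v w k i
    by (intro commutant_mult \<kappa>L that \<epsilon>)
  \<comment> \<open>Column \<open>j\<close> lists the coordinates of the image of the basis vector
    \<open>e j\<close>, each moved to the opposite algebra by \<open>\<tau>\<close>.\<close>
  define \<theta> where "\<theta> Y = mat m m (\<lambda>(i, j). \<tau> (\<kappa> (Y *\<^sub>v e j) i))" for Y
  let ?F = "full_matrix_algebra m (EndG \<epsilon>)"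
  have \<theta>_in: "\<theta> Y \<in> carrier ?F" if "Y \<in> block \<epsilon>" for Y
    using \<tau>_in \<kappa>L Yv[OF that ec] by (auto simp: full_matrix_algebra_carrier \<theta>_def)
  have \<theta>_mult: "\<theta> (Y * Z) = \<theta> Y \<otimes>\<^bsub>?F\<^esub> \<theta> Z" if Y: "Y \<in> block \<epsilon>" and Z: "Z \<in> block \<epsilon>" for Y Z
  proof -
    \<comment> \<open>Without \<open>\<tau>\<close> the entries of \<open>Z\<close> would stand to
      the left of those of \<open>Y\<close>; the anti-automorphism exchanges them, which gives a
      genuine matrix product.\<close>
    have "\<tau> (\<kappa> (Y * Z *\<^sub>v e j) i) = finsum (EndG \<epsilon>) (\<lambda>k. \<tau> (\<kappa> (Y *\<^sub>v e k) i) * \<tau> (\<kappa> (Z *\<^sub>v e j) k)) {..<m}"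
      if ij: "i < m" "j < m" for i j
    proof -
      have "Y * Z *\<^sub>v e j = Y *\<^sub>v (Z *\<^sub>v e j)"
        using block_carrier[OF Y] block_carrier[OF Z] ec[OF ij(2)] by (intro assoc_mult_mat_vec) (auto simp: n_def)
      then have "\<kappa> (Y * Z *\<^sub>v e j) i = mat_sum \<epsilon> (\<lambda>k. \<kappa> (Z *\<^sub>v e j) k * \<kappa> (Y *\<^sub>v e k) i) {..<m}"
        using \<kappa>_block[OF Y Yv[OF Z ec[OF ij(2)]] ij(1)] by simp
      then have "\<tau> (\<kappa> (Y * Z *\<^sub>v e j) i) = mat_sum \<epsilon> (\<lambda>k. \<tau> (\<kappa> (Z *\<^sub>v e j) k * \<kappa> (Y *\<^sub>v e k) i)) {..<m}"
        using opposite_iso_mat_sum[OF \<epsilon> \<tau>, of "{..<m}" "\<lambda>k. \<kappa> (Z *\<^sub>v e j) k * \<kappa> (Y *\<^sub>v e k) i"]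
          \<kappa>_mult_in Yv[OF Z] Yv[OF Y] ec ij by simp
      also have "\<dots> = mat_sum \<epsilon> (\<lambda>k. \<tau> (\<kappa> (Y *\<^sub>v e k) i) * \<tau> (\<kappa> (Z *\<^sub>v e j) k)) {..<m}"
        using \<kappa>L Yv[OF Z] Yv[OF Y] ec ij by (intro mat_sum_cong \<tau>_mult) auto
      also have "\<dots> = finsum (EndG \<epsilon>) (\<lambda>k. \<tau> (\<kappa> (Y *\<^sub>v e k) i) * \<tau> (\<kappa> (Z *\<^sub>v e j) k)) {..<m}"
        using \<kappa>L Yv[OF Z] Yv[OF Y] ec ij \<tau>_in by (intro finsum_EndG[symmetric] \<epsilon> commutant_mult) auto
      finally show ?thesis .
    qed
    moreover have "finsum (EndG \<epsilon>) (\<lambda>k. \<theta> Y $$ (i, k) * \<theta> Z $$ (k, j)) {..<m}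
        = finsum (EndG \<epsilon>) (\<lambda>k. \<tau> (\<kappa> (Y *\<^sub>v e k) i) * \<tau> (\<kappa> (Z *\<^sub>v e j) k)) {..<m}" if ij: "i < m" "j < m" for i j
    proof -
      have "mat_sum \<epsilon> (\<lambda>k. \<theta> Y $$ (i, k) * \<theta> Z $$ (k, j)) {..<m} = mat_sum \<epsilon> (\<lambda>k. \<tau> (\<kappa> (Y *\<^sub>v e k) i) * \<tau> (\<kappa> (Z *\<^sub>v e j) k)) {..<m}"
        using ij by (intro mat_sum_cong) (simp add: \<theta>_def)
      moreover have "\<theta> Y $$ (i, k) \<in> commutant \<epsilon>" "\<theta> Z $$ (k, j) \<in> commutant \<epsilon>"
        "\<tau> (\<kappa> (Y *\<^sub>v e k) i) \<in> commutant \<epsilon>" "\<tau> (\<kappa> (Z *\<^sub>v e j) k) \<in> commutant \<epsilon>" if "k \<in> {..<m}" for k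
        using that \<theta>_in[OF Y] \<theta>_in[OF Z] ij \<tau>_in \<kappa>L Yv[OF Z] Yv[OF Y] ec by (auto simp: full_matrix_algebra_carrier)
      ultimately show ?thesis
        by (subst (1 2) finsum_EndG[OF \<epsilon>]) (auto intro: commutant_mult[OF _ _ \<epsilon>])
    qed
    ultimately show ?thesis
      by (intro eq_matI) (auto simp: full_matrix_algebra_def EndG_simps, auto simp: \<theta>_def)
  qed
  have \<theta>_add: "\<theta> (Y + Z) = \<theta> Y \<oplus>\<^bsub>?F\<^esub> \<theta> Z" if Y: "Y \<in> block \<epsilon>" and Z: "Z \<in> block \<epsilon>" for Y Z
  proof -
    have "\<tau> (\<kappa> ((Y + Z) *\<^sub>v e j) i) = \<tau> (\<kappa> (Y *\<^sub>v e j) i) + \<tau> (\<kappa> (Z *\<^sub>v e j) i)" if "i < m" "j < m" for i j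
      using add_mult_distrib_mat_vec[of Y n n Z "e j"] block_carrier[OF Y] block_carrier[OF Z] ec that
        \<kappa>_add Yv[OF Y] Yv[OF Z] \<tau>_add \<kappa>L by (simp add: n_def)
    then show ?thesis
      by (intro eq_matI) (auto simp: full_matrix_algebra_def EndG_simps \<theta>_def)
  qed
  have \<theta>_smult: "\<theta> (c \<cdot>\<^sub>m Y) = c \<odot>\<^bsub>?F\<^esub> \<theta> Y" if Y: "Y \<in> block \<epsilon>" for c Y
  proof -
    have "\<tau> (\<kappa> ((c \<cdot>\<^sub>m Y) *\<^sub>v e j) i) = c \<cdot>\<^sub>m \<tau> (\<kappa> (Y *\<^sub>v e j) i)" if ij: "i < m" "j < m" for i j
    proof -
      note Yc = block_carrier[OF Y, folded n_def]
      have "(c \<cdot>\<^sub>m Y) *\<^sub>v e j = (c \<cdot>\<^sub>m 1\<^sub>m n * Y) *\<^sub>v e j"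
        using Yc by (simp add: mult_smult_assoc_mat[of _ n n _ n])
      also have "\<dots> = (c \<cdot>\<^sub>m 1\<^sub>m n) *\<^sub>v (Y *\<^sub>v e j)"
        using Yc ec[OF ij(2)] by (intro assoc_mult_mat_vec) auto
      also have "\<dots> = c \<cdot>\<^sub>v (Y *\<^sub>v e j)"
        by (rule smult_as_mult_mat_vec[OF Yv[OF Y ec[OF ij(2)]]])
      finally show ?thesis
        using \<kappa>_smult[OF Yv[OF Y ec[OF ij(2)]] ij(1)] \<tau>_smult \<kappa>L[OF Yv[OF Y ec[OF ij(2)]] ij(1)] by simp
    qed
    then show ?thesis
      by (intro eq_matI) (auto simp: full_matrix_algebra_def EndG_simps \<theta>_def)
  qed
  have \<tau>_zero: "\<tau> (0\<^sub>m n n) = 0\<^sub>m n n"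
    using opposite_iso_mat_sum[OF \<epsilon> \<tau>, of "{}"] by (simp add: mat_sum_empty n_def)
  have \<theta>_one: "\<theta> (1\<^sub>m n) = \<one>\<^bsub>?F\<^esub>"
  proof -
    have "\<tau> (\<kappa> (1\<^sub>m n *\<^sub>v e j) i) = (if i = j then 1\<^sub>m n else 0\<^sub>m n n)" if "i < m" "j < m" for i j
      using ec[OF that(2)] \<kappa>_e[OF that] by (simp add: \<tau>_one \<tau>_zero)
    then show ?thesis
      by (intro eq_matI) (auto simp: full_matrix_algebra_def EndG_simps \<theta>_def n_def)
  qed
  have "inj_on \<theta> (block \<epsilon>)"
  proof (rule inj_onI)
    fix Y Z assume Y: "Y \<in> block \<epsilon>" and Z: "Z \<in> block \<epsilon>" and eq: "\<theta> Y = \<theta> Z"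
    have \<kappa>eq: "\<kappa> (Y *\<^sub>v e k) i = \<kappa> (Z *\<^sub>v e k) i" if ik: "i < m" "k < m" for i k
    proof -
      have "\<tau> (\<kappa> (Y *\<^sub>v e k) i) = \<tau> (\<kappa> (Z *\<^sub>v e k) i)"
        using arg_cong[OF eq, of "\<lambda>M. M $$ (i, k)"] ik by (simp add: \<theta>_def)
      then show ?thesis
        using \<tau>_bij \<kappa>L[OF Yv[OF Y ec[OF ik(2)]] ik(1)] \<kappa>L[OF Yv[OF Z ec[OF ik(2)]] ik(1)]
        by (auto simp: bij_betw_def dest: inj_onD)
    qed
    show "Y = Z"
    proof (rule mat_eq_mult_vecI[OF block_carrier[OF Y] block_carrier[OF Z]])
      fix v :: "'k vec" assume "v \<in> carrier_vec (dimE \<epsilon>)"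
      then have v: "v \<in> carrier_vec n"
        by (simp add: n_def)
      show "Y *\<^sub>v v = Z *\<^sub>v v"
      proof (rule \<kappa>_inj[OF Yv[OF Y v] Yv[OF Z v]])
        fix i assume i: "i < m"
        show "\<kappa> (Y *\<^sub>v v) i = \<kappa> (Z *\<^sub>v v) i"
          unfolding \<kappa>_block[OF Y v i] \<kappa>_block[OF Z v i]
          by (rule mat_sum_cong) (simp add: \<kappa>eq i)
      qed
    qed
  qed
  moreover have "\<exists>Y\<in>block \<epsilon>. \<theta> Y = A" if A: "A \<in> carrier ?F" for A
  proof -
    \<comment> \<open>Surjectivity: undoing \<open>\<tau>\<close> on the entries of \<open>A\<close>
      prescribes the coordinates of the images of the basis vectors, and \<open>F\<close> is the
      extension that is linear over the commutant.\<close>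
    define a where "a i j = the_inv_into (commutant \<epsilon>) \<tau> (A $$ (i, j))" for i j
    have AL: "A $$ (i, j) \<in> commutant \<epsilon>" if "i < m" "j < m" for i j
      using A that by (simp add: full_matrix_algebra_carrier)
    have aL: "a i j \<in> commutant \<epsilon>" and \<tau>a: "\<tau> (a i j) = A $$ (i, j)" if "i < m" "j < m" for i j
      using \<tau>_bij AL[OF that] by (auto simp: a_def bij_betw_def f_the_inv_into_f intro!: the_inv_into_into)
    define idx where "idx = the_inv_into {..<m} e"
    have idx: "idx b < m" "e (idx b) = b" if "b \<in> B" for b
      using e that the_inv_into_into[of e "{..<m}" b "{..<m}"]
      by (auto simp: idx_def bij_betw_def f_the_inv_into_f)
    have idx_e: "idx (e i) = i" if "i < m" for i
      using e that by (auto simp: idx_def bij_betw_def the_inv_into_f_f)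
    define X where "X v b = mat_sum \<epsilon> (\<lambda>j. \<kappa> v j * a (idx b) j) {..<m}" for v b
    have prodL: "\<kappa> v j * a (idx b) j \<in> commutant \<epsilon>" if "v \<in> carrier_vec n" "b \<in> B" "j < m" for v b j
      using that idx by (intro commutant_mult \<kappa>L aL \<epsilon>) auto
    have XL: "X v b \<in> commutant \<epsilon>" if "v \<in> carrier_vec n" "b \<in> B" for v b
      unfolding X_def using prodL that by (intro mat_sum_commutant \<epsilon>) auto
    define F where "F v = combination \<epsilon> (X v) B" for v
    have Fc: "F v \<in> carrier_vec n" for v
      by (simp add: F_def n_def)
    have Bc': "B \<subseteq> carrier_vec (dimE \<epsilon>)"
      using Bc by (simp add: n_def)
    have F_add: "F (v + w) = F v + F w" if v: "v \<in> carrier_vec n" and w: "w \<in> carrier_vec n" for v w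
    proof -
      have "X (v + w) b = X v b + X w b" if b: "b \<in> B" for b
      proof -
        have "X (v + w) b = mat_sum \<epsilon> (\<lambda>j. \<kappa> v j * a (idx b) j + \<kappa> w j * a (idx b) j) {..<m}"
          unfolding X_def
        proof (rule mat_sum_cong)
          fix j assume "j \<in> {..<m}"
          then have j: "j < m"
            by simp
          show "\<kappa> (v + w) j * a (idx b) j = \<kappa> v j * a (idx b) j + \<kappa> w j * a (idx b) j"
            unfolding \<kappa>_add[OF v w j]
            by (rule add_mult_distrib_mat[OF commutant_carrier[OF \<kappa>L[OF v j]] commutant_carrier[OF \<kappa>L[OF w j]]
                  commutant_carrier[OF aL[OF idx(1)[OF b] j]]])
        qed
        also have "\<dots> = X v b + X w b"
          unfolding X_def using prodL v w b commutant_carrier by (intro mat_sum_add) auto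
        finally show ?thesis .
      qed
      then have "F (v + w) = combination \<epsilon> (\<lambda>b. X v b + X w b) B"
        unfolding F_def by (rule combination_cong)
      then show ?thesis
        unfolding F_def using XL v w by (simp add: combination_add[OF Bc'])
    qed
    have F_mult: "F (Z *\<^sub>v v) = Z *\<^sub>v F v" if Z: "Z \<in> commutant \<epsilon>" and v: "v \<in> carrier_vec n" for Z v
    proof -
      note Zc = commutant_carrier[OF Z, folded n_def]
      have "X (Z *\<^sub>v v) b = Z * X v b" if b: "b \<in> B" for b
      proof -
        have "X (Z *\<^sub>v v) b = mat_sum \<epsilon> (\<lambda>j. Z * (\<kappa> v j * a (idx b) j)) {..<m}"
          unfolding X_def
        proof (rule mat_sum_cong)
          fix j assume "j \<in> {..<m}"
          then have j: "j < m"
            by simp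
          show "\<kappa> (Z *\<^sub>v v) j * a (idx b) j = Z * (\<kappa> v j * a (idx b) j)"
            unfolding \<kappa>_mult[OF v Z j]
            by (rule assoc_mult_mat[OF commutant_carrier[OF Z] commutant_carrier[OF \<kappa>L[OF v j]]
                  commutant_carrier[OF aL[OF idx(1)[OF b] j]]])
        qed
        also have "\<dots> = Z * X v b"
          unfolding X_def using prodL v b commutant_carrier Zc by (intro mat_sum_mult) (auto simp: n_def)
        finally show ?thesis .
      qed
      then have "F (Z *\<^sub>v v) = combination \<epsilon> (\<lambda>b. Z * X v b) B"
        unfolding F_def by (rule combination_cong)
      then show ?thesis
        unfolding F_def using XL v Zc by (subst combination_mult[OF Bc']) (auto simp: n_def)
    qed
    have F_smult: "F (c \<cdot>\<^sub>v v) = c \<cdot>\<^sub>v F v" if v: "v \<in> carrier_vec n" for c v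
      using F_mult[OF scal v, of c] smult_as_mult_mat_vec[OF v, of c] smult_as_mult_mat_vec[OF Fc, of c] by simp
    obtain Y where Yc: "Y \<in> carrier_mat n n" and YF: "\<And>v. v \<in> carrier_vec n \<Longrightarrow> Y *\<^sub>v v = F v"
      using linear_map_matrix[of n F n] Fc F_add F_smult by blast
    \<comment> \<open>Linearity of \<open>F\<close> over the commutant says exactly that its matrix
      belongs to the block.\<close>
    have "Z * Y = Y * Z" if Z: "Z \<in> commutant \<epsilon>" for Z
    proof -
      note Zc = commutant_carrier[OF Z, folded n_def]
      show ?thesis
      proof (rule mat_eq_mult_vecI[OF mult_carrier_mat[OF Zc Yc] mult_carrier_mat[OF Yc Zc]])
        fix v :: "'k vec" assume v: "v \<in> carrier_vec n"
        show "Z * Y *\<^sub>v v = Y * Z *\<^sub>v v"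
          unfolding assoc_mult_mat_vec[OF Zc Yc v] assoc_mult_mat_vec[OF Yc Zc v] YF[OF v]
            YF[OF mult_mat_vec_carrier[OF Zc v]]
          by (rule F_mult[OF Z v, symmetric])
      qed
    qed
    then have Y: "Y \<in> block \<epsilon>"
      using Yc by (simp add: block_def commutant_def n_def)
    have "\<tau> (\<kappa> (Y *\<^sub>v e j) i) = A $$ (i, j)" if ij: "i < m" "j < m" for i j
    proof -
      have "\<kappa> (F (e j)) i = X (e j) (e i)"
        unfolding \<kappa>_def F_def using XL[OF ec[OF ij(2)]] eB[OF ij(1)] by (intro coordinate_unique[OF \<epsilon> B]) auto
      also have "\<dots> = mat_sum \<epsilon> (\<lambda>k. if k = j then a i j else 0\<^sub>m n n) {..<m}"
        unfolding X_def idx_e[OF ij(1)]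
        using ij left_mult_one_mat[OF commutant_carrier[OF aL], folded n_def]
          left_mult_zero_mat[OF commutant_carrier[OF aL], folded n_def]
        by (intro mat_sum_cong) (auto simp: \<kappa>_e)
      also have "\<dots> = a i j"
      proof (rule eq_matI)
        note ac = commutant_carrier[OF aL[OF ij]]
        fix p q assume "p < dim_row (a i j)" "q < dim_col (a i j)"
        then have pq: "p < n" "q < n"
          using ac by (auto simp: n_def)
        have "(\<Sum>k<m. (if k = j then a i j else 0\<^sub>m n n) $$ (p, q)) = (\<Sum>k<m. if k = j then a i j $$ (p, q) else 0)"
          using pq by (intro sum.cong) auto
        then show "mat_sum \<epsilon> (\<lambda>k. if k = j then a i j else 0\<^sub>m n n) {..<m} $$ (p, q) = a i j $$ (p, q)"
          using pq ij by (simp add: mat_sum_def n_def)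
      qed (use commutant_carrier[OF aL[OF ij]] in \<open>auto simp: mat_sum_def\<close>)
      finally show ?thesis
        using YF[OF ec[OF ij(2)]] \<tau>a[OF ij] by simp
    qed
    moreover have "A \<in> carrier_mat m m"
      using A by (simp add: full_matrix_algebra_carrier)
    ultimately have "\<theta> Y = A"
      by (intro eq_matI) (auto simp: \<theta>_def)
    then show ?thesis
      using Y by blast
  qed
  ultimately have "bij_betw \<theta> (block \<epsilon>) (carrier ?F)"
    using \<theta>_in by (auto simp: bij_betw_def)
  moreover have "\<theta> \<in> Ring.ring_hom (End_over (EndG \<epsilon>) (dimE \<epsilon>)) ?F"
    using \<theta>_in \<theta>_mult \<theta>_add \<theta>_one
    by (intro ring_hom_memI) (simp_all add: carrier_End_over End_over_simps n_def)
  moreover have "\<theta> \<in> module_hom class_ring (End_over (EndG \<epsilon>) (dimE \<epsilon>)) ?F"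
    using \<theta>_in \<theta>_add \<theta>_smult by (auto simp: module_hom_def carrier_End_over End_over_simps)
  ultimately have "\<theta> \<in> algebra_isos (End_over (EndG \<epsilon>) (dimE \<epsilon>)) ?F"
    by (simp add: algebra_isos_def algebra_homs_def carrier_End_over)
  with \<open>m > 0\<close> show ?thesis
    by (rule that)
qed

end

section \<open>The minimal ideals of KG\<close>

section \<open>The ideals\<close>

lemma algebra_isos_compose:
  assumes "f \<in> algebra_isos A B" "g \<in> algebra_isos B C"
  shows "(\<lambda>x. g (f x)) \<in> algebra_isos A C"
proof -
  have f: "f \<in> Ring.ring_hom A B" "f \<in> module_hom class_ring A B" "bij_betw f (carrier A) (carrier B)"
    and g: "g \<in> Ring.ring_hom B C" "g \<in> module_hom class_ring B C" "bij_betw g (carrier B) (carrier C)"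
    using assms by (simp_all add: algebra_isos_def algebra_homs_def)
  have "(\<lambda>x. g (f x)) \<in> Ring.ring_hom A C"
    using ring_hom_trans[OF f(1) g(1)] by (simp add: o_def)
  moreover have "(\<lambda>x. g (f x)) \<in> module_hom class_ring A C"
    using f(2) g(2) by (auto simp: module_hom_def Pi_def)
  moreover have "bij_betw (\<lambda>x. g (f x)) (carrier A) (carrier C)"
    using bij_betw_trans[OF f(3) g(3)] by (simp add: o_def)
  ultimately show ?thesis
    by (simp add: algebra_isos_def algebra_homs_def)
qed

lemma ideal_algebra_simps:
  "carrier (ideal_algebra A I) = I" "x \<otimes>\<^bsub>ideal_algebra A I\<^esub> y = x \<otimes>\<^bsub>A\<^esub> y"
  "x \<oplus>\<^bsub>ideal_algebra A I\<^esub> y = x \<oplus>\<^bsub>A\<^esub> y" "\<zero>\<^bsub>ideal_algebra A I\<^esub> = \<zero>\<^bsub>A\<^esub>"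
  "c \<odot>\<^bsub>ideal_algebra A I\<^esub> x = c \<odot>\<^bsub>A\<^esub> x"
  by (simp_all add: ideal_algebra_def)

context group_algebra
begin

lemma \<Phi>_zero:
  assumes "\<epsilon> \<in> chars"
  shows "\<Phi> \<epsilon> \<zero>\<^bsub>KG\<^esub> = 0\<^sub>m (dimE \<epsilon>) (dimE \<epsilon>)"
proof -
  have c: "\<Phi> \<epsilon> \<zero>\<^bsub>KG\<^esub> \<in> carrier_mat (dimE \<epsilon>) (dimE \<epsilon>)"
    by (rule mat_hom_carrier[OF \<Phi>_hom[OF assms]]) simp
  have sum: "\<Phi> \<epsilon> \<zero>\<^bsub>KG\<^esub> + \<Phi> \<epsilon> \<zero>\<^bsub>KG\<^esub> = \<Phi> \<epsilon> \<zero>\<^bsub>KG\<^esub>"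
    using mat_hom_add[OF \<Phi>_hom[OF assms], of "\<zero>\<^bsub>KG\<^esub>" "\<zero>\<^bsub>KG\<^esub>"] by simp
  show ?thesis
  proof (rule eq_matI)
    fix i j assume "i < dim_row (0\<^sub>m (dimE \<epsilon>) (dimE \<epsilon>) :: 'k mat)" "j < dim_col (0\<^sub>m (dimE \<epsilon>) (dimE \<epsilon>) :: 'k mat)"
    then have ij: "i < dimE \<epsilon>" "j < dimE \<epsilon>"
      by simp_all
    have "(\<Phi> \<epsilon> \<zero>\<^bsub>KG\<^esub> + \<Phi> \<epsilon> \<zero>\<^bsub>KG\<^esub>) $$ (i, j) = \<Phi> \<epsilon> \<zero>\<^bsub>KG\<^esub> $$ (i, j)"
      by (simp only: sum)
    then show "\<Phi> \<epsilon> \<zero>\<^bsub>KG\<^esub> $$ (i, j) = 0\<^sub>m (dimE \<epsilon>) (dimE \<epsilon>) $$ (i, j)"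
      using ij c by simp
  qed (use c in auto)
qed

lemma zero_block: "\<epsilon> \<in> chars \<Longrightarrow> 0\<^sub>m (dimE \<epsilon>) (dimE \<epsilon>) \<in> block \<epsilon>"
  using \<Phi>_block[of \<epsilon> "\<zero>\<^bsub>KG\<^esub>"] by (simp add: \<Phi>_zero)

lemma one_block: "\<epsilon> \<in> chars \<Longrightarrow> 1\<^sub>m (dimE \<epsilon>) \<in> block \<epsilon>"
  using \<Phi>_block[of \<epsilon> "\<one>\<^bsub>KG\<^esub>"] by (simp add: mat_hom_one[OF \<Phi>_hom])

text \<open>The preimage in \<open>KG\<close> of one factor of the product of the blocks.\<close>

definition component :: "('g \<Rightarrow> 'k) \<Rightarrow> 'a set" where
  "component \<epsilon> = {x \<in> carrier KG. \<forall>\<epsilon>'\<in>chars. \<epsilon>' \<noteq> \<epsilon> \<longrightarrow> \<Phi> \<epsilon>' x = 0\<^sub>m (dimE \<epsilon>') (dimE \<epsilon>')}"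

lemma component_carrier: "x \<in> component \<epsilon> \<Longrightarrow> x \<in> carrier KG"
  and \<Phi>_component: "x \<in> component \<epsilon> \<Longrightarrow> \<epsilon>' \<in> chars \<Longrightarrow> \<epsilon>' \<noteq> \<epsilon> \<Longrightarrow> \<Phi> \<epsilon>' x = 0\<^sub>m (dimE \<epsilon>') (dimE \<epsilon>')"
  and componentI: "x \<in> carrier KG \<Longrightarrow>
    (\<And>\<epsilon>'. \<epsilon>' \<in> chars \<Longrightarrow> \<epsilon>' \<noteq> \<epsilon> \<Longrightarrow> \<Phi> \<epsilon>' x = 0\<^sub>m (dimE \<epsilon>') (dimE \<epsilon>')) \<Longrightarrow> x \<in> component \<epsilon>"
  by (auto simp: component_def)

lemma component_eqI:
  assumes "x \<in> component \<epsilon>" "y \<in> component \<epsilon>" "\<Phi> \<epsilon> x = \<Phi> \<epsilon> y"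
  shows "x = y"
proof (rule \<Phi>_inj)
  fix \<epsilon>' assume "\<epsilon>' \<in> chars"
  then show "\<Phi> \<epsilon>' x = \<Phi> \<epsilon>' y"
    using assms \<Phi>_component by (cases "\<epsilon>' = \<epsilon>") auto
qed (use assms component_carrier in auto)

lemma component_surj:
  assumes "\<epsilon> \<in> chars" "Y \<in> block \<epsilon>"
  obtains x where "x \<in> component \<epsilon>" "\<Phi> \<epsilon> x = Y"
proof -
  define y where "y \<epsilon>' = (if \<epsilon>' = \<epsilon> then Y else 0\<^sub>m (dimE \<epsilon>') (dimE \<epsilon>'))" for \<epsilon>'
  have y: "y \<epsilon>' \<in> block \<epsilon>'" if "\<epsilon>' \<in> chars" for \<epsilon>'
    using that assms(2) zero_block by (simp add: y_def)
  obtain x where x: "x \<in> carrier KG" "\<And>\<epsilon>'. \<epsilon>' \<in> chars \<Longrightarrow> \<Phi> \<epsilon>' x = y \<epsilon>'"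
    by (rule \<Phi>_surj[of y, OF y]) (assumption, rule that)
  show ?thesis
  proof (rule that)
    show "x \<in> component \<epsilon>"
      using x by (intro componentI) (simp_all add: y_def)
    show "\<Phi> \<epsilon> x = Y"
      using x(2)[OF assms(1)] by (simp add: y_def)
  qed
qed

lemma zero_component: "\<zero>\<^bsub>KG\<^esub> \<in> component \<epsilon>"
  by (rule componentI) (simp_all add: \<Phi>_zero)

lemma component_add: "x \<in> component \<epsilon> \<Longrightarrow> y \<in> component \<epsilon> \<Longrightarrow> x \<oplus>\<^bsub>KG\<^esub> y \<in> component \<epsilon>"
  by (rule componentI) (simp_all add: component_carrier \<Phi>_component mat_hom_add[OF \<Phi>_hom])

lemma component_smult: "x \<in> component \<epsilon> \<Longrightarrow> c \<odot>\<^bsub>KG\<^esub> x \<in> component \<epsilon>"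
  by (rule componentI) (simp_all add: component_carrier \<Phi>_component mat_hom_smult[OF \<Phi>_hom] smult_closed)

lemma component_mult_left:
  assumes "x \<in> carrier KG" "y \<in> component \<epsilon>"
  shows "x \<otimes>\<^bsub>KG\<^esub> y \<in> component \<epsilon>"
proof (rule componentI)
  fix \<epsilon>' assume \<epsilon>': "\<epsilon>' \<in> chars" "\<epsilon>' \<noteq> \<epsilon>"
  show "\<Phi> \<epsilon>' (x \<otimes>\<^bsub>KG\<^esub> y) = 0\<^sub>m (dimE \<epsilon>') (dimE \<epsilon>')"
    unfolding mat_hom_mult[OF \<Phi>_hom[OF \<epsilon>'(1)] assms(1) component_carrier[OF assms(2)]] \<Phi>_component[OF assms(2) \<epsilon>']
    by (rule right_mult_zero_mat[OF mat_hom_carrier[OF \<Phi>_hom[OF \<epsilon>'(1)] assms(1)]])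
qed (use assms component_carrier in auto)

lemma component_mult_right:
  assumes "x \<in> carrier KG" "y \<in> component \<epsilon>"
  shows "y \<otimes>\<^bsub>KG\<^esub> x \<in> component \<epsilon>"
proof (rule componentI)
  fix \<epsilon>' assume \<epsilon>': "\<epsilon>' \<in> chars" "\<epsilon>' \<noteq> \<epsilon>"
  show "\<Phi> \<epsilon>' (y \<otimes>\<^bsub>KG\<^esub> x) = 0\<^sub>m (dimE \<epsilon>') (dimE \<epsilon>')"
    unfolding mat_hom_mult[OF \<Phi>_hom[OF \<epsilon>'(1)] component_carrier[OF assms(2)] assms(1)] \<Phi>_component[OF assms(2) \<epsilon>']
    by (rule left_mult_zero_mat[OF mat_hom_carrier[OF \<Phi>_hom[OF \<epsilon>'(1)] assms(1)]])
qed (use assms component_carrier in auto)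

text \<open>Makes ring ideals of \<open>KG\<close> into linear subspaces.\<close>

lemma smult_as_mult: "x \<in> carrier KG \<Longrightarrow> c \<odot>\<^bsub>KG\<^esub> x = (c \<odot>\<^bsub>KG\<^esub> \<one>\<^bsub>KG\<^esub>) \<otimes>\<^bsub>KG\<^esub> x"
  by (simp add: smult_mult)

lemma uminus_as_smult:
  assumes "x \<in> carrier KG"
  shows "\<ominus>\<^bsub>KG\<^esub> x = (- 1) \<odot>\<^bsub>KG\<^esub> x"
proof -
  interpret V: vectorspace class_ring KG
    by (rule vectorspace_KG)
  have "(- 1) \<odot>\<^bsub>KG\<^esub> x \<oplus>\<^bsub>KG\<^esub> x = (- 1 + 1) \<odot>\<^bsub>KG\<^esub> x"
    using V.smult_l_distr[of "- 1" 1 x] V.smult_one[OF assms] assms by (simp add: class_ring_simps)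
  also have "\<dots> = \<zero>\<^bsub>KG\<^esub>"
    using V.smult_l_null[OF assms] by (simp add: class_ring_simps)
  finally show ?thesis
    using A.minus_equality assms smult_closed by blast
qed

lemma ideal_component: "ideal (component \<epsilon>) KG"
proof (rule idealI)
  show "subgroup (component \<epsilon>) (add_monoid KG)"
  proof
    fix x assume x: "x \<in> component \<epsilon>"
    then show "inv\<^bsub>add_monoid KG\<^esub> x \<in> component \<epsilon>"
      using component_smult[OF x, of "- 1"] uminus_as_smult[OF component_carrier[OF x]] by (simp add: a_inv_def)
  qed (auto simp: component_carrier component_add zero_component)
qed (auto simp: component_mult_left component_mult_right A.ring_axioms)

text \<open>\<open>\<Phi> \<epsilon>\<close> is injective on the component, so identities there may
  be checked in the block. This evaluates the definite description in
  \<open>ideal_algebra\<close>.\<close>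

lemma one_ideal_algebra:
  assumes \<epsilon>: "\<epsilon> \<in> chars" and e: "e \<in> component \<epsilon>" "\<Phi> \<epsilon> e = 1\<^sub>m (dimE \<epsilon>)"
  shows "\<one>\<^bsub>ideal_algebra KG (component \<epsilon>)\<^esub> = e"
proof -
  have unit: "e \<otimes>\<^bsub>KG\<^esub> x = x \<and> x \<otimes>\<^bsub>KG\<^esub> e = x" if x: "x \<in> component \<epsilon>" for x
  proof -
    note c = component_carrier[OF e(1)] component_carrier[OF x]
    note \<Phi>c = mat_hom_carrier[OF \<Phi>_hom[OF \<epsilon>] c(2)]
    have "\<Phi> \<epsilon> (e \<otimes>\<^bsub>KG\<^esub> x) = \<Phi> \<epsilon> x" "\<Phi> \<epsilon> (x \<otimes>\<^bsub>KG\<^esub> e) = \<Phi> \<epsilon> x"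
      unfolding mat_hom_mult[OF \<Phi>_hom[OF \<epsilon>] c] mat_hom_mult[OF \<Phi>_hom[OF \<epsilon>] c(2,1)] e(2)
      using \<Phi>c by simp_all
    then show ?thesis
      using component_eqI component_mult_left[OF c(1) x] component_mult_right[OF c(1) x] x by blast
  qed
  have "(THE e. e \<in> component \<epsilon> \<and> (\<forall>x\<in>component \<epsilon>. e \<otimes>\<^bsub>KG\<^esub> x = x \<and> x \<otimes>\<^bsub>KG\<^esub> e = x)) = e"
  proof (rule the_equality)
    fix e' assume e': "e' \<in> component \<epsilon> \<and> (\<forall>x\<in>component \<epsilon>. e' \<otimes>\<^bsub>KG\<^esub> x = x \<and> x \<otimes>\<^bsub>KG\<^esub> e' = x)"
    then have "e' \<otimes>\<^bsub>KG\<^esub> e = e" "e' \<otimes>\<^bsub>KG\<^esub> e = e'"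
      using e(1) unit[of e'] by blast+
    then show "e' = e"
      by simp
  qed (use e(1) unit in blast)
  then show ?thesis
    by (simp add: ideal_algebra_def)
qed

lemma \<Phi>_one_component:
  assumes "\<epsilon> \<in> chars"
  shows "\<one>\<^bsub>ideal_algebra KG (component \<epsilon>)\<^esub> \<in> component \<epsilon>"
    and "\<Phi> \<epsilon> \<one>\<^bsub>ideal_algebra KG (component \<epsilon>)\<^esub> = 1\<^sub>m (dimE \<epsilon>)"
proof -
  obtain e where "e \<in> component \<epsilon>" "\<Phi> \<epsilon> e = 1\<^sub>m (dimE \<epsilon>)"
    by (rule component_surj[OF assms one_block[OF assms]])
  then show "\<one>\<^bsub>ideal_algebra KG (component \<epsilon>)\<^esub> \<in> component \<epsilon>"
    "\<Phi> \<epsilon> \<one>\<^bsub>ideal_algebra KG (component \<epsilon>)\<^esub> = 1\<^sub>m (dimE \<epsilon>)"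
    using one_ideal_algebra[OF assms] by simp_all
qed

lemma bij_betw_\<Phi>:
  assumes "\<epsilon> \<in> chars"
  shows "bij_betw (\<Phi> \<epsilon>) (component \<epsilon>) (block \<epsilon>)"
proof (rule bij_betw_imageI)
  show "inj_on (\<Phi> \<epsilon>) (component \<epsilon>)"
    by (rule inj_onI) (rule component_eqI)
  show "\<Phi> \<epsilon> ` component \<epsilon> = block \<epsilon>"
  proof
    show "\<Phi> \<epsilon> ` component \<epsilon> \<subseteq> block \<epsilon>"
      using \<Phi>_block[OF assms] component_carrier by blast
    show "block \<epsilon> \<subseteq> \<Phi> \<epsilon> ` component \<epsilon>"
    proof
      fix Y assume "Y \<in> block \<epsilon>"
      from component_surj[OF assms this] show "Y \<in> \<Phi> \<epsilon> ` component \<epsilon>"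
        by (metis imageI)
    qed
  qed
qed

lemma component_iso:
  assumes \<epsilon>: "\<epsilon> \<in> chars"
  shows "\<Phi> \<epsilon> \<in> algebra_isos (ideal_algebra KG (component \<epsilon>)) (End_over (EndG \<epsilon>) (dimE \<epsilon>))"
proof -
  note \<Phi>h = \<Phi>_hom[OF \<epsilon>]
  have "\<Phi> \<epsilon> \<in> Ring.ring_hom (ideal_algebra KG (component \<epsilon>)) (End_over (EndG \<epsilon>) (dimE \<epsilon>))"
    by (rule ring_hom_memI)
      (simp_all add: ideal_algebra_simps End_over_simps carrier_End_over \<Phi>_block[OF \<epsilon>] component_carrier
        mat_hom_mult[OF \<Phi>h] mat_hom_add[OF \<Phi>h] \<Phi>_one_component[OF \<epsilon>])
  moreover have "\<Phi> \<epsilon> \<in> module_hom class_ring (ideal_algebra KG (component \<epsilon>)) (End_over (EndG \<epsilon>) (dimE \<epsilon>))"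
    by (auto simp: module_hom_def ideal_algebra_simps End_over_simps carrier_End_over \<Phi>_block[OF \<epsilon>] component_carrier
        mat_hom_smult[OF \<Phi>h] mat_hom_add[OF \<Phi>h])
  ultimately show ?thesis
    using bij_betw_\<Phi>[OF \<epsilon>]
    by (simp add: algebra_isos_def algebra_homs_def ideal_algebra_simps carrier_End_over)
qed

lemma component_full_matrix_iso:
  assumes \<epsilon>: "\<epsilon> \<in> chars"
  shows "\<exists>m>0. algebra_isos (ideal_algebra KG (component \<epsilon>)) (full_matrix_algebra m (EndG \<epsilon>)) \<noteq> {}"
proof -
  obtain m \<theta> where "m > 0" "\<theta> \<in> algebra_isos (End_over (EndG \<epsilon>) (dimE \<epsilon>)) (full_matrix_algebra m (EndG \<epsilon>))"
    by (rule block_full_matrix_iso[OF \<epsilon>])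
  then show ?thesis
    using algebra_isos_compose[OF component_iso[OF \<epsilon>]] by blast
qed

lemma component_nonzero:
  assumes \<epsilon>: "\<epsilon> \<in> chars"
  shows "component \<epsilon> \<noteq> {\<zero>\<^bsub>KG\<^esub>}"
proof
  assume "component \<epsilon> = {\<zero>\<^bsub>KG\<^esub>}"
  then have "1\<^sub>m (dimE \<epsilon>) = (0\<^sub>m (dimE \<epsilon>) (dimE \<epsilon>) :: 'k mat)"
    using \<Phi>_one_component[OF \<epsilon>] \<Phi>_zero[OF \<epsilon>] by simp
  then have "1\<^sub>m (dimE \<epsilon>) $$ (0, 0) = (0\<^sub>m (dimE \<epsilon>) (dimE \<epsilon>) :: 'k mat) $$ (0, 0)"
    by simp
  then show False
    using irreducible_pos[OF irr[OF \<epsilon>]] by simp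
qed

text \<open>Transports \<open>block_simple\<close> along the bijection
  \<open>\<Phi> \<epsilon>\<close>. Stated for subspaces closed under multiplication by
  \<open>G\<close> on both sides, it covers the ideals of \<open>KG\<close> and the submodules for
  \<open>G \<times>\<times> G\<close> alike.\<close>

lemma component_simple:
  assumes \<epsilon>: "\<epsilon> \<in> chars" and U: "U \<subseteq> component \<epsilon>" and u0: "u0 \<in> U" "u0 \<noteq> \<zero>\<^bsub>KG\<^esub>"
    and add: "\<And>u v. u \<in> U \<Longrightarrow> v \<in> U \<Longrightarrow> u \<oplus>\<^bsub>KG\<^esub> v \<in> U" and smult: "\<And>c u. u \<in> U \<Longrightarrow> c \<odot>\<^bsub>KG\<^esub> u \<in> U"
    and left: "\<And>g u. g \<in> carrier G \<Longrightarrow> u \<in> U \<Longrightarrow> \<eta> g \<otimes>\<^bsub>KG\<^esub> u \<in> U"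
    and right: "\<And>g u. g \<in> carrier G \<Longrightarrow> u \<in> U \<Longrightarrow> u \<otimes>\<^bsub>KG\<^esub> \<eta> g \<in> U"
  shows "U = component \<epsilon>"
proof -
  have Uc: "u \<in> carrier KG" if "u \<in> U" for u
    using that U component_carrier by blast
  note \<Phi>h = \<Phi>_hom[OF \<epsilon>]
  have "\<Phi> \<epsilon> ` U = block \<epsilon>"
  proof (rule block_simple[OF \<epsilon>])
    show "\<Phi> \<epsilon> ` U \<subseteq> block \<epsilon>"
      using \<Phi>_block[OF \<epsilon>] Uc by blast
    show "\<Phi> \<epsilon> u0 \<in> \<Phi> \<epsilon> ` U"
      using u0(1) by blast
    show "\<Phi> \<epsilon> u0 \<noteq> 0\<^sub>m (dimE \<epsilon>) (dimE \<epsilon>)"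
      using component_eqI[of u0 \<epsilon> "\<zero>\<^bsub>KG\<^esub>"] zero_component u0 U \<Phi>_zero[OF \<epsilon>] by auto
  next
    fix Y Z assume "Y \<in> \<Phi> \<epsilon> ` U" "Z \<in> \<Phi> \<epsilon> ` U"
    then obtain u v where "u \<in> U" "v \<in> U" "Y = \<Phi> \<epsilon> u" "Z = \<Phi> \<epsilon> v"
      by blast
    then show "Y + Z \<in> \<Phi> \<epsilon> ` U"
      using mat_hom_add[OF \<Phi>h Uc Uc, of u v] add by (metis imageI)
  next
    fix c Y assume "Y \<in> \<Phi> \<epsilon> ` U"
    then obtain u where "u \<in> U" "Y = \<Phi> \<epsilon> u"
      by blast
    then show "c \<cdot>\<^sub>m Y \<in> \<Phi> \<epsilon> ` U"
      using mat_hom_smult[OF \<Phi>h Uc, of u c] smult by (metis imageI)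
  next
    fix g Y assume g: "g \<in> carrier G" and "Y \<in> \<Phi> \<epsilon> ` U"
    then obtain u where u: "u \<in> U" and Y: "Y = \<Phi> \<epsilon> u"
      by blast
    show "\<rho> \<epsilon> g * Y \<in> \<Phi> \<epsilon> ` U"
      using mat_hom_mult[OF \<Phi>h eta_carrier[OF g] Uc[OF u]] \<Phi>_eta[OF \<epsilon> g] left[OF g u] Y by (metis imageI)
    show "Y * \<rho> \<epsilon> g \<in> \<Phi> \<epsilon> ` U"
      using mat_hom_mult[OF \<Phi>h Uc[OF u] eta_carrier[OF g]] \<Phi>_eta[OF \<epsilon> g] right[OF g u] Y by (metis imageI)
  qed
  then have "\<Phi> \<epsilon> ` U = \<Phi> \<epsilon> ` component \<epsilon>"
    using bij_betw_imp_surj_on[OF bij_betw_\<Phi>[OF \<epsilon>]] by simp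
  then show ?thesis
    using inj_on_image_eq_iff[OF bij_betw_imp_inj_on[OF bij_betw_\<Phi>[OF \<epsilon>]] U subset_refl] by simp
qed

lemma minimal_component:
  assumes \<epsilon>: "\<epsilon> \<in> chars"
  shows "minimal_ideal (component \<epsilon>) KG"
  unfolding minimal_ideal_def
proof (intro conjI allI impI)
  fix J assume "ideal J KG \<and> J \<subseteq> component \<epsilon>"
  then interpret J: ideal J KG
    by simp
  show "J = {\<zero>\<^bsub>KG\<^esub>} \<or> J = component \<epsilon>"
  proof (rule disjCI)
    assume "J \<noteq> component \<epsilon>"
    have "u = \<zero>\<^bsub>KG\<^esub>" if u: "u \<in> J" for u
    proof (rule ccontr)
      assume nz: "u \<noteq> \<zero>\<^bsub>KG\<^esub>"
      have "J = component \<epsilon>"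
      proof (rule component_simple[OF \<epsilon> _ u nz])
        show "J \<subseteq> component \<epsilon>"
          using \<open>ideal J KG \<and> J \<subseteq> component \<epsilon>\<close> by simp
      next
        fix c u assume u: "u \<in> J"
        show "c \<odot>\<^bsub>KG\<^esub> u \<in> J"
          unfolding smult_as_mult[OF J.Icarr[OF u]] by (rule J.I_l_closed[OF u]) (simp add: smult_closed)
      qed (auto intro: J.I_l_closed J.I_r_closed eta_carrier)
      then show False
        using \<open>J \<noteq> component \<epsilon>\<close> by simp
    qed
    then show "J = {\<zero>\<^bsub>KG\<^esub>}"
      using J.zero_closed by blast
  qed
qed (simp_all add: ideal_component component_nonzero[OF \<epsilon>])

lemma vectorspace_component: "vectorspace class_ring (KG\<lparr>carrier := component \<epsilon>\<rparr>)"
proof -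
  interpret V: vectorspace class_ring KG
    by (rule vectorspace_KG)
  have "submodule class_ring (component \<epsilon>) KG"
    by unfold_locales (auto simp: component_carrier component_add zero_component component_smult)
  then show ?thesis
    by (intro V.subspace_is_vs) (simp add: VectorSpace.subspace_def V.vectorspace_axioms)
qed

text \<open>The spanning set consists of preimages in the component of finitely many group matrices
  that span the block.\<close>

lemma fin_dim_component:
  assumes \<epsilon>: "\<epsilon> \<in> chars"
  shows "vectorspace.fin_dim class_ring (KG\<lparr>carrier := component \<epsilon>\<rparr>)"
proof -
  let ?V = "KG\<lparr>carrier := component \<epsilon>\<rparr>"
  interpret V: vectorspace class_ring ?V
    by (rule vectorspace_component)
  note \<Phi>h = \<Phi>_hom[OF \<epsilon>]
  obtain D where D: "finite D" "D \<subseteq> carrier G"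
    and span: "\<And>y. y \<in> block \<epsilon> \<Longrightarrow> \<exists>c. y = mat (dimE \<epsilon>) (dimE \<epsilon>) (\<lambda>(p, r). \<Sum>g\<in>D. c g * \<rho> \<epsilon> g $$ (p, r))"
    by (rule block_finite_span[OF \<epsilon>]) (rule that)
  define u where "u g = inv_into (component \<epsilon>) (\<Phi> \<epsilon>) (\<rho> \<epsilon> g)" for g
  have u: "u g \<in> component \<epsilon>" "\<Phi> \<epsilon> (u g) = \<rho> \<epsilon> g" if g: "g \<in> carrier G" for g
  proof -
    have "\<rho> \<epsilon> g \<in> \<Phi> \<epsilon> ` component \<epsilon>"
      using bij_betw_imp_surj_on[OF bij_betw_\<Phi>[OF \<epsilon>]] \<Phi>_block[OF \<epsilon> eta_carrier[OF g]] \<Phi>_eta[OF \<epsilon> g] by simp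
    then show "u g \<in> component \<epsilon>" "\<Phi> \<epsilon> (u g) = \<rho> \<epsilon> g"
      unfolding u_def by (rule inv_into_into, rule f_inv_into_f)
  qed
  have S: "u ` D \<subseteq> carrier ?V"
    using u D(2) by auto
  have sub: "submodule class_ring (V.span (u ` D)) ?V"
    by (rule V.span_is_submodule[OF S])
  have span_sub: "V.span (u ` D) \<subseteq> component \<epsilon>"
    using submodule.subset[OF sub] by simp
  have "x \<in> V.span (u ` D)" if x: "x \<in> component \<epsilon>" for x
  proof -
    obtain c where c: "\<Phi> \<epsilon> x = mat (dimE \<epsilon>) (dimE \<epsilon>) (\<lambda>(p, r). \<Sum>g\<in>D. c g * \<rho> \<epsilon> g $$ (p, r))"
      using span[OF \<Phi>_block[OF \<epsilon> component_carrier[OF x]]] by blast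
    have "mat (dimE \<epsilon>) (dimE \<epsilon>) (\<lambda>(p, r). \<Sum>g\<in>D. c g * \<rho> \<epsilon> g $$ (p, r)) \<in> \<Phi> \<epsilon> ` V.span (u ` D)"
    proof (rule combination_in[OF \<epsilon> D])
      show "0\<^sub>m (dimE \<epsilon>) (dimE \<epsilon>) \<in> \<Phi> \<epsilon> ` V.span (u ` D)"
        using imageI[OF submodule.zero_closed[OF sub], of "\<Phi> \<epsilon>"] by (simp add: \<Phi>_zero[OF \<epsilon>])
    next
      fix g c Y assume g: "g \<in> D" and "Y \<in> \<Phi> \<epsilon> ` V.span (u ` D)"
      then obtain v where v: "v \<in> V.span (u ` D)" and Y: "Y = \<Phi> \<epsilon> v"
        by blast
      have gG: "g \<in> carrier G"
        using g D(2) by blast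
      have "u g \<in> V.span (u ` D)"
        using V.in_own_span[OF S] g by blast
      then have "c \<odot>\<^bsub>?V\<^esub> u g \<in> V.span (u ` D)"
        by (rule submodule.smult_closed[OF sub, rotated]) (simp add: class_ring_simps)
      then have "c \<odot>\<^bsub>?V\<^esub> u g \<oplus>\<^bsub>?V\<^esub> v \<in> V.span (u ` D)"
        using v by (rule submodule.m_closed[OF sub])
      moreover have "\<Phi> \<epsilon> (c \<odot>\<^bsub>?V\<^esub> u g \<oplus>\<^bsub>?V\<^esub> v) = c \<cdot>\<^sub>m \<rho> \<epsilon> g + Y"
      proof -
        have "u g \<in> carrier KG" "v \<in> carrier KG"
          using component_carrier u(1)[OF gG] v span_sub by auto
        then show ?thesis
          by (simp add: mat_hom_add[OF \<Phi>h] mat_hom_smult[OF \<Phi>h] smult_closed u(2)[OF gG] Y)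
      qed
      ultimately show "c \<cdot>\<^sub>m \<rho> \<epsilon> g + Y \<in> \<Phi> \<epsilon> ` V.span (u ` D)"
        by (metis imageI)
    qed
    then obtain v where v: "v \<in> V.span (u ` D)" and "\<Phi> \<epsilon> x = \<Phi> \<epsilon> v"
      unfolding c[symmetric] by blast
    then have "x = v"
      using component_eqI[OF x] span_sub by blast
    then show ?thesis
      using v by simp
  qed
  then have "V.span (u ` D) = carrier ?V"
    using span_sub by auto
  then show ?thesis
    unfolding V.fin_dim_def using S D(1) by blast
qed

lemma two_sided_action_eta:
  "h \<in> carrier G \<Longrightarrow> two_sided_action KG \<eta> (g, h) x = \<eta> g \<otimes>\<^bsub>KG\<^esub> x \<otimes>\<^bsub>KG\<^esub> \<eta> (inv h)"
  by (simp add: two_sided_action_def eta_inv)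

lemma two_sided_action_component:
  assumes "g \<in> carrier G" "h \<in> carrier G" "x \<in> component \<epsilon>"
  shows "two_sided_action KG \<eta> (g, h) x \<in> component \<epsilon>"
  unfolding two_sided_action_eta[OF assms(2)]
  by (intro component_mult_left component_mult_right eta_carrier assms inv_closed)

lemma simple_component:
  assumes \<epsilon>: "\<epsilon> \<in> chars"
  shows "simple_group_module (G \<times>\<times> G) (KG\<lparr>carrier := component \<epsilon>\<rparr>) (two_sided_action KG \<eta>)"
proof -
  let ?V = "KG\<lparr>carrier := component \<epsilon>\<rparr>"
  have "group_module (G \<times>\<times> G) ?V (two_sided_action KG \<eta>)"
    unfolding group_module_def
  proof (intro conjI ballI vectorspace_component)
    fix p assume "p \<in> carrier (G \<times>\<times> G)"
    then obtain g h where p: "p = (g, h)" and gh: "g \<in> carrier G" "h \<in> carrier G"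
      by auto
    show "two_sided_action KG \<eta> p \<in> module_hom class_ring ?V ?V"
      using gh two_sided_action_component[OF gh]
      by (auto simp: module_hom_def p two_sided_action_eta eta_carrier component_carrier A.l_distr A.r_distr
          smult_mult mult_smult smult_closed)
  next
    fix x assume "x \<in> carrier ?V"
    then show "two_sided_action KG \<eta> \<one>\<^bsub>G \<times>\<times> G\<^esub> x = x"
      by (simp add: two_sided_action_eta eta_one component_carrier)
  next
    fix p q x assume "p \<in> carrier (G \<times>\<times> G)" "q \<in> carrier (G \<times>\<times> G)" and x: "x \<in> carrier ?V"
    then obtain g h g' h' where pq: "p = (g, h)" "q = (g', h')"
      and gh: "g \<in> carrier G" "h \<in> carrier G" "g' \<in> carrier G" "h' \<in> carrier G"
      by auto
    have "x \<in> carrier KG"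
      using x component_carrier by simp
    then show "two_sided_action KG \<eta> (p \<otimes>\<^bsub>G \<times>\<times> G\<^esub> q) x = two_sided_action KG \<eta> p (two_sided_action KG \<eta> q x)"
      using gh by (simp add: pq two_sided_action_eta inv_mult_group eta_mult eta_carrier A.m_assoc)
  qed
  moreover have "U = {\<zero>\<^bsub>KG\<^esub>} \<or> U = component \<epsilon>"
    if U: "VectorSpace.subspace class_ring U ?V"
      and inv: "\<forall>p\<in>carrier (G \<times>\<times> G). \<forall>x\<in>U. two_sided_action KG \<eta> p x \<in> U" for U
  proof -
    interpret U: submodule class_ring U ?V
      using U by (simp add: VectorSpace.subspace_def)
    have Uc: "u \<in> carrier KG" if "u \<in> U" for u
      using U.subset that component_carrier by auto
    show ?thesis
    proof (rule disjCI)
      assume "U \<noteq> component \<epsilon>"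
      have "u = \<zero>\<^bsub>KG\<^esub>" if u: "u \<in> U" for u
      proof (rule ccontr)
        assume nz: "u \<noteq> \<zero>\<^bsub>KG\<^esub>"
        have "U = component \<epsilon>"
        proof (rule component_simple[OF \<epsilon> _ u nz])
          show "U \<subseteq> component \<epsilon>"
            using U.subset by simp
        next
          fix c u assume "u \<in> U"
          then show "c \<odot>\<^bsub>KG\<^esub> u \<in> U"
            using U.smult_closed[of c u] by (simp add: class_ring_simps)
        next
          fix g u assume g: "g \<in> carrier G" and u: "u \<in> U"
          \<comment> \<open>One-sided multiplications by \<open>\<eta> g\<close> are the actions of
            \<open>(g, \<one>)\<close> and, because of the inverse in the action, of
            \<open>(\<one>, inv g)\<close>.\<close>
          show "\<eta> g \<otimes>\<^bsub>KG\<^esub> u \<in> U"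
            using inv[rule_format, of "(g, \<one>)" u] g u Uc[OF u]
            by (simp add: two_sided_action_eta eta_one eta_carrier)
          show "u \<otimes>\<^bsub>KG\<^esub> \<eta> g \<in> U"
            using inv[rule_format, of "(\<one>, inv g)" u] g u Uc[OF u]
            by (simp add: two_sided_action_eta eta_one eta_carrier)
        qed (use U.m_closed in simp)
        then show False
          using \<open>U \<noteq> component \<epsilon>\<close> by simp
      qed
      moreover have "\<zero>\<^bsub>KG\<^esub> \<in> U"
        using U.zero_closed by simp
      ultimately show "U = {\<zero>\<^bsub>KG\<^esub>}"
        by blast
    qed
  qed
  ultimately show ?thesis
    unfolding simple_group_module_def using component_nonzero[OF \<epsilon>] by simp
qed

section \<open>Identification of KG with the product of its ideals\<close>

section \<open>The product decomposition\<close>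

definition proj :: "('g \<Rightarrow> 'k) \<Rightarrow> 'a \<Rightarrow> 'a" where
  "proj \<epsilon> x = inv_into (component \<epsilon>) (\<Phi> \<epsilon>) (\<Phi> \<epsilon> x)"

lemma proj:
  assumes "\<epsilon> \<in> chars" "x \<in> carrier KG"
  shows proj_component: "proj \<epsilon> x \<in> component \<epsilon>" and \<Phi>_proj: "\<Phi> \<epsilon> (proj \<epsilon> x) = \<Phi> \<epsilon> x"
proof -
  have "\<Phi> \<epsilon> x \<in> \<Phi> \<epsilon> ` component \<epsilon>"
    using bij_betw_imp_surj_on[OF bij_betw_\<Phi>[OF assms(1)]] \<Phi>_block[OF assms] by simp
  then show "proj \<epsilon> x \<in> component \<epsilon>" "\<Phi> \<epsilon> (proj \<epsilon> x) = \<Phi> \<epsilon> x"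
    unfolding proj_def by (rule inv_into_into, rule f_inv_into_f)
qed

lemma proj_eqI:
  assumes "\<epsilon> \<in> chars" "x \<in> carrier KG" "z \<in> component \<epsilon>" "\<Phi> \<epsilon> x = \<Phi> \<epsilon> z"
  shows "proj \<epsilon> x = z"
  using proj[OF assms(1,2)] assms(3,4) by (intro component_eqI) auto

text \<open>Followed by a map \<open>\<Phi> \<epsilon>'\<close>, the projection becomes
  \<open>\<Phi> \<epsilon>\<close> or 0, and continuity into \<open>KG\<close> can be tested on the
  entries of these maps.\<close>

lemma proj_continuous:
  assumes \<epsilon>: "\<epsilon> \<in> chars"
  shows "continuous_map T T (proj \<epsilon>)"
proof (rule continuous_map_into_T)
  fix x assume "x \<in> topspace T"
  then show "proj \<epsilon> x \<in> carrier KG"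
    using component_carrier[OF proj_component[OF \<epsilon>]] by (simp add: topspace_T)
next
  fix \<epsilon>' i j assume \<epsilon>': "\<epsilon>' \<in> chars" and ij: "i < dimE \<epsilon>'" "j < dimE \<epsilon>'"
  show "continuous_map T euclidean (\<lambda>x. \<Phi> \<epsilon>' (proj \<epsilon> x) $$ (i, j))"
  proof (cases "\<epsilon>' = \<epsilon>")
    case True
    show ?thesis
      using functional_continuous[OF functional_\<Phi>[OF \<epsilon>' ij]]
      by (rule continuous_map_eq) (simp add: True \<Phi>_proj[OF \<epsilon>] topspace_T)
  next
    case False
    have "continuous_map T euclidean (\<lambda>x. 0 :: 'k)"
      by simp
    then show ?thesis
      by (rule continuous_map_eq)
        (simp add: \<Phi>_component[OF proj_component[OF \<epsilon>] \<epsilon>' False] topspace_T ij)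
  qed
qed

lemma direct_product: "direct_product_of_ideals KG T chars component"
proof -
  let ?P = "product_algebra chars (\<lambda>\<epsilon>. ideal_algebra KG (component \<epsilon>))"
  let ?X = "product_topology (\<lambda>\<epsilon>. subtopology T (component \<epsilon>)) chars"
  define p where "p x = (\<lambda>\<epsilon>\<in>chars. proj \<epsilon> x)" for x
  have carP: "carrier ?P = (\<Pi>\<^sub>E \<epsilon>\<in>chars. component \<epsilon>)"
    by (simp add: product_algebra_def ideal_algebra_simps)
  have topX: "topspace ?X = (\<Pi>\<^sub>E \<epsilon>\<in>chars. component \<epsilon>)"
    by (auto simp: topspace_T component_carrier intro!: PiE_cong)
  have p_in: "p x \<in> (\<Pi>\<^sub>E \<epsilon>\<in>chars. component \<epsilon>)" if "x \<in> carrier KG" for x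
    using proj_component that by (auto simp: p_def)
  \<comment> \<open>The inverse of \<open>p\<close>. Such an element exists because the family of
    the \<open>\<Phi> \<epsilon>\<close> is onto the product of the blocks, and it is unique because
    the family is injective.\<close>
  define q where "q z = (SOME x. x \<in> carrier KG \<and> (\<forall>\<epsilon>\<in>chars. \<Phi> \<epsilon> x = \<Phi> \<epsilon> (z \<epsilon>)))" for z
  have q: "q z \<in> carrier KG \<and> (\<forall>\<epsilon>\<in>chars. \<Phi> \<epsilon> (q z) = \<Phi> \<epsilon> (z \<epsilon>))" if z: "z \<in> (\<Pi>\<^sub>E \<epsilon>\<in>chars. component \<epsilon>)" for z
    unfolding q_def
  proof (rule someI_ex)
    have block: "\<Phi> \<epsilon> (z \<epsilon>) \<in> block \<epsilon>" if "\<epsilon> \<in> chars" for \<epsilon>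
      using z that component_carrier by (intro \<Phi>_block) auto
    obtain x where "x \<in> carrier KG" "\<And>\<epsilon>. \<epsilon> \<in> chars \<Longrightarrow> \<Phi> \<epsilon> x = \<Phi> \<epsilon> (z \<epsilon>)"
      by (rule \<Phi>_surj[of "\<lambda>\<epsilon>. \<Phi> \<epsilon> (z \<epsilon>)", OF block]) (assumption, rule that)
    then show "\<exists>x. x \<in> carrier KG \<and> (\<forall>\<epsilon>\<in>chars. \<Phi> \<epsilon> x = \<Phi> \<epsilon> (z \<epsilon>))"
      by blast
  qed
  have qp: "q (p x) = x" if x: "x \<in> carrier KG" for x
    using q[OF p_in[OF x]] x by (intro \<Phi>_inj) (auto simp: p_def \<Phi>_proj)
  have pq: "p (q z) = z" if z: "z \<in> (\<Pi>\<^sub>E \<epsilon>\<in>chars. component \<epsilon>)" for z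
  proof (rule PiE_ext)
    show "p (q z) \<in> (\<Pi>\<^sub>E \<epsilon>\<in>chars. component \<epsilon>)"
      using p_in q[OF z] by blast
    fix \<epsilon> assume \<epsilon>: "\<epsilon> \<in> chars"
    then have "z \<epsilon> \<in> component \<epsilon>"
      using z by blast
    then show "p (q z) \<epsilon> = z \<epsilon>"
      using proj_eqI[OF \<epsilon>, of "q z" "z \<epsilon>"] q[OF z] \<epsilon> by (simp add: p_def)
  qed (rule z)
  have "continuous_map T ?X p"
    unfolding continuous_map_componentwise
  proof (intro conjI ballI)
    show "p ` topspace T \<subseteq> extensional chars"
      by (auto simp: p_def)
    fix \<epsilon> assume \<epsilon>: "\<epsilon> \<in> chars"
    then show "continuous_map T (subtopology T (component \<epsilon>)) (\<lambda>x. p x \<epsilon>)"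
      using proj_continuous[OF \<epsilon>] proj_component[OF \<epsilon>]
      by (auto simp: continuous_map_in_subtopology p_def topspace_T)
  qed
  \<comment> \<open>Tested entry by entry: \<open>\<Phi> \<epsilon> (q z)\<close> depends on the
    single component \<open>z \<epsilon>\<close>.\<close>
  moreover have "continuous_map ?X T q"
  proof (rule continuous_map_into_T)
    fix \<epsilon> i j assume \<epsilon>: "\<epsilon> \<in> chars" and ij: "i < dimE \<epsilon>" "j < dimE \<epsilon>"
    have "continuous_map ?X euclidean (\<lambda>z. \<Phi> \<epsilon> (z \<epsilon>) $$ (i, j))"
      using continuous_map_compose[OF continuous_map_product_projection[OF \<epsilon>, of "\<lambda>\<epsilon>. subtopology T (component \<epsilon>)"]
          continuous_map_from_subtopology[OF functional_continuous[OF functional_\<Phi>[OF \<epsilon> ij]]]]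
      by (simp add: o_def)
    then show "continuous_map ?X euclidean (\<lambda>z. \<Phi> \<epsilon> (q z) $$ (i, j))"
      by (rule continuous_map_eq) (use q \<epsilon> in \<open>simp add: topX del: topspace_product_topology\<close>)
  qed (use q in \<open>simp add: topX del: topspace_product_topology\<close>)
  ultimately have "homeomorphic_maps T ?X p q"
    using qp pq by (simp add: homeomorphic_maps_def topspace_T topX del: topspace_product_topology)
  then have homeo: "homeomorphic_map T ?X p"
    by (rule homeomorphic_maps_imp_map)
  have "p \<in> Ring.ring_hom KG ?P"
  proof (rule ring_hom_memI)
    fix x y assume xy: "x \<in> carrier KG" "y \<in> carrier KG"
    show "p x \<in> carrier ?P"
      using p_in[OF xy(1)] by (simp add: carP)
    have "proj \<epsilon> (x \<otimes>\<^bsub>KG\<^esub> y) = proj \<epsilon> x \<otimes>\<^bsub>KG\<^esub> proj \<epsilon> y" if \<epsilon>: "\<epsilon> \<in> chars" for \<epsilon>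
      using proj[OF \<epsilon> xy(1)] proj[OF \<epsilon> xy(2)] xy component_carrier
      by (intro proj_eqI component_mult_left) (auto simp: \<epsilon> mat_hom_mult[OF \<Phi>_hom[OF \<epsilon>]])
    then show "p (x \<otimes>\<^bsub>KG\<^esub> y) = p x \<otimes>\<^bsub>?P\<^esub> p y"
      by (auto simp: p_def product_algebra_def ideal_algebra_simps)
    have "proj \<epsilon> (x \<oplus>\<^bsub>KG\<^esub> y) = proj \<epsilon> x \<oplus>\<^bsub>KG\<^esub> proj \<epsilon> y" if \<epsilon>: "\<epsilon> \<in> chars" for \<epsilon>
      using proj[OF \<epsilon> xy(1)] proj[OF \<epsilon> xy(2)] xy component_carrier
      by (intro proj_eqI component_add) (auto simp: \<epsilon> mat_hom_add[OF \<Phi>_hom[OF \<epsilon>]])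
    then show "p (x \<oplus>\<^bsub>KG\<^esub> y) = p x \<oplus>\<^bsub>?P\<^esub> p y"
      by (auto simp: p_def product_algebra_def ideal_algebra_simps)
  next
    \<comment> \<open>The unit of the ideal is its element with image 1 under
      \<open>\<Phi> \<epsilon>\<close>, hence the projection of the unit of
      \<open>KG\<close>.\<close>
    have "proj \<epsilon> \<one>\<^bsub>KG\<^esub> = \<one>\<^bsub>ideal_algebra KG (component \<epsilon>)\<^esub>" if \<epsilon>: "\<epsilon> \<in> chars" for \<epsilon>
      using \<Phi>_one_component[OF \<epsilon>] by (intro proj_eqI) (simp_all add: \<epsilon> mat_hom_one[OF \<Phi>_hom[OF \<epsilon>]])
    then show "p \<one>\<^bsub>KG\<^esub> = \<one>\<^bsub>?P\<^esub>"
      by (auto simp: p_def product_algebra_def)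
  qed
  moreover from this have "p \<in> module_hom class_ring KG ?P"
  proof -
    have "p (c \<odot>\<^bsub>KG\<^esub> x) = c \<odot>\<^bsub>?P\<^esub> p x" if x: "x \<in> carrier KG" for c x
    proof -
      have "proj \<epsilon> (c \<odot>\<^bsub>KG\<^esub> x) = c \<odot>\<^bsub>KG\<^esub> proj \<epsilon> x" if \<epsilon>: "\<epsilon> \<in> chars" for \<epsilon>
        using proj[OF \<epsilon> x] x component_carrier
        by (intro proj_eqI component_smult) (auto simp: \<epsilon> smult_closed mat_hom_smult[OF \<Phi>_hom[OF \<epsilon>]])
      then show ?thesis
        by (auto simp: p_def product_algebra_def ideal_algebra_simps)
    qed
    then show ?thesis
      using ring_hom_add[OF \<open>p \<in> Ring.ring_hom KG ?P\<close>] ring_hom_closed[OF \<open>p \<in> Ring.ring_hom KG ?P\<close>]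
      by (auto simp: module_hom_def)
  qed
  moreover have "bij_betw p (carrier KG) (carrier ?P)"
    unfolding carP using qp pq p_in q by (intro bij_betw_byWitness[where f' = q]) blast+
  ultimately have iso: "p \<in> algebra_isos KG ?P"
    by (simp add: algebra_isos_def algebra_homs_def)
  have "p x = (\<lambda>\<epsilon>'\<in>chars. if \<epsilon>' = \<epsilon> then x else \<zero>\<^bsub>KG\<^esub>)" if \<epsilon>: "\<epsilon> \<in> chars" and x: "x \<in> component \<epsilon>" for \<epsilon> x
  proof -
    have "proj \<epsilon>' x = (if \<epsilon>' = \<epsilon> then x else \<zero>\<^bsub>KG\<^esub>)" if \<epsilon>': "\<epsilon>' \<in> chars" for \<epsilon>'
      using x \<epsilon>' zero_component
      by (intro proj_eqI) (auto simp: component_carrier \<Phi>_zero \<Phi>_component)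
    then show ?thesis
      by (auto simp: p_def)
  qed
  with iso homeo show ?thesis
    unfolding direct_product_of_ideals_def by blast
qed

end

theorem theorem4p3:
  fixes G :: "('g, 'm) monoid_scheme" and TG :: "'g topology"
    and KG :: "('k::real_or_complex, 'a) module" and T :: "'a topology" and \<eta> :: "'g \<Rightarrow> 'a"
    and dimE :: "('g \<Rightarrow> 'k) \<Rightarrow> nat" and \<rho> :: "('g \<Rightarrow> 'k) \<Rightarrow> 'g \<Rightarrow> 'k mat"
  assumes "compact_group G TG"
    and "weakly_complete_group_algebra G TG KG T \<eta>"
    and "\<And>\<epsilon>. \<epsilon> \<in> irreducible_characters G TG \<Longrightarrow>
           irreducible_representation G TG (dimE \<epsilon>) (\<rho> \<epsilon>) \<and> character G (dimE \<epsilon>) (\<rho> \<epsilon>) = \<epsilon>"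
  defines "L \<equiv> \<lambda>\<epsilon>. End_G G (dimE \<epsilon>) (\<rho> \<epsilon>)"
  shows "\<exists>I :: ('g \<Rightarrow> 'k) \<Rightarrow> 'a set.
    direct_product_of_ideals KG T (irreducible_characters G TG) I \<and>
    (\<forall>\<epsilon> \<in> irreducible_characters G TG.
       minimal_ideal (I \<epsilon>) KG \<and>
       vectorspace.fin_dim class_ring (KG\<lparr>carrier := I \<epsilon>\<rparr>) \<and>
       algebra_isos (ideal_algebra KG (I \<epsilon>)) (End_over (L \<epsilon>) (dimE \<epsilon>)) \<noteq> {} \<and>
       simple_group_module (G \<times>\<times> G) (KG\<lparr>carrier := I \<epsilon>\<rparr>) (two_sided_action KG \<eta>) \<and>
       (\<exists>m>0. algebra_isos (ideal_algebra KG (I \<epsilon>)) (full_matrix_algebra m (L \<epsilon>)) \<noteq> {}))"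
proof -
  interpret group_algebra G TG dimE \<rho> KG T \<eta>
    by unfold_locales (use assms(1-3) in auto)
  show ?thesis
    unfolding L_def
    using direct_product minimal_component fin_dim_component component_iso simple_component component_full_matrix_iso
    by (intro exI[of _ component]) blast
qed

end
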